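(* Let $(M,\nabla,g)$ be a simply connected special Kähler manifold of real dimension $n=2m$ (with possibly indefinite metric $g$), oriented by its complex structure. Then there exists a Blaschke immersion $\varphi : M \to \mathbf{R}^{n+1}$ with induced connection $\nabla$ and Blaschke metric $g$. Moreover, $\varphi$ is a parabolic affine hypersphere, and $\varphi$ is uniquely determined (by the requirement that it be a Blaschke immersion with induced connection $\nabla$ and Blaschke metric $g$) up to equiaffine transformations of $\mathbf{R}^{n+1}$.
   Context: Special Kähler manifolds. Let $(M,J,g)$ be a Kähler manifold with possibly indefinite Kähler metric $g$: $J$ is an integrable complex structure, $g$ is a pseudo-Riemannian metric with $g(J\cdot,J\cdot)=g$, and the Kähler form $\omega := g(\cdot,J\cdot)$ is closed. Let $\nabla$ be a torsionfree flat connection on $M$ (i.e. on the tangent bundle). The triple $(M,\nabla,g)$ (with $J$ understood) is called a special Kähler manifold if $\nabla\omega=0$ and $d^\nabla J=0$, where $d^\nabla J(X,Y) = (\nabla_XJ)Y-(\nabla_YJ)X$. Affine immersions. $\mathbf{R}^{n+1}$ is regarded as affine space with its standard volume form $\det$ and standard flat connection $D$. An affine transformation is called equiaffine if it preserves $\det$. Let $\varphi:M\to\mathbf{R}^{n+1}$ be an immersion of an $n$-dimensional manifold and $\xi$ a vector field along $\varphi$ transversal to $\varphi$. The formulas $$D_X\varphi_*Y=\varphi_*(\nabla_XY)+g(X,Y)\xi,\qquad D_X\xi=-\varphi_*(SX)+\tau(X)\xi$$ define a torsionfree connection $\nabla$ (the induced connection), a symmetric bilinear form $g$, an endomorphism field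 $S$ (the shape tensor) and a 1-form $\tau$; one also has the induced volume form $\theta(X_1,\ldots,X_n)=\det(\xi,\varphi_*X_1,\ldots,\varphi_*X_n)$. Nondegeneracy of $g$ does not depend on the choice of $\xi$. If $g$ is nondegenerate, then $\xi$ is called an affine normal if the metric volume form $\nu$ of $g$ (with respect to the given orientation of $M$) is $\nabla$-parallel and coincides with $\theta$. The immersion $\varphi$ together with an affine normal $\xi$ is called a Blaschke immersion, and the corresponding pseudo-Riemannian metric $g$ is called its Blaschke metric. A Blaschke immersion is called an affine hypersphere if $S=\lambda\,\mathrm{Id}$ for some $\lambda\in\mathbf{R}$, and it is called parabolic (or a parabolic sphere) if $\lambda=0$. *)

theory Defs
  imports "HOL-Analysis.Analysis" "HOL-Library.Function_Algebras"
begin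

text \<open>
  A manifold is a type \<open>'a\<close> of class \<open>{t2_space, second_countable_topology}\<close> with a smooth atlas
  modelled on \<open>real ^ 'n\<close>. Tangent vectors at \<open>p\<close> are derivations at \<open>p\<close> of the algebra of smooth
  functions, and connections are Koszul operators on smooth vector fields. Sums and differences of
  functions, tangent vectors and vector fields are pointwise (\<open>Function_Algebras\<close>).
\<close>

subsection \<open>Smooth manifolds\<close>

text \<open>The domain is meant to be an open subset of a finite-dimensional space.\<close>

primrec Ck_on ::
  "nat \<Rightarrow> 'a::real_normed_vector set \<Rightarrow> ('a \<Rightarrow> 'b::real_normed_vector) \<Rightarrow> bool" where
  "Ck_on 0 U f \<longleftrightarrow> continuous_on U f"
| "Ck_on (Suc k) U f \<longleftrightarrow> (\<forall>x\<in>U. f differentiable (at x)) \<and>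
     (\<forall>v. Ck_on k U (\<lambda>x. frechet_derivative f (at x) v))"

definition smooth_on ::
  "'a::real_normed_vector set \<Rightarrow> ('a \<Rightarrow> 'b::real_normed_vector) \<Rightarrow> bool" where
  "smooth_on U f \<longleftrightarrow> (\<forall>k. Ck_on k U f)"

text \<open>A chart is a pair \<open>(U, x)\<close>: the domain and the coordinate map.\<close>

type_synonym ('a, 'n) chart = "'a set \<times> ('a \<Rightarrow> real ^ 'n)"

definition is_chart :: "('a::topological_space, 'n::finite) chart \<Rightarrow> bool" where
  "is_chart = (\<lambda>(U, x). open U \<and> open (x ` U) \<and> homeomorphism U (x ` U) x (inv_into U x))"

definition smooth_transition ::
  "('a::topological_space, 'n::finite) chart \<Rightarrow> ('a, 'n) chart \<Rightarrow> bool" where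
  "smooth_transition = (\<lambda>(U, x) (V, y). smooth_on (x ` (U \<inter> V)) (y \<circ> inv_into U x))"

definition smooth_atlas :: "('a::topological_space, 'n::finite) chart set \<Rightarrow> bool" where
  "smooth_atlas A \<longleftrightarrow> (\<forall>c\<in>A. is_chart c) \<and> (\<Union>c\<in>A. fst c) = UNIV \<and>
     (\<forall>c\<in>A. \<forall>d\<in>A. smooth_transition c d)"

definition compatible_chart ::
  "('a::topological_space, 'n::finite) chart set \<Rightarrow> ('a, 'n) chart \<Rightarrow> bool" where
  "compatible_chart A c \<longleftrightarrow> is_chart c \<and>
     (\<forall>d\<in>A. smooth_transition c d \<and> smooth_transition d c)"

definition smooth_map ::
  "('a::topological_space, 'n::finite) chart set \<Rightarrow> ('a \<Rightarrow> 'b::real_normed_vector) \<Rightarrow> bool" where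
  "smooth_map A f \<longleftrightarrow> (\<forall>(U, x)\<in>A. smooth_on (x ` U) (f \<circ> inv_into U x))"

abbreviation Cinf :: "('a::topological_space, 'n::finite) chart set \<Rightarrow> ('a \<Rightarrow> real) set" where
  "Cinf A \<equiv> {f. smooth_map A f}"

subsection \<open>Tangent vectors and vector fields\<close>

definition fscale :: "real \<Rightarrow> ('b \<Rightarrow> real) \<Rightarrow> 'b \<Rightarrow> real"  (infixr "*\<^sub>f" 75) where
  "c *\<^sub>f f = (\<lambda>x. c * f x)"

type_synonym 'a tangent = "('a \<Rightarrow> real) \<Rightarrow> real"
type_synonym 'a vfield = "'a \<Rightarrow> 'a tangent"

text \<open>The last clause fixes the value on non-smooth functions, so that a derivation of the algebra
  of smooth functions corresponds to exactly one HOL function.\<close>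

definition tangent_space ::
  "('a::topological_space, 'n::finite) chart set \<Rightarrow> 'a \<Rightarrow> 'a tangent set" where
  "tangent_space A p = {v.
     (\<forall>f\<in>Cinf A. \<forall>h\<in>Cinf A. v (f + h) = v f + v h) \<and>
     (\<forall>c. \<forall>f\<in>Cinf A. v (c *\<^sub>f f) = c * v f) \<and>
     (\<forall>f\<in>Cinf A. \<forall>h\<in>Cinf A. v (f * h) = f p * v h + h p * v f) \<and>
     (\<forall>f. f \<notin> Cinf A \<longrightarrow> v f = 0)}"

definition vector_fields :: "('a::topological_space, 'n::finite) chart set \<Rightarrow> 'a vfield set" where
  "vector_fields A = {X. (\<forall>p. X p \<in> tangent_space A p) \<and>
     (\<forall>f\<in>Cinf A. (\<lambda>p. X p f) \<in> Cinf A)}"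

definition vf_scale :: "('a \<Rightarrow> real) \<Rightarrow> 'a vfield \<Rightarrow> 'a vfield" where
  "vf_scale h X = (\<lambda>p. h p *\<^sub>f X p)"

definition lie_bracket :: "'a vfield \<Rightarrow> 'a vfield \<Rightarrow> 'a vfield" where
  "lie_bracket X Y = (\<lambda>p f. X p (\<lambda>q. Y q f) - Y p (\<lambda>q. X q f))"

text \<open>The tangent vector at \<open>q\<close> with components \<open>w\<close> with respect to a chart.\<close>

definition chart_vector ::
  "('a::topological_space, 'n::finite) chart set \<Rightarrow> ('a, 'n) chart \<Rightarrow> 'a \<Rightarrow> real ^ 'n \<Rightarrow> 'a tangent"
  where
  "chart_vector A c q w = (\<lambda>f. if f \<in> Cinf A
     then frechet_derivative (f \<circ> inv_into (fst c) (snd c)) (at (snd c q)) w else 0)"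

definition frame ::
  "('a::topological_space, 'n::finite) chart set \<Rightarrow> 'a \<Rightarrow> ('n \<Rightarrow> 'a tangent) \<Rightarrow> bool" where
  "frame A p E \<longleftrightarrow> (\<forall>i. E i \<in> tangent_space A p) \<and>
     (\<forall>v\<in>tangent_space A p. \<exists>!c. v = (\<Sum>i\<in>UNIV. c i *\<^sub>f E i))"

subsection \<open>Tensor fields\<close>

definition bilinear_field ::
  "('a::topological_space, 'n::finite) chart set \<Rightarrow> ('a \<Rightarrow> 'a tangent \<Rightarrow> 'a tangent \<Rightarrow> real) \<Rightarrow> bool"
  where
  "bilinear_field A B \<longleftrightarrow>
     (\<forall>p. \<forall>u\<in>tangent_space A p. \<forall>v\<in>tangent_space A p. \<forall>w\<in>tangent_space A p. \<forall>c.
        B p (u + v) w = B p u w + B p v w \<and> B p (c *\<^sub>f u) w = c * B p u w \<and>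
        B p w (u + v) = B p w u + B p w v \<and> B p w (c *\<^sub>f u) = c * B p w u) \<and>
     (\<forall>X\<in>vector_fields A. \<forall>Y\<in>vector_fields A. (\<lambda>p. B p (X p) (Y p)) \<in> Cinf A)"

definition nondegenerate ::
  "('a::topological_space, 'n::finite) chart set \<Rightarrow> ('a \<Rightarrow> 'a tangent \<Rightarrow> 'a tangent \<Rightarrow> real) \<Rightarrow> bool"
  where
  "nondegenerate A g \<longleftrightarrow> (\<forall>p. \<forall>v\<in>tangent_space A p.
     (\<forall>w\<in>tangent_space A p. g p v w = 0) \<longrightarrow> v = 0)"

definition pseudo_riemannian_metric ::
  "('a::topological_space, 'n::finite) chart set \<Rightarrow> ('a \<Rightarrow> 'a tangent \<Rightarrow> 'a tangent \<Rightarrow> real) \<Rightarrow> bool"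
  where
  "pseudo_riemannian_metric A g \<longleftrightarrow> bilinear_field A g \<and>
     (\<forall>p. \<forall>v\<in>tangent_space A p. \<forall>w\<in>tangent_space A p. g p v w = g p w v) \<and>
     nondegenerate A g"

text \<open>Endomorphism fields act on a vector field \<open>Y\<close> by \<open>\<lambda>p. J p (Y p)\<close>.\<close>

definition endo_app :: "('a \<Rightarrow> 'a tangent \<Rightarrow> 'a tangent) \<Rightarrow> 'a vfield \<Rightarrow> 'a vfield" where
  "endo_app J Y = (\<lambda>p. J p (Y p))"

definition endo_field ::
  "('a::topological_space, 'n::finite) chart set \<Rightarrow> ('a \<Rightarrow> 'a tangent \<Rightarrow> 'a tangent) \<Rightarrow> bool" where
  "endo_field A J \<longleftrightarrow>
     (\<forall>p. \<forall>u\<in>tangent_space A p. \<forall>v\<in>tangent_space A p. \<forall>c.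
        J p u \<in> tangent_space A p \<and> J p (u + v) = J p u + J p v \<and> J p (c *\<^sub>f u) = c *\<^sub>f J p u) \<and>
     (\<forall>X\<in>vector_fields A. endo_app J X \<in> vector_fields A)"

subsection \<open>Connections on the tangent bundle\<close>

type_synonym 'a conn = "'a vfield \<Rightarrow> 'a vfield \<Rightarrow> 'a vfield"

definition connection :: "('a::topological_space, 'n::finite) chart set \<Rightarrow> 'a conn \<Rightarrow> bool" where
  "connection A nab \<longleftrightarrow>
     (\<forall>X\<in>vector_fields A. \<forall>Y\<in>vector_fields A. nab X Y \<in> vector_fields A \<and>
       (\<forall>Z\<in>vector_fields A. nab (X + Y) Z = nab X Z + nab Y Z \<and>
                              nab Z (X + Y) = nab Z X + nab Z Y) \<and>
       (\<forall>f\<in>Cinf A. nab (vf_scale f X) Y = vf_scale f (nab X Y) \<and>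
                    nab X (vf_scale f Y) = vf_scale (\<lambda>p. X p f) Y + vf_scale f (nab X Y)))"

definition torsionfree :: "('a::topological_space, 'n::finite) chart set \<Rightarrow> 'a conn \<Rightarrow> bool" where
  "torsionfree A nab \<longleftrightarrow> (\<forall>X\<in>vector_fields A. \<forall>Y\<in>vector_fields A.
     nab X Y - nab Y X = lie_bracket X Y)"

definition flat :: "('a::topological_space, 'n::finite) chart set \<Rightarrow> 'a conn \<Rightarrow> bool" where
  "flat A nab \<longleftrightarrow> (\<forall>X\<in>vector_fields A. \<forall>Y\<in>vector_fields A. \<forall>Z\<in>vector_fields A.
     nab X (nab Y Z) - nab Y (nab X Z) - nab (lie_bracket X Y) Z = 0)"

definition parallel_bilinear ::
  "('a::topological_space, 'n::finite) chart set \<Rightarrow> 'a conn \<Rightarrow>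
   ('a \<Rightarrow> 'a tangent \<Rightarrow> 'a tangent \<Rightarrow> real) \<Rightarrow> bool" where
  "parallel_bilinear A nab B \<longleftrightarrow>
     (\<forall>X\<in>vector_fields A. \<forall>Y\<in>vector_fields A. \<forall>Z\<in>vector_fields A. \<forall>p.
        X p (\<lambda>q. B q (Y q) (Z q)) = B p (nab X Y p) (Z p) + B p (Y p) (nab X Z p))"

definition parallel_volume ::
  "('a::topological_space, 'n::finite) chart set \<Rightarrow> 'a conn \<Rightarrow>
   ('a \<Rightarrow> ('n \<Rightarrow> 'a tangent) \<Rightarrow> real) \<Rightarrow> bool" where
  "parallel_volume A nab vol \<longleftrightarrow>
     (\<forall>X\<in>vector_fields A. \<forall>Y. (\<forall>i. Y i \<in> vector_fields A) \<longrightarrow>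
        (\<forall>p. X p (\<lambda>q. vol q (\<lambda>j. Y j q)) =
             (\<Sum>i\<in>UNIV. vol p (\<lambda>j. (Y(i := nab X (Y i))) j p))))"

subsection \<open>Special Kaehler manifolds\<close>

text \<open>In holomorphic coordinates \<open>z\<^sub>k = x\<^sub>k + i y\<^sub>k\<close>, the index \<open>Inl k\<close> stands for \<open>x\<^sub>k\<close> and
  \<open>Inr k\<close> for \<open>y\<^sub>k\<close>; \<open>std_J\<close> is multiplication by \<open>i\<close>.\<close>

definition std_J :: "real ^ ('m::finite + 'm) \<Rightarrow> real ^ ('m + 'm)" where
  "std_J w = (\<chi> i. case i of Inl k \<Rightarrow> - w $ Inr k | Inr k \<Rightarrow> w $ Inl k)"

text \<open>Integrability means that \<open>J\<close> comes from an atlas of holomorphic charts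
  (compatible with the smooth structure).\<close>

definition integrable_complex_structure ::
  "('a::topological_space, 'm::finite + 'm) chart set \<Rightarrow> ('a \<Rightarrow> 'a tangent \<Rightarrow> 'a tangent) \<Rightarrow> bool"
  where
  "integrable_complex_structure A J \<longleftrightarrow> endo_field A J \<and>
     (\<forall>p. \<forall>v\<in>tangent_space A p. J p (J p v) = - v) \<and>
     (\<forall>p. \<exists>c. compatible_chart A c \<and> p \<in> fst c \<and>
        (\<forall>q\<in>fst c. \<forall>w. J q (chart_vector A c q w) = chart_vector A c q (std_J w)))"

definition kaehler_form ::
  "('a \<Rightarrow> 'a tangent \<Rightarrow> 'a tangent) \<Rightarrow> ('a \<Rightarrow> 'a tangent \<Rightarrow> 'a tangent \<Rightarrow> real) \<Rightarrow>
   'a \<Rightarrow> 'a tangent \<Rightarrow> 'a tangent \<Rightarrow> real" where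
  "kaehler_form J g = (\<lambda>p v w. g p v (J p w))"

text \<open>Invariant formula for the exterior derivative of a 2-form.\<close>

definition closed_2form ::
  "('a::topological_space, 'n::finite) chart set \<Rightarrow> ('a \<Rightarrow> 'a tangent \<Rightarrow> 'a tangent \<Rightarrow> real) \<Rightarrow> bool"
  where
  "closed_2form A w \<longleftrightarrow>
     (\<forall>X\<in>vector_fields A. \<forall>Y\<in>vector_fields A. \<forall>Z\<in>vector_fields A. \<forall>p.
        X p (\<lambda>q. w q (Y q) (Z q)) - Y p (\<lambda>q. w q (X q) (Z q)) + Z p (\<lambda>q. w q (X q) (Y q))
        - w p (lie_bracket X Y p) (Z p) + w p (lie_bracket X Z p) (Y p)
        - w p (lie_bracket Y Z p) (X p) = 0)"

definition kaehler_manifold ::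
  "('a::topological_space, 'm::finite + 'm) chart set \<Rightarrow> ('a \<Rightarrow> 'a tangent \<Rightarrow> 'a tangent) \<Rightarrow>
   ('a \<Rightarrow> 'a tangent \<Rightarrow> 'a tangent \<Rightarrow> real) \<Rightarrow> bool" where
  "kaehler_manifold A J g \<longleftrightarrow> smooth_atlas A \<and>
     integrable_complex_structure A J \<and> pseudo_riemannian_metric A g \<and>
     (\<forall>p. \<forall>v\<in>tangent_space A p. \<forall>w\<in>tangent_space A p. g p (J p v) (J p w) = g p v w) \<and>
     closed_2form A (kaehler_form J g)"

definition cov_deriv_endo ::
  "'a conn \<Rightarrow> ('a \<Rightarrow> 'a tangent \<Rightarrow> 'a tangent) \<Rightarrow> 'a vfield \<Rightarrow> 'a vfield \<Rightarrow> 'a vfield" where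
  "cov_deriv_endo nab J X Y = nab X (endo_app J Y) - endo_app J (nab X Y)"

definition special_kaehler ::
  "('a::topological_space, 'm::finite + 'm) chart set \<Rightarrow> ('a \<Rightarrow> 'a tangent \<Rightarrow> 'a tangent) \<Rightarrow>
   'a conn \<Rightarrow> ('a \<Rightarrow> 'a tangent \<Rightarrow> 'a tangent \<Rightarrow> real) \<Rightarrow> bool" where
  "special_kaehler A J nab g \<longleftrightarrow> kaehler_manifold A J g \<and>
     connection A nab \<and> torsionfree A nab \<and> flat A nab \<and>
     parallel_bilinear A nab (kaehler_form J g) \<and>
     (\<forall>X\<in>vector_fields A. \<forall>Y\<in>vector_fields A.
        cov_deriv_endo nab J X Y - cov_deriv_endo nab J Y X = 0)"

text \<open>An orientation is given by its set of positively oriented frames at each point. For the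
  orientation by the complex structure, \<open>(e\<^sub>1, J e\<^sub>1, \<dots>, e\<^sub>m, J e\<^sub>m)\<close> is positive. Frames are indexed
  by \<open>'m + 'm\<close> itself, with \<open>Inl k\<close> for \<open>e\<^sub>k\<close> and \<open>Inr k\<close> for \<open>J e\<^sub>k\<close>; hence no order of the index
  type is involved when two frames are compared.\<close>

definition complex_orientation ::
  "('a::topological_space, 'm::finite + 'm) chart set \<Rightarrow> ('a \<Rightarrow> 'a tangent \<Rightarrow> 'a tangent) \<Rightarrow>
   'a \<Rightarrow> ('m + 'm \<Rightarrow> 'a tangent) set" where
  "complex_orientation A J p = {X. \<exists>e (a :: real ^ ('m + 'm) ^ ('m + 'm)).
     frame A p (case_sum e (\<lambda>k. J p (e k))) \<and> det a > 0 \<and>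
     (\<forall>j. X j = (\<Sum>i\<in>UNIV. (a $ i $ j) *\<^sub>f case_sum e (\<lambda>k. J p (e k)) i))}"

subsection \<open>Affine immersions of hypersurfaces\<close>

text \<open>For manifolds modelled on \<open>real ^ 'n\<close>, the affine space of dimension one higher is
  \<open>real ^ ('n option)\<close>; coordinates and vectors are both numbered by \<open>'n option\<close>, \<open>None\<close> first,
  so that the determinant again does not depend on an order of \<open>'n\<close>.\<close>

definition std_volume :: "('k::finite \<Rightarrow> real ^ 'k) \<Rightarrow> real" where
  "std_volume v = det (\<chi> i j. v j $ i)"

definition equiaffine :: "(real ^ 'k::finite \<Rightarrow> real ^ 'k) \<Rightarrow> bool" where
  "equiaffine F \<longleftrightarrow> (\<exists>L b. linear L \<and> bij L \<and> (\<forall>y. F y = L y + b) \<and>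
     (\<forall>v. std_volume (\<lambda>j. L (v j)) = std_volume v))"

text \<open>The directional derivative \<open>D\<^sub>v F\<close> of a map \<open>F\<close> into a coordinate space. If \<open>F\<close> is a vector
  field along an immersion, this is its derivative with respect to the standard connection;
  if \<open>F\<close> is the immersion itself, it is the push-forward of \<open>v\<close>.\<close>

definition dir_deriv :: "'a tangent \<Rightarrow> ('a \<Rightarrow> real ^ 'k) \<Rightarrow> real ^ 'k::finite" where
  "dir_deriv v F = (\<chi> i. v (\<lambda>q. F q $ i))"

definition immersion ::
  "('a::topological_space, 'n::finite) chart set \<Rightarrow> ('a \<Rightarrow> real ^ 'k::finite) \<Rightarrow> bool" where
  "immersion A \<phi> \<longleftrightarrow> smooth_map A \<phi> \<and>
     (\<forall>p. \<forall>v\<in>tangent_space A p. dir_deriv v \<phi> = 0 \<longrightarrow> v = 0)"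

definition transversal ::
  "('a::topological_space, 'n::finite) chart set \<Rightarrow> ('a \<Rightarrow> real ^ 'n option) \<Rightarrow>
   ('a \<Rightarrow> real ^ 'n option) \<Rightarrow> bool" where
  "transversal A \<phi> \<xi> \<longleftrightarrow> smooth_map A \<xi> \<and>
     (\<forall>p. \<xi> p \<notin> (\<lambda>v. dir_deriv v \<phi>) ` tangent_space A p)"

text \<open>The formulas \<open>D\<^sub>X \<phi>\<^sub>*Y = \<phi>\<^sub>*(\<nabla>\<^sub>X Y) + g(X,Y) \<xi>\<close> and \<open>D\<^sub>X \<xi> = - \<phi>\<^sub>*(S X) + \<tau>(X) \<xi>\<close>, which determine
  \<open>\<nabla>\<close> on vector fields and \<open>g\<close>, \<open>S\<close>, \<open>\<tau>\<close> on tangent vectors.\<close>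

definition affine_immersion ::
  "('a::topological_space, 'n::finite) chart set \<Rightarrow> ('a \<Rightarrow> real ^ 'n option) \<Rightarrow>
   ('a \<Rightarrow> real ^ 'n option) \<Rightarrow> 'a conn \<Rightarrow> ('a \<Rightarrow> 'a tangent \<Rightarrow> 'a tangent \<Rightarrow> real) \<Rightarrow>
   ('a \<Rightarrow> 'a tangent \<Rightarrow> 'a tangent) \<Rightarrow> ('a \<Rightarrow> 'a tangent \<Rightarrow> real) \<Rightarrow> bool" where
  "affine_immersion A \<phi> \<xi> nab g S \<tau> \<longleftrightarrow> immersion A \<phi> \<and> transversal A \<phi> \<xi> \<and>
     (\<forall>X\<in>vector_fields A. \<forall>Y\<in>vector_fields A. nab X Y \<in> vector_fields A \<and>
        (\<forall>p. dir_deriv (X p) (\<lambda>q. dir_deriv (Y q) \<phi>) =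
             dir_deriv (nab X Y p) \<phi> + g p (X p) (Y p) *\<^sub>R \<xi> p)) \<and>
     (\<forall>p. \<forall>v\<in>tangent_space A p. S p v \<in> tangent_space A p \<and>
        dir_deriv v \<xi> = - dir_deriv (S p v) \<phi> + \<tau> p v *\<^sub>R \<xi> p)"

definition induced_volume ::
  "('a \<Rightarrow> real ^ 'n option) \<Rightarrow> ('a \<Rightarrow> real ^ 'n option) \<Rightarrow>
   'a \<Rightarrow> ('n::finite \<Rightarrow> 'a tangent) \<Rightarrow> real" where
  "induced_volume \<phi> \<xi> = (\<lambda>p X. std_volume (case_option (\<xi> p) (\<lambda>k. dir_deriv (X k) \<phi>)))"

text \<open>\<open>ori p\<close> is the set of positively oriented frames at \<open>p\<close>. On linearly dependent tuples the
  Gram determinant, and hence the form, vanishes.\<close>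

definition metric_volume ::
  "('a \<Rightarrow> ('n \<Rightarrow> 'a tangent) set) \<Rightarrow> ('a \<Rightarrow> 'a tangent \<Rightarrow> 'a tangent \<Rightarrow> real) \<Rightarrow>
   'a \<Rightarrow> ('n::finite \<Rightarrow> 'a tangent) \<Rightarrow> real" where
  "metric_volume ori g = (\<lambda>p X. (if X \<in> ori p then 1 else - 1) *
     sqrt \<bar>det (\<chi> i j. g p (X i) (X j))\<bar>)"

text \<open>\<open>nab\<close> and \<open>g\<close> stand for the connection and the bilinear form induced by \<open>\<phi>\<close> and \<open>\<xi>\<close>.\<close>

definition affine_normal ::
  "('a::topological_space, 'n::finite) chart set \<Rightarrow> ('a \<Rightarrow> ('n \<Rightarrow> 'a tangent) set) \<Rightarrow>
   ('a \<Rightarrow> real ^ 'n option) \<Rightarrow> ('a \<Rightarrow> real ^ 'n option) \<Rightarrow> 'a conn \<Rightarrow>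
   ('a \<Rightarrow> 'a tangent \<Rightarrow> 'a tangent \<Rightarrow> real) \<Rightarrow> bool" where
  "affine_normal A ori \<phi> \<xi> nab g \<longleftrightarrow> nondegenerate A g \<and>
     parallel_volume A nab (metric_volume ori g) \<and>
     (\<forall>p X. (\<forall>i. X i \<in> tangent_space A p) \<longrightarrow>
        metric_volume ori g p X = induced_volume \<phi> \<xi> p X)"

text \<open>\<open>\<phi>\<close> with affine normal \<open>\<xi>\<close> is a Blaschke immersion with induced connection \<open>nab\<close> and
  Blaschke metric \<open>g\<close>.\<close>

definition blaschke_immersion ::
  "('a::topological_space, 'n::finite) chart set \<Rightarrow> ('a \<Rightarrow> ('n \<Rightarrow> 'a tangent) set) \<Rightarrow>
   ('a \<Rightarrow> real ^ 'n option) \<Rightarrow> ('a \<Rightarrow> real ^ 'n option) \<Rightarrow> 'a conn \<Rightarrow>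
   ('a \<Rightarrow> 'a tangent \<Rightarrow> 'a tangent \<Rightarrow> real) \<Rightarrow> bool" where
  "blaschke_immersion A ori \<phi> \<xi> nab g \<longleftrightarrow>
     (\<exists>S \<tau>. affine_immersion A \<phi> \<xi> nab g S \<tau>) \<and> affine_normal A ori \<phi> \<xi> nab g"

definition affine_hypersphere ::
  "('a::topological_space, 'n::finite) chart set \<Rightarrow> ('a \<Rightarrow> ('n \<Rightarrow> 'a tangent) set) \<Rightarrow>
   ('a \<Rightarrow> real ^ 'n option) \<Rightarrow> ('a \<Rightarrow> real ^ 'n option) \<Rightarrow> real \<Rightarrow> bool" where
  "affine_hypersphere A ori \<phi> \<xi> lam \<longleftrightarrow>
     (\<exists>nab g S \<tau>. affine_immersion A \<phi> \<xi> nab g S \<tau> \<and> affine_normal A ori \<phi> \<xi> nab g \<and>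
        (\<forall>p. \<forall>v\<in>tangent_space A p. S p v = lam *\<^sub>f v))"

abbreviation parabolic_hypersphere ::
  "('a::topological_space, 'n::finite) chart set \<Rightarrow> ('a \<Rightarrow> ('n \<Rightarrow> 'a tangent) set) \<Rightarrow>
   ('a \<Rightarrow> real ^ 'n option) \<Rightarrow> ('a \<Rightarrow> real ^ 'n option) \<Rightarrow> bool" where
  "parabolic_hypersphere A ori \<phi> \<xi> \<equiv> affine_hypersphere A ori \<phi> \<xi> 0"

end

theory Submission
  imports Defs
begin

text \<open>
  A function \<open>f\<close> with \<open>\<nabla> df = c g\<close>, \<open>c\<close> constant, is a parallel section \<open>(f, df, c)\<close> of a connection on
  \<open>\<real> \<oplus> T\<^sup>*M \<oplus> \<real>\<close>. This connection is flat, because \<open>\<nabla>\<close> is flat and \<open>\<nabla>g\<close> is totally symmetric, which follows from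
  \<open>\<nabla>\<omega> = 0\<close> and \<open>d\<^sup>\<nabla>J = 0\<close>: indeed \<open>(\<nabla>\<^sub>X g)(Y, Z) = g((\<nabla>\<^sub>X J)Y, JZ)\<close>. Since \<open>M\<close> is simply connected, its parallel
  sections are global. They provide \<open>F\<close> with \<open>\<nabla> dF = g\<close> and affine functions \<open>f\<^sub>1, \<dots>, f\<^sub>n\<close> with independent
  differentials; \<open>\<phi> = (F, f\<^sub>1, \<dots>, f\<^sub>n)\<close> and \<open>\<xi> = e\<^sub>0\<close> then satisfy the structure equations with \<open>S = 0\<close>, \<open>\<tau> = 0\<close>.
  As \<open>\<omega>\<close> is parallel, its coefficients with respect to the \<open>df\<^sub>k\<close> are constant, and \<open>\<bar>det g\<bar> = \<bar>det \<omega>\<bar>\<close>; so the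
  metric volume is \<open>df\<^sub>1 \<and> \<dots> \<and> df\<^sub>n\<close> after scaling.

  Conversely, \<open>\<nabla>\<theta> = 0\<close> forces \<open>\<tau> = 0\<close>. The Gauss equation of the flat connection \<open>\<nabla>\<close> is
  \<open>g(Y, Z) SX = g(X, Z) SY\<close>; taking \<open>X = v\<close>, \<open>Y = Jv\<close> and \<open>Z\<close> orthogonal to \<open>v\<close> but not to \<open>Jv\<close> gives \<open>S = 0\<close>.
  Hence \<open>\<xi>\<close> is constant, and two Blaschke immersions with the same \<open>\<nabla>\<close> and \<open>g\<close>, matched to first order at a
  point by a linear map of determinant \<open>1\<close>, differ by a function with \<open>\<nabla> df = 0\<close> and \<open>df = 0\<close> at that point,
  that is, by a constant.
\<close>

section \<open>Smooth maps between normed spaces\<close>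

text \<open>The constant \<open>c\<close> is carried as a third component of the section because it
  makes the equation homogeneous: the term \<open>c g\<close> becomes linear in the unknown, and a
  Frobenius theorem for linear systems suffices. The main obstacle is that tangent vectors are
  derivations of the algebra of globally smooth functions, whereas solutions are first found on a
  chart. They are therefore cut off by bump functions; a local section at a point is encoded as a
  global smooth function that solves the equation near that point, taken up to equality of germs.
  Continuation along paths and homotopies is carried out for an abstract locally constant family of
  such germs. The orientation needs a separate argument: the real determinant of a complex frame is
  never negative. This makes the sign of the volume of the differentials comparable with the complex
  orientation in each holomorphic chart, and the intermediate value theorem spreads positivity from
  one point to the whole manifold.\<close>

lemma Ck_on_cong:
  assumes "open U" "\<And>x. x \<in> U \<Longrightarrow> f x = g x" "Ck_on k U f"
  shows "Ck_on k U g"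
  using assms(2,3)
proof (induction k arbitrary: f g)
  case 0
  then show ?case by (simp cong: continuous_on_cong)
next
  case (Suc k)
  have g: "g differentiable (at x)" "frechet_derivative f (at x) = frechet_derivative g (at x)" if x: "x \<in> U" for x
  proof -
    have "(f has_derivative frechet_derivative f (at x)) (at x)"
      using Suc.prems(2) x by (simp add: frechet_derivative_works[symmetric])
    then have g: "(g has_derivative frechet_derivative f (at x)) (at x)"
      by (rule has_derivative_transform_within_open[OF _ assms(1) x Suc.prems(1)])
    then show "g differentiable (at x)" unfolding differentiable_def by blast
    show "frechet_derivative f (at x) = frechet_derivative g (at x)"
      by (rule frechet_derivative_at[OF g])
  qed
  have "Ck_on k U (\<lambda>x. frechet_derivative g (at x) v)" for v
    by (rule Suc.IH[of "\<lambda>x. frechet_derivative f (at x) v"]) (use g(2) Suc.prems(2) in auto)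
  then show ?case using g(1) by simp
qed

lemma Ck_on_subset: "Ck_on k U f \<Longrightarrow> V \<subseteq> U \<Longrightarrow> Ck_on k V f"
  by (induction k arbitrary: f) (auto intro: continuous_on_subset)

lemma Ck_on_continuous: "Ck_on k U f \<Longrightarrow> continuous_on U f"
proof (cases k)
  case (Suc j)
  assume "Ck_on k U f"
  then show ?thesis
    using Suc by (auto intro!: differentiable_imp_continuous_on simp: differentiable_on_def differentiable_at_withinI)
qed simp

lemma Ck_on_Suc_imp: "Ck_on (Suc k) U f \<Longrightarrow> Ck_on k U f"
proof (induction k arbitrary: f)
  case 0
  then show ?case using Ck_on_continuous[of "Suc 0" U f] by simp
next
  case (Suc k)
  then show ?case by (metis Ck_on.simps(2))
qed

lemma Ck_on_localI:
  assumes "\<And>x. x \<in> U \<Longrightarrow> \<exists>V. open V \<and> x \<in> V \<and> Ck_on k V f"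
  shows "Ck_on k U f"
  using assms
proof (induction k arbitrary: f)
  case 0
  have "continuous (at x) f" if "x \<in> U" for x
    using 0[OF that] by (auto simp: continuous_on_eq_continuous_at)
  then show ?case by (simp add: continuous_at_imp_continuous_on)
next
  case (Suc k)
  have "Ck_on k U (\<lambda>x. frechet_derivative f (at x) v)" for v
    by (rule Suc.IH) (use Suc.prems in fastforce)
  then show ?case using Suc.prems by fastforce
qed

text \<open>Derivatives are unique, so on an open set the induction over the order of
  differentiability may use any explicit derivative in place of
  \<open>frechet_derivative\<close>.\<close>

lemma Ck_on_SucI:
  assumes U: "open U" and d: "\<And>x. x \<in> U \<Longrightarrow> (f has_derivative f' x) (at x)"
    and c: "\<And>v. Ck_on k U (\<lambda>x. f' x v)"
  shows "Ck_on (Suc k) U f"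
proof -
  have "Ck_on k U (\<lambda>x. frechet_derivative f (at x) v)" for v
    by (rule Ck_on_cong[OF U _ c[of v]]) (use frechet_derivative_at[OF d] in auto)
  then show ?thesis using d by (auto simp: differentiable_def)
qed

lemma Ck_on_derivative:
  assumes "Ck_on (Suc k) U f" "x \<in> U"
  shows "(f has_derivative frechet_derivative f (at x)) (at x)"
  using assms by (simp add: frechet_derivative_works[symmetric])

lemma Ck_on_const: "open U \<Longrightarrow> Ck_on k U (\<lambda>x. c)"
proof (induction k arbitrary: c)
  case (Suc k)
  show ?case by (rule Ck_on_SucI[OF Suc.prems, of _ "\<lambda>_ _. 0"]) (use Suc in auto)
qed simp

lemma Ck_on_bounded_linear:
  assumes U: "open U" and L: "bounded_linear L" and "Ck_on k U f"
  shows "Ck_on k U (\<lambda>x. L (f x))"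
  using assms(3)
proof (induction k arbitrary: f)
  case 0
  then show ?case using bounded_linear.continuous_on[OF L] by auto
next
  case (Suc k)
  show ?case
  proof (rule Ck_on_SucI[OF U])
    show "((\<lambda>x. L (f x)) has_derivative (\<lambda>v. L (frechet_derivative f (at x) v))) (at x)" if "x \<in> U" for x
      by (rule bounded_linear.has_derivative[OF L Ck_on_derivative[OF Suc.prems that]])
  qed (use Suc in auto)
qed

lemma Ck_on_add:
  assumes U: "open U" and "Ck_on k U f" "Ck_on k U g"
  shows "Ck_on k U (\<lambda>x. f x + g x)"
  using assms(2,3)
proof (induction k arbitrary: f g)
  case (Suc k)
  show ?case
    by (rule Ck_on_SucI[OF U has_derivative_add[OF Ck_on_derivative[OF Suc.prems(1)] Ck_on_derivative[OF Suc.prems(2)]]])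
      (use Suc in auto)
qed (auto intro: continuous_intros)

lemma Ck_on_sum:
  assumes U: "open U" and "\<And>i. i \<in> I \<Longrightarrow> Ck_on k U (f i)"
  shows "Ck_on k U (\<lambda>x. \<Sum>i\<in>I. f i x)"
proof (cases "finite I")
  case True
  then show ?thesis
    using assms(2) by (induction I) (auto intro: Ck_on_const[OF U] Ck_on_add[OF U])
qed (simp add: Ck_on_const[OF U])

lemma Ck_on_mult:
  fixes f g :: "'a::real_normed_vector \<Rightarrow> real"
  assumes U: "open U" and "Ck_on k U f" "Ck_on k U g"
  shows "Ck_on k U (\<lambda>x. f x * g x)"
  using assms(2,3)
proof (induction k arbitrary: f g)
  case (Suc k)
  show ?case
    by (rule Ck_on_SucI[OF U has_derivative_mult[OF Ck_on_derivative[OF Suc.prems(1)] Ck_on_derivative[OF Suc.prems(2)]]])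
      (use Suc.prems Ck_on_Suc_imp[OF Suc.prems(1)] Ck_on_Suc_imp[OF Suc.prems(2)]
        in \<open>auto intro!: Ck_on_add[OF U] Suc.IH\<close>)
qed (auto intro: continuous_intros)

text \<open>In the chain rule the derivative of \<open>g\<close> is expanded in
  \<open>Basis\<close>. This gives a finite sum of products of real functions, and the induction
  hypothesis applies to each directional derivative of \<open>g\<close> while \<open>f\<close> stays
  fixed.\<close>

lemma Ck_on_compose:
  fixes f :: "'a::real_normed_vector \<Rightarrow> 'b::euclidean_space" and g :: "'b \<Rightarrow> real"
  assumes U: "open U" and V: "open V" and fUV: "f ` U \<subseteq> V" and "Ck_on k U f" "Ck_on k V g"
  shows "Ck_on k U (\<lambda>x. g (f x))"
  using assms(4,5)
proof (induction k arbitrary: g)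
  case 0
  then show ?case using fUV by (auto intro: continuous_on_compose2)
next
  case (Suc k)
  let ?f' = "\<lambda>x. frechet_derivative f (at x)" and ?g' = "\<lambda>y. frechet_derivative g (at y)"
  show ?case
  proof (rule Ck_on_SucI[OF U, of _ "\<lambda>x v. \<Sum>b\<in>Basis. (?f' x v \<bullet> b) * ?g' (f x) b"])
    fix x assume x: "x \<in> U"
    then have fx: "f x \<in> V" using fUV by auto
    have d: "(g has_derivative ?g' (f x)) (at (f x))" by (rule Ck_on_derivative[OF Suc.prems(2) fx])
    have "linear (?g' (f x))" using d has_derivative_linear by blast
    then have eq: "?g' (f x) w = (\<Sum>b\<in>Basis. (w \<bullet> b) * ?g' (f x) b)" for w
      by (subst euclidean_representation[of w, symmetric]) (simp add: linear_sum linear_scale)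
    have "((\<lambda>x. g (f x)) has_derivative (\<lambda>v. ?g' (f x) (?f' x v))) (at x)"
      using diff_chain_at[OF Ck_on_derivative[OF Suc.prems(1) x] d] by (simp add: o_def)
    then show "((\<lambda>x. g (f x)) has_derivative (\<lambda>v. \<Sum>b\<in>Basis. (?f' x v \<bullet> b) * ?g' (f x) b)) (at x)"
      by (rule has_derivative_eq_rhs) (rule ext, rule eq)
  next
    fix v
    have "Ck_on k U (\<lambda>x. ?f' x v \<bullet> b)" for b
      using Suc.prems(1) by (intro Ck_on_bounded_linear[OF U bounded_linear_inner_left]) simp
    moreover have "Ck_on k U (\<lambda>x. ?g' (f x) b)" for b
      using Suc.prems(2) by (intro Suc.IH[OF Ck_on_Suc_imp[OF Suc.prems(1)]]) simp
    ultimately show "Ck_on k U (\<lambda>x. \<Sum>b\<in>Basis. (?f' x v \<bullet> b) * ?g' (f x) b)"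
      by (intro Ck_on_sum[OF U] Ck_on_mult[OF U])
  qed
qed

lemma smooth_onD: "smooth_on U f \<Longrightarrow> Ck_on k U f"
  by (simp add: smooth_on_def)

lemma smooth_on_cong: "open U \<Longrightarrow> (\<And>x. x \<in> U \<Longrightarrow> f x = g x) \<Longrightarrow> smooth_on U f \<Longrightarrow> smooth_on U g"
  unfolding smooth_on_def using Ck_on_cong by blast

lemma smooth_on_subset: "smooth_on U f \<Longrightarrow> V \<subseteq> U \<Longrightarrow> smooth_on V f"
  unfolding smooth_on_def using Ck_on_subset by blast

lemma smooth_on_localI:
  assumes "\<And>x. x \<in> U \<Longrightarrow> \<exists>V. open V \<and> x \<in> V \<and> smooth_on V f"
  shows "smooth_on U f"
  unfolding smooth_on_def
proof (intro allI Ck_on_localI)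
  fix k x assume "x \<in> U"
  then obtain V where "open V \<and> x \<in> V \<and> smooth_on V f" using assms by (elim exE[OF assms])
  then show "\<exists>V. open V \<and> x \<in> V \<and> Ck_on k V f" by (intro exI[of _ V]) (simp add: smooth_onD)
qed

lemma smooth_on_continuous: "smooth_on U f \<Longrightarrow> continuous_on U f"
  unfolding smooth_on_def using Ck_on_continuous by blast

lemma smooth_on_has_derivative:
  "smooth_on U f \<Longrightarrow> x \<in> U \<Longrightarrow> (f has_derivative frechet_derivative f (at x)) (at x)"
  using Ck_on_derivative smooth_onD by blast

lemma smooth_on_derivative: "smooth_on U f \<Longrightarrow> smooth_on U (\<lambda>x. frechet_derivative f (at x) v)"
  unfolding smooth_on_def by (metis Ck_on.simps(2))

lemma smooth_on_const: "open U \<Longrightarrow> smooth_on U (\<lambda>x. c)"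
  by (simp add: smooth_on_def Ck_on_const)

lemma smooth_on_add: "open U \<Longrightarrow> smooth_on U f \<Longrightarrow> smooth_on U g \<Longrightarrow> smooth_on U (\<lambda>x. f x + g x)"
  by (simp add: smooth_on_def Ck_on_add)

lemma smooth_on_sum: "open U \<Longrightarrow> (\<And>i. i \<in> I \<Longrightarrow> smooth_on U (f i)) \<Longrightarrow> smooth_on U (\<lambda>x. \<Sum>i\<in>I. f i x)"
  by (simp add: smooth_on_def Ck_on_sum)

lemma smooth_on_mult:
  fixes f g :: "'a::real_normed_vector \<Rightarrow> real"
  shows "open U \<Longrightarrow> smooth_on U f \<Longrightarrow> smooth_on U g \<Longrightarrow> smooth_on U (\<lambda>x. f x * g x)"
  by (simp add: smooth_on_def Ck_on_mult)

lemma smooth_on_bounded_linear: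
  "open U \<Longrightarrow> bounded_linear L \<Longrightarrow> smooth_on U f \<Longrightarrow> smooth_on U (\<lambda>x. L (f x))"
  by (simp add: smooth_on_def Ck_on_bounded_linear)

lemma smooth_on_compose:
  fixes f :: "'a::real_normed_vector \<Rightarrow> 'b::euclidean_space" and g :: "'b \<Rightarrow> real"
  shows "open U \<Longrightarrow> open V \<Longrightarrow> f ` U \<subseteq> V \<Longrightarrow> smooth_on U f \<Longrightarrow> smooth_on V g \<Longrightarrow> smooth_on U (\<lambda>x. g (f x))"
  unfolding smooth_on_def by (intro allI Ck_on_compose[of U V]) simp_all

lemma smooth_on_id:
  assumes U: "open U"
  shows "smooth_on U (\<lambda>x. x)"
proof -
  have "Ck_on k U (\<lambda>x. x)" for k
  proof (cases k)
    case (Suc j)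
    show ?thesis unfolding Suc
      by (rule Ck_on_SucI[OF U has_derivative_ident Ck_on_const[OF U]])
  qed simp
  then show ?thesis by (simp add: smooth_on_def)
qed

lemma smooth_on_minus: "open U \<Longrightarrow> smooth_on U f \<Longrightarrow> smooth_on U (\<lambda>x. - f x)"
  by (rule smooth_on_bounded_linear[OF _ bounded_linear_minus[OF bounded_linear_ident]])

lemma smooth_on_diff: "open U \<Longrightarrow> smooth_on U f \<Longrightarrow> smooth_on U g \<Longrightarrow> smooth_on U (\<lambda>x. f x - g x)"
  using smooth_on_add[OF _ _ smooth_on_minus] by force

lemma smooth_on_vec:
  fixes f :: "'a::real_normed_vector \<Rightarrow> real ^ 'k::finite"
  assumes U: "open U"
  shows "smooth_on U f \<longleftrightarrow> (\<forall>i. smooth_on U (\<lambda>x. f x $ i))"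
proof
  assume "\<forall>i. smooth_on U (\<lambda>x. f x $ i)"
  then have "smooth_on U (\<lambda>x. \<Sum>i\<in>UNIV. f x $ i *\<^sub>R axis i (1::real))"
    by (intro smooth_on_sum[OF U] smooth_on_bounded_linear[OF U bounded_linear_scaleR_left]) auto
  moreover have "(\<Sum>i\<in>UNIV. f x $ i *\<^sub>R axis i (1::real)) = f x" for x
    using basis_expansion[of "f x"] by (simp add: scalar_mult_eq_scaleR)
  ultimately show "smooth_on U f" by simp
qed (auto intro: smooth_on_bounded_linear[OF U bounded_linear_vec_nth])

text \<open>The derivative of \<open>inverse\<close> is a polynomial in \<open>inverse\<close>,
  which closes the induction.\<close>

lemma smooth_on_inverse: "smooth_on (- {0 :: real}) inverse"
proof -
  have o: "open (- {0 :: real})" by auto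
  have "Ck_on k (- {0 :: real}) inverse" for k
  proof (induction k)
    case 0
    then show ?case by (auto intro!: continuous_intros)
  next
    case (Suc k)
    show ?case
    proof (rule Ck_on_SucI[OF o])
      show "(inverse has_derivative (\<lambda>v. - (inverse x * v * inverse x))) (at x)" if "x \<in> - {0}" for x :: real
        using that by (intro has_derivative_inverse') auto
      show "Ck_on k (- {0}) (\<lambda>x::real. - (inverse x * v * inverse x))" for v
        using Ck_on_bounded_linear[OF o bounded_linear_mult_right[of "- v"] Ck_on_mult[OF o Suc Suc]]
        by (simp add: mult_ac)
    qed
  qed
  then show ?thesis by (simp add: smooth_on_def)
qed

section \<open>Bump functions\<close>

text \<open>The flat function exp(-1/t), multiplied by a power of 1/t. The family spans a space
  closed under differentiation, so one induction over the order, for all \<open>n\<close> at once,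
  gives smoothness at 0.\<close>

definition flat_exp :: "nat \<Rightarrow> real \<Rightarrow> real" where
  "flat_exp n t = (if 0 < t then exp (- inverse t) * inverse t ^ n else 0)"

lemma flat_exp_tendsto_0: "(flat_exp n \<longlongrightarrow> 0) (at_right 0)"
proof -
  have "((\<lambda>t. inverse t ^ n / exp (inverse t)) \<longlongrightarrow> (0::real)) (at_right 0)"
    by (rule filterlim_compose[OF tendsto_power_div_exp_0 filterlim_inverse_at_top_right])
  then show ?thesis
    by (rule Lim_transform_eventually)
      (auto simp: eventually_at_right_less flat_exp_def exp_minus field_simps
        intro!: eventually_mono[OF eventually_at_right_less[of 0]])
qed

lemma flat_exp_has_derivative:
  "(flat_exp n has_real_derivative flat_exp (n + 2) t - real n * flat_exp (n + 1) t) (at t)"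
proof (cases t "0 :: real" rule: linorder_cases)
  case less
  have "((\<lambda>_. 0) has_real_derivative 0) (at t)" by simp
  then have "(flat_exp n has_real_derivative 0) (at t)"
    by (rule has_field_derivative_transform_within_open[of _ _ _ "{..<0}"])
      (use less in \<open>auto simp: flat_exp_def\<close>)
  then show ?thesis using less by (simp add: flat_exp_def)
next
  case greater
  have 1: "((\<lambda>t. exp (- inverse t)) has_real_derivative exp (- inverse t) * (inverse t)\<^sup>2) (at t)"
    using greater by (auto intro!: derivative_eq_intros simp: power2_eq_square)
  have 2: "((\<lambda>t. inverse t ^ n) has_real_derivative real n * inverse t ^ (n - 1) * - ((inverse t)\<^sup>2)) (at t)"
    using greater by (auto intro!: derivative_eq_intros simp: power2_eq_square)
  have "((\<lambda>t. exp (- inverse t) * inverse t ^ n) has_real_derivative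
      flat_exp (n + 2) t - real n * flat_exp (n + 1) t) (at t)"
    by (rule DERIV_cong[OF DERIV_mult[OF 1 2]])
      (use greater in \<open>cases n; simp add: flat_exp_def power2_eq_square algebra_simps\<close>)
  then show ?thesis
    by (rule has_field_derivative_transform_within_open[of _ _ _ "{0<..}"])
      (use greater in \<open>auto simp: flat_exp_def\<close>)
next
  case equal
  \<comment> \<open>At 0 the difference quotient of \<open>flat_exp n\<close> from the right is
    \<open>flat_exp (n + 1)\<close>, which tends to 0; from the left it is 0.\<close>
  have "((\<lambda>h. (flat_exp n h - flat_exp n 0) / (h - 0)) \<longlongrightarrow> 0) (at_right 0)"
    by (rule Lim_transform_eventually[OF flat_exp_tendsto_0[of "Suc n"]])
      (auto simp: flat_exp_def field_simps intro!: eventually_mono[OF eventually_at_right_less[of 0]])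
  moreover have "((\<lambda>h. (flat_exp n h - flat_exp n 0) / (h - 0)) \<longlongrightarrow> 0) (at_left 0)"
    by (rule Lim_transform_eventually[OF tendsto_const])
      (auto simp: flat_exp_def intro!: eventually_at_leftI[of "-1"])
  ultimately have "((\<lambda>h. (flat_exp n h - flat_exp n 0) / (h - 0)) \<longlongrightarrow> 0) (at 0)"
    by (simp add: filterlim_at_split)
  then show ?thesis by (simp add: equal has_field_derivative_iff flat_exp_def)
qed

lemma smooth_flat_exp: "smooth_on UNIV (flat_exp n)"
proof -
  have "Ck_on k UNIV (flat_exp n)" for k
  proof (induction k arbitrary: n)
    case 0
    then show ?case
      using flat_exp_has_derivative by (auto intro!: DERIV_continuous_on)
  next
    case (Suc k)
    have "Ck_on k UNIV (\<lambda>x. flat_exp (n + 2) x + (- real n) * flat_exp (n + 1) x)"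
      by (intro Ck_on_add Ck_on_mult Ck_on_const Suc) auto
    then have "Ck_on k UNIV (\<lambda>x. (flat_exp (n + 2) x + (- real n) * flat_exp (n + 1) x) * v)" for v
      by (intro Ck_on_mult Ck_on_const) auto
    then show ?case
      by (intro Ck_on_SucI[OF open_UNIV flat_exp_has_derivative[unfolded has_field_derivative_def]]) simp
  qed
  then show ?thesis by (simp add: smooth_on_def)
qed

lemma smooth_bump:
  fixes a :: "real ^ 'n::finite"
  assumes r: "r > 0"
  shows "\<exists>b :: real ^ 'n \<Rightarrow> real. smooth_on UNIV b \<and> (\<forall>y. dist a y \<le> r \<longrightarrow> b y = 1) \<and>
    (\<forall>y. 2 * r \<le> dist a y \<longrightarrow> b y = 0)"
proof -
  \<comment> \<open>A smooth step, 0 for t \<le> 0 and 1 for t \<ge> 1. The denominator is positive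
    because \<open>t\<close> and \<open>1 - t\<close> are never both nonpositive.\<close>
  define s where "s t = flat_exp 0 t * inverse (flat_exp 0 t + flat_exp 0 (1 - t))" for t
  have pos: "flat_exp 0 t + flat_exp 0 (1 - t) \<noteq> 0" for t
    using add_pos_pos[of "exp (- inverse t)" "exp (- inverse (1 - t))"]
    by (cases "0 < t"; cases "t < 1") (auto simp: flat_exp_def)
  have s2: "smooth_on UNIV (\<lambda>t. flat_exp 0 (1 - t))"
    by (rule smooth_on_compose[OF _ _ _ _ smooth_flat_exp])
      (auto intro: smooth_on_diff[OF open_UNIV smooth_on_const smooth_on_id])
  have "smooth_on UNIV (\<lambda>t. inverse (flat_exp 0 t + flat_exp 0 (1 - t)))"
    by (rule smooth_on_compose[OF _ _ _ _ smooth_on_inverse])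
      (use pos s2 in \<open>auto intro: smooth_on_add smooth_flat_exp\<close>)
  then have s: "smooth_on UNIV s"
    unfolding s_def by (intro smooth_on_mult smooth_flat_exp) auto
  \<comment> \<open>The squared distance keeps \<open>u\<close> smooth at \<open>a\<close>. It gives
    \<open>u y \<ge> 1\<close> up to radius r, and \<open>u y \<le> 0\<close> from radius sqrt 2 * r
    on, in particular from 2 * r on.\<close>
  define u where "u y = 2 - (\<Sum>i\<in>UNIV. (y $ i - a $ i) * (y $ i - a $ i)) * inverse (r\<^sup>2)" for y :: "real ^ 'n"
  have u: "smooth_on UNIV u"
    unfolding u_def
    by (intro smooth_on_diff smooth_on_mult smooth_on_sum smooth_on_const open_UNIV
      smooth_on_bounded_linear[OF open_UNIV bounded_linear_vec_nth] smooth_on_id)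
  have u_dist: "u y = 2 - (dist a y)\<^sup>2 / r\<^sup>2" for y
    by (simp add: u_def dist_norm norm_vec_def L2_set_def sum_nonneg power2_eq_square[symmetric]
      power2_commute divide_inverse)
  have "smooth_on UNIV (\<lambda>y. s (u y))" by (rule smooth_on_compose[OF _ _ _ u s]) auto
  moreover have "s (u y) = 1" if "dist a y \<le> r" for y
  proof -
    have "(dist a y)\<^sup>2 \<le> r\<^sup>2" using that by (intro power_mono) auto
    then have "1 \<le> u y" using r by (simp add: u_dist divide_simps)
    then show ?thesis using pos[of "u y"] by (simp add: s_def flat_exp_def)
  qed
  moreover have "s (u y) = 0" if "2 * r \<le> dist a y" for y
  proof -
    have "(2 * r)\<^sup>2 \<le> (dist a y)\<^sup>2" using that r by (intro power_mono) auto
    then have "4 * r\<^sup>2 \<le> (dist a y)\<^sup>2" by (simp add: power_mult_distrib)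
    then have "2 * r\<^sup>2 \<le> (dist a y)\<^sup>2" using zero_le_power2[of r] by linarith
    then have "u y \<le> 0" using r by (simp add: u_dist divide_simps)
    then show ?thesis by (simp add: s_def flat_exp_def)
  qed
  ultimately show ?thesis by blast
qed

section \<open>Hadamard's lemma\<close>

text \<open>Differentiating under the integral gives an integral of the same kind, with
  \<open>g\<close> replaced by a directional derivative and the weight \<open>w t\<close> by
  \<open>w t * t\<close>. The weight is part of the statement so that this induction closes.\<close>

lemma smooth_on_segment_integral:
  fixes g :: "real ^ 'n::finite \<Rightarrow> real"
  assumes B: "open B" "convex B" "a \<in> B" and g: "smooth_on B g" and w: "continuous_on {0..1} w"
  shows "smooth_on B (\<lambda>y. integral {0..1} (\<lambda>t. w t * g (a + t *\<^sub>R (y - a))))"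
proof -
  have \<gamma>B: "a + t *\<^sub>R (y - a) \<in> B" if "y \<in> B" "t \<in> {0..1}" for y t
  proof -
    have "a + t *\<^sub>R (y - a) = (1 - t) *\<^sub>R a + t *\<^sub>R y" by (simp add: algebra_simps)
    then show ?thesis using B that by (simp add: convexD)
  qed
  have c\<gamma>: "continuous_on (B \<times> {0..1}) (\<lambda>p. a + snd p *\<^sub>R (fst p - a))" by (intro continuous_intros)
  have comp: "continuous_on (B \<times> {0..1}) (\<lambda>p. f (a + snd p *\<^sub>R (fst p - a)))" if "continuous_on B f"
    for f :: "real ^ 'n \<Rightarrow> real"
    by (rule continuous_on_compose2[OF that c\<gamma>]) (use \<gamma>B in auto)
  have comp1: "continuous_on {0..1} (\<lambda>t. f (a + t *\<^sub>R (y - a)))" if "continuous_on B f" "y \<in> B"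
    for f :: "real ^ 'n \<Rightarrow> real" and y
    by (rule continuous_on_compose2[OF that(1)]) (use \<gamma>B that in \<open>auto intro!: continuous_intros\<close>)
  have "Ck_on k B (\<lambda>y. integral {0..1} (\<lambda>t. w t * g (a + t *\<^sub>R (y - a))))"
    if g: "smooth_on B g" and w: "continuous_on {0..1} w" for k and w :: "real \<Rightarrow> real" and g
    using that
  proof (induction k arbitrary: w g)
    case 0
    have "continuous_on (B \<times> {0..1}) (\<lambda>p. w (snd p) * g (a + snd p *\<^sub>R (fst p - a)))"
      by (intro continuous_intros comp smooth_on_continuous 0 continuous_on_compose2[OF 0(2)]) auto
    then show ?case using integral_continuous_on_param[of B 0 1 "\<lambda>y t. w t * g (a + t *\<^sub>R (y - a))"]
      by (simp add: split_beta)
  next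
    case (Suc k)
    note cg = smooth_on_continuous[OF Suc.prems(1)]
    define E where "E y t = (w t * t) *\<^sub>R Blinfun (frechet_derivative g (at (a + t *\<^sub>R (y - a))))" for y t
    have E: "E y t v = w t * t * frechet_derivative g (at (a + t *\<^sub>R (y - a))) v" if "y \<in> B" "t \<in> {0..1}" for y t v
      using has_derivative_bounded_linear[OF smooth_on_has_derivative[OF Suc.prems(1) \<gamma>B[OF that]]]
      by (simp add: E_def blinfun.scaleR_left bounded_linear_Blinfun_apply)
    have cE: "continuous_on (B \<times> {0..1}) (\<lambda>(y, t). E y t)"
    proof (rule continuous_on_blinfun_componentwise)
      fix i :: "real ^ 'n"
      have "continuous_on (B \<times> {0..1}) (\<lambda>p. w (snd p) * snd p * frechet_derivative g (at (a + snd p *\<^sub>R (fst p - a))) i)"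
        by (intro continuous_intros comp[of "\<lambda>z. frechet_derivative g (at z) i"] smooth_on_continuous
          smooth_on_derivative Suc.prems continuous_on_compose2[OF Suc.prems(2)]) auto
      then show "continuous_on (B \<times> {0..1}) (\<lambda>x. (case x of (y, t) \<Rightarrow> E y t) i)"
        by (rule continuous_on_cong[THEN iffD1, OF refl, rotated]) (auto simp: E)
    qed
    show ?case
    proof (rule Ck_on_SucI[OF B(1)])
      fix y assume y: "y \<in> B"
      have "((\<lambda>y. integral (cbox 0 1) (\<lambda>t. w t * g (a + t *\<^sub>R (y - a)))) has_derivative
          integral (cbox 0 1) (E y)) (at y within B)"
      proof (rule leibniz_rule[OF _ _ _ y B(2)])
        fix z t assume z: "z \<in> B" and t: "t \<in> cbox 0 (1::real)"
        have 1: "((\<lambda>z. a + t *\<^sub>R (z - a)) has_derivative (\<lambda>v. t *\<^sub>R v)) (at z)"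
          by (auto intro!: derivative_eq_intros)
        have 2: "(g has_derivative frechet_derivative g (at (a + t *\<^sub>R (z - a)))) (at (a + t *\<^sub>R (z - a)))"
          using smooth_on_has_derivative[OF Suc.prems(1) \<gamma>B[OF z]] t by simp
        have 3: "((\<lambda>z. w t * g (a + t *\<^sub>R (z - a))) has_derivative
            (\<lambda>v. w t * frechet_derivative g (at (a + t *\<^sub>R (z - a))) (t *\<^sub>R v))) (at z)"
          using has_derivative_mult_right[OF diff_chain_at[OF 1 2]] by (simp add: o_def)
        have 4: "frechet_derivative g (at (a + t *\<^sub>R (z - a))) (t *\<^sub>R v) =
            t * frechet_derivative g (at (a + t *\<^sub>R (z - a))) v" for v
          using linear_scale[OF has_derivative_linear[OF 2]] by simp
        have "w t * frechet_derivative g (at (a + t *\<^sub>R (z - a))) (t *\<^sub>R v) = E z t v" for v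
          using E[OF z, of t v] t 4[of v] by simp
        then show "((\<lambda>z. w t * g (a + t *\<^sub>R (z - a))) has_derivative blinfun_apply (E z t)) (at z within B)"
          using has_derivative_at_withinI[OF 3] by simp
      next
        fix z assume z: "z \<in> B"
        show "(\<lambda>t. w t * g (a + t *\<^sub>R (z - a))) integrable_on cbox 0 1"
          by (intro integrable_continuous) (auto intro!: continuous_intros comp1 cg z Suc.prems(2))
      qed (use cE in simp)
      then show "((\<lambda>y. integral {0..1} (\<lambda>t. w t * g (a + t *\<^sub>R (y - a)))) has_derivative
          blinfun_apply (integral {0..1} (E y))) (at y)"
        using B(1) y by (simp add: at_within_open[of _ B])
    next
      fix v
      have "Ck_on k B (\<lambda>y. integral {0..1} (\<lambda>t. (w t * t) * frechet_derivative g (at (a + t *\<^sub>R (y - a))) v))"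
        by (rule Suc.IH) (intro smooth_on_derivative Suc.prems continuous_intros)+
      then show "Ck_on k B (\<lambda>y. blinfun_apply (integral {0..1} (E y)) v)"
      proof (rule Ck_on_cong[OF B(1), rotated])
        fix y assume y: "y \<in> B"
        have "E y integrable_on {0..1}"
          using continuous_on_compose2[OF cE continuous_on_Pair[OF continuous_on_const continuous_on_id], of y "{0..1}"] y
          by (intro integrable_continuous_interval) auto
        then have "integral {0..1} (E y) v = integral {0..1} (\<lambda>t. E y t v)"
          using integral_linear[OF _ blinfun.bounded_linear_left, of "E y" "{0..1}" v] by (simp add: o_def)
        also have "\<dots> = integral {0..1} (\<lambda>t. (w t * t) * frechet_derivative g (at (a + t *\<^sub>R (y - a))) v)"
          by (rule integral_cong) (use y in \<open>simp add: E\<close>)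
        finally show "integral {0..1} (\<lambda>t. (w t * t) * frechet_derivative g (at (a + t *\<^sub>R (y - a))) v) =
          integral {0..1} (E y) v" by simp
      qed
    qed
  qed
  then show ?thesis using g w by (simp add: smooth_on_def)
qed

text \<open>\<open>h i\<close> is the i-th partial derivative averaged over the segment from
  \<open>a\<close> to \<open>y\<close>. Since the factors \<open>y $ i - a $ i\<close> vanish at
  \<open>a\<close>, a derivation at \<open>a\<close> can be computed from its values on the
  coordinates.\<close>

lemma hadamard:
  fixes f :: "real ^ 'n::finite \<Rightarrow> real"
  assumes B: "open B" "convex B" "a \<in> B" and f: "smooth_on B f"
  shows "\<exists>h. (\<forall>i. smooth_on B (h i) \<and> h i a = frechet_derivative f (at a) (axis i 1)) \<and>
    (\<forall>y\<in>B. f y = f a + (\<Sum>i\<in>UNIV. (y $ i - a $ i) * h i y))"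
proof -
  define d where "d i y = frechet_derivative f (at y) (axis i 1)" for i y
  define h where "h i y = integral {0..1} (\<lambda>t. 1 * d i (a + t *\<^sub>R (y - a)))" for i and y :: "real ^ 'n"
  have d: "smooth_on B (d i)" for i unfolding d_def by (rule smooth_on_derivative[OF f])
  have "smooth_on B (h i)" for i
    unfolding h_def by (rule smooth_on_segment_integral[OF B d]) simp
  moreover have "h i a = d i a" for i by (simp add: h_def)
  moreover have "f y = f a + (\<Sum>i\<in>UNIV. (y $ i - a $ i) * h i y)" if y: "y \<in> B" for y
  proof -
    have \<gamma>B: "a + t *\<^sub>R (y - a) \<in> B" if "t \<in> {0..1}" for t
    proof -
      have "a + t *\<^sub>R (y - a) = (1 - t) *\<^sub>R a + t *\<^sub>R y" by (simp add: algebra_simps)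
      then show ?thesis using B that y by (simp add: convexD)
    qed
    have "((\<lambda>t. \<Sum>i\<in>UNIV. (y $ i - a $ i) * d i (a + t *\<^sub>R (y - a))) has_integral
        f (a + 1 *\<^sub>R (y - a)) - f (a + 0 *\<^sub>R (y - a))) {0..1}"
    proof (rule fundamental_theorem_of_calculus)
      fix t :: real assume t: "t \<in> {0..1}"
      have 1: "((\<lambda>t. a + t *\<^sub>R (y - a)) has_vector_derivative (y - a)) (at t within {0..1})"
        by (auto intro!: derivative_eq_intros)
      have 2: "(f has_derivative frechet_derivative f (at (a + t *\<^sub>R (y - a)))) (at (a + t *\<^sub>R (y - a)))"
        by (rule smooth_on_has_derivative[OF f \<gamma>B[OF t]])
      have "((f \<circ> (\<lambda>t. a + t *\<^sub>R (y - a))) has_vector_derivative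
          frechet_derivative f (at (a + t *\<^sub>R (y - a))) (y - a)) (at t within {0..1})"
        by (rule vector_derivative_diff_chain_within[OF 1 has_derivative_at_withinI[OF 2]])
      moreover have "frechet_derivative f (at (a + t *\<^sub>R (y - a))) (y - a) =
          (\<Sum>i\<in>UNIV. (y $ i - a $ i) * d i (a + t *\<^sub>R (y - a)))"
      proof -
        have "y - a = (\<Sum>i\<in>UNIV. (y - a) $ i *\<^sub>R axis i 1)"
          using basis_expansion[of "y - a"] by (simp add: scalar_mult_eq_scaleR)
        then show ?thesis
          using has_derivative_linear[OF 2] by (simp add: d_def linear_sum linear_scale)
      qed
      ultimately show "((\<lambda>t. f (a + t *\<^sub>R (y - a))) has_vector_derivative
          (\<Sum>i\<in>UNIV. (y $ i - a $ i) * d i (a + t *\<^sub>R (y - a)))) (at t within {0..1})"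
        by (simp add: o_def)
    qed simp
    then have "f y - f a = integral {0..1} (\<lambda>t. \<Sum>i\<in>UNIV. (y $ i - a $ i) * d i (a + t *\<^sub>R (y - a)))"
      by (simp add: integral_unique)
    also have "\<dots> = (\<Sum>i\<in>UNIV. (y $ i - a $ i) * h i y)"
    proof -
      have "(\<lambda>t. d i (a + t *\<^sub>R (y - a))) integrable_on {0..1}" for i
        by (intro integrable_continuous_interval continuous_on_compose2[OF smooth_on_continuous[OF d]])
          (use \<gamma>B in \<open>auto intro!: continuous_intros\<close>)
      then show ?thesis by (subst integral_sum) (auto simp: h_def intro: integrable_on_mult_right)
    qed
    finally show ?thesis by simp
  qed
  ultimately show ?thesis by (auto simp: d_def)
qed

section \<open>Flat linear systems\<close>

text \<open>A maximum argument in the place of Gronwall's inequality: where the norm of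
  \<open>y\<close> is largest on the segment, the mean value inequality bounds it by half of
  itself.\<close>

lemma linear_ode_zero:
  fixes y :: "'v::euclidean_space \<Rightarrow> 'e::real_normed_vector"
  assumes B: "convex B" "q \<in> B" "x \<in> B" and y0: "y q = 0"
    and der: "\<And>x. x \<in> B \<Longrightarrow> (y has_derivative y' x) (at x)"
    and bound: "\<And>x v. x \<in> B \<Longrightarrow> norm (y' x v) \<le> C * norm (y x) * norm v"
    and C: "0 \<le> C" and small: "\<And>x. x \<in> B \<Longrightarrow> C * norm (x - q) \<le> 1/2"
  shows "y x = 0"
proof -
  define S where "S = closed_segment q x"
  have SB: "S \<subseteq> B" using B by (simp add: S_def closed_segment_subset)
  have "continuous_on S (\<lambda>z. norm (y z))"
    using der SB by (intro continuous_on_norm) (meson has_derivative_continuous_on has_derivative_at_withinI subsetD)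
  moreover have "compact S" "S \<noteq> {}" by (auto simp: S_def)
  ultimately obtain z where z: "z \<in> S" "\<And>w. w \<in> S \<Longrightarrow> norm (y w) \<le> norm (y z)"
    using continuous_attains_sup[of S] by blast
  have "norm (y z - y q) \<le> (C * norm (y z)) * norm (z - q)"
  proof (rule differentiable_bound[where f'=y' and S=S])
    fix w assume w: "w \<in> S"
    then show "(y has_derivative y' w) (at w within S)" using der SB has_derivative_at_withinI by blast
    show "onorm (y' w) \<le> C * norm (y z)"
    proof (rule onorm_le)
      fix v
      have "norm (y' w v) \<le> C * norm (y w) * norm v" using bound w SB by blast
      also have "\<dots> \<le> C * norm (y z) * norm v"
        using z(2)[OF w] C by (intro mult_right_mono mult_left_mono) auto
      finally show "norm (y' w v) \<le> C * norm (y z) * norm v" .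
    qed
  qed (use z in \<open>auto simp: S_def\<close>)
  also have "\<dots> = (C * norm (z - q)) * norm (y z)" by simp
  also have "\<dots> \<le> 1/2 * norm (y z)" using small z SB by (intro mult_right_mono) auto
  finally have "norm (y z) \<le> 0" by (simp add: y0)
  then show ?thesis using z(2)[of x] by (simp add: S_def)
qed

lemma continuous_on_flip:
  fixes D :: "'p::t2_space \<Rightarrow> 'v::euclidean_space \<Rightarrow>\<^sub>L 'v \<Rightarrow>\<^sub>L 'e::real_normed_vector"
  assumes "continuous_on U D" "continuous_on U u"
  shows "continuous_on U (\<lambda>p. Blinfun (\<lambda>v. D p v (u p)))"
  by (rule continuous_on_blinfun_componentwise)
    (use assms in \<open>auto simp: bounded_linear_Blinfun_apply blinfun.bounded_linear_left
      bounded_linear_compose[OF blinfun.bounded_linear_left blinfun.bounded_linear_right]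
      intro!: continuous_intros\<close>)

text \<open>An operator on a Euclidean space is a sum of rank-one operators \<open>T i\<close>
  formed from its values on \<open>Basis\<close>. Differentiability in operator norm thus reduces to
  that of the single values.\<close>

lemma has_derivative_blinfun_componentwise:
  fixes f :: "'p::real_normed_vector \<Rightarrow> 'v::euclidean_space \<Rightarrow>\<^sub>L 'e::real_normed_vector"
    and D :: "'p \<Rightarrow> 'v \<Rightarrow>\<^sub>L 'e"
  assumes "\<And>i. ((\<lambda>x. f x i) has_derivative (\<lambda>w. D w i)) F"
  shows "(f has_derivative D) F"
proof -
  define T where "T i y = Blinfun (\<lambda>v. (v \<bullet> i) *\<^sub>R y)" for i :: 'v and y :: 'e
  have T1: "bounded_linear (\<lambda>v. (v \<bullet> i) *\<^sub>R y)" for i :: 'v and y :: 'e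
    by (intro bounded_linear_scaleR_const bounded_linear_inner_left)
  have T: "T i y v = (v \<bullet> i) *\<^sub>R y" for i y v
    by (simp add: T_def bounded_linear_Blinfun_apply[OF T1])
  have T2: "bounded_linear (T i)" for i
  proof (rule bounded_linear_intro)
    show "T i (y + z) = T i y + T i z" "T i (c *\<^sub>R y) = c *\<^sub>R T i y" for y z c
      by (rule blinfun_eqI; simp add: T blinfun.add_left blinfun.scaleR_left scaleR_right_distrib)+
    show "norm (T i y) \<le> norm y * norm i" for y
    proof (rule norm_blinfun_bound)
      fix v
      have "\<bar>v \<bullet> i\<bar> * norm y \<le> (norm v * norm i) * norm y"
        by (intro mult_right_mono Cauchy_Schwarz_ineq2) simp
      then show "norm (T i y v) \<le> norm y * norm i * norm v" by (simp add: T mult_ac)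
    qed simp
  qed
  have expand: "g = (\<Sum>i\<in>Basis. T i (g i))" for g :: "'v \<Rightarrow>\<^sub>L 'e"
  proof (rule blinfun_eqI)
    fix v
    have "g v = g (\<Sum>i\<in>Basis. (v \<bullet> i) *\<^sub>R i)" by (simp add: euclidean_representation)
    then show "g v = (\<Sum>i\<in>Basis. T i (g i)) v"
      by (simp add: T blinfun.sum_left blinfun.sum_right blinfun.scaleR_right)
  qed
  have "((\<lambda>x. \<Sum>i\<in>Basis. T i (f x i)) has_derivative (\<lambda>w. \<Sum>i\<in>Basis. T i (D w i))) F"
    by (intro has_derivative_sum bounded_linear.has_derivative[OF T2] assms)
  then show ?thesis by (simp add: expand[symmetric])
qed

text \<open>\<open>H\<close> is the homotopy operator of the Poincare lemma, and the integral on the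
  right contains the exterior derivative of \<beta>. It is kept as an explicit error term because
  the 1-forms of the Picard iterates are only approximately closed.\<close>

lemma poincare_homotopy:
  fixes \<beta> :: "'v::euclidean_space \<Rightarrow> 'v \<Rightarrow>\<^sub>L 'e::euclidean_space"
    and D :: "'v \<Rightarrow> 'v \<Rightarrow>\<^sub>L 'v \<Rightarrow>\<^sub>L 'e"
  assumes B: "open B" "convex B" "q \<in> B"
    and der: "\<And>x. x \<in> B \<Longrightarrow> (\<beta> has_derivative blinfun_apply (D x)) (at x)"
    and cont: "continuous_on B D"
  defines "\<gamma> \<equiv> \<lambda>x t. q + t *\<^sub>R (x - q)"
  defines "H \<equiv> \<lambda>x. integral {0..1} (\<lambda>t. \<beta> (\<gamma> x t) (x - q))"
  shows "\<exists>DH :: 'v \<Rightarrow> 'v \<Rightarrow>\<^sub>L 'e. continuous_on B DH \<and> (\<forall>x\<in>B. (H has_derivative blinfun_apply (DH x)) (at x) \<and>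
    (\<forall>v. (\<lambda>t. t *\<^sub>R (D (\<gamma> x t) v (x - q) - D (\<gamma> x t) (x - q) v)) integrable_on {0..1} \<and>
      DH x v = \<beta> x v + integral {0..1} (\<lambda>t. t *\<^sub>R (D (\<gamma> x t) v (x - q) - D (\<gamma> x t) (x - q) v))))"
proof -
  have \<gamma>B: "\<gamma> x t \<in> B" if "x \<in> B" "t \<in> {0..1}" for x t
  proof -
    have "\<gamma> x t = (1 - t) *\<^sub>R q + t *\<^sub>R x" by (simp add: \<gamma>_def algebra_simps)
    then show ?thesis using B that by (simp add: convexD)
  qed
  have cont\<beta>: "continuous_on B \<beta>"
    using der by (meson has_derivative_continuous_on has_derivative_at_withinI)
  have c\<gamma>: "continuous_on (B \<times> {0..1}) (\<lambda>p. \<gamma> (fst p) (snd p))"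
    unfolding \<gamma>_def by (intro continuous_intros)
  have \<gamma>s: "(\<lambda>p. \<gamma> (fst p) (snd p)) ` (B \<times> {0..1}) \<subseteq> B" using \<gamma>B by auto
  \<comment> \<open>The derivative in \<open>x\<close> of the integrand of \<open>H\<close>: the
    first part comes from moving \<open>\<gamma> x t\<close>, the second from the vector
    \<open>x - q\<close>.\<close>
  define E where "E x t = t *\<^sub>R Blinfun (\<lambda>v. D (\<gamma> x t) v (x - q)) + \<beta> (\<gamma> x t)" for x t
  have E: "E x t v = t *\<^sub>R D (\<gamma> x t) v (x - q) + \<beta> (\<gamma> x t) v" for x t v
    unfolding E_def
    by (simp add: blinfun.add_left blinfun.scaleR_left bounded_linear_Blinfun_apply
      bounded_linear_compose[OF blinfun.bounded_linear_left blinfun.bounded_linear_right])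
  have contE: "continuous_on (B \<times> {0..1}) (\<lambda>(x, t). E x t)"
    unfolding E_def split_beta
    by (intro continuous_intros continuous_on_flip continuous_on_compose2[OF cont c\<gamma> \<gamma>s]
      continuous_on_compose2[OF cont\<beta> c\<gamma> \<gamma>s])
  have cont_t: "continuous_on {0..1} (\<lambda>t. f (\<gamma> x t))" if "continuous_on B f" "x \<in> B"
    for f :: "'v \<Rightarrow> 'z::topological_space" and x
    by (rule continuous_on_compose2[OF that(1)])
      (auto simp: \<gamma>_def intro!: continuous_intros \<gamma>B[OF that(2), unfolded \<gamma>_def])
  have lder: "((\<lambda>x. \<beta> (\<gamma> x t) (x - q)) has_derivative E x t) (at x within B)"
    if x: "x \<in> B" and t: "t \<in> cbox 0 1" for x t
  proof -
    have 1: "((\<lambda>x. \<gamma> x t) has_derivative (\<lambda>v. t *\<^sub>R v)) (at x within B)"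
      unfolding \<gamma>_def by (auto intro!: derivative_eq_intros)
    have 2: "((\<lambda>x. \<beta> (\<gamma> x t)) has_derivative (\<lambda>v. D (\<gamma> x t) (t *\<^sub>R v))) (at x within B)"
      using diff_chain_within[OF 1, of \<beta> "D (\<gamma> x t)"] der[OF \<gamma>B[OF x]] t
      by (simp add: o_def has_derivative_at_withinI)
    have 3: "((\<lambda>x. x - q) has_derivative (\<lambda>v. v)) (at x within B)"
      by (auto intro!: derivative_eq_intros)
    show ?thesis
      by (rule has_derivative_eq_rhs[OF blinfun.FDERIV[OF 2 3]])
        (simp add: E blinfun.bilinear_simps fun_eq_iff scaleR_right_diff_distrib)
  qed
  define DH where "DH x = integral {0..1} (E x)" for x
  have "continuous_on B DH"
    unfolding DH_def using integral_continuous_on_param[of B 0 1 E] contE by simp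
  moreover have "(H has_derivative blinfun_apply (DH x)) (at x)" if x: "x \<in> B" for x
  proof -
    have "((\<lambda>x. integral (cbox 0 1) (\<lambda>t. \<beta> (\<gamma> x t) (x - q))) has_derivative
      integral (cbox 0 1) (E x)) (at x within B)"
    proof (rule leibniz_rule[OF lder _ _ x B(2)])
      fix x assume x: "x \<in> B"
      show "(\<lambda>t. \<beta> (\<gamma> x t) (x - q)) integrable_on cbox 0 1"
        by (intro integrable_continuous) (auto intro!: continuous_intros cont_t[OF cont\<beta> x])
    qed (use contE in simp_all)
    then show ?thesis
      using B(1) x by (simp add: H_def DH_def at_within_open[of _ B])
  qed
  moreover have "(\<lambda>t. t *\<^sub>R (D (\<gamma> x t) v (x - q) - D (\<gamma> x t) (x - q) v)) integrable_on {0..1} \<and>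
      DH x v = \<beta> x v + integral {0..1} (\<lambda>t. t *\<^sub>R (D (\<gamma> x t) v (x - q) - D (\<gamma> x t) (x - q) v))"
    if x: "x \<in> B" for x v
  proof
    show int: "(\<lambda>t. t *\<^sub>R (D (\<gamma> x t) v (x - q) - D (\<gamma> x t) (x - q) v)) integrable_on {0..1}"
      by (intro integrable_continuous_interval continuous_intros cont_t[OF cont x])
    \<comment> \<open>This integrand differs from \<open>E x t v\<close> only in the order of the
      two arguments of \<open>D\<close>. It is the derivative in \<open>t\<close> of
      \<open>t *\<^sub>R \<beta> (\<gamma> x t) v\<close>, whose boundary value is
      \<open>\<beta> x v\<close>.\<close>
    have ftc: "((\<lambda>t. t *\<^sub>R D (\<gamma> x t) (x - q) v + \<beta> (\<gamma> x t) v) has_integral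
        1 *\<^sub>R \<beta> (\<gamma> x 1) v - 0 *\<^sub>R \<beta> (\<gamma> x 0) v) {0..1}"
    proof (rule fundamental_theorem_of_calculus)
      fix t :: real assume t: "t \<in> {0..1}"
      have 1: "((\<lambda>t. \<gamma> x t) has_vector_derivative (x - q)) (at t within {0..1})"
        unfolding \<gamma>_def by (auto intro!: derivative_eq_intros)
      have "((\<beta> \<circ> \<gamma> x) has_vector_derivative D (\<gamma> x t) (x - q)) (at t within {0..1})"
        by (rule vector_derivative_diff_chain_within[OF 1])
          (use der[OF \<gamma>B[OF x t]] has_derivative_at_withinI in blast)
      then have "((\<lambda>t. \<beta> (\<gamma> x t) v) has_vector_derivative D (\<gamma> x t) (x - q) v) (at t within {0..1})"
        unfolding o_def
        by (rule bounded_linear.has_vector_derivative[OF blinfun.bounded_linear_left])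
      from has_vector_derivative_scaleR[OF _ this, of "\<lambda>t. t" 1]
      show "((\<lambda>t. t *\<^sub>R \<beta> (\<gamma> x t) v) has_vector_derivative
          t *\<^sub>R D (\<gamma> x t) (x - q) v + \<beta> (\<gamma> x t) v) (at t within {0..1})"
        by (auto intro: DERIV_ident)
    qed simp
    have "E x integrable_on {0..1}"
      using continuous_on_compose2[OF contE continuous_on_Pair[OF continuous_on_const continuous_on_id], of x "{0..1}"] x
      by (intro integrable_continuous_interval) auto
    then have "DH x v = integral {0..1} (\<lambda>t. E x t v)"
      unfolding DH_def
      using integral_linear[OF _ blinfun.bounded_linear_left, of "E x" "{0..1}" v] by (simp add: o_def)
    also have "(\<lambda>t. E x t v) = (\<lambda>t. (t *\<^sub>R D (\<gamma> x t) (x - q) v + \<beta> (\<gamma> x t) v) +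
        t *\<^sub>R (D (\<gamma> x t) v (x - q) - D (\<gamma> x t) (x - q) v))"
      by (simp add: E fun_eq_iff algebra_simps)
    also have "integral {0..1} \<dots> = \<beta> x v + integral {0..1} (\<lambda>t. t *\<^sub>R (D (\<gamma> x t) v (x - q) - D (\<gamma> x t) (x - q) v))"
      using integral_add[OF has_integral_integrable[OF ftc] int] integral_unique[OF ftc]
      by (simp add: \<gamma>_def)
    finally show "DH x v = \<beta> x v + integral {0..1} (\<lambda>t. t *\<^sub>R (D (\<gamma> x t) v (x - q) - D (\<gamma> x t) (x - q) v))" .
  qed
  ultimately show ?thesis by blast
qed

text \<open>Picard iteration \<open>Y\<^sub>k\<^sub>+\<^sub>1 = y\<^sub>0 + H(A Y\<^sub>k)\<close>. By flatness, the exterior derivative of \<open>A Y\<^sub>k\<close> is controlled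
  by the error \<open>A Y\<^sub>k - dY\<^sub>k\<close>, so that the errors tend to \<open>0\<close> as well.\<close>

theorem linear_frobenius:
  fixes A :: "'v::euclidean_space \<Rightarrow> 'v \<Rightarrow>\<^sub>L 'e::euclidean_space \<Rightarrow>\<^sub>L 'e"
    and DA :: "'v \<Rightarrow> 'v \<Rightarrow>\<^sub>L 'v \<Rightarrow>\<^sub>L 'e \<Rightarrow>\<^sub>L 'e"
  assumes B: "open B" "convex B" "q \<in> B"
    and der: "\<And>x. x \<in> B \<Longrightarrow> (A has_derivative blinfun_apply (DA x)) (at x)"
    and cont: "continuous_on B DA"
    and flat: "\<And>x v w y. x \<in> B \<Longrightarrow> DA x w v y + A x v (A x w y) = DA x v w y + A x w (A x v y)"
    and C: "\<And>x. x \<in> B \<Longrightarrow> norm (A x) \<le> C" and d: "\<And>x. x \<in> B \<Longrightarrow> norm (x - q) \<le> d"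
    and Cd: "C * d \<le> 1/4"
  shows "\<exists>y. y q = y0 \<and> (\<forall>x\<in>B. (y has_derivative (\<lambda>v. A x v (y x))) (at x))"
proof -
  define \<gamma> where "\<gamma> x t = q + t *\<^sub>R (x - q)" for x t
  have \<gamma>B: "\<gamma> x t \<in> B" if "x \<in> B" "t \<in> {0..1}" for x t
  proof -
    have "\<gamma> x t = (1 - t) *\<^sub>R q + t *\<^sub>R x" by (simp add: \<gamma>_def algebra_simps)
    then show ?thesis using B that by (simp add: convexD)
  qed
  have C0: "0 \<le> C" using C[OF B(3)] norm_ge_zero order_trans by blast
  have d0: "0 \<le> d" using d[OF B(3)] by simp
  have contA: "continuous_on B A"
    using der by (meson has_derivative_continuous_on has_derivative_at_withinI)
  have nA: "norm (A x v y) \<le> C * norm v * norm y" if "x \<in> B" for x v y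
  proof -
    have "norm (A x v y) \<le> norm (A x v) * norm y" by (rule norm_blinfun)
    also have "\<dots> \<le> (norm (A x) * norm v) * norm y" by (intro mult_right_mono norm_blinfun) auto
    also have "\<dots> \<le> (C * norm v) * norm y" using C[OF that] by (intro mult_right_mono) auto
    finally show ?thesis .
  qed
  define next_it where "next_it Y x = y0 + integral {0..1} (\<lambda>t. A (\<gamma> x t) (x - q) (Y (\<gamma> x t)))"
    for Y :: "'v \<Rightarrow> 'e" and x
  define C1 where "C1 Y DY \<longleftrightarrow> continuous_on B DY \<and> (\<forall>x\<in>B. (Y has_derivative blinfun_apply (DY x)) (at x))"
    for Y :: "'v \<Rightarrow> 'e" and DY :: "'v \<Rightarrow> 'v \<Rightarrow>\<^sub>L 'e"
  define err where "err Y DY m \<longleftrightarrow> (\<forall>x\<in>B. \<forall>v. norm (A x v (Y x) - blinfun_apply (DY x) v) \<le> m * norm v)"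
    for Y :: "'v \<Rightarrow> 'e" and DY :: "'v \<Rightarrow> 'v \<Rightarrow>\<^sub>L 'e" and m :: real
  have contY: "continuous_on B Y" if "C1 Y DY" for Y DY
    using that unfolding C1_def by (meson has_derivative_continuous_on has_derivative_at_withinI)
  have intY: "(\<lambda>t. A (\<gamma> x t) (x - q) (Y (\<gamma> x t))) integrable_on {0..1}" if "continuous_on B Y" "x \<in> B" for Y x
  proof -
    have c: "continuous_on {0..1} (\<gamma> x)" unfolding \<gamma>_def by (intro continuous_intros)
    have s: "\<gamma> x ` {0..1} \<subseteq> B" using \<gamma>B that by auto
    show ?thesis
      by (intro integrable_continuous_interval continuous_intros
        continuous_on_compose2[OF contA c s] continuous_on_compose2[OF that(1) c s])
  qed
  \<comment> \<open>The bound compares the new derivative with \<open>A\<close> at the old iterate;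
    passing to the new iterate is paid for separately by the contraction estimate.\<close>
  have step: "\<exists>DY'. C1 (next_it Y) DY' \<and> (\<forall>m. err Y DY m \<longrightarrow>
      (\<forall>x\<in>B. \<forall>v. norm (A x v (Y x) - DY' x v) \<le> m / 2 * norm v))"
    if Y: "C1 Y DY" for Y DY
  proof -
    define \<beta> where "\<beta> x = Blinfun (\<lambda>v. A x v (Y x))" for x
    have \<beta>: "\<beta> x v = A x v (Y x)" for x v
      unfolding \<beta>_def by (simp add: bounded_linear_Blinfun_apply
        bounded_linear_compose[OF blinfun.bounded_linear_left blinfun.bounded_linear_right])
    define D where "D x = Blinfun (\<lambda>w. Blinfun (\<lambda>v. DA x w v (Y x) + A x v (DY x w)))" for x
    have D1: "bounded_linear (\<lambda>v. DA x w v (Y x) + A x v (DY x w))" for x w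
      by (intro bounded_linear_add
        bounded_linear_compose[OF blinfun.bounded_linear_left blinfun.bounded_linear_right])
    have D2: "bounded_linear (\<lambda>w. Blinfun (\<lambda>v. DA x w v (Y x) + A x v (DY x w)))" for x
      unfolding linear_conv_bounded_linear[symmetric]
      by (rule linearI; rule blinfun_eqI; simp only: blinfun.add_left blinfun.scaleR_left
        bounded_linear_Blinfun_apply[OF D1]; simp add: blinfun.bilinear_simps algebra_simps)
    have D: "D x w v = DA x w v (Y x) + A x v (DY x w)" for x w v
      unfolding D_def by (simp add: bounded_linear_Blinfun_apply[OF D2] bounded_linear_Blinfun_apply[OF D1])
    have der\<beta>: "(\<beta> has_derivative blinfun_apply (D x)) (at x)" if x: "x \<in> B" for x
    proof (rule has_derivative_blinfun_componentwise)
      fix i :: 'v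
      have 1: "((\<lambda>x. A x i) has_derivative (\<lambda>w. DA x w i)) (at x)"
        using bounded_linear.has_derivative[OF blinfun.bounded_linear_left der[OF x]] .
      have 2: "(Y has_derivative DY x) (at x)" using Y x by (simp add: C1_def)
      have "((\<lambda>x. A x i (Y x)) has_derivative (\<lambda>w. A x i (DY x w) + DA x w i (Y x))) (at x)"
        by (rule blinfun.FDERIV[OF 1 2])
      then show "((\<lambda>x. \<beta> x i) has_derivative (\<lambda>w. D x w i)) (at x)"
        by (simp add: \<beta> D add.commute)
    qed
    have contD: "continuous_on B D"
      by (rule continuous_on_blinfun_componentwise, rule continuous_on_blinfun_componentwise)
        (use cont contA contY[OF Y] Y in \<open>auto simp: D C1_def intro!: continuous_intros\<close>)
    obtain DH where DH: "continuous_on B DH"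
      and derH: "\<And>x. x \<in> B \<Longrightarrow> ((\<lambda>x. integral {0..1} (\<lambda>t. \<beta> (\<gamma> x t) (x - q))) has_derivative blinfun_apply (DH x)) (at x)"
      and intH: "\<And>x v. x \<in> B \<Longrightarrow> (\<lambda>t. t *\<^sub>R (D (\<gamma> x t) v (x - q) - D (\<gamma> x t) (x - q) v)) integrable_on {0..1}"
      and DHeq: "\<And>x v. x \<in> B \<Longrightarrow> DH x v = \<beta> x v + integral {0..1} (\<lambda>t. t *\<^sub>R (D (\<gamma> x t) v (x - q) - D (\<gamma> x t) (x - q) v))"
      using poincare_homotopy[OF B der\<beta> contD] unfolding \<gamma>_def by blast
    have "C1 (next_it Y) DH"
      unfolding C1_def next_it_def using DH derH
      by (auto simp: \<beta> intro!: derivative_eq_intros)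
    moreover have "norm (A x v (Y x) - DH x v) \<le> m / 2 * norm v"
      if m: "err Y DY m" and x: "x \<in> B" for m x v
    proof -
      have m0: "0 \<le> m * norm v" for v :: 'v
        using m B(3) norm_ge_zero order_trans unfolding err_def by blast
      have "norm (integral {0..1} (\<lambda>t. t *\<^sub>R (D (\<gamma> x t) v (x - q) - D (\<gamma> x t) (x - q) v)))
        \<le> integral {0..1} (\<lambda>t::real. m / 2 * norm v)"
      proof (rule integral_norm_bound_integral[OF intH[OF x]])
        fix t :: real assume t: "t \<in> {0..1}"
        define z where "z = \<gamma> x t"
        have zB: "z \<in> B" using \<gamma>B x t by (simp add: z_def)
        define e where "e v = A z v (Y z) - DY z v" for v
        have e: "norm (e v) \<le> m * norm v" for v using m zB by (simp add: err_def e_def)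
        \<comment> \<open>By \<open>flat\<close> the derivatives of \<open>A\<close> and the
          products of two values of \<open>A\<close> cancel, so the exterior derivative is linear in
          the defect \<open>e\<close>.\<close>
        have "D z v (x - q) - D z (x - q) v = A z v (e (x - q)) - A z (x - q) (e v)"
          using flat[OF zB, of v "x - q" "Y z"] by (simp add: D e_def blinfun.bilinear_simps algebra_simps)
        also have "norm \<dots> \<le> norm (A z v (e (x - q))) + norm (A z (x - q) (e v))"
          by (rule norm_triangle_ineq4)
        also have "\<dots> \<le> C * norm v * (m * norm (x - q)) + C * norm (x - q) * (m * norm v)"
          using order_trans[OF nA[OF zB] mult_left_mono[OF e]] C0 by (intro add_mono) auto
        also have "\<dots> = (C * norm (x - q)) * (2 * (m * norm v))" by simp
        also have "\<dots> \<le> (C * d) * (2 * (m * norm v))"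
          using d[OF x] C0 m0 by (intro mult_right_mono mult_left_mono) auto
        also have "\<dots> \<le> 1/4 * (2 * (m * norm v))"
          using Cd m0[of v] by (intro mult_right_mono) auto
        finally have 1: "norm (D z v (x - q) - D z (x - q) v) \<le> m / 2 * norm v" by simp
        have "norm (t *\<^sub>R (D z v (x - q) - D z (x - q) v)) \<le> 1 * (m / 2 * norm v)"
          unfolding norm_scaleR using t 1 by (intro mult_mono) auto
        then show "norm (t *\<^sub>R (D (\<gamma> x t) v (x - q) - D (\<gamma> x t) (x - q) v)) \<le> m / 2 * norm v"
          by (simp add: z_def)
      qed (rule integrable_const_ivl)
      then show ?thesis using DHeq[OF x, of v] by (simp add: \<beta> norm_minus_commute)
    qed
    ultimately show ?thesis by blast
  qed
  have contr: "norm (next_it Y x - next_it Z x) \<le> r / 4"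
    if Y: "continuous_on B Y" and Z: "continuous_on B Z" and r: "\<And>x. x \<in> B \<Longrightarrow> norm (Y x - Z x) \<le> r"
      and x: "x \<in> B" for Y Z r x
  proof -
    have r0: "0 \<le> r" using r[OF B(3)] norm_ge_zero order_trans by blast
    have "next_it Y x - next_it Z x = integral {0..1} (\<lambda>t. A (\<gamma> x t) (x - q) (Y (\<gamma> x t)) - A (\<gamma> x t) (x - q) (Z (\<gamma> x t)))"
      unfolding next_it_def using integral_diff[OF intY[OF Y x] intY[OF Z x]] by simp
    also have "norm \<dots> \<le> integral {0..1} (\<lambda>t::real. r / 4)"
    proof (rule integral_norm_bound_integral[OF integrable_diff[OF intY[OF Y x] intY[OF Z x]]])
      fix t :: real assume t: "t \<in> {0..1}"
      note zB = \<gamma>B[OF x t]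
      have "norm (A (\<gamma> x t) (x - q) (Y (\<gamma> x t)) - A (\<gamma> x t) (x - q) (Z (\<gamma> x t))) \<le> (C * norm (x - q)) * norm (Y (\<gamma> x t) - Z (\<gamma> x t))"
        using nA[OF zB, of "x - q" "Y (\<gamma> x t) - Z (\<gamma> x t)"] by (simp add: blinfun.bilinear_simps)
      also have "\<dots> \<le> (C * d) * r"
        using r[OF zB] d[OF x] C0 d0 by (intro mult_mono) auto
      also have "\<dots> \<le> 1/4 * r" using Cd r0 by (intro mult_right_mono)
      finally show "norm (A (\<gamma> x t) (x - q) (Y (\<gamma> x t)) - A (\<gamma> x t) (x - q) (Z (\<gamma> x t))) \<le> r / 4" by simp
    qed (rule integrable_const_ivl)
    finally show ?thesis by simp
  qed
  define Y where "Y k = (next_it ^^ k) (\<lambda>_. y0)" for k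
  have Y0: "Y 0 = (\<lambda>_. y0)" and YS: "Y (Suc k) = next_it (Y k)" for k by (simp_all add: Y_def)
  define N where "N = norm y0"
  \<comment> \<open>The constant iterate has defect at most C * N. The factor 4 is slack: it makes
    the contraction error C * N / 4 ^ k at most a quarter of the defect bound at stage
    \<open>k\<close>.\<close>
  have "\<exists>DY. C1 (Y 0) (DY 0) \<and> err (Y 0) (DY 0) (4 * C * N) \<and> True"
    by (rule exI[of _ "\<lambda>_ _. 0"])
      (use nA in \<open>auto simp: C1_def err_def Y0 N_def intro!: order_trans[OF nA] derivative_eq_intros simp: C0 mult_ac\<close>)
  then obtain DY0 where DY0: "C1 (Y 0) DY0" "err (Y 0) DY0 (4 * C * N)" by blast
  have ex: "\<exists>DY. C1 (Y k) DY" for k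
  proof (induction k)
    case (Suc k)
    then show ?case using step YS by metis
  qed (use DY0 in blast)
  then have contYk: "continuous_on B (Y k)" for k using contY by blast
  have diff: "norm (Y (Suc k) x - Y k x) \<le> N / 4 ^ k" if "x \<in> B" for k x
    using that
  proof (induction k arbitrary: x)
    case 0
    have "next_it (\<lambda>_. 0) x = y0" by (simp add: next_it_def)
    then have "norm (Y (Suc 0) x - Y 0 x) = norm (next_it (\<lambda>_. y0) x - next_it (\<lambda>_. 0) x)"
      by (simp add: YS Y0)
    also have "\<dots> \<le> N / 4" by (rule contr[OF _ _ _ 0]) (auto simp: N_def)
    also have "\<dots> \<le> N" by (simp add: N_def)
    finally show ?case by simp
  next
    case (Suc k)
    have "norm (next_it (Y (Suc k)) x - next_it (Y k) x) \<le> (N / 4 ^ k) / 4"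
      by (rule contr[OF contYk contYk Suc.IH Suc.prems])
    then show ?case by (simp add: YS)
  qed
  have ex2: "\<exists>DY. C1 (Y k) DY \<and> err (Y k) DY (4 * C * N * (3/4) ^ k)" for k
  proof (induction k)
    case 0
    then show ?case using DY0 by auto
  next
    case (Suc k)
    define m where "m = 4 * C * N * (3/4) ^ k"
    obtain DY where DY: "C1 (Y k) DY" "err (Y k) DY m" using Suc m_def by blast
    obtain DY' where DY': "C1 (Y (Suc k)) DY'"
      and b: "\<And>x v. x \<in> B \<Longrightarrow> norm (A x v (Y k x) - DY' x v) \<le> m / 2 * norm v"
      using step[OF DY(1)] DY(2) YS by metis
    \<comment> \<open>One half from the Picard step and one quarter from the exchange of the
      iterates give the rate 3/4.\<close>
    have "err (Y (Suc k)) DY' (m * (3/4))"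
      unfolding err_def
    proof (intro ballI allI)
      fix x v assume x: "x \<in> B"
      have "A x v (Y (Suc k) x) - DY' x v = A x v (Y (Suc k) x - Y k x) + (A x v (Y k x) - DY' x v)"
        by (simp add: blinfun.bilinear_simps)
      also have "norm \<dots> \<le> C * norm v * (N / 4 ^ k) + m / 2 * norm v"
        using b[OF x, of v] order_trans[OF nA[OF x] mult_left_mono[OF diff[OF x]]] C0
        by (intro norm_triangle_le add_mono) auto
      also have "C * norm v * (N / 4 ^ k) \<le> m / 4 * norm v"
      proof -
        have "(1/4::real) ^ k \<le> (3/4) ^ k" by (rule power_mono) auto
        then have "(C * N * norm v) * (1/4) ^ k \<le> (C * N * norm v) * (3/4) ^ k"
          using C0 by (intro mult_left_mono) (auto simp: N_def)
        then show ?thesis by (simp add: m_def power_one_over divide_simps mult_ac)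
      qed
      finally show "norm (A x v (Y (Suc k) x) - DY' x v) \<le> m * (3/4) * norm v" by simp
    qed
    then show ?case using DY' by (auto simp: m_def mult_ac)
  qed
  then obtain DY where DY: "\<And>k. C1 (Y k) (DY k)" "\<And>k. err (Y k) (DY k) (4 * C * N * (3/4) ^ k)"
    by metis
  define L where "L x = y0 + (\<Sum>k. Y (Suc k) x - Y k x)" for x
  have "uniform_limit B (\<lambda>n x. \<Sum>k<n. Y (Suc k) x - Y k x) (\<lambda>x. \<Sum>k. Y (Suc k) x - Y k x) sequentially"
  proof (rule Weierstrass_m_test[OF diff])
    have "summable (\<lambda>k. N * (1/4) ^ k)" by (intro summable_mult summable_geometric) simp
    moreover have "(\<lambda>k. N * (1/4) ^ k) = (\<lambda>k. N / 4 ^ k)" by (simp add: power_divide)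
    ultimately show "summable (\<lambda>k. N / 4 ^ k)" by simp
  qed
  then have "uniform_limit B (\<lambda>n x. y0 + (\<Sum>k<n. Y (Suc k) x - Y k x)) L sequentially"
    unfolding L_def by (rule uniform_limit_add[OF uniform_limit_const])
  moreover have "y0 + (\<Sum>k<n. Y (Suc k) x - Y k x) = Y n x" for n x
    using sum_lessThan_telescope[of "\<lambda>k. Y k x" n] by (simp add: Y0)
  ultimately have lim: "uniform_limit B Y L sequentially" by simp
  \<comment> \<open>The iterates converge uniformly and their defects tend to 0, so the derivatives
    converge uniformly to \<open>A\<close> applied to the limit. Differentiation of the sequence
    term by term gives the equation.\<close>
  have "\<exists>g. \<forall>x\<in>B. (\<lambda>n. Y n x) \<longlonglongrightarrow> g x \<and> (g has_derivative (\<lambda>v. A x v (L x))) (at x within B)"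
  proof (rule has_derivative_sequence[OF B(2), where f'="\<lambda>k x. blinfun_apply (DY k x)"])
    show "(Y n has_derivative DY n x) (at x within B)" if "x \<in> B" for n x
      using DY(1) that has_derivative_at_withinI unfolding C1_def by blast
    show "q \<in> B" by fact
    show "(\<lambda>n. Y n q) \<longlonglongrightarrow> L q" using tendsto_uniform_limitI[OF lim B(3)] .
    fix e :: real assume e: "e > 0"
    have "(\<lambda>k. 4 * C * N * (3/4) ^ k) \<longlonglongrightarrow> 4 * C * N * 0"
      by (intro tendsto_mult_left LIMSEQ_power_zero) auto
    then have 1: "\<forall>\<^sub>F k in sequentially. 4 * C * N * (3/4) ^ k < e / 2"
      using e by (intro order_tendstoD(2)) auto
    have 2: "\<forall>\<^sub>F k in sequentially. \<forall>x\<in>B. dist (Y k x) (L x) < e / (2 * (C + 1))"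
      by (rule uniform_limitD[OF lim]) (use e C0 in auto)
    show "\<forall>\<^sub>F n in sequentially. \<forall>x\<in>B. \<forall>h. norm (DY n x h - A x h (L x)) \<le> e * norm h"
      using 1 2
    proof eventually_elim
      case (elim k)
      show ?case
      proof (intro ballI allI)
        fix x h assume x: "x \<in> B"
        have "DY k x h - A x h (L x) = A x h (Y k x - L x) - (A x h (Y k x) - DY k x h)"
          by (simp add: blinfun.bilinear_simps)
        also have "norm \<dots> \<le> norm (A x h (Y k x - L x)) + norm (A x h (Y k x) - DY k x h)"
          by (rule norm_triangle_ineq4)
        also have "norm (A x h (Y k x) - DY k x h) \<le> 4 * C * N * (3/4) ^ k * norm h"
          using DY(2) x by (simp add: err_def)
        also have "4 * C * N * (3/4) ^ k * norm h \<le> e / 2 * norm h"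
          using elim(1) by (intro mult_right_mono) auto
        also have "norm (A x h (Y k x - L x)) \<le> C * norm h * (e / (2 * (C + 1)))"
          using order_trans[OF nA[OF x] mult_left_mono] elim(2) x C0
          by (smt (verit, ccfv_SIG) dist_norm mult_nonneg_nonneg norm_ge_zero)
        also have "C * norm h * (e / (2 * (C + 1))) \<le> e / 2 * norm h"
        proof -
          have "C / (C + 1) \<le> 1" using C0 by simp
          then have "C / (C + 1) * (e / 2 * norm h) \<le> 1 * (e / 2 * norm h)"
            using e by (intro mult_right_mono) auto
          then show ?thesis using C0 by (simp add: field_simps)
        qed
        finally show "norm (DY k x h - A x h (L x)) \<le> e * norm h" by simp
      qed
    qed
  qed
  then obtain g where g: "\<And>x. x \<in> B \<Longrightarrow> (\<lambda>n. Y n x) \<longlonglongrightarrow> g x"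
    "\<And>x. x \<in> B \<Longrightarrow> (g has_derivative (\<lambda>v. A x v (L x))) (at x within B)" by blast
  have gL: "g x = L x" if "x \<in> B" for x
    using g(1)[OF that] tendsto_uniform_limitI[OF lim that] LIMSEQ_unique by blast
  have "Y k q = y0" for k by (cases k) (simp_all add: Y0 YS next_it_def)
  then have "g q = y0" using g(1)[OF B(3)] by (simp add: LIMSEQ_const_iff)
  moreover have "(g has_derivative (\<lambda>v. A x v (g x))) (at x)" if "x \<in> B" for x
    using g(2)[OF that] gL[OF that] at_within_open[OF that B(1)] by simp
  ultimately show ?thesis by blast
qed

section \<open>Local systems on simply connected spaces\<close>

text \<open>Any two constant loops are homotopic, and the base point of the homotopy traces a
  path.\<close>

lemma ex_path_if_simply_connected:
  assumes "simply_connected (UNIV :: 'p::topological_space set)"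
  shows "\<exists>\<gamma>. path \<gamma> \<and> \<gamma> 0 = (p :: 'p) \<and> \<gamma> 1 = q"
proof -
  have "homotopic_loops UNIV (\<lambda>_::real. p) (\<lambda>_. q)"
    using assms unfolding simply_connected_def by (auto simp: path_def pathfinish_def pathstart_def)
  then obtain h where h: "continuous_on ({0..1::real} \<times> {0..1::real}) h"
    "\<forall>x\<in>{0..1}. h (0, x) = p" "\<forall>x\<in>{0..1}. h (1, x) = q"
    unfolding homotopic_loops by auto
  have "path (\<lambda>t. h (t, 0))"
    unfolding path_def by (rule continuous_on_compose2[OF h(1)]) (auto intro!: continuous_intros)
  then show ?thesis using h by (intro exI[of _ "\<lambda>t. h (t, 0)"]) auto
qed

text \<open>A locally constant sheaf in terms of representatives: \<open>sol p s\<close> says that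
  \<open>s\<close> represents an element of the stalk at \<open>p\<close>, and \<open>eqv p\<close>
  is equality in this stalk. \<open>trivial_nbhd\<close> contains both halves of local triviality:
  every germ extends over \<open>U\<close>, and a section over \<open>U\<close> is determined by one
  of its germs.\<close>

locale local_system =
  fixes sol :: "'p::topological_space \<Rightarrow> 's \<Rightarrow> bool"
    and eqv :: "'p \<Rightarrow> 's \<Rightarrow> 's \<Rightarrow> bool"
  assumes eqv_refl: "eqv p s s"
    and eqv_sym: "eqv p s t \<Longrightarrow> eqv p t s"
    and eqv_trans: "eqv p s t \<Longrightarrow> eqv p t u \<Longrightarrow> eqv p s u"
    and eqv_open: "eqv p s t \<Longrightarrow> \<exists>W. open W \<and> p \<in> W \<and> (\<forall>q\<in>W. eqv q s t)"
    and sol_eqv: "eqv p s t \<Longrightarrow> sol p s \<Longrightarrow> sol p t"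
    and trivial_nbhd: "\<exists>U. open U \<and> p \<in> U \<and> path_connected U \<and>
       (\<forall>q\<in>U. \<forall>s. sol q s \<longrightarrow> (\<exists>t. (\<forall>r\<in>U. sol r t) \<and> eqv q t s)) \<and>
       (\<forall>s t. (\<forall>r\<in>U. sol r s \<and> sol r t) \<longrightarrow> (\<forall>q\<in>U. \<forall>r\<in>U. eqv q s t \<longrightarrow> eqv r s t))"
begin

text \<open>A section of the sheaf pulled back along \<open>h\<close>. Continuity means that near
  each parameter a single representative stays valid.\<close>

definition lift :: "'k::topological_space set \<Rightarrow> ('k \<Rightarrow> 'p) \<Rightarrow> ('k \<Rightarrow> 's) \<Rightarrow> bool" where
  "lift K h \<sigma> \<longleftrightarrow> (\<forall>k\<in>K. sol (h k) (\<sigma> k) \<and>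
     (\<exists>W. open W \<and> k \<in> W \<and> (\<forall>l\<in>W \<inter> K. eqv (h l) (\<sigma> l) (\<sigma> k))))"

definition liftable :: "('k::topological_space \<Rightarrow> 'p) \<Rightarrow> 'k set \<Rightarrow> bool" where
  "liftable h K \<longleftrightarrow> (\<forall>k\<in>K. \<forall>s. sol (h k) s \<longrightarrow> (\<exists>\<sigma>. lift K h \<sigma> \<and> eqv (h k) (\<sigma> k) s))"

definition trivial_on :: "'p set \<Rightarrow> bool" where
  "trivial_on U \<longleftrightarrow>
     (\<forall>q\<in>U. \<forall>s. sol q s \<longrightarrow> (\<exists>t. (\<forall>r\<in>U. sol r t) \<and> eqv q t s)) \<and>
     (\<forall>s t. (\<forall>r\<in>U. sol r s \<and> sol r t) \<longrightarrow> (\<forall>q\<in>U. \<forall>r\<in>U. eqv q s t \<longrightarrow> eqv r s t))"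

lemma trivial_nbhdE:
  obtains U where "open U" "p \<in> U" "path_connected U" "trivial_on U"
  using trivial_nbhd[of p, folded trivial_on_def] by (elim exE conjE)

lemma trivial_onD:
  assumes "trivial_on U"
  shows "q \<in> U \<Longrightarrow> sol q s \<Longrightarrow> \<exists>t. (\<forall>r\<in>U. sol r t) \<and> eqv q t s"
    and "\<forall>r\<in>U. sol r s \<and> sol r t \<Longrightarrow> q \<in> U \<Longrightarrow> r \<in> U \<Longrightarrow> eqv q s t \<Longrightarrow> eqv r s t"
  using assms[unfolded trivial_on_def, THEN conjunct1, THEN bspec, THEN spec, THEN mp]
    assms[unfolded trivial_on_def, THEN conjunct2, THEN spec, THEN spec, THEN mp, THEN bspec, THEN bspec, THEN mp]
  by (iprover, iprover)

lemma liftD: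
  assumes "lift K h \<sigma>" "k \<in> K"
  shows "sol (h k) (\<sigma> k)"
    and "\<exists>W. open W \<and> k \<in> W \<and> (\<forall>l\<in>W \<inter> K. eqv (h l) (\<sigma> l) (\<sigma> k))"
  using assms unfolding lift_def by blast+

lemma lift_subset: "lift K h \<sigma> \<Longrightarrow> L \<subseteq> K \<Longrightarrow> lift L h \<sigma>"
  unfolding lift_def by (meson IntD1 IntD2 IntI subsetD)

lemma continuous_on_nbhd:
  assumes "continuous_on K h" "k \<in> K" "open U" "h k \<in> U"
  shows "\<exists>W. open W \<and> k \<in> W \<and> (\<forall>l\<in>W \<inter> K. h l \<in> U)"
proof -
  obtain A where "open A" "k \<in> A" "\<forall>y\<in>K. y \<in> A \<longrightarrow> h y \<in> U"
    using continuous_on_topological[THEN iffD1, OF assms(1), THEN bspec, OF assms(2), THEN spec,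
        THEN mp, OF assms(3), THEN mp, OF assms(4)] by auto
  then show ?thesis by auto
qed

section \<open>Lifts along paths and homotopies\<close>

lemma lift_compose:
  assumes "lift K h \<sigma>" "continuous_on L c" "c ` L \<subseteq> K"
  shows "lift L (h \<circ> c) (\<sigma> \<circ> c)"
  unfolding lift_def
proof (intro ballI conjI)
  fix l assume l: "l \<in> L"
  then have cl: "c l \<in> K" using assms(3) by auto
  show "sol ((h \<circ> c) l) ((\<sigma> \<circ> c) l)" using liftD(1)[OF assms(1) cl] by simp
  obtain W where W: "open W" "c l \<in> W" "\<forall>k\<in>W \<inter> K. eqv (h k) (\<sigma> k) (\<sigma> (c l))"
    using liftD(2)[OF assms(1) cl] by blast
  obtain V where "open V" "l \<in> V" "\<forall>x\<in>V \<inter> L. c x \<in> W"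
    using continuous_on_nbhd[OF assms(2) l W(1,2)] by blast
  then show "\<exists>W. open W \<and> l \<in> W \<and> (\<forall>k\<in>W \<inter> L. eqv ((h \<circ> c) k) ((\<sigma> \<circ> c) k) ((\<sigma> \<circ> c) l))"
    using W(3) assms(3) by (intro exI[of _ V]) (auto simp: image_subset_iff)
qed

text \<open>Near any parameter both lifts are represented by solutions over one trivial
  neighbourhood. Agreement is therefore locally constant and spreads over the connected set
  \<open>K\<close>.\<close>

lemma lift_unique:
  assumes K: "connected K" and h: "continuous_on K h"
    and \<sigma>: "lift K h \<sigma>" and \<tau>: "lift K h \<tau>"
    and k: "k \<in> K" "l \<in> K" and e: "eqv (h k) (\<sigma> k) (\<tau> k)"
  shows "eqv (h l) (\<sigma> l) (\<tau> l)"
proof (rule connected_induction_simple[OF K, of k l "\<lambda>k. eqv (h k) (\<sigma> k) (\<tau> k)"])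
  fix a assume a: "a \<in> K"
  obtain U where U: "open U" "h a \<in> U" "path_connected U" and tr: "trivial_on U"
    by (rule trivial_nbhdE)
  note ex = trivial_onD(1)[OF tr] and un = trivial_onD(2)[OF tr]
  have *: "\<exists>s W. (\<forall>r\<in>U. sol r s) \<and> open W \<and> a \<in> W \<and> (\<forall>l\<in>W \<inter> K. h l \<in> U \<and> eqv (h l) s (\<rho> l))"
    if \<rho>: "lift K h \<rho>" for \<rho>
  proof -
    obtain s where s: "\<forall>r\<in>U. sol r s" "eqv (h a) s (\<rho> a)"
      using ex[OF U(2) liftD(1)[OF \<rho> a]] by blast
    obtain W1 where W1: "open W1" "a \<in> W1" "\<forall>l\<in>W1 \<inter> K. eqv (h l) (\<rho> l) (\<rho> a)"
      using liftD(2)[OF \<rho> a] by blast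
    obtain V where V: "open V" "h a \<in> V" "\<forall>q\<in>V. eqv q s (\<rho> a)"
      using eqv_open[OF s(2)] by blast
    obtain W2 where W2: "open W2" "a \<in> W2" "\<forall>l\<in>W2 \<inter> K. h l \<in> U \<inter> V"
      using continuous_on_nbhd[OF h a, of "U \<inter> V"] U V by auto
    have "\<forall>l\<in>(W1 \<inter> W2) \<inter> K. h l \<in> U \<and> eqv (h l) s (\<rho> l)"
      using W1(3) W2(3) V(3) eqv_sym eqv_trans by blast
    then show ?thesis using s(1) W1(1,2) W2(1,2) by blast
  qed
  obtain s W where s: "\<forall>r\<in>U. sol r s" "open W" "a \<in> W" "\<forall>l\<in>W \<inter> K. h l \<in> U \<and> eqv (h l) s (\<sigma> l)"
    using *[OF \<sigma>] by blast
  obtain t V where t: "\<forall>r\<in>U. sol r t" "open V" "a \<in> V" "\<forall>l\<in>V \<inter> K. h l \<in> U \<and> eqv (h l) t (\<tau> l)"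
    using *[OF \<tau>] by blast
  show "\<exists>T. openin (top_of_set K) T \<and> a \<in> T \<and>
      (\<forall>x\<in>T. \<forall>y\<in>T. eqv (h x) (\<sigma> x) (\<tau> x) \<longrightarrow> eqv (h y) (\<sigma> y) (\<tau> y))"
  proof (intro exI conjI ballI impI)
    show "openin (top_of_set K) (K \<inter> (W \<inter> V))"
      using s t by (intro openin_open_Int) auto
    show "a \<in> K \<inter> (W \<inter> V)" using a s t by auto
    fix x y assume x: "x \<in> K \<inter> (W \<inter> V)" and y: "y \<in> K \<inter> (W \<inter> V)"
      and e: "eqv (h x) (\<sigma> x) (\<tau> x)"
    have "eqv (h x) s t" using x s(4) t(4) e by (meson IntD1 IntD2 IntI eqv_sym eqv_trans)
    then have "eqv (h y) s t" using un[of s t "h x" "h y"] x y s t by blast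
    then show "eqv (h y) (\<sigma> y) (\<tau> y)"
      using y s(4) t(4) by (meson IntD1 IntD2 IntI eqv_sym eqv_trans)
  qed
qed (use k e in auto)

lemma path_lift_unique:
  assumes "path \<gamma>" "lift {0..1} \<gamma> \<sigma>" "lift {0..1} \<gamma> \<tau>"
    and "eqv (\<gamma> a) (\<sigma> a) (\<tau> a)" "a \<in> {0..1}" "b \<in> {0..1}"
  shows "eqv (\<gamma> b) (\<sigma> b) (\<tau> b)"
  by (rule lift_unique[OF connected_Icc assms(1)[unfolded path_def] assms(2,3,5,6,4)])

lemma liftable_local:
  assumes h: "continuous_on K h" and k: "k \<in> K"
  shows "\<exists>W. open W \<and> k \<in> W \<and> (\<forall>L \<subseteq> W \<inter> K. liftable h L)"
proof -
  obtain U where U: "open U" "h k \<in> U" "path_connected U" and tr: "trivial_on U"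
    by (rule trivial_nbhdE)
  note ex = trivial_onD(1)[OF tr] and un = trivial_onD(2)[OF tr]
  obtain W where W: "open W" "k \<in> W" "\<forall>l\<in>W \<inter> K. h l \<in> U"
    using continuous_on_nbhd[OF h k U(1,2)] by blast
  have "liftable h L" if L: "L \<subseteq> W \<inter> K" for L
    unfolding liftable_def
  proof (intro ballI allI impI)
    fix l s assume "l \<in> L" "sol (h l) s"
    then obtain t where t: "\<forall>r\<in>U. sol r t" "eqv (h l) t s" using ex W(3) L by blast
    have "lift L h (\<lambda>_. t)" unfolding lift_def using t(1) W(3) L eqv_refl by blast
    then show "\<exists>\<sigma>. lift L h \<sigma> \<and> eqv (h l) (\<sigma> l) s" using t(2) by blast
  qed
  then show ?thesis using W by blast
qed

text \<open>The lift over \<open>L\<close> is chosen to agree with the one over \<open>K\<close> at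
  a point of the intersection, and connectedness makes them agree on all of it. As the pieces are
  closed, continuity of the union may be checked on each piece.\<close>

lemma liftable_Un:
  assumes h: "continuous_on (K \<union> L) h"
    and cl: "closed K" "closed L" and c: "connected (K \<inter> L)" "K \<inter> L \<noteq> {}"
    and K: "liftable h K" and L: "liftable h L"
  shows "liftable h (K \<union> L)"
proof -
  have main: "\<exists>\<sigma>. lift (K \<union> L) h \<sigma> \<and> eqv (h k) (\<sigma> k) s"
    if h: "continuous_on (K \<union> L) h" and cl: "closed K" "closed L"
      and c: "connected (K \<inter> L)" "K \<inter> L \<noteq> {}" and K: "liftable h K" and L: "liftable h L"
      and k: "k \<in> K" "sol (h k) s" for K L k s
  proof -
    obtain \<sigma> where \<sigma>: "lift K h \<sigma>" "eqv (h k) (\<sigma> k) s"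
      using K k unfolding liftable_def by blast
    obtain m where m: "m \<in> K" "m \<in> L" using c by blast
    obtain \<tau> where \<tau>: "lift L h \<tau>" "eqv (h m) (\<tau> m) (\<sigma> m)"
      using L m liftD(1)[OF \<sigma>(1) m(1)] unfolding liftable_def by blast
    have agree: "eqv (h l) (\<tau> l) (\<sigma> l)" if "l \<in> K \<inter> L" for l
      by (rule lift_unique[OF c(1), of h \<tau> \<sigma> m l])
        (use h \<sigma>(1) \<tau> m that in \<open>auto intro: lift_subset continuous_on_subset\<close>)
    define \<rho> where "\<rho> l = (if l \<in> K then \<sigma> l else \<tau> l)" for l
    have \<rho>\<tau>: "eqv (h l) (\<rho> l) (\<tau> l)" if "l \<in> L" for l
      using agree[of l] that eqv_refl eqv_sym by (auto simp: \<rho>_def)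
    have \<rho>\<sigma>: "eqv (h l) (\<rho> l) (\<sigma> l)" if "l \<in> K" for l
      using that eqv_refl by (auto simp: \<rho>_def)
    have near: "\<exists>W. open W \<and> l \<in> W \<and> (\<forall>x\<in>W \<inter> M. eqv (h x) (\<rho> x) (\<rho> l))"
      if M: "lift M h \<upsilon>" "closed M" "\<And>x. x \<in> M \<Longrightarrow> eqv (h x) (\<rho> x) (\<upsilon> x)" "M \<subseteq> K \<union> L"
        and l: "l \<in> K \<union> L" for M \<upsilon> l
    proof (cases "l \<in> M")
      case False
      then show ?thesis using M(2) by (intro exI[of _ "- M"]) auto
    next
      case True
      obtain W where W: "open W" "l \<in> W" "\<forall>x\<in>W \<inter> M. eqv (h x) (\<upsilon> x) (\<upsilon> l)"
        using liftD(2)[OF M(1) True] by blast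
      obtain V where V: "open V" "h l \<in> V" "\<forall>q\<in>V. eqv q (\<rho> l) (\<upsilon> l)"
        using eqv_open[OF M(3)[OF True]] by blast
      obtain W2 where W2: "open W2" "l \<in> W2" "\<forall>x\<in>W2 \<inter> (K \<union> L). h x \<in> V"
        using continuous_on_nbhd[OF h l V(1,2)] by blast
      have "\<forall>x\<in>(W \<inter> W2) \<inter> M. eqv (h x) (\<rho> x) (\<rho> l)"
      proof
        fix x assume x: "x \<in> (W \<inter> W2) \<inter> M"
        then have "eqv (h x) (\<rho> x) (\<upsilon> x)" "eqv (h x) (\<upsilon> x) (\<upsilon> l)" "eqv (h x) (\<rho> l) (\<upsilon> l)"
          using M(3,4) W(3) W2(3) V(3) by auto
        then show "eqv (h x) (\<rho> x) (\<rho> l)" using eqv_sym eqv_trans by blast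
      qed
      then show ?thesis using W(1,2) W2(1,2) by blast
    qed
    have "lift (K \<union> L) h \<rho>"
      unfolding lift_def
    proof (intro ballI conjI)
      fix l assume l: "l \<in> K \<union> L"
      show "sol (h l) (\<rho> l)"
        using l liftD(1)[OF \<sigma>(1)] liftD(1)[OF \<tau>(1)] by (auto simp: \<rho>_def)
      obtain W1 where "open W1 \<and> l \<in> W1 \<and> (\<forall>x\<in>W1 \<inter> K. eqv (h x) (\<rho> x) (\<rho> l))"
        using near[OF \<sigma>(1) cl(1) \<rho>\<sigma> _ l] by blast
      moreover obtain W2 where "open W2 \<and> l \<in> W2 \<and> (\<forall>x\<in>W2 \<inter> L. eqv (h x) (\<rho> x) (\<rho> l))"
        using near[OF \<tau>(1) cl(2) \<rho>\<tau> _ l] by blast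
      ultimately show "\<exists>W. open W \<and> l \<in> W \<and> (\<forall>x\<in>W \<inter> (K \<union> L). eqv (h x) (\<rho> x) (\<rho> l))"
        by (intro exI[of _ "W1 \<inter> W2"]) auto
    qed
    moreover have "eqv (h k) (\<rho> k) s" using \<sigma>(2) k by (simp add: \<rho>_def)
    ultimately show ?thesis by blast
  qed
  show ?thesis
    unfolding liftable_def
  proof (intro ballI allI impI)
    fix k s assume "k \<in> K \<union> L" "sol (h k) s"
    then consider "k \<in> K" | "k \<in> L" by blast
    then show "\<exists>\<sigma>. lift (K \<union> L) h \<sigma> \<and> eqv (h k) (\<sigma> k) s"
    proof cases
      case 1
      then show ?thesis using main[OF h cl c K L _ \<open>sol (h k) s\<close>] by blast
    next
      case 2
      then show ?thesis
        using main[of L K k s] h cl c K L \<open>sol (h k) s\<close> by (simp add: Un_commute Int_commute)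
    qed
  qed
qed

text \<open>Subdivision by two nested bisections: along the width, which gives a strip about each
  height \<open>t\<close>, and then along the height. Rectangles can be glued because they meet in a
  convex set.\<close>

lemma liftable_square:
  fixes h :: "real \<times> real \<Rightarrow> 'p"
  assumes h: "continuous_on ({0..1} \<times> {0..1}) h"
  shows "liftable h ({0..1} \<times> {0..1})"
proof -
  define S where "S = ({0..1} \<times> {0..1} :: (real \<times> real) set)"
  have h: "continuous_on S h" using h by (simp add: S_def)
  have glue: "liftable h ({a..b} \<times> {c..d} \<union> {a'..b'} \<times> {c'..d'})"
    if "liftable h ({a..b} \<times> {c..d})" "liftable h ({a'..b'} \<times> {c'..d'})"
      and sub: "{a..b} \<times> {c..d} \<subseteq> S" "{a'..b'} \<times> {c'..d'} \<subseteq> S"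
      and ne: "({a..b} \<times> {c..d}) \<inter> ({a'..b'} \<times> {c'..d'}) \<noteq> {}"
    for a b c d a' b' c' d' :: real
  proof (rule liftable_Un)
    show "continuous_on ({a..b} \<times> {c..d} \<union> {a'..b'} \<times> {c'..d'}) h"
      using sub by (intro continuous_on_subset[OF h]) auto
    show "connected (({a..b} \<times> {c..d}) \<inter> ({a'..b'} \<times> {c'..d'}))"
      by (intro convex_connected convex_Int convex_Times) auto
  qed (use that in \<open>auto intro: closed_Times\<close>)
  define P where "P c d \<longleftrightarrow> (0 \<le> c \<longrightarrow> d \<le> 1 \<longrightarrow> liftable h ({0..1} \<times> {c..d}))" for c d
  have "P 0 1"
  proof (rule Bolzano)
    fix a b c :: real
    assume P: "P a b" "P b c" and le: "a \<le> b" "b \<le> c"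
    show "P a c"
      unfolding P_def
    proof (intro impI)
      assume ac: "0 \<le> a" "c \<le> 1"
      then have "liftable h ({0..1} \<times> {a..b} \<union> {0..1} \<times> {b..c})"
        using P le by (intro glue) (auto simp: P_def S_def Times_Int_Times)
      moreover have "{0..1} \<times> {a..b} \<union> {0..1} \<times> {b..c} = {0..1::real} \<times> {a..c}"
        using le by auto
      ultimately show "liftable h ({0..1} \<times> {a..c})" by simp
    qed
  next
    fix t :: real
    assume t: "0 \<le> t" "t \<le> 1"
    \<comment> \<open>One bound \<open>e\<close> on the height must serve the whole width from
      \<open>a\<close> to \<open>b\<close>; joining two intervals takes the minimum of the
      bounds.\<close>
    define R where "R a b \<longleftrightarrow> (0 \<le> a \<longrightarrow> b \<le> 1 \<longrightarrow> (\<exists>e>0. \<forall>c d. 0 \<le> c \<and> c \<le> t \<and> t \<le> d \<and> d \<le> 1 \<and>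
      d - c < e \<longrightarrow> liftable h ({a..b} \<times> {c..d})))" for a b
    have "R 0 1"
    proof (rule Bolzano)
      fix a b c :: real
      assume R: "R a b" "R b c" and le: "a \<le> b" "b \<le> c"
      show "R a c"
        unfolding R_def
      proof (intro impI)
        assume ac: "0 \<le> a" "c \<le> 1"
        obtain e where e: "e > 0" "\<And>c d. 0 \<le> c \<and> c \<le> t \<and> t \<le> d \<and> d \<le> 1 \<and> d - c < e \<Longrightarrow>
            liftable h ({a..b} \<times> {c..d})"
          using R(1) ac le unfolding R_def by auto
        obtain e' where e': "e' > 0" "\<And>c' d. 0 \<le> c' \<and> c' \<le> t \<and> t \<le> d \<and> d \<le> 1 \<and> d - c' < e' \<Longrightarrow>
            liftable h ({b..c} \<times> {c'..d})"
          using R(2) ac le unfolding R_def by auto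
        have "liftable h ({a..c} \<times> {c'..d})"
          if cd: "0 \<le> c' \<and> c' \<le> t \<and> t \<le> d \<and> d \<le> 1 \<and> d - c' < min e e'" for c' d
        proof -
          have "liftable h ({a..b} \<times> {c'..d} \<union> {b..c} \<times> {c'..d})"
            using e(2)[of c' d] e'(2)[of c' d] le ac cd by (intro glue) (auto simp: S_def Times_Int_Times)
          moreover have "{a..b} \<times> {c'..d} \<union> {b..c} \<times> {c'..d} = {a..c} \<times> {c'..d}"
            using le by auto
          ultimately show ?thesis by simp
        qed
        then show "\<exists>e>0. \<forall>c' d. 0 \<le> c' \<and> c' \<le> t \<and> t \<le> d \<and> d \<le> 1 \<and> d - c' < e \<longrightarrow>
            liftable h ({a..c} \<times> {c'..d})"
          using e(1) e'(1) by (intro exI[of _ "min e e'"] conjI) (simp, blast)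
      qed
    next
      fix x :: real
      assume x: "0 \<le> x" "x \<le> 1"
      then have "(x, t) \<in> S" using t by (simp add: S_def)
      then obtain W where W: "open W" "(x, t) \<in> W" "\<And>L. L \<subseteq> W \<inter> S \<Longrightarrow> liftable h L"
        using liftable_local[OF h] by metis
      obtain A B where AB: "open A" "open B" "x \<in> A" "t \<in> B" "A \<times> B \<subseteq> W"
        using open_prod_elim[OF W(1,2)] by (metis SigmaE2)
      obtain e1 where e1: "e1 > 0" "ball x e1 \<subseteq> A" using AB openE by blast
      obtain e2 where e2: "e2 > 0" "ball t e2 \<subseteq> B" using AB openE by blast
      have "R a b" if ab: "a \<le> x \<and> x \<le> b \<and> b - a < e1" for a b
        unfolding R_def
      proof (intro impI exI[of _ e2] conjI allI e2(1))
        fix c d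
        assume ab': "0 \<le> a" "b \<le> 1"
          and cd: "0 \<le> c \<and> c \<le> t \<and> t \<le> d \<and> d \<le> 1 \<and> d - c < e2"
        have "{a..b} \<subseteq> ball x e1" "{c..d} \<subseteq> ball t e2"
          using ab cd by (auto simp: dist_real_def)
        then show "liftable h ({a..b} \<times> {c..d})"
          using AB(5) e1(2) e2(2) ab' cd by (intro W(3)) (force simp: S_def)
      qed
      then show "\<exists>d>0. \<forall>a b. a \<le> x \<and> x \<le> b \<and> b - a < d \<longrightarrow> R a b" using e1(1) by blast
    qed simp
    then obtain e where "e > 0" "\<And>c d. 0 \<le> c \<and> c \<le> t \<and> t \<le> d \<and> d \<le> 1 \<and> d - c < e \<Longrightarrow>
        liftable h ({0..1} \<times> {c..d})"
      unfolding R_def by auto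
    then show "\<exists>d>0. \<forall>a b. a \<le> t \<and> t \<le> b \<and> b - a < d \<longrightarrow> P a b"
      unfolding P_def by blast
  qed simp
  then show ?thesis by (simp add: P_def)
qed

text \<open>A path is a homotopy that does not depend on its second parameter; the lift over the
  square is restricted to an edge.\<close>

lemma path_liftable:
  assumes "path \<gamma>"
  shows "liftable \<gamma> {0..1}"
  unfolding liftable_def
proof (intro ballI allI impI)
  fix k :: real and s assume k: "k \<in> {0..1}" "sol (\<gamma> k) s"
  have "continuous_on ({0..1} \<times> {0..1}) (\<lambda>x. \<gamma> (fst x))"
    using assms unfolding path_def
    by (rule continuous_on_compose2) (auto intro!: continuous_intros)
  then have "liftable (\<lambda>x. \<gamma> (fst x)) ({0..1} \<times> {0..1 :: real})" by (rule liftable_square)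
  then obtain \<sigma> where \<sigma>: "lift ({0..1} \<times> {0..1 :: real}) (\<lambda>x. \<gamma> (fst x)) \<sigma>" "eqv (\<gamma> k) (\<sigma> (k, 0)) s"
    using k unfolding liftable_def by (metis (no_types, lifting) SigmaI atLeastAtMost_iff fst_conv order_refl zero_le_one)
  have "lift {0..1} ((\<lambda>x. \<gamma> (fst x)) \<circ> (\<lambda>x. (x, 0::real))) (\<sigma> \<circ> (\<lambda>x. (x, 0)))"
    using \<sigma>(1) by (rule lift_compose) (auto intro!: continuous_intros simp: image_subset_iff)
  then show "\<exists>\<sigma>. lift {0..1} \<gamma> \<sigma> \<and> eqv (\<gamma> k) (\<sigma> k) s"
    using \<sigma>(2) by (intro exI[of _ "\<sigma> \<circ> (\<lambda>x. (x, 0))"]) (simp add: o_def)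
qed

text \<open>A null homotopy is lifted over the square. Its stages are loops, so the upper and the
  lower edge project to the same path. The two lifts of this path agree at the collapsed end, hence
  also at the end that lies on the given loop.\<close>

lemma lift_loop_closed:
  assumes sc: "simply_connected (UNIV :: 'p set)"
    and \<gamma>: "path \<gamma>" "pathfinish \<gamma> = pathstart \<gamma>" and \<sigma>: "lift {0..1} \<gamma> \<sigma>"
  shows "eqv (\<gamma> 0) (\<sigma> 1) (\<sigma> 0)"
proof -
  have "homotopic_loops UNIV \<gamma> (linepath' (\<gamma> 0))"
    if "linepath' = (\<lambda>x (_::real). x)" for linepath'
    using sc \<gamma> unfolding simply_connected_def
    by (auto simp: that path_def pathfinish_def pathstart_def)
  then have "homotopic_loops UNIV \<gamma> (\<lambda>_. \<gamma> 0)" by simp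
  then obtain h where h: "continuous_on ({0..1::real} \<times> {0..1::real}) h"
    and h0: "\<And>x. x \<in> {0..1} \<Longrightarrow> h (0, x) = \<gamma> x" and h1: "\<And>x. x \<in> {0..1} \<Longrightarrow> h (1, x) = \<gamma> 0"
    and hl: "\<And>t. t \<in> {0..1} \<Longrightarrow> h (t, 1) = h (t, 0)"
    unfolding homotopic_loops by (auto simp: pathfinish_def pathstart_def)
  have s0: "sol (h (0, 0)) (\<sigma> 0)" using liftD(1)[OF \<sigma>, of 0] h0 by simp
  obtain \<Sigma> where \<Sigma>: "lift ({0..1} \<times> {0..1}) h \<Sigma>" "eqv (h (0, 0)) (\<Sigma> (0, 0)) (\<sigma> 0)"
    using liftable_square[OF h] s0 unfolding liftable_def by (meson SigmaI atLeastAtMost_iff order_refl zero_le_one)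
  have edge: "lift {0..1} (h \<circ> c) (\<Sigma> \<circ> c) \<and> continuous_on {0..1} (h \<circ> c)"
    if c: "continuous_on {0..1} c" "c ` {0..1} \<subseteq> {0..1} \<times> {0..1}" for c :: "real \<Rightarrow> real \<times> real"
    using lift_compose[OF \<Sigma>(1) c] continuous_on_compose[OF c(1) continuous_on_subset[OF h c(2)]]
    by simp
  have contPair: "continuous_on {0..1} (Pair a)" for a :: real
    by (rule continuous_on_Pair[OF continuous_on_const continuous_on_id])
  have contPair': "continuous_on {0..1} (\<lambda>t::real. (t, a))" "b \<in> {0..1} \<Longrightarrow> (\<lambda>t. (t, b)) ` {0..1} \<subseteq> {0..1} \<times> {0..1}"
    for a b :: real
    by (auto intro: continuous_on_Pair[OF continuous_on_id continuous_on_const])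
  have subPair: "Pair a ` {0..1} \<subseteq> {0..1} \<times> {0..1}" if "a \<in> {0..1}" for a :: real
    using that by auto
  have 0: "lift {0..1} (h \<circ> Pair 0) (\<Sigma> \<circ> Pair 0)" "continuous_on {0..1} (h \<circ> Pair 0)"
    using edge[OF contPair subPair, of 0] by simp_all
  have 1: "lift {0..1} (h \<circ> Pair 1) (\<Sigma> \<circ> Pair 1)" "continuous_on {0..1} (h \<circ> Pair 1)"
    using edge[OF contPair subPair, of 1] by simp_all
  have lower: "lift {0..1} (h \<circ> (\<lambda>t. (t, 0))) (\<Sigma> \<circ> (\<lambda>t. (t, 0)))" "continuous_on {0..1} (h \<circ> (\<lambda>t. (t, 0)))"
    using edge[OF contPair', of 0] by auto
  have upper: "lift {0..1} (h \<circ> (\<lambda>t. (t, 1))) (\<Sigma> \<circ> (\<lambda>t. (t, 1)))"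
    using edge[OF contPair', of 1] by auto
  have upper: "lift {0..1} (h \<circ> (\<lambda>t. (t, 0))) (\<Sigma> \<circ> (\<lambda>t. (t, 1)))"
    using upper hl unfolding lift_def by auto
  have const: "lift {0..1} (h \<circ> Pair 1) (\<lambda>_. \<Sigma> (1, 0))"
    unfolding lift_def using h1 liftD(1)[OF 1(1), of 0] eqv_refl by auto
  have "eqv ((h \<circ> Pair 1) 1) ((\<Sigma> \<circ> Pair 1) 1) (\<Sigma> (1, 0))"
    by (rule path_lift_unique[OF 1(2)[folded path_def] 1(1) const, of 0]) (auto intro: eqv_refl)
  then have "eqv (h (1, 0)) (\<Sigma> (1, 1)) (\<Sigma> (1, 0))" using h1 by simp
  then have "eqv ((h \<circ> (\<lambda>t. (t, 0))) 0) ((\<Sigma> \<circ> (\<lambda>t. (t, 1))) 0) ((\<Sigma> \<circ> (\<lambda>t. (t, 0))) 0)"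
    using path_lift_unique[OF lower(2)[folded path_def] upper lower(1), of 1 0] by simp
  then have a: "eqv (\<gamma> 0) (\<Sigma> (0, 1)) (\<Sigma> (0, 0))" using h0 by simp
  have "lift {0..1} (h \<circ> Pair 0) \<sigma>" using \<sigma> h0 unfolding lift_def by auto
  then have "eqv ((h \<circ> Pair 0) 1) ((\<Sigma> \<circ> Pair 0) 1) (\<sigma> 1)"
    using path_lift_unique[OF 0(2)[folded path_def] 0(1), of \<sigma> 0 1] \<Sigma>(2) by simp
  then have "eqv (\<gamma> 0) (\<Sigma> (0, 1)) (\<sigma> 1)" using h0 hl[of 0] by simp
  moreover have "eqv (\<gamma> 0) (\<Sigma> (0, 0)) (\<sigma> 0)" using \<Sigma>(2) h0 by simp
  ultimately show ?thesis using a eqv_sym eqv_trans by blast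
qed

text \<open>The loop that follows \<gamma> and returns along \<delta> has a closed lift. The
  reparametrizations \<open>t / 2\<close> and \<open>1 - t / 2\<close> recover from it lifts of both
  paths with equivalent starting values and the same end.\<close>

lemma lift_endpoints_unique:
  assumes sc: "simply_connected (UNIV :: 'p set)"
    and \<gamma>: "path \<gamma>" "lift {0..1} \<gamma> \<sigma>" and \<delta>: "path \<delta>" "lift {0..1} \<delta> \<tau>"
    and ends: "\<gamma> 0 = \<delta> 0" "\<gamma> 1 = \<delta> 1" and e: "eqv (\<gamma> 0) (\<sigma> 0) (\<tau> 0)"
  shows "eqv (\<gamma> 1) (\<sigma> 1) (\<tau> 1)"
proof -
  define c where "c = \<gamma> +++ reversepath \<delta>"
  have c: "path c" "pathfinish c = pathstart c"
    using path_join_imp[OF \<gamma>(1) path_reversepath[THEN iffD2, OF \<delta>(1)]] ends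
    by (auto simp: c_def pathfinish_def pathstart_def reversepath_def joinpaths_def)
  have c0: "c 0 = \<gamma> 0" by (simp add: c_def joinpaths_def)
  obtain \<rho> where \<rho>: "lift {0..1} c \<rho>" "eqv (c 0) (\<rho> 0) (\<sigma> 0)"
    using path_liftable[OF c(1)] liftD(1)[OF \<gamma>(2), of 0] unfolding liftable_def c0 
    by (metis atLeastAtMost_iff c0 order_refl zero_le_one)
  have cl: "eqv (c 0) (\<rho> 1) (\<rho> 0)" by (rule lift_loop_closed[OF sc c \<rho>(1)])
  have 1: "lift {0..1} (c \<circ> (\<lambda>t. t / 2)) (\<rho> \<circ> (\<lambda>t. t / 2))"
    by (rule lift_compose[OF \<rho>(1)]) (auto intro!: continuous_intros)
  have c1: "(c \<circ> (\<lambda>t. t / 2)) t = \<gamma> t" if "t \<in> {0..1}" for t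
    using that by (simp add: c_def joinpaths_def)
  have "lift {0..1} \<gamma> (\<rho> \<circ> (\<lambda>t. t / 2))" using 1 c1 unfolding lift_def by (metis IntE)
  then have a: "eqv (\<gamma> 1) ((\<rho> \<circ> (\<lambda>t. t / 2)) 1) (\<sigma> 1)"
    using path_lift_unique[OF \<gamma>(1) _ \<gamma>(2), of "\<rho> \<circ> (\<lambda>t. t / 2)" 0 1] \<rho>(2) c0 by simp
  have 2: "lift {0..1} (c \<circ> (\<lambda>t. 1 - t / 2)) (\<rho> \<circ> (\<lambda>t. 1 - t / 2))"
    by (rule lift_compose[OF \<rho>(1)]) (auto intro!: continuous_intros)
  have c2: "(c \<circ> (\<lambda>t. 1 - t / 2)) t = \<delta> t" if "t \<in> {0..1}" for t
  proof (cases "t = 1")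
    case True
    then show ?thesis using ends by (simp add: c_def joinpaths_def)
  next
    case False
    then show ?thesis using that by (simp add: c_def joinpaths_def reversepath_def)
  qed
  have "lift {0..1} \<delta> (\<rho> \<circ> (\<lambda>t. 1 - t / 2))" using 2 c2 unfolding lift_def by (metis IntE)
  moreover have "eqv (\<delta> 0) ((\<rho> \<circ> (\<lambda>t. 1 - t / 2)) 0) (\<tau> 0)"
    using eqv_trans[OF eqv_trans[OF cl \<rho>(2)]] e c0 ends by simp
  ultimately have b: "eqv (\<delta> 1) ((\<rho> \<circ> (\<lambda>t. 1 - t / 2)) 1) (\<tau> 1)"
    using path_lift_unique[OF \<delta>(1) _ \<delta>(2), of "\<rho> \<circ> (\<lambda>t. 1 - t / 2)" 0 1] by simp
  show ?thesis using eqv_trans[OF eqv_sym[OF a]] b ends by simp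
qed

text \<open>Monodromy: the germ at \<open>p\<close> results from continuing \<open>s0\<close> along
  any path from \<open>p0\<close>. Independence of the path determines it up to \<open>eqv\<close>,
  so the conclusion speaks of a family of representatives that is coherent up to
  \<open>eqv\<close>.\<close>

theorem global_section:
  assumes sc: "simply_connected (UNIV :: 'p set)" and s0: "sol p0 s0"
  shows "\<exists>\<sigma>. (\<forall>p. sol p (\<sigma> p)) \<and> eqv p0 (\<sigma> p0) s0 \<and>
    (\<forall>p. \<exists>W. open W \<and> p \<in> W \<and> (\<forall>q\<in>W. eqv q (\<sigma> q) (\<sigma> p)))"
proof -
  define reach where "reach p s \<longleftrightarrow> (\<exists>\<gamma> \<sigma>. path \<gamma> \<and> \<gamma> 0 = p0 \<and> \<gamma> 1 = p \<and> lift {0..1} \<gamma> \<sigma> \<and>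
    eqv p0 (\<sigma> 0) s0 \<and> eqv p (\<sigma> 1) s)" for p s
  have uniq: "eqv p s t" if st: "reach p s" "reach p t" for p s t
  proof -
    obtain \<gamma> \<sigma> where 1: "path \<gamma>" "\<gamma> 0 = p0" "\<gamma> 1 = p" "lift {0..1} \<gamma> \<sigma>" "eqv p0 (\<sigma> 0) s0" "eqv p (\<sigma> 1) s"
      using st(1) unfolding reach_def by blast
    obtain \<delta> \<tau> where 2: "path \<delta>" "\<delta> 0 = p0" "\<delta> 1 = p" "lift {0..1} \<delta> \<tau>" "eqv p0 (\<tau> 0) s0" "eqv p (\<tau> 1) t"
      using st(2) unfolding reach_def by blast
    have "eqv (\<gamma> 0) (\<sigma> 0) (\<tau> 0)" using eqv_trans[OF 1(5) eqv_sym[OF 2(5)]] 1(2) by simp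
    then have "eqv (\<gamma> 1) (\<sigma> 1) (\<tau> 1)"
      by (intro lift_endpoints_unique[OF sc 1(1,4) 2(1,4)]) (simp_all only: 1 2)
    then have "eqv p (\<sigma> 1) (\<tau> 1)" using 1(3) by simp
    then show ?thesis using 1(6) 2(6) by (blast intro: eqv_sym eqv_trans)
  qed
  have ex: "\<exists>s. reach p s" for p
  proof -
    obtain \<gamma> where \<gamma>: "path \<gamma>" "\<gamma> 0 = p0" "\<gamma> 1 = p"
      using ex_path_if_simply_connected[OF sc] by blast
    obtain \<sigma> where "lift {0..1} \<gamma> \<sigma>" "eqv (\<gamma> 0) (\<sigma> 0) s0"
      using path_liftable[OF \<gamma>(1)] s0 \<gamma>(2) unfolding liftable_def
      by (metis atLeastAtMost_iff order_refl zero_le_one)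
    then show ?thesis using \<gamma> eqv_refl unfolding reach_def by blast
  qed
  define \<sigma> where "\<sigma> p = (SOME s. reach p s)" for p
  have \<sigma>: "reach p (\<sigma> p)" for p unfolding \<sigma>_def using ex by (rule someI_ex)
  have sol: "sol p (\<sigma> p)" for p
  proof -
    obtain \<gamma> \<rho> where "path \<gamma>" "\<gamma> 0 = p0" "\<gamma> 1 = p" "lift {0..1} \<gamma> \<rho>" "eqv p0 (\<rho> 0) s0"
      "eqv p (\<rho> 1) (\<sigma> p)"
      using \<sigma>[of p] unfolding reach_def by (elim exE conjE)
    then show ?thesis using liftD(1)[of "{0..1}" \<gamma> \<rho> 1] sol_eqv by auto
  qed
  have "reach p0 s0"
    unfolding reach_def using s0 eqv_refl
    by (intro exI[of _ "\<lambda>_. p0"] exI[of _ "\<lambda>_. s0"]) (auto simp: path_def lift_def)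
  then have init: "eqv p0 (\<sigma> p0) s0" using uniq \<sigma> by blast
  have near: "\<exists>W. open W \<and> p \<in> W \<and> (\<forall>q\<in>W. eqv q (\<sigma> q) (\<sigma> p))" for p
  proof -
    obtain U where U: "open U" "p \<in> U" "path_connected U" and tr: "trivial_on U"
    by (rule trivial_nbhdE)
  note exU = trivial_onD(1)[OF tr] and un = trivial_onD(2)[OF tr]
    obtain s where s: "\<forall>r\<in>U. sol r s" "eqv p s (\<sigma> p)" using exU[OF U(2) sol] by blast
    \<comment> \<open>The path to \<open>p\<close> is prolonged inside \<open>U\<close>, where
      continuation keeps the representative \<open>s\<close>. Path-connectedness of \<open>U\<close>
      enters here.\<close>
    have reach: "reach q s" if q: "q \<in> U" for q
    proof -
      obtain \<gamma> \<rho> where \<gamma>: "path \<gamma>" "\<gamma> 0 = p0" "\<gamma> 1 = p" "lift {0..1} \<gamma> \<rho>" "eqv p0 (\<rho> 0) s0" "eqv p (\<rho> 1) (\<sigma> p)"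
        using \<sigma>[of p] unfolding reach_def by (elim exE conjE)
      obtain \<delta> where \<delta>: "path \<delta>" "path_image \<delta> \<subseteq> U" "\<delta> 0 = p" "\<delta> 1 = q"
        using U q unfolding path_connected_def pathstart_def pathfinish_def by blast
      have pj: "path (\<gamma> +++ \<delta>)" using \<gamma> \<delta> by (simp add: pathfinish_def pathstart_def)
      have "sol ((\<gamma> +++ \<delta>) 0) (\<rho> 0)" using liftD(1)[OF \<gamma>(4), of 0] by (simp add: joinpaths_def)
      then obtain \<tau> where \<tau>: "lift {0..1} (\<gamma> +++ \<delta>) \<tau>" "eqv ((\<gamma> +++ \<delta>) 0) (\<tau> 0) (\<rho> 0)"
        using path_liftable[OF pj] unfolding liftable_def
        by (meson atLeastAtMost_iff order_refl zero_le_one)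
      have 1: "lift {0..1} ((\<gamma> +++ \<delta>) \<circ> (\<lambda>t. t / 2)) (\<tau> \<circ> (\<lambda>t. t / 2))"
        by (rule lift_compose[OF \<tau>(1)]) (auto intro!: continuous_intros)
      have "((\<gamma> +++ \<delta>) \<circ> (\<lambda>t. t / 2)) t = \<gamma> t" if "t \<in> {0..1}" for t
        using that by (simp add: joinpaths_def)
      then have "lift {0..1} \<gamma> (\<tau> \<circ> (\<lambda>t. t / 2))" using 1 unfolding lift_def by (metis IntE)
      moreover have "eqv (\<gamma> 0) ((\<tau> \<circ> (\<lambda>t. t / 2)) 0) (\<rho> 0)" using \<tau>(2) by (simp add: joinpaths_def)
      ultimately have a: "eqv (\<gamma> 1) ((\<tau> \<circ> (\<lambda>t. t / 2)) 1) (\<rho> 1)"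
        using path_lift_unique[OF \<gamma>(1) _ \<gamma>(4), of "\<tau> \<circ> (\<lambda>t. t / 2)" 0 1] by simp
      have 2: "lift {0..1} ((\<gamma> +++ \<delta>) \<circ> (\<lambda>t. 1/2 + t / 2)) (\<tau> \<circ> (\<lambda>t. 1/2 + t / 2))"
        by (rule lift_compose[OF \<tau>(1)]) (auto intro!: continuous_intros)
      have "((\<gamma> +++ \<delta>) \<circ> (\<lambda>t. 1/2 + t / 2)) t = \<delta> t" if "t \<in> {0..1}" for t
      proof (cases "t = 0")
        case True
        then show ?thesis using \<gamma> \<delta> by (simp add: joinpaths_def)
      next
        case False
        then show ?thesis using that by (simp add: joinpaths_def)
      qed
      then have 2: "lift {0..1} \<delta> (\<tau> \<circ> (\<lambda>t. 1/2 + t / 2))" using 2 unfolding lift_def by (metis IntE)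
      have 3: "lift {0..1} \<delta> (\<lambda>_. s)"
        using s(1) \<delta>(2) eqv_refl unfolding lift_def path_image_def by blast
      have "eqv (\<delta> 0) ((\<tau> \<circ> (\<lambda>t. 1/2 + t / 2)) 0) s"
        using eqv_trans[OF _ eqv_trans[OF \<gamma>(6) eqv_sym[OF s(2)]]] a \<gamma>(3) \<delta>(3) by simp
      then have b: "eqv (\<delta> 1) ((\<tau> \<circ> (\<lambda>t. 1/2 + t / 2)) 1) s"
        using path_lift_unique[OF \<delta>(1) 2 3, of 0 1] by simp
      have "eqv p0 (\<tau> 0) s0" using eqv_trans[OF _ \<gamma>(5)] \<tau>(2) \<gamma>(2) by (simp add: joinpaths_def)
      then show ?thesis
        unfolding reach_def using pj \<tau>(1) b \<gamma>(2) \<delta>(4)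
        by (intro exI[of _ "\<gamma> +++ \<delta>"] exI[of _ \<tau>]) (auto simp: joinpaths_def)
    qed
    have a: "eqv q (\<sigma> q) s" if "q \<in> U" for q using uniq[OF \<sigma> reach[OF that]] .
    obtain V where V: "open V" "p \<in> V" "\<forall>q\<in>V. eqv q s (\<sigma> p)" using eqv_open[OF s(2)] by blast
    have "\<forall>q\<in>U \<inter> V. eqv q (\<sigma> q) (\<sigma> p)" using a V(3) eqv_trans by blast
    then show ?thesis using U(1,2) V(1,2) by blast
  qed
  show ?thesis using sol init near by blast
qed

end

section \<open>Determinants\<close>

lemma map_permutation_option:
  fixes p :: "'n \<Rightarrow> 'n"
  assumes "p permutes UNIV"
  shows "map_permutation UNIV Some p = map_option p"
proof
  fix x :: "'n option"
  show "map_permutation UNIV Some p x = map_option p x"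
    by (cases x) (auto simp: map_permutation_def restrict_id_def)
qed

text \<open>A permutation that moves \<open>None\<close> sends some \<open>Some i\<close> to
  \<open>None\<close> and meets a zero entry. The remaining ones are of the form
  \<open>map_option p\<close> and have the sign of \<open>p\<close>.\<close>

lemma det_option:
  fixes m :: "real ^ 'n::finite option ^ 'n option"
  assumes col: "\<And>i. m $ Some i $ None = 0"
  shows "det m = m $ None $ None * det (\<chi> i j. m $ Some i $ Some j)"
proof -
  define P where "P = {p :: 'n option \<Rightarrow> 'n option. p permutes UNIV}"
  define Q where "Q = {p :: 'n \<Rightarrow> 'n. p permutes UNIV}"
  define f where "f p = of_int (sign p) * (\<Prod>i\<in>UNIV. m $ i $ p i)" for p :: "'n option \<Rightarrow> 'n option"
  have sub: "map_option ` Q \<subseteq> P"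
  proof
    fix r assume "r \<in> map_option ` Q"
    then obtain p where p: "p permutes UNIV" "r = map_option p" by (auto simp: Q_def)
    have "map_permutation UNIV Some p permutes (Some ` UNIV)"
      using p(1) by (intro map_permutation_permutes) (auto simp: inj_on_def bij_betw_def)
    then have "r permutes UNIV"
      using permutes_subset[of r "Some ` UNIV" UNIV] p by (simp add: map_permutation_option)
    then show "r \<in> P" by (simp add: P_def)
  qed
  have zero: "f p = 0" if "p \<in> P - map_option ` Q" for p
  proof -
    have pP: "p permutes UNIV" using that by (simp add: P_def)
    have "p None \<noteq> None"
    proof
      assume n: "p None = None"
      have ns: "p (Some i) \<noteq> None" for i
        using permutes_inj[OF pP] n by (metis injD option.distinct(1))
      define r where "r i = the (p (Some i))" for i
      have r: "p (Some i) = Some (r i)" for i using ns[of i] by (auto simp: r_def)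
      have "inj r" by (rule injI) (metis r permutes_inj[OF pP] injD option.inject)
      then have "r permutes UNIV" using finite_UNIV_inj_surj[of r] by (intro bij_imp_permutes) (auto simp: bij_def)
      moreover have "p = map_option r"
      proof
        fix x show "p x = map_option r x" by (cases x) (auto simp: n r)
      qed
      ultimately show False using that by (auto simp: Q_def)
    qed
    then obtain i where i: "p (Some i) = None"
      using permutes_surj[OF pP] by (metis option.exhaust surjD)
    have "(\<Prod>i\<in>UNIV. m $ i $ p i) = 0"
      by (rule prod_zero) (use i col[of i] in \<open>auto intro: exI[of _ "Some i"]\<close>)
    then show ?thesis by (simp add: f_def)
  qed
  have "det m = sum f P" by (simp add: det_def f_def P_def)
  also have "\<dots> = sum f (map_option ` Q)"
    by (rule sum.mono_neutral_right) (use sub zero in \<open>auto simp: P_def finite_permutations\<close>)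
  also have "\<dots> = (\<Sum>p\<in>Q. f (map_option p))"
  proof (rule sum.reindex_cong[OF _ refl refl])
    show "inj_on map_option Q" by (rule inj_onI) (metis ext option.inject option.simps(9))
  qed
  also have "\<dots> = (\<Sum>p\<in>Q. m $ None $ None * (of_int (sign p) * (\<Prod>i\<in>UNIV. m $ Some i $ Some (p i))))"
  proof (rule sum.cong[OF refl])
    fix p assume "p \<in> Q"
    then have p: "p permutes UNIV" by (simp add: Q_def)
    have "sign (map_permutation UNIV Some p) = sign p"
      by (rule sign_map_permutation) (use p in auto)
    then have s: "sign (map_option p) = sign p" using map_permutation_option[OF p] by simp
    have "(\<Prod>i\<in>UNIV. m $ i $ map_option p i) = m $ None $ None * (\<Prod>i\<in>range Some. m $ i $ map_option p i)"
      by (simp add: UNIV_option_conv)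
    also have "(\<Prod>i\<in>range Some. m $ i $ map_option p i) = (\<Prod>i\<in>UNIV. m $ Some i $ Some (p i))"
      by (simp add: prod.reindex)
    finally show "f (map_option p) = m $ None $ None * (of_int (sign p) * (\<Prod>i\<in>UNIV. m $ Some i $ Some (p i)))"
      by (simp add: f_def s)
  qed
  also have "\<dots> = m $ None $ None * det (\<chi> i j. m $ Some i $ Some j)"
    by (simp add: det_def Q_def sum_distrib_left)
  finally show ?thesis .
qed

text \<open>\<open>cdet e\<close> is the determinant of the real tuple \<open>(e\<^sub>k, i e\<^sub>k)\<close> and equals \<open>\<bar>det e\<bar>\<^sup>2\<close> for the complex
  determinant. Only its sign is needed. It is obtained by replacing one vector at a time: as a function of
  \<open>e\<^sub>k\<close> alone, \<open>cdet\<close> is the squared modulus of a complex linear form times a constant.\<close>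

definition cdet :: "('m::finite \<Rightarrow> real ^ ('m + 'm)) \<Rightarrow> real" where
  "cdet e = det (\<chi> i. case_sum e (std_J \<circ> e) i)"

lemma std_J_linear: "linear std_J"
  by (rule linearI) (auto simp: std_J_def vec_eq_iff split: sum.splits)

lemma std_J_std_J: "std_J (std_J w) = - w"
  by (auto simp: std_J_def vec_eq_iff split: sum.splits)

context
  fixes e :: "'m::finite \<Rightarrow> real ^ ('m + 'm)" and k :: 'm
begin

text \<open>The rows e_k and i e_k of \<open>cdet\<close> are freed to become independent arguments.
  The result is an alternating bilinear form that vanishes on the other vectors e_l and i
  e_l.\<close>

definition cpair :: "real ^ ('m + 'm) \<Rightarrow> real ^ ('m + 'm) \<Rightarrow> real" where
  "cpair v w = det (\<chi> i. if i = Inl k then v else if i = Inr k then w else case_sum e (std_J \<circ> e) i)"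

lemma cdet_eq_cpair: "cdet (e(k := v)) = cpair v (std_J v)"
  unfolding cdet_def cpair_def
  by (rule arg_cong[where f=det]) (auto simp: vec_eq_iff split: sum.splits)

lemma cpair_swap: "cpair v w = - cpair w v"
proof -
  have "cpair w v = det (\<chi> i. (\<chi> i. if i = Inl k then v else if i = Inr k then w else case_sum e (std_J \<circ> e) i)
      $ Transposition.transpose (Inl k) (Inr k) i)"
    unfolding cpair_def
    by (rule arg_cong[where f=det]) (auto simp: vec_eq_iff Transposition.transpose_def)
  also have "\<dots> = of_int (sign (Transposition.transpose (Inl k) (Inr k :: 'm + 'm))) * cpair v w"
    unfolding cpair_def
    by (rule det_permute_rows) (simp add: permutes_swap_id)
  finally show ?thesis by (simp add: sign_swap_id)
qed

lemma cpair_linear: "linear (\<lambda>v. cpair v w)"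
proof (rule linearI)
  fix u v :: "real ^ ('m + 'm)" and c :: real
  show "cpair (u + v) w = cpair u w + cpair v w"
    unfolding cpair_def using det_row_add[of "Inl k" "\<lambda>_. u" "\<lambda>_. v" "\<lambda>i. if i = Inr k then w else case_sum e (std_J \<circ> e) i"]
    by simp
  show "cpair (c *\<^sub>R v) w = c *\<^sub>R cpair v w"
    unfolding cpair_def using det_row_mul[of "Inl k" c "\<lambda>_. v" "\<lambda>i. if i = Inr k then w else case_sum e (std_J \<circ> e) i"]
    by (simp add: scalar_mult_eq_scaleR[symmetric] cong: if_cong)
qed

lemma cpair_linear_right: "linear (\<lambda>w. cpair v w)"
  using linear_compose_neg[OF cpair_linear[of v]] cpair_swap[of v] by simp

lemma cpair_row:
  assumes "l \<noteq> k"
  shows "cpair (e l) w = 0" "cpair (std_J (e l)) w = 0"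
  unfolding cpair_def
  by (rule det_identical_rows[of "Inl k" "Inl l"], use assms in \<open>auto simp: row_def vec_eq_iff\<close>)
    (rule det_identical_rows[of "Inl k" "Inr l"], use assms in \<open>auto simp: row_def vec_eq_iff\<close>)

lemma cpair_same: "cpair v v = 0"
  using cpair_swap[of v v] by simp

end

text \<open>When \<open>v\<close> is expanded in the real basis of all e_l and i e_l, only the
  coefficients \<open>a\<close> and \<open>b\<close> of e_k and i e_k survive in
  \<open>cpair\<close>. Thus a + i b is the complex coordinate of \<open>v\<close> along e_k, and
  the factor is its squared modulus.\<close>

lemma cdet_update:
  fixes e :: "'m::finite \<Rightarrow> real ^ ('m + 'm)"
  assumes ne: "cdet e \<noteq> 0"
  shows "\<exists>a b. cdet (e(k := v)) = (a\<^sup>2 + b\<^sup>2) * cdet e \<and>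
    (\<forall>w. cpair e k v w = a * cpair e k (e k) w + b * cpair e k (std_J (e k)) w) \<and>
    (\<forall>w. cpair e k (std_J v) w = a * cpair e k (std_J (e k)) w - b * cpair e k (e k) w)"
proof -
  define r where "r i = case_sum e (std_J \<circ> e) i" for i
  have "invertible (\<chi> i. r i)" using ne by (simp add: invertible_det_nz cdet_def r_def)
  then obtain N where N: "transpose (\<chi> i. r i) ** N = mat 1"
    using transpose_invertible unfolding invertible_def by blast
  define u where "u = N *v v"
  have "transpose (\<chi> i. r i) *v u = v"
    by (simp add: u_def matrix_vector_mul_assoc N)
  then have v: "v = (\<Sum>i\<in>UNIV. u $ i *\<^sub>R r i)"
    by (simp add: vec_eq_iff matrix_vector_mult_def transpose_def mult.commute)
  have sum: "(\<Sum>i\<in>UNIV. g i) = (\<Sum>l\<in>UNIV. g (Inl l)) + (\<Sum>l\<in>UNIV. g (Inr l))" for g :: "'m + 'm \<Rightarrow> real"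
    using sum.Plus[of UNIV UNIV g] by (simp add: o_def)
  define a b where "a = u $ (Inl k)" and "b = u $ (Inr k)"
  have one: "(\<Sum>l\<in>UNIV. g l) = g k" if "\<And>l. l \<noteq> k \<Longrightarrow> g l = 0" for g :: "'m \<Rightarrow> real"
    using that by (subst sum.remove[of _ k]) auto
  have lin: "cpair e k v w = a * cpair e k (e k) w + b * cpair e k (std_J (e k)) w" for w
  proof -
    have "cpair e k v w = (\<Sum>i\<in>UNIV. u $ i * cpair e k (r i) w)"
      by (subst v) (simp add: linear_sum[OF cpair_linear] linear_scale[OF cpair_linear])
    also have "\<dots> = a * cpair e k (e k) w + b * cpair e k (std_J (e k)) w"
      unfolding sum by (subst (1 2) one) (simp_all add: r_def cpair_row a_def b_def)
    finally show ?thesis .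
  qed
  have Jlin: "cpair e k (std_J v) w = a * cpair e k (std_J (e k)) w - b * cpair e k (e k) w" for w
  proof -
    have "std_J v = (\<Sum>i\<in>UNIV. u $ i *\<^sub>R std_J (r i))"
      by (subst v) (simp add: linear_sum[OF std_J_linear] linear_scale[OF std_J_linear])
    then have "cpair e k (std_J v) w = (\<Sum>i\<in>UNIV. u $ i * cpair e k (std_J (r i)) w)"
      by (simp add: linear_sum[OF cpair_linear] linear_scale[OF cpair_linear])
    also have "\<dots> = a * cpair e k (std_J (e k)) w - b * cpair e k (e k) w"
      unfolding sum
      by (subst (1 2) one) (simp_all add: r_def cpair_row a_def b_def std_J_std_J linear_neg[OF cpair_linear])
    finally show ?thesis .
  qed
  have e: "cdet e = cpair e k (e k) (std_J (e k))" using cdet_eq_cpair[of e k "e k"] by simp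
  have "cdet (e(k := v)) = cpair e k v (std_J v)" by (rule cdet_eq_cpair)
  also have "\<dots> = a * cpair e k (e k) (std_J v) + b * cpair e k (std_J (e k)) (std_J v)" by (rule lin)
  also have "\<dots> = - a * cpair e k (std_J v) (e k) - b * cpair e k (std_J v) (std_J (e k))"
    using cpair_swap[of e k "std_J v"] by simp
  also have "\<dots> = (a\<^sup>2 + b\<^sup>2) * cdet e"
    using cpair_swap[of e k "std_J (e k)" "e k"]
    by (simp add: Jlin cpair_same e power2_eq_square algebra_simps)
  finally show ?thesis using lin Jlin by blast
qed

lemma cdet_update_nonneg:
  assumes "cdet e \<noteq> 0"
  shows "0 \<le> cdet (e(k := v)) * cdet e"
proof -
  obtain a b where "cdet (e(k := v)) = (a\<^sup>2 + b\<^sup>2) * cdet e" using cdet_update[OF assms] by blast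
  then show ?thesis by (simp add: mult.assoc)
qed

text \<open>If \<open>v\<close> makes the determinant vanish, then its complex coordinate along f_k
  is 0, so \<open>v\<close> contributes nothing and adding f_k restores the old value. This supplies
  a vector that fits into two frames at once.\<close>

lemma cdet_update_degenerate:
  assumes f: "cdet f \<noteq> 0" and v: "cdet (f(k := v)) = 0"
  shows "cdet (f(k := v + f k)) = cdet f"
proof -
  obtain a b where "cdet (f(k := v)) = (a\<^sup>2 + b\<^sup>2) * cdet f"
    and lin: "\<And>w. cpair f k v w = a * cpair f k (f k) w + b * cpair f k (std_J (f k)) w"
      "\<And>w. cpair f k (std_J v) w = a * cpair f k (std_J (f k)) w - b * cpair f k (f k) w"
    using cdet_update[OF f, of k v] by blast
  then have "a = 0" "b = 0" using f v by auto
  then have 0: "cpair f k v w = 0" "cpair f k w (std_J v) = 0" for w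
    using lin cpair_swap[of f k w "std_J v"] by simp_all
  have "cdet (f(k := v + f k)) = cpair f k (v + f k) (std_J (v + f k))" by (rule cdet_eq_cpair)
  also have "\<dots> = cpair f k (f k) (std_J (f k))"
    by (simp add: 0 linear_add[OF cpair_linear] linear_add[OF std_J_linear] linear_add[OF cpair_linear_right])
  also have "\<dots> = cdet f" using cdet_eq_cpair[of f k "f k"] by simp
  finally show ?thesis .
qed

lemma cdet_nonneg_prod:
  fixes e f :: "'m::finite \<Rightarrow> real ^ ('m + 'm)"
  shows "0 \<le> cdet e * cdet f"
proof -
  \<comment> \<open>Induction over a set of indices outside of which the frames agree: in each step
    the same vector is put in place \<open>k\<close> of both frames, which preserves both
    signs.\<close>
  have *: "finite S \<Longrightarrow> (\<And>k. k \<notin> S \<Longrightarrow> e k = f k) \<Longrightarrow> cdet e \<noteq> 0 \<Longrightarrow> cdet f \<noteq> 0 \<Longrightarrow> 0 < cdet e * cdet f"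
    for S and e f :: "'m \<Rightarrow> real ^ ('m + 'm)"
  proof (induction S arbitrary: e f rule: finite_induct)
    case empty
    then have "e = f" by auto
    then show ?case using empty by (auto simp: zero_less_mult_iff not_less)
  next
    case (insert k S)
    \<comment> \<open>If neither e_k fits into \<open>f\<close> nor f_k into \<open>e\<close>, then
      their sum fits into both.\<close>
    have "\<exists>x. cdet (e(k := x)) \<noteq> 0 \<and> cdet (f(k := x)) \<noteq> 0"
    proof (cases "cdet (f(k := e k)) = 0 \<and> cdet (e(k := f k)) = 0")
      case True
      then show ?thesis
        using cdet_update_degenerate[of f k "e k"] cdet_update_degenerate[of e k "f k"] insert.prems
        by (intro exI[of _ "e k + f k"]) (simp add: add.commute)
    next
      case False
      then show ?thesis using insert.prems by (metis fun_upd_triv)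
    qed
    then obtain x where x: "cdet (e(k := x)) \<noteq> 0" "cdet (f(k := x)) \<noteq> 0" by blast
    have "0 < cdet (e(k := x)) * cdet (f(k := x))"
    proof (rule insert.IH)
      fix l assume "l \<notin> S"
      then show "(e(k := x)) l = (f(k := x)) l" using insert.prems(1)[of l] by (cases "l = k") auto
    qed (rule x)+
    moreover have "0 \<le> cdet (e(k := x)) * cdet e" "0 \<le> cdet (f(k := x)) * cdet f"
      using cdet_update_nonneg insert.prems by blast+
    ultimately show ?case
      using insert.prems(2,3) by (auto simp: zero_less_mult_iff zero_le_mult_iff)
  qed
  show ?thesis
  proof (cases "cdet e = 0 \<or> cdet f = 0")
    case False
    then show ?thesis using *[of UNIV e f] by simp
  qed auto
qed

lemma cdet_nonneg:
  fixes e :: "'m::finite \<Rightarrow> real ^ ('m + 'm)"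
  shows "0 \<le> cdet e"
proof -
  let ?f = "\<lambda>k. axis (Inl k) 1 :: real ^ ('m + 'm)"
  obtain f where f_def: "f = ?f" by blast
  have "(\<chi> i. case_sum f (std_J \<circ> f) i) = (mat 1 :: real ^ ('m + 'm) ^ ('m + 'm))"
    by (auto simp: f_def vec_eq_iff mat_def axis_def std_J_def split: sum.splits)
  then have "cdet f = 1" by (simp add: cdet_def)
  then show ?thesis using cdet_nonneg_prod[of e f] mult_1_right by metis
qed

section \<open>Manifolds\<close>

lemma chartD:
  assumes "is_chart (U, x)"
  shows "open U" "open (x ` U)" "continuous_on U x" "continuous_on (x ` U) (inv_into U x)"
    "q \<in> U \<Longrightarrow> inv_into U x (x q) = q"
    "z \<in> x ` U \<Longrightarrow> x (inv_into U x z) = z" "z \<in> x ` U \<Longrightarrow> inv_into U x z \<in> U"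
  using assms unfolding is_chart_def homeomorphism_def by (auto simp: f_inv_into_f inv_into_into)

lemma chart_open_image:
  assumes c: "is_chart (U, x)" and O: "open S" "S \<subseteq> U"
  shows "open (x ` S)"
proof -
  have "x ` S = (x ` U) \<inter> (inv_into U x -` S)"
    using chartD[OF c] O(2) by (auto simp: image_iff)
  moreover have "open ((x ` U) \<inter> (inv_into U x -` S))"
    using continuous_on_open_vimage[OF chartD(2)[OF c], of "inv_into U x"] chartD(4)[OF c] O(1)
    by (metis inf_commute)
  ultimately show ?thesis by simp
qed

locale smooth_mfd =
  fixes A :: "('a::{t2_space, second_countable_topology}, 'n::finite) chart set"
  assumes atlas: "smooth_atlas A"
begin

lemma ex_chart: "\<exists>U x. (U, x) \<in> A \<and> p \<in> U"
proof -
  have "p \<in> (\<Union>c\<in>A. fst c)" using atlas by (simp add: smooth_atlas_def)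
  then show ?thesis by (metis UN_E prod.collapse)
qed

lemma chart_compatible: "c \<in> A \<Longrightarrow> compatible_chart A c"
  using atlas by (auto simp: smooth_atlas_def compatible_chart_def)

lemma compatible_is_chart: "compatible_chart A c \<Longrightarrow> is_chart c"
  by (simp add: compatible_chart_def)

lemma atlas_is_chart: "c \<in> A \<Longrightarrow> is_chart c"
  using chart_compatible compatible_is_chart by blast

lemma smooth_transfer:
  fixes f :: "'a \<Rightarrow> real"
  assumes c: "is_chart (V, x)" and d: "is_chart (W, z)" and t: "smooth_transition (V, x) (W, z)"
    and f: "smooth_on (z ` S) (f \<circ> inv_into W z)" and S: "open S" "S \<subseteq> W"
  shows "smooth_on (x ` (V \<inter> S)) (f \<circ> inv_into V x)"
proof -
  have o1: "open (x ` (V \<inter> S))" using chart_open_image[OF c] chartD(1)[OF c] S by auto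
  have o2: "open (z ` S)" using chart_open_image[OF d S] .
  have "smooth_on (x ` (V \<inter> S)) (\<lambda>y. (f \<circ> inv_into W z) ((z \<circ> inv_into V x) y))"
  proof (rule smooth_on_compose[OF o1 o2 _ _ f])
    show "smooth_on (x ` (V \<inter> S)) (z \<circ> inv_into V x)"
      using t S(2) by (auto simp: smooth_transition_def intro: smooth_on_subset)
    show "(z \<circ> inv_into V x) ` x ` (V \<inter> S) \<subseteq> z ` S" using chartD(5)[OF c] by auto
  qed
  then show ?thesis
    by (rule smooth_on_cong[OF o1, rotated]) (use chartD(5)[OF c] chartD(5)[OF d] S in auto)
qed

text \<open>The holomorphic charts are only compatible with the atlas, so smoothness must be
  available in every compatible chart.\<close>

lemma smooth_map_compatible:
  fixes f :: "'a \<Rightarrow> real"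
  assumes f: "smooth_map A f" and c: "compatible_chart A (V, x)"
  shows "smooth_on (x ` V) (f \<circ> inv_into V x)"
proof (rule smooth_on_localI)
  fix y assume "y \<in> x ` V"
  then obtain p where p: "p \<in> V" "y = x p" by blast
  obtain W z where W: "(W, z) \<in> A" "p \<in> W" using ex_chart by blast
  have "smooth_on (x ` (V \<inter> W)) (f \<circ> inv_into V x)"
    using c W f chartD(1)[OF atlas_is_chart[OF W(1)]]
    by (intro smooth_transfer[of V x W z]) (auto simp: compatible_chart_def smooth_map_def atlas_is_chart)
  moreover have "open (x ` (V \<inter> W))"
    using chart_open_image[of V x "V \<inter> W"] chartD(1)[OF atlas_is_chart[OF W(1)]] c chartD(1)
    by (auto simp: compatible_chart_def)
  ultimately show "\<exists>T. open T \<and> y \<in> T \<and> smooth_on T (f \<circ> inv_into V x)" using p W by blast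
qed

lemma smooth_map_localI:
  fixes f :: "'a \<Rightarrow> real"
  assumes loc: "\<And>p. \<exists>V x S. compatible_chart A (V, x) \<and> open S \<and> p \<in> S \<and> S \<subseteq> V \<and> smooth_on (x ` S) (f \<circ> inv_into V x)"
  shows "smooth_map A f"
  unfolding smooth_map_def
proof (clarify, rule smooth_on_localI)
  fix W z y assume W: "(W, z) \<in> A" and "y \<in> z ` W"
  then obtain p where p: "p \<in> W" "y = z p" by blast
  obtain V x S where V: "compatible_chart A (V, x)" "open S" "p \<in> S" "S \<subseteq> V" "smooth_on (x ` S) (f \<circ> inv_into V x)"
    using loc[of p] by (elim exE conjE)
  have "smooth_on (z ` (W \<inter> S)) (f \<circ> inv_into W z)"
    using V W by (intro smooth_transfer[of W z V x]) (auto simp: compatible_chart_def atlas_is_chart)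
  moreover have "open (z ` (W \<inter> S))"
    using chart_open_image[OF atlas_is_chart[OF W], of "W \<inter> S"] chartD(1)[OF atlas_is_chart[OF W]] V(2) by auto
  ultimately show "\<exists>T. open T \<and> y \<in> T \<and> smooth_on T (f \<circ> inv_into W z)" using p V(3) by blast
qed

lemma smooth_map_cong_local:
  fixes f :: "'a \<Rightarrow> real"
  assumes "\<And>p. \<exists>S h. open S \<and> p \<in> S \<and> smooth_map A h \<and> (\<forall>q\<in>S. f q = h q)"
  shows "smooth_map A f"
proof (rule smooth_map_localI)
  fix p
  obtain S h where S: "open S" "p \<in> S" "smooth_map A h" "\<forall>q\<in>S. f q = h q"
    using assms[of p] by (elim exE conjE)
  obtain V x where V: "(V, x) \<in> A" "p \<in> V" using ex_chart by blast
  note c = atlas_is_chart[OF V(1)]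
  have o: "open (x ` (V \<inter> S))" using chart_open_image[OF c, of "V \<inter> S"] chartD(1)[OF c] S(1) by auto
  have "smooth_on (x ` (V \<inter> S)) (h \<circ> inv_into V x)"
    using S(3) V(1) by (auto simp: smooth_map_def intro: smooth_on_subset)
  then have "smooth_on (x ` (V \<inter> S)) (f \<circ> inv_into V x)"
    by (rule smooth_on_cong[OF o, rotated]) (use S(4) chartD(5)[OF c] in auto)
  then show "\<exists>V x S. compatible_chart A (V, x) \<and> open S \<and> p \<in> S \<and> S \<subseteq> V \<and> smooth_on (x ` S) (f \<circ> inv_into V x)"
    using V S chart_compatible[OF V(1)] chartD(1)[OF c]
    by (intro exI[of _ V] exI[of _ x] exI[of _ "V \<inter> S"]) auto
qed

lemma atlas_open_image: "(U, x) \<in> A \<Longrightarrow> open (x ` U)"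
  using chartD(2)[OF atlas_is_chart] .

lemma smooth_map_const: "smooth_map A (\<lambda>_. c)"
  by (auto simp: smooth_map_def o_def intro!: smooth_on_const atlas_open_image)

lemma smooth_map_add: "smooth_map A f \<Longrightarrow> smooth_map A h \<Longrightarrow> smooth_map A (\<lambda>q. f q + h q)"
  by (auto simp: smooth_map_def o_def intro!: smooth_on_add atlas_open_image)

lemma smooth_map_mult:
  fixes f h :: "'a \<Rightarrow> real"
  shows "smooth_map A f \<Longrightarrow> smooth_map A h \<Longrightarrow> smooth_map A (\<lambda>q. f q * h q)"
  by (auto simp: smooth_map_def o_def intro!: smooth_on_mult atlas_open_image)

lemma smooth_map_sum: "(\<And>i. i \<in> I \<Longrightarrow> smooth_map A (f i)) \<Longrightarrow> smooth_map A (\<lambda>q. \<Sum>i\<in>I. f i q)"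
  by (auto simp: smooth_map_def o_def intro!: smooth_on_sum atlas_open_image)

lemma smooth_map_prod:
  fixes f :: "'i \<Rightarrow> 'a \<Rightarrow> real"
  assumes "\<And>i. i \<in> I \<Longrightarrow> smooth_map A (f i)"
  shows "smooth_map A (\<lambda>q. \<Prod>i\<in>I. f i q)"
proof (cases "finite I")
  case True
  then show ?thesis using assms by (induction I) (auto intro: smooth_map_const smooth_map_mult)
qed (simp add: smooth_map_const)

lemma smooth_map_diff: "smooth_map A f \<Longrightarrow> smooth_map A h \<Longrightarrow> smooth_map A (\<lambda>q. f q - h q)"
  by (auto simp: smooth_map_def o_def intro!: smooth_on_diff atlas_open_image)

lemma smooth_map_vec:
  "smooth_map A (f :: 'a \<Rightarrow> real ^ 'k::finite) \<longleftrightarrow> (\<forall>i. smooth_map A (\<lambda>q. f q $ i))"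
  unfolding smooth_map_def using smooth_on_vec[OF atlas_open_image] by (fastforce simp: o_def)

section \<open>Derivations at a point and vector fields\<close>

lemma tangentD:
  assumes "v \<in> tangent_space A p" "smooth_map A f" "smooth_map A h"
  shows "v (\<lambda>q. f q + h q) = v f + v h" "v (\<lambda>q. c * f q) = c * v f"
    "v (\<lambda>q. f q * h q) = f p * v h + h p * v f"
  using assms unfolding tangent_space_def by (auto simp: plus_fun_def times_fun_def fscale_def)

lemma tangent_nonsmooth: "v \<in> tangent_space A p \<Longrightarrow> \<not> smooth_map A f \<Longrightarrow> v f = 0"
  unfolding tangent_space_def by auto

lemma tangent_const:
  assumes "v \<in> tangent_space A p" shows "v (\<lambda>_. c) = 0"
  using tangentD(3)[OF assms smooth_map_const smooth_map_const, of 1 1]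
    tangentD(2)[OF assms smooth_map_const smooth_map_const, of c 1] by simp

lemma tangent_diff:
  assumes "v \<in> tangent_space A p" "smooth_map A f" "smooth_map A h"
  shows "v (\<lambda>q. f q - h q) = v f - v h"
proof -
  have "v (\<lambda>q. f q + (-1) * h q) = v f + (-1) * v h"
    using tangentD(1)[OF assms(1,2), of "\<lambda>q. (-1) * h q"] tangentD(2)[OF assms(1,3,3), of "-1"]
      smooth_map_mult[OF smooth_map_const assms(3), of "-1"] by simp
  then show ?thesis by simp
qed

lemma tangent_sum:
  assumes "v \<in> tangent_space A p" "finite I" "\<And>i. i \<in> I \<Longrightarrow> smooth_map A (f i)"
  shows "v (\<lambda>q. \<Sum>i\<in>I. f i q) = (\<Sum>i\<in>I. v (f i))"
  using assms(2,3)
proof (induction I)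
  case empty
  then show ?case using tangent_const[OF assms(1), of 0] by simp
next
  case (insert i I)
  then show ?case
    using tangentD(1)[OF assms(1), of "f i" "\<lambda>q. \<Sum>i\<in>I. f i q"] by (simp add: smooth_map_sum)
qed

lemma tangent_prod:
  assumes v: "v \<in> tangent_space A p" and "finite I" "\<And>i. i \<in> I \<Longrightarrow> smooth_map A (f i)"
  shows "v (\<lambda>q. \<Prod>i\<in>I. f i q) = (\<Sum>i\<in>I. v (f i) * (\<Prod>j\<in>I - {i}. f j p))"
  using assms(2,3)
proof (induction I)
  case empty
  then show ?case using tangent_const[OF v, of 1] by simp
next
  case (insert i I)
  have "v (\<lambda>q. f i q * (\<Prod>i\<in>I. f i q)) = f i p * v (\<lambda>q. \<Prod>i\<in>I. f i q) + (\<Prod>i\<in>I. f i p) * v (f i)"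
    using insert by (intro tangentD(3)[OF v] smooth_map_prod) auto
  also have "\<dots> = (\<Prod>i\<in>I. f i p) * v (f i) + (\<Sum>k\<in>I. f i p * (v (f k) * (\<Prod>j\<in>I - {k}. f j p)))"
    using insert by (simp add: sum_distrib_left)
  also have "(\<Sum>k\<in>I. f i p * (v (f k) * (\<Prod>j\<in>I - {k}. f j p))) =
      (\<Sum>k\<in>I. v (f k) * (\<Prod>j\<in>insert i I - {k}. f j p))"
  proof (rule sum.cong[OF refl])
    fix k assume "k \<in> I"
    then have "insert i I - {k} = insert i (I - {k})" using insert.hyps by auto
    then show "f i p * (v (f k) * (\<Prod>j\<in>I - {k}. f j p)) = v (f k) * (\<Prod>j\<in>insert i I - {k}. f j p)"
      using insert.hyps by simp
  qed
  finally show ?case using insert.hyps by (simp add: Diff_insert_absorb)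
qed

lemma tangent_lincomb:
  assumes "u \<in> tangent_space A p" "v \<in> tangent_space A p"
  shows "u + v \<in> tangent_space A p" "c *\<^sub>f u \<in> tangent_space A p" "0 \<in> tangent_space A p"
    "u - v \<in> tangent_space A p"
  using assms unfolding tangent_space_def by (auto simp: fscale_def algebra_simps)

lemma tangent_sum_mem:
  "(\<And>i. i \<in> I \<Longrightarrow> v i \<in> tangent_space A p) \<Longrightarrow> (\<Sum>i\<in>I. v i) \<in> tangent_space A p"
proof (induction I rule: infinite_finite_induct)
  case (insert i I)
  have "v i + sum v I \<in> tangent_space A p" using insert by (intro tangent_lincomb(1)) auto
  then show ?case by (simp only: sum.insert[OF insert.hyps])
qed (auto simp: tangent_space_def)

lemma vfD:
  assumes "X \<in> vector_fields A"
  shows "X p \<in> tangent_space A p" "smooth_map A f \<Longrightarrow> smooth_map A (\<lambda>q. X q f)"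
  using assms unfolding vector_fields_def by auto

lemma vf_add: "X \<in> vector_fields A \<Longrightarrow> Y \<in> vector_fields A \<Longrightarrow> X + Y \<in> vector_fields A"
  unfolding vector_fields_def by (auto simp: tangent_lincomb smooth_map_add)

lemma vf_scale:
  assumes X: "X \<in> vector_fields A" and h: "smooth_map A h"
  shows "vf_scale h X \<in> vector_fields A"
proof -
  have "h p *\<^sub>f X p \<in> tangent_space A p" for p
    using tangent_lincomb(2)[of "X p" p "X p"] vfD(1)[OF X] by blast
  moreover have "smooth_map A (\<lambda>p. (h p *\<^sub>f X p) f)" if "smooth_map A f" for f
    using smooth_map_mult[OF h vfD(2)[OF X that]] by (simp add: fscale_def)
  ultimately show ?thesis by (simp only: vector_fields_def vf_scale_def mem_Collect_eq) blast
qed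

lemma vf_zero: "0 \<in> vector_fields A"
  by (simp add: vector_fields_def tangent_space_def smooth_map_const)

lemma vf_sum: "(\<And>i. i \<in> I \<Longrightarrow> X i \<in> vector_fields A) \<Longrightarrow> (\<Sum>i\<in>I. X i) \<in> vector_fields A"
proof (induction I rule: infinite_finite_induct)
  case (insert i I)
  have "X i + sum X I \<in> vector_fields A" using insert by (intro vf_add) auto
  then show ?case by (simp only: sum.insert[OF insert.hyps])
next
  case (infinite I)
  show ?case by (simp only: sum.infinite[OF infinite(1)] vf_zero)
qed (simp only: sum.empty vf_zero)

lemma vf_diff:
  assumes "X \<in> vector_fields A" "Y \<in> vector_fields A" shows "X - Y \<in> vector_fields A"
proof -
  have eq: "X - Y = X + vf_scale (\<lambda>_. -1) Y" by (simp add: fun_eq_iff vf_scale_def fscale_def)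
  show ?thesis unfolding eq by (rule vf_add[OF assms(1) vf_scale[OF assms(2) smooth_map_const]])
qed

end


text \<open>A compatible chart \<open>(V, x)\<close> with a bump function \<open>b\<close> that is \<open>1\<close> on the ball of radius \<open>r\<close> about \<open>a\<close>.
  Everything on the chart is transported to globally defined objects by means of \<open>b\<close>, and these are
  meaningful on \<open>U\<close>, the preimage of that ball.\<close>

locale coord = smooth_mfd A
  for A :: "('a::{t2_space, second_countable_topology}, 'n::finite) chart set" +
  fixes V :: "'a set" and x :: "'a \<Rightarrow> real ^ 'n" and a :: "real ^ 'n" and r :: real and b :: "real ^ 'n \<Rightarrow> real"
  assumes compat: "compatible_chart A (V, x)" and r: "0 < r" and sub: "cball a (3 * r) \<subseteq> x ` V"
    and b_smooth: "smooth_on UNIV b" and b_1: "\<And>y. dist a y \<le> r \<Longrightarrow> b y = 1"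
    and b_0: "\<And>y. 2 * r \<le> dist a y \<Longrightarrow> b y = 0"
begin

abbreviation inv_x :: "real ^ 'n \<Rightarrow> 'a" where "inv_x \<equiv> inv_into V x"

lemma isch: "is_chart (V, x)" using compat by (rule compatible_is_chart)

lemmas chart = chartD[OF isch]

definition U :: "'a set" where "U = {q\<in>V. dist a (x q) < r}"

lemma U_eq: "U = inv_x ` ball a r"
proof -
  have "ball a r \<subseteq> cball a (3 * r)" using r by auto
  then have "ball a r \<subseteq> x ` V" using sub by blast
  then show ?thesis using chart(5,6,7) by (force simp: U_def)
qed

lemma ball_sub: "ball a (3 * r) \<subseteq> x ` V" "ball a r \<subseteq> x ` V" "ball a r \<subseteq> ball a (3 * r)"
  using sub r by auto

lemma U_V: "q \<in> U \<Longrightarrow> q \<in> V" by (simp add: U_def)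

lemma x_U: "q \<in> U \<Longrightarrow> x q \<in> ball a r" "q \<in> U \<Longrightarrow> inv_x (x q) = q"
  using chart(5) by (auto simp: U_def)

lemma inv_ball: "z \<in> ball a r \<Longrightarrow> inv_x z \<in> U" "z \<in> ball a r \<Longrightarrow> x (inv_x z) = z"
  using chart(6,7) ball_sub(2) by (auto simp: U_def)

lemma open_preimage:
  assumes "open S" shows "open {q\<in>V. x q \<in> S}"
proof -
  have "open (x -` S \<inter> V)" using continuous_on_open_vimage[OF chart(1), of x] chart(3) assms by blast
  moreover have "{q\<in>V. x q \<in> S} = x -` S \<inter> V" by auto
  ultimately show ?thesis by simp
qed

lemma open_U: "open U"
  using open_preimage[of "ball a r"] by (simp add: U_def)

lemma x_image_open: "open S \<Longrightarrow> S \<subseteq> U \<Longrightarrow> open (x ` S)"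
  using chart_open_image[OF isch] U_V by blast

lemma path_connected_U: "path_connected U"
  unfolding U_eq
  by (rule path_connected_continuous_image)
    (auto intro: convex_imp_path_connected continuous_on_subset[OF chart(4) ball_sub(2)])

definition ext :: "(real ^ 'n \<Rightarrow> real) \<Rightarrow> 'a \<Rightarrow> real" where
  "ext h q = (if q \<in> V then b (x q) * h (x q) else 0)"

lemma ext_U: "q \<in> U \<Longrightarrow> ext h q = h (x q)"
  using b_1[of "x q"] by (auto simp: ext_def U_def)

text \<open>The set is compact, and the Hausdorff property makes it closed in the whole manifold and
  not only in \<open>V\<close>. On its open complement every cut-off function vanishes.\<close>

lemma closed_inv: "closed (inv_x ` cball a (2 * r))"
proof -
  have "cball a (2 * r) \<subseteq> cball a (3 * r)" using r by (intro subset_cball) simp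
  then have "cball a (2 * r) \<subseteq> x ` V" using sub by blast
  then have "compact (inv_x ` cball a (2 * r))"
    by (intro compact_continuous_image continuous_on_subset[OF chart(4)]) auto
  then show ?thesis by (rule compact_imp_closed)
qed

text \<open>On the preimage of the ball of radius 3 * r the defining product is smooth in the chart;
  off the closed preimage of radius 2 * r the function is 0. The gap between the radii makes these
  two open sets cover the manifold.\<close>

lemma smooth_ext:
  assumes h: "smooth_on (ball a (3 * r)) h"
  shows "smooth_map A (ext h)"
proof (rule smooth_map_localI)
  fix p
  show "\<exists>W z S. compatible_chart A (W, z) \<and> open S \<and> p \<in> S \<and> S \<subseteq> W \<and> smooth_on (z ` S) (ext h \<circ> inv_into W z)"
  proof (cases "p \<in> V \<and> dist a (x p) < 3 * r")
    case True
    define S where "S = {q\<in>V. x q \<in> ball a (3 * r)}"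
    have S: "open S" "S \<subseteq> V" "p \<in> S"
      using True open_preimage[OF open_ball, of a "3 * r"] by (auto simp: S_def)
    have xS: "open (x ` S)" using chart_open_image[OF isch S(1,2)] .
    have "x ` S \<subseteq> ball a (3 * r)" by (auto simp: S_def)
    then have "smooth_on (x ` S) (\<lambda>z. b z * h z)"
      using h b_smooth by (intro smooth_on_mult[OF xS]) (auto intro: smooth_on_subset)
    then have "smooth_on (x ` S) (ext h \<circ> inv_x)"
      by (rule smooth_on_cong[OF xS, rotated]) (use S(2) chart(5) in \<open>auto simp: ext_def\<close>)
    then show ?thesis using S compat by blast
  next
    case False
    define K where "K = inv_x ` cball a (2 * r)"
    have K: "closed K" using closed_inv by (simp add: K_def)
    have pK: "p \<notin> K"
    proof
      assume "p \<in> K"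
      then obtain z where z: "dist a z \<le> 2 * r" "p = inv_x z" by (auto simp: K_def)
      then have "z \<in> cball a (3 * r)" using r by simp
      then have "z \<in> x ` V" using sub by blast
      then have "p \<in> V" "x p = z" using chart(6,7) z by auto
      then show False using False z r by simp
    qed
    obtain W z where W: "(W, z) \<in> A" "p \<in> W" using ex_chart by blast
    note c = atlas_is_chart[OF W(1)]
    define S where "S = W - K"
    have S: "open S" "S \<subseteq> W" "p \<in> S" using W pK K chartD(1)[OF c] by (auto simp: S_def open_Diff)
    have zS: "open (z ` S)" using chart_open_image[OF c S(1,2)] .
    have 0: "ext h q = 0" if "q \<notin> K" for q
    proof (cases "q \<in> V")
      case True
      have "\<not> dist a (x q) \<le> 2 * r"
      proof
        assume "dist a (x q) \<le> 2 * r"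
        then have "inv_x (x q) \<in> K" by (auto simp: K_def)
        then show False using that chart(5)[OF True] by simp
      qed
      then show ?thesis using b_0[of "x q"] by (simp add: ext_def)
    qed (simp add: ext_def)
    have "smooth_on (z ` S) (\<lambda>_. 0 :: real)" by (rule smooth_on_const[OF zS])
    then have "smooth_on (z ` S) (ext h \<circ> inv_into W z)"
      by (rule smooth_on_cong[OF zS, rotated]) (use chartD(5)[OF c] 0 in \<open>auto simp: S_def\<close>)
    then show ?thesis using S chart_compatible[OF W(1)] by blast
  qed
qed

definition rep :: "('a \<Rightarrow> real) \<Rightarrow> real ^ 'n \<Rightarrow> real" where "rep f = f \<circ> inv_x"

lemma rep_x: "q \<in> V \<Longrightarrow> rep f (x q) = f q"
  by (simp add: rep_def chart(5))

lemma smooth_rep: "smooth_map A f \<Longrightarrow> smooth_on (ball a (3 * r)) (rep f)"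
  unfolding rep_def by (rule smooth_on_subset[OF smooth_map_compatible[OF _ compat] ball_sub(1)])

definition d :: "'n \<Rightarrow> ('a \<Rightarrow> real) \<Rightarrow> 'a \<Rightarrow> real" where
  "d i f q = frechet_derivative (rep f) (at (x q)) (axis i 1)"

text \<open>The coordinate vector field times the bump function. The value 0 on nonsmooth functions
  is the normalization made in \<open>tangent_space\<close>.\<close>

definition E :: "'n \<Rightarrow> 'a vfield" where
  "E i q = (\<lambda>f. if smooth_map A f \<and> q \<in> V then b (x q) * d i f q else 0)"

definition xt :: "'n \<Rightarrow> 'a \<Rightarrow> real" where "xt i = ext (\<lambda>z. z $ i)"

lemma smooth_xt: "smooth_map A (xt i)"
  unfolding xt_def by (intro smooth_ext smooth_on_bounded_linear[OF _ bounded_linear_vec_nth] smooth_on_id) auto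

lemma E_U: "q \<in> U \<Longrightarrow> smooth_map A f \<Longrightarrow> E i q f = d i f q"
  using b_1[of "x q"] by (auto simp: E_def U_def)

lemma E_ext: "smooth_map A f \<Longrightarrow> (\<lambda>q. E i q f) = ext (\<lambda>z. frechet_derivative (rep f) (at z) (axis i 1))"
  by (auto simp: E_def ext_def d_def fun_eq_iff)

lemma rep_has_derivative:
  assumes "smooth_map A f" "q \<in> V"
  shows "(rep f has_derivative frechet_derivative (rep f) (at (x q))) (at (x q))"
  unfolding rep_def
  by (rule smooth_on_has_derivative[OF smooth_map_compatible[OF assms(1) compat]]) (use assms in auto)

lemma d_rules:
  assumes f: "smooth_map A f" "smooth_map A h" and q: "q \<in> V"
  shows "d i (\<lambda>q. f q + h q) q = d i f q + d i h q"
    "d i (\<lambda>q. f q * h q) q = f q * d i h q + h q * d i f q"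
proof -
  note 1 = rep_has_derivative[OF f(1) q] and 2 = rep_has_derivative[OF f(2) q]
  have "rep (\<lambda>q. f q + h q) = (\<lambda>z. rep f z + rep h z)" by (simp add: rep_def o_def)
  then show "d i (\<lambda>q. f q + h q) q = d i f q + d i h q"
    using fun_cong[OF frechet_derivative_at[OF has_derivative_add[OF 1 2]], of "axis i 1"] by (simp add: d_def)
  have "rep (\<lambda>q. f q * h q) = (\<lambda>z. rep f z * rep h z)" by (simp add: rep_def o_def)
  then show "d i (\<lambda>q. f q * h q) q = f q * d i h q + h q * d i f q"
    using fun_cong[OF frechet_derivative_at[OF has_derivative_mult[OF 1 2]], of "axis i 1"] q
    by (simp add: d_def rep_x mult.commute)
qed

lemma d_const: "d i (\<lambda>_. c) q = 0"
proof -
  have "rep (\<lambda>_. c) = (\<lambda>_. c)" by (simp add: rep_def o_def)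
  then show ?thesis by (simp add: d_def)
qed

lemma E_vf: "E i \<in> vector_fields A"
proof -
  have "E i q \<in> tangent_space A q" for q
  proof (cases "q \<in> V")
    case True
    show ?thesis
      using d_rules[OF _ _ True] d_rules(2)[OF smooth_map_const _ True]
      by (auto simp: tangent_space_def E_def plus_fun_def times_fun_def fscale_def algebra_simps
        smooth_map_add smooth_map_mult smooth_map_const True d_const)
  qed (simp add: tangent_space_def E_def)
  moreover have "smooth_map A (\<lambda>q. E i q f)" if "smooth_map A f" for f
    unfolding E_ext[OF that] by (intro smooth_ext smooth_on_derivative smooth_rep that)
  ultimately show ?thesis by (simp add: vector_fields_def)
qed

lemma E_tangent: "E i q \<in> tangent_space A q"
  using vfD(1)[OF E_vf] .

lemma d_local:
  assumes "open S" "q \<in> S" "S \<subseteq> U" "\<And>s. s \<in> S \<Longrightarrow> f s = h s" "smooth_map A f"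
  shows "d i f q = d i h q"
proof -
  have "(rep h has_derivative frechet_derivative (rep f) (at (x q))) (at (x q))"
    by (rule has_derivative_transform_within_open[OF rep_has_derivative[OF assms(5)] x_image_open[OF assms(1,3)]])
      (use assms U_V in \<open>auto simp: rep_x subset_iff\<close>)
  then show ?thesis using frechet_derivative_at by (fastforce simp: d_def)
qed

lemma d_xt:
  assumes q: "q \<in> U"
  shows "d i (xt j) q = (if i = j then 1 else 0)"
proof -
  have "((\<lambda>z. z $ j) has_derivative (\<lambda>z. z $ j)) (at (x q))"
    by (rule bounded_linear.has_derivative[OF bounded_linear_vec_nth has_derivative_ident])
  then have "(rep (xt j) has_derivative (\<lambda>z. z $ j)) (at (x q))"
    by (rule has_derivative_transform_within_open[of _ _ _ _ "ball a r"])
      (use x_U(1)[OF q] inv_ball in \<open>auto simp: rep_def xt_def ext_U\<close>)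
  then show ?thesis using frechet_derivative_at[of "rep (xt j)" "\<lambda>z. z $ j"]
    by (auto simp: d_def axis_def dest!: fun_cong[where x="axis i 1"])
qed

end

section \<open>Locality of derivations and expansion in coordinates\<close>

context smooth_mfd
begin

lemma ex_coord:
  assumes c: "compatible_chart A (V, x)" and p: "p \<in> V" and O: "open S" "p \<in> S"
  shows "\<exists>r b. coord A V x (x p) r b \<and> inv_into V x ` cball (x p) (3 * r) \<subseteq> S"
proof -
  note isch = compatible_is_chart[OF c]
  have "open (x ` (V \<inter> S))"
    using chart_open_image[OF isch, of "V \<inter> S"] chartD(1)[OF isch] O(1) by auto
  then have "\<exists>e>0. cball (x p) e \<subseteq> x ` (V \<inter> S)"
    using p O(2) unfolding open_contains_cball by blast
  then obtain e where e: "e > 0" "cball (x p) e \<subseteq> x ` (V \<inter> S)" by blast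
  define r where "r = e / 3"
  have r: "0 < r" "3 * r = e" using e(1) by (auto simp: r_def)
  obtain b where b: "smooth_on UNIV b" "\<forall>y. dist (x p) y \<le> r \<longrightarrow> b y = (1::real)"
    "\<forall>y. 2 * r \<le> dist (x p) y \<longrightarrow> b y = 0"
    using smooth_bump[OF r(1), of "x p"] by (elim exE conjE)
  have "cball (x p) (3 * r) \<subseteq> x ` V" using e(2) r(2) by auto
  then have "coord A V x (x p) r b"
    by (intro coord.intro coord_axioms.intro smooth_mfd_axioms c r(1) b(1)) (use b in auto)
  moreover have "inv_into V x ` cball (x p) (3 * r) \<subseteq> S"
    using e(2) chartD(5)[OF isch] by (auto simp: r_def)
  ultimately show ?thesis by blast
qed

lemma ex_local_bump:
  assumes O: "open S" "p \<in> S"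
  shows "\<exists>h T. smooth_map A h \<and> open T \<and> p \<in> T \<and> T \<subseteq> S \<and> (\<forall>q\<in>T. h q = 1) \<and> (\<forall>q. q \<notin> S \<longrightarrow> h q = (0::real))"
proof -
  obtain V x where V: "(V, x) \<in> A" "p \<in> V" using ex_chart by blast
  obtain r b where c: "coord A V x (x p) r b" and s: "inv_into V x ` cball (x p) (3 * r) \<subseteq> S"
    using ex_coord[OF chart_compatible[OF V(1)] V(2) O] by blast
  interpret coord A V x "x p" r b by (rule c)
  have 0: "ext (\<lambda>_. 1) q = 0" if "q \<notin> S" for q
  proof (cases "q \<in> V")
    case True
    have "\<not> dist (x p) (x q) \<le> 3 * r"
    proof
      assume "dist (x p) (x q) \<le> 3 * r"
      then have "inv_x (x q) \<in> S" using s by auto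
      then show False using that chart(5)[OF True] by simp
    qed
    then show ?thesis using b_0[of "x q"] r by (simp add: ext_def)
  qed (simp add: ext_def)
  have "U \<subseteq> S" unfolding U_eq using s r by (auto simp: subset_iff)
  moreover have "smooth_map A (ext (\<lambda>_. 1))" by (intro smooth_ext smooth_on_const) auto
  moreover have "p \<in> U" using V(2) r by (simp add: U_def)
  ultimately show ?thesis using open_U 0 by (intro exI[of _ "ext (\<lambda>_. 1)"] exI[of _ U]) (auto simp: ext_U)
qed

text \<open>The difference times a bump function that vanishes outside \<open>S\<close> is
  identically 0. At \<open>p\<close> the bump is 1 and the difference 0, so the product rule leaves
  the derivative of the difference.\<close>

lemma tangent_local:
  assumes v: "v \<in> tangent_space A p" and f: "smooth_map A f" "smooth_map A h"
    and O: "open S" "p \<in> S" "\<And>q. q \<in> S \<Longrightarrow> f q = h q"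
  shows "v f = v h"
proof -
  obtain \<eta> T where \<eta>: "smooth_map A \<eta>" "p \<in> T" "\<forall>q\<in>T. \<eta> q = 1" "\<forall>q. q \<notin> S \<longrightarrow> \<eta> q = (0::real)"
    using ex_local_bump[OF O(1,2)] by blast
  have s: "smooth_map A (\<lambda>q. f q - h q)" by (rule smooth_map_diff[OF f])
  have "(\<lambda>q. \<eta> q * (f q - h q)) = (\<lambda>_. 0)" using \<eta>(4) O(3) by (force simp: fun_eq_iff)
  then have "0 = v (\<lambda>q. \<eta> q * (f q - h q))" using tangent_const[OF v, of 0] by simp
  also have "\<dots> = v (\<lambda>q. f q - h q)"
    using tangentD(3)[OF v \<eta>(1) s] \<eta>(2,3) O(2,3) by simp
  also have "\<dots> = v f - v h" by (rule tangent_diff[OF v f])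
  finally show ?thesis by simp
qed

end

context coord
begin

text \<open>Hadamard's lemma at \<open>x q\<close>: the derivation kills the constant, and in each
  product the factor that vanishes at \<open>q\<close> leaves only its own derivative times a
  partial derivative of \<open>f\<close>.\<close>

lemma tangent_expand:
  assumes v: "v \<in> tangent_space A q" and q: "q \<in> U" and f: "smooth_map A f"
  shows "v f = (\<Sum>i\<in>UNIV. v (xt i) * d i f q)"
proof -
  have xq: "x q \<in> ball a (3 * r)" using x_U(1)[OF q] ball_sub(3) by blast
  obtain h where h: "\<And>i. smooth_on (ball a (3 * r)) (h i)"
    "\<And>i. h i (x q) = frechet_derivative (rep f) (at (x q)) (axis i 1)"
    "\<And>y. y \<in> ball a (3 * r) \<Longrightarrow> rep f y = rep f (x q) + (\<Sum>i\<in>UNIV. (y $ i - x q $ i) * h i y)"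
    using hadamard[OF open_ball convex_ball xq smooth_rep[OF f]] by blast
  have sh: "smooth_map A (ext (h i))" for i by (rule smooth_ext[OF h(1)])
  have sx: "smooth_map A (\<lambda>s. xt i s - x q $ i)" for i
    by (rule smooth_map_diff[OF smooth_xt smooth_map_const])
  have "v f = v (\<lambda>s. f q + (\<Sum>i\<in>UNIV. (xt i s - x q $ i) * ext (h i) s))"
  proof (rule tangent_local[OF v f _ open_U q])
    show "smooth_map A (\<lambda>s. f q + (\<Sum>i\<in>UNIV. (xt i s - x q $ i) * ext (h i) s))"
      by (intro smooth_map_add smooth_map_const smooth_map_sum smooth_map_mult sx sh)
    fix s assume s: "s \<in> U"
    then have "x s \<in> ball a (3 * r)" using x_U(1) ball_sub(3) by blast
    from h(3)[OF this] show "f s = f q + (\<Sum>i\<in>UNIV. (xt i s - x q $ i) * ext (h i) s)"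
      using s q by (simp add: rep_x U_V xt_def ext_U)
  qed
  also have "\<dots> = (\<Sum>i\<in>UNIV. v (\<lambda>s. (xt i s - x q $ i) * ext (h i) s))"
    using tangentD(1)[OF v smooth_map_const, of "\<lambda>s. \<Sum>i\<in>UNIV. (xt i s - x q $ i) * ext (h i) s" "f q"]
      tangent_const[OF v] tangent_sum[OF v finite, of UNIV "\<lambda>i s. (xt i s - x q $ i) * ext (h i) s"]
    by (simp add: smooth_map_sum smooth_map_mult sx sh)
  also have "\<dots> = (\<Sum>i\<in>UNIV. v (xt i) * d i f q)"
  proof (rule sum.cong[OF refl])
    fix i
    have "v (\<lambda>s. (xt i s - x q $ i) * ext (h i) s) =
        (xt i q - x q $ i) * v (ext (h i)) + ext (h i) q * v (\<lambda>s. xt i s - x q $ i)"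
      by (rule tangentD(3)[OF v sx sh])
    also have "\<dots> = d i f q * v (xt i)"
      using q tangent_diff[OF v smooth_xt smooth_map_const, of i "x q $ i"] tangent_const[OF v]
      by (simp add: xt_def ext_U h(2) d_def)
    finally show "v (\<lambda>s. (xt i s - x q $ i) * ext (h i) s) = v (xt i) * d i f q" by simp
  qed
  finally show ?thesis .
qed

lemma tangent_eq_sum:
  assumes v: "v \<in> tangent_space A q" and q: "q \<in> U"
  shows "v = (\<Sum>i\<in>UNIV. v (xt i) *\<^sub>f E i q)"
proof
  fix f
  have s: "(\<Sum>i\<in>I. v (xt i) *\<^sub>f E i q) f = (\<Sum>i\<in>I. v (xt i) * E i q f)" for I
    by (induction I rule: infinite_finite_induct) (auto simp: fscale_def)
  show "v f = (\<Sum>i\<in>UNIV. v (xt i) *\<^sub>f E i q) f"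
  proof (cases "smooth_map A f")
    case True
    then show ?thesis using tangent_expand[OF v q True] by (simp add: s E_U[OF q])
  next
    case False
    then have "E i q f = 0" for i by (simp add: E_def)
    then show ?thesis using tangent_nonsmooth[OF v False] by (simp add: s)
  qed
qed

text \<open>Multiplying by a bump function turns the local expansion of a vector field in the coordinate frame into
  a global identity, to which a \<open>C\<^sup>\<infinity>\<close>-linear operator can be applied.\<close>

lemma tensorial:
  fixes T :: "'a vfield \<Rightarrow> real"
  assumes add: "\<And>X Y. X \<in> vector_fields A \<Longrightarrow> Y \<in> vector_fields A \<Longrightarrow> T (X + Y) = T X + T Y"
    and scale: "\<And>h X. X \<in> vector_fields A \<Longrightarrow> smooth_map A h \<Longrightarrow> T (vf_scale h X) = h q * T X"
    and X: "X \<in> vector_fields A" and q: "q \<in> U"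
  shows "T X = (\<Sum>i\<in>UNIV. X q (xt i) * T (E i))"
proof -
  obtain \<eta> S where \<eta>: "smooth_map A \<eta>" "q \<in> S" "\<forall>s\<in>S. \<eta> s = 1" "\<forall>s. s \<notin> U \<longrightarrow> \<eta> s = (0::real)"
    using ex_local_bump[OF open_U q] by blast
  define c where "c i s = \<eta> s * X s (xt i)" for i s
  have c: "smooth_map A (c i)" for i unfolding c_def by (intro smooth_map_mult \<eta> vfD(2)[OF X] smooth_xt)
  have s: "(\<Sum>i\<in>I. vf_scale (c i) (E i)) p = (\<Sum>i\<in>I. c i p *\<^sub>f E i p)" for I p
    by (induction I rule: infinite_finite_induct) (auto simp: vf_scale_def)
  have s2: "(\<Sum>i\<in>I. u i *\<^sub>f w i) f = (\<Sum>i\<in>I. u i * w i f)" for I and u :: "'n \<Rightarrow> real" and w :: "'n \<Rightarrow> ('a \<Rightarrow> real) \<Rightarrow> real" and f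
    by (induction I rule: infinite_finite_induct) (auto simp: fscale_def)
  have "vf_scale \<eta> X = (\<Sum>i\<in>UNIV. vf_scale (c i) (E i))"
  proof (intro ext)
    fix p f
    show "vf_scale \<eta> X p f = (\<Sum>i\<in>UNIV. vf_scale (c i) (E i)) p f"
    proof (cases "p \<in> U")
      case True
      have "X p f = (\<Sum>i\<in>UNIV. X p (xt i) * E i p f)"
        by (subst tangent_eq_sum[OF vfD(1)[OF X] True]) (simp add: s2)
      moreover have "(\<Sum>i\<in>UNIV. vf_scale (c i) (E i)) p f = (\<Sum>i\<in>UNIV. c i p * E i p f)"
        by (simp only: s s2)
      ultimately show ?thesis by (simp add: vf_scale_def fscale_def c_def sum_distrib_left mult.assoc)
    next
      case False
      moreover have "(\<Sum>i\<in>UNIV. vf_scale (c i) (E i)) p f = (\<Sum>i\<in>UNIV. c i p * E i p f)"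
        by (simp only: s s2)
      ultimately show ?thesis using \<eta>(4) by (simp add: vf_scale_def fscale_def c_def)
    qed
  qed
  moreover have "T (\<Sum>i\<in>I. vf_scale (c i) (E i)) = (\<Sum>i\<in>I. c i q * T (E i))" if "finite I" for I
    using that
  proof (induction I)
    case empty
    have "T 0 = 0" using add[OF vf_zero vf_zero] by simp
    then show ?case by (simp only: sum.empty)
  next
    case (insert i I)
    have "T (vf_scale (c i) (E i) + (\<Sum>i\<in>I. vf_scale (c i) (E i))) =
        T (vf_scale (c i) (E i)) + T (\<Sum>i\<in>I. vf_scale (c i) (E i))"
      by (intro add vf_scale[OF E_vf c] vf_sum)
    then show ?case
      by (simp only: sum.insert[OF insert.hyps] scale[OF E_vf c] insert.IH)
  qed
  ultimately have "T (vf_scale \<eta> X) = (\<Sum>i\<in>UNIV. c i q * T (E i))" by simp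
  then show ?thesis using scale[OF X \<eta>(1)] \<eta>(2,3) by (simp add: c_def)
qed

lemma ex_vf:
  assumes v: "v \<in> tangent_space A q" and q: "q \<in> U"
  shows "\<exists>X\<in>vector_fields A. X q = v"
proof
  show "(\<Sum>i\<in>UNIV. vf_scale (\<lambda>_. v (xt i)) (E i)) \<in> vector_fields A"
    by (intro vf_sum vf_scale E_vf smooth_map_const)
  have s: "(\<Sum>i\<in>I. vf_scale (\<lambda>_. v (xt i)) (E i)) q = (\<Sum>i\<in>I. v (xt i) *\<^sub>f E i q)" for I
    by (induction I rule: infinite_finite_induct) (auto simp: vf_scale_def)
  show "(\<Sum>i\<in>UNIV. vf_scale (\<lambda>_. v (xt i)) (E i)) q = v"
    using tangent_eq_sum[OF v q] s by simp
qed

end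

section \<open>Local solutions for systems given by bilinear coefficients\<close>

lemma bilinear_bounded_linear:
  fixes f :: "'v::euclidean_space \<Rightarrow> 'e::euclidean_space \<Rightarrow> 'w::real_normed_vector"
  assumes "bilinear f"
  shows "bounded_linear (f v)" "bounded_linear (\<lambda>v. Blinfun (f v))"
    "blinfun_apply (blinfun_apply (Blinfun (\<lambda>v. Blinfun (f v))) v) y = f v y"
proof -
  show 1: "bounded_linear (f v)" for v
    using assms by (simp add: bilinear_def linear_conv_bounded_linear)
  have l: "linear (\<lambda>v. f v y)" for y using assms by (simp add: bilinear_def)
  show 2: "bounded_linear (\<lambda>v. Blinfun (f v))"
    unfolding linear_conv_bounded_linear[symmetric]
    by (rule linearI; rule blinfun_eqI; simp only: blinfun.add_left blinfun.scaleR_left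
      bounded_linear_Blinfun_apply[OF 1] linear_add[OF l] linear_scale[OF l])
  show "blinfun_apply (blinfun_apply (Blinfun (\<lambda>v. Blinfun (f v))) v) y = f v y"
    by (simp only: bounded_linear_Blinfun_apply[OF 2] bounded_linear_Blinfun_apply[OF 1])
qed

lemma bilinear_local_bound:
  fixes a :: "'v::euclidean_space \<Rightarrow> 'v \<Rightarrow> 'e::euclidean_space \<Rightarrow> 'e"
  assumes B: "open B" "p \<in> B" and bil: "\<And>z. bilinear (a z)"
    and cont: "\<And>v y. continuous_on B (\<lambda>z. a z v y)"
  shows "\<exists>e C. 0 < e \<and> 0 < C \<and> ball p e \<subseteq> B \<and>
    (\<forall>z\<in>ball p e. norm (Blinfun (\<lambda>v. Blinfun (a z v))) \<le> C)"
proof -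
  define L where "L z = Blinfun (\<lambda>v. Blinfun (a z v))" for z
  have "continuous_on B L"
    by (rule continuous_on_blinfun_componentwise, rule continuous_on_blinfun_componentwise)
      (simp add: L_def bilinear_bounded_linear(3)[OF bil] cont)
  then have "continuous (at p) L" using B by (simp add: continuous_on_eq_continuous_at)
  then have "eventually (\<lambda>z. dist (L z) (L p) < 1) (at p)"
    by (auto simp: continuous_at tendsto_iff)
  then obtain e1 where e1: "e1 > 0" "\<And>z. z \<noteq> p \<Longrightarrow> dist z p < e1 \<Longrightarrow> dist (L z) (L p) < 1"
    unfolding eventually_at by auto
  obtain e2 where e2: "e2 > 0" "ball p e2 \<subseteq> B" using B openE by blast
  have "norm (L z) \<le> norm (L p) + 1" if "z \<in> ball p (min e1 e2)" for z
  proof (cases "z = p")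
    case False
    moreover have "dist z p < e1" using that by (simp add: dist_commute)
    ultimately have "dist (L z) (L p) < 1" by (rule e1(2))
    then have "norm (L z - L p) < 1" by (simp add: dist_norm)
    then show ?thesis using norm_triangle_sub[of "L z" "L p"] by simp
  qed simp
  then show ?thesis using e1(1) e2
    by (intro exI[of _ "min e1 e2"] exI[of _ "norm (L p) + 1"]) (auto simp: L_def add_nonneg_pos)
qed

text \<open>In finite dimension, derivatives and continuity of the single values of \<open>a\<close>
  carry over to the operator norm. One radius serves all base points and all initial values; this
  uniformity is what later gives trivial neighbourhoods.\<close>

theorem frobenius_components:
  fixes a :: "'v::euclidean_space \<Rightarrow> 'v \<Rightarrow> 'e::euclidean_space \<Rightarrow> 'e"
  assumes B: "open B" "p \<in> B" and bil: "\<And>z. bilinear (a z)" and dbil: "\<And>z w. bilinear (da z w)"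
    and der: "\<And>z v y. z \<in> B \<Longrightarrow> ((\<lambda>z. a z v y) has_derivative (\<lambda>w. da z w v y)) (at z)"
    and cont: "\<And>w v y. continuous_on B (\<lambda>z. da z w v y)"
    and flat: "\<And>z v w y. z \<in> B \<Longrightarrow> da z w v y + a z v (a z w y) = da z v w y + a z w (a z v y)"
  shows "\<exists>e>0. ball p e \<subseteq> B \<and> (\<forall>q\<in>ball p e. \<forall>y0. \<exists>y. y q = y0 \<and>
    (\<forall>z\<in>ball p e. (y has_derivative (\<lambda>v. a z v (y z))) (at z)))"
proof -
  have "continuous_on B (\<lambda>z. a z v y)" for v y
    using der by (meson has_derivative_continuous_on has_derivative_at_withinI)
  then obtain e0 C where e0: "0 < e0" "0 < C" "ball p e0 \<subseteq> B"
    and C: "\<And>z. z \<in> ball p e0 \<Longrightarrow> norm (Blinfun (\<lambda>v. Blinfun (a z v))) \<le> C"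
    using bilinear_local_bound[OF B, of a, OF bil] by blast
  \<comment> \<open>The base point \<open>q\<close> may lie anywhere in the ball, so distances to it
    are bounded by 2 * e. The choice gives C * (2 * e) \<le> 1/4, as \<open>linear_frobenius\<close>
    requires.\<close>
  define e where "e = min e0 (1 / (8 * C))"
  have e: "0 < e" "ball p e \<subseteq> ball p e0" using e0 by (auto simp: e_def)
  have "C * e \<le> C * (1 / (8 * C))" using e0 by (intro mult_left_mono) (auto simp: e_def)
  then have Ce: "C * (2 * e) \<le> 1/4" using e0 by simp
  define L where "L z = Blinfun (\<lambda>v. Blinfun (a z v))" for z
  define D where "D z = Blinfun (\<lambda>w. Blinfun (\<lambda>v. Blinfun (da z w v)))" for z
  have L: "L z v y = a z v y" for z v y by (simp add: L_def bilinear_bounded_linear(3)[OF bil])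
  have D: "D z w v y = da z w v y" if z: "z \<in> B" for z w v y
  proof -
    have lin: "linear (\<lambda>w. da z w v y)" for v y using der[OF z] has_derivative_linear by blast
    have "linear (\<lambda>w. Blinfun (\<lambda>v. Blinfun (da z w v)))"
      by (rule linearI; rule blinfun_eqI; rule blinfun_eqI; simp only: blinfun.add_left blinfun.scaleR_left
        bilinear_bounded_linear(3)[OF dbil] linear_add[OF lin] linear_scale[OF lin])
    then have 1: "bounded_linear (\<lambda>w. Blinfun (\<lambda>v. Blinfun (da z w v)))"
      by (simp add: linear_conv_bounded_linear)
    show ?thesis
      by (simp only: D_def bounded_linear_Blinfun_apply[OF 1] bilinear_bounded_linear(3)[OF dbil])
  qed
  have eB: "ball p e \<subseteq> B" using e e0 by blast
  have "\<exists>y. y q = y0 \<and> (\<forall>z\<in>ball p e. (y has_derivative (\<lambda>v. L z v (y z))) (at z))"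
    if q: "q \<in> ball p e" for q y0
  proof (rule linear_frobenius[OF open_ball convex_ball q, of L D C "2 * e"])
    fix z assume z: "z \<in> ball p e"
    then have zB: "z \<in> B" using eB by blast
    show "(L has_derivative D z) (at z)"
      by (rule has_derivative_blinfun_componentwise, rule has_derivative_blinfun_componentwise)
        (simp only: L D[OF zB] der[OF zB])
    show "norm (L z) \<le> C" using C e(2) z unfolding L_def by blast
    have "norm (z - q) \<le> dist p z + dist p q" unfolding dist_norm[symmetric] by (rule dist_triangle3)
    then show "norm (z - q) \<le> 2 * e" using z q by simp
    show "D z w v y + L z v (L z w y) = D z v w y + L z w (L z v y)" for v w y
      using flat[OF zB] by (simp add: L D[OF zB])
  next
    show "continuous_on (ball p e) D"
    proof (rule continuous_on_blinfun_componentwise, rule continuous_on_blinfun_componentwise,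
        rule continuous_on_blinfun_componentwise)
      fix i j :: 'v and k :: 'e
      have "continuous_on (ball p e) (\<lambda>z. da z i j k)" by (rule continuous_on_subset[OF cont eB])
      then show "continuous_on (ball p e) (\<lambda>z. D z i j k)"
        by (rule continuous_on_cong[THEN iffD1, OF refl, rotated]) (use D eB in auto)
    qed
  qed (rule Ce)
  then show ?thesis using e(1) eB by (intro exI[of _ e]) (simp add: L)
qed

text \<open>Arbitrary convex subsets of one ball are allowed because two germs solve the system only
  on a possibly smaller ball about the point where they are compared.\<close>

theorem linear_ode_unique:
  fixes a :: "'v::euclidean_space \<Rightarrow> 'v \<Rightarrow> 'e::euclidean_space \<Rightarrow> 'e"
  assumes B: "open B" "p \<in> B" and bil: "\<And>z. bilinear (a z)"
    and cont: "\<And>v y. continuous_on B (\<lambda>z. a z v y)"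
  shows "\<exists>e>0. ball p e \<subseteq> B \<and> (\<forall>S y q. convex S \<longrightarrow> S \<subseteq> ball p e \<longrightarrow> q \<in> S \<longrightarrow> y q = 0 \<longrightarrow>
    (\<forall>z\<in>S. (y has_derivative (\<lambda>v. a z v (y z))) (at z)) \<longrightarrow> (\<forall>z\<in>S. y z = 0))"
proof -
  obtain e0 C where e0: "0 < e0" "0 < C" "ball p e0 \<subseteq> B"
    and C: "\<And>z. z \<in> ball p e0 \<Longrightarrow> norm (Blinfun (\<lambda>v. Blinfun (a z v))) \<le> C"
    using bilinear_local_bound[OF B, of a, OF bil cont] by blast
  \<comment> \<open>As for existence, with the threshold 1/2 of
    \<open>linear_ode_zero\<close>.\<close>
  define e where "e = min e0 (1 / (4 * C))"
  have e: "0 < e" "ball p e \<subseteq> ball p e0" using e0 by (auto simp: e_def)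
  have "C * e \<le> C * (1 / (4 * C))" using e0 by (intro mult_left_mono) (auto simp: e_def)
  then have Ce: "C * (2 * e) \<le> 1/2" using e0 by simp
  have bound: "norm (a z v y) \<le> C * norm y * norm v" if z: "z \<in> ball p e" for z v y
  proof -
    define L where "L = Blinfun (\<lambda>v. Blinfun (a z v))"
    have "norm (L v y) \<le> norm (L v) * norm y" by (rule norm_blinfun)
    also have "\<dots> \<le> (norm L * norm v) * norm y" by (intro mult_right_mono norm_blinfun) auto
    also have "\<dots> \<le> (C * norm v) * norm y"
      using C e(2) z by (intro mult_right_mono) (auto simp: L_def)
    finally show ?thesis by (simp add: L_def bilinear_bounded_linear(3)[OF bil] mult_ac)
  qed
  have "y z = 0" if S: "convex S" "S \<subseteq> ball p e" "q \<in> S" and y: "y q = 0"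
      "\<forall>z\<in>S. (y has_derivative (\<lambda>v. a z v (y z))) (at z)" and z: "z \<in> S" for S y q z
  proof (rule linear_ode_zero[where y=y and B=S and q=q and C=C and y'="\<lambda>z v. a z v (y z)"])
    show "convex S" "q \<in> S" "z \<in> S" "y q = 0" using S z y(1) by auto
  next
    fix w assume w: "w \<in> S"
    show "(y has_derivative (\<lambda>v. a w v (y w))) (at w)" using y(2) w by blast
    show "norm (a w v (y w)) \<le> C * norm (y w) * norm v" for v using bound w S(2) by blast
    have "dist w q \<le> dist p w + dist p q" by (rule dist_triangle3)
    moreover have "dist p w < e" "dist p q < e" using w S by auto
    ultimately have "norm (w - q) \<le> 2 * e" by (simp add: dist_norm)
    then have "C * norm (w - q) \<le> C * (2 * e)" using e0 by (intro mult_left_mono) auto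
    then show "C * norm (w - q) \<le> 1/2" using Ce by simp
  qed (use e0 in auto)
  then show ?thesis using e e0 by (intro exI[of _ e]) blast
qed

section \<open>Flat connections and Codazzi metrics\<close>

text \<open>The affine part of the geometry. \<open>codazzi\<close> says that \<nabla>g is symmetric
  in its first two arguments, which is the integrability condition of \<nabla> df = c g.\<close>

locale hessian_mfd = smooth_mfd A
  for A :: "('a::{t2_space, second_countable_topology}, 'n::finite) chart set" +
  fixes nab :: "'a conn" and g :: "'a \<Rightarrow> 'a tangent \<Rightarrow> 'a tangent \<Rightarrow> real"
  assumes conn: "connection A nab" and tf: "torsionfree A nab" and fl: "flat A nab"
    and gb: "bilinear_field A g"
    and g_sym: "\<And>p v w. v \<in> tangent_space A p \<Longrightarrow> w \<in> tangent_space A p \<Longrightarrow> g p v w = g p w v"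
    and codazzi: "\<And>X Y Z p. X \<in> vector_fields A \<Longrightarrow> Y \<in> vector_fields A \<Longrightarrow> Z \<in> vector_fields A \<Longrightarrow>
      X p (\<lambda>q. g q (Y q) (Z q)) - g p (nab X Y p) (Z p) - g p (Y p) (nab X Z p) =
      Y p (\<lambda>q. g q (X q) (Z q)) - g p (nab Y X p) (Z p) - g p (X p) (nab Y Z p)"
begin

lemma nab_vf: "X \<in> vector_fields A \<Longrightarrow> Y \<in> vector_fields A \<Longrightarrow> nab X Y \<in> vector_fields A"
  using conn unfolding connection_def by blast

lemma nab_add:
  assumes "X \<in> vector_fields A" "Y \<in> vector_fields A" "Z \<in> vector_fields A"
  shows "nab (X + Y) Z = nab X Z + nab Y Z" "nab Z (X + Y) = nab Z X + nab Z Y"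
  using conn assms unfolding connection_def by blast+

lemma nab_scale:
  assumes "X \<in> vector_fields A" "Y \<in> vector_fields A" "smooth_map A h"
  shows "nab (vf_scale h X) Y = vf_scale h (nab X Y)"
    "nab X (vf_scale h Y) = vf_scale (\<lambda>p. X p h) Y + vf_scale h (nab X Y)"
  using conn assms unfolding connection_def by blast+

lemma g_smooth: "X \<in> vector_fields A \<Longrightarrow> Y \<in> vector_fields A \<Longrightarrow> smooth_map A (\<lambda>q. g q (X q) (Y q))"
  using gb unfolding bilinear_field_def by blast

lemma g_add:
  assumes "u \<in> tangent_space A p" "v \<in> tangent_space A p" "w \<in> tangent_space A p"
  shows "g p (u + v) w = g p u w + g p v w" "g p w (u + v) = g p w u + g p w v"
  using gb assms unfolding bilinear_field_def by blast+

lemma g_scale: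
  assumes "u \<in> tangent_space A p" "w \<in> tangent_space A p"
  shows "g p (c *\<^sub>f u) w = c * g p u w" "g p w (c *\<^sub>f u) = c * g p w u"
  using gb assms unfolding bilinear_field_def by blast+

text \<open>The defect of the equation \<nabla> df = c g. With \<open>c\<close> as a parameter,
  affine functions (c = 0) and potentials (c = 1) are treated together.\<close>

definition hess :: "('a \<Rightarrow> real) \<Rightarrow> real \<Rightarrow> 'a \<Rightarrow> 'a vfield \<Rightarrow> 'a vfield \<Rightarrow> real" where
  "hess f c q X Y = X q (\<lambda>s. Y s f) - nab X Y q f - c * g q (X q) (Y q)"

text \<open>The derivative of \<open>h\<close> from the product rule cancels against the Leibniz
  rule of \<open>nab\<close>. The defect is therefore a tensor and can be tested on a frame.\<close>

lemma hess_linear: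
  assumes f: "smooth_map A f" and X: "X \<in> vector_fields A" and Y: "Y \<in> vector_fields A"
    and Z: "Z \<in> vector_fields A" and h: "smooth_map A h"
  shows "hess f c q (X + Y) Z = hess f c q X Z + hess f c q Y Z"
    "hess f c q Z (X + Y) = hess f c q Z X + hess f c q Z Y"
    "hess f c q (vf_scale h X) Z = h q * hess f c q X Z"
    "hess f c q Z (vf_scale h X) = h q * hess f c q Z X"
proof -
  note t = vfD(1)[OF X, of q] vfD(1)[OF Y, of q] vfD(1)[OF Z, of q]
  show "hess f c q (X + Y) Z = hess f c q X Z + hess f c q Y Z"
    using t by (simp add: hess_def nab_add[OF X Y Z] g_add algebra_simps)
  have "Z q (\<lambda>s. X s f + Y s f) = Z q (\<lambda>s. X s f) + Z q (\<lambda>s. Y s f)"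
    by (rule tangentD(1)[OF t(3) vfD(2)[OF X f] vfD(2)[OF Y f]])
  then show "hess f c q Z (X + Y) = hess f c q Z X + hess f c q Z Y"
    using t by (simp add: hess_def nab_add[OF X Y Z] g_add algebra_simps)
  have s: "vf_scale k W q = k q *\<^sub>f W q" for k and W :: "'a vfield" and q by (simp add: vf_scale_def)
  have s': "(k *\<^sub>f v) f = k * v f" for k and v :: "'a tangent" and f by (simp add: fscale_def)
  show "hess f c q (vf_scale h X) Z = h q * hess f c q X Z"
    using t by (simp add: hess_def nab_scale[OF X Z h] s s' g_scale algebra_simps)
  have "Z q (\<lambda>s. h s * X s f) = h q * Z q (\<lambda>s. X s f) + X q f * Z q h"
    by (rule tangentD(3)[OF t(3) h vfD(2)[OF X f]])
  then show "hess f c q Z (vf_scale h X) = h q * hess f c q Z X"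
    using t by (simp add: hess_def nab_scale[OF Z X h] s s' g_scale algebra_simps)
qed

end

section \<open>Christoffel symbols, flatness and the Codazzi equation in coordinates\<close>

locale hessian_coord = hessian_mfd A nab g + coord A V x a r b
  for A :: "('a::{t2_space, second_countable_topology}, 'n::finite) chart set"
    and nab g V x a r b
begin

text \<open>The Christoffel symbols, encoded as global smooth functions that have this meaning on
  \<open>U\<close>.\<close>

definition G :: "'n \<Rightarrow> 'n \<Rightarrow> 'n \<Rightarrow> 'a \<Rightarrow> real" where "G i j k q = nab (E i) (E j) q (xt k)"

definition gg :: "'n \<Rightarrow> 'n \<Rightarrow> 'a \<Rightarrow> real" where "gg i j q = g q (E i q) (E j q)"

lemma smooth_G: "smooth_map A (G i j k)"
  unfolding G_def by (rule vfD(2)[OF nab_vf[OF E_vf E_vf] smooth_xt])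

lemma smooth_gg: "smooth_map A (gg i j)"
  unfolding gg_def by (rule g_smooth[OF E_vf E_vf])

lemma gg_sym: "gg i j q = gg j i q"
  unfolding gg_def by (rule g_sym[OF E_tangent E_tangent])

lemma nab_E: "q \<in> U \<Longrightarrow> smooth_map A f \<Longrightarrow> nab (E i) (E j) q f = (\<Sum>k\<in>UNIV. G i j k q * d k f q)"
  unfolding G_def by (rule tangent_expand[OF vfD(1)[OF nab_vf[OF E_vf E_vf]]])

lemma smooth_E: "smooth_map A f \<Longrightarrow> smooth_map A (\<lambda>s. E j s f)"
  by (rule vfD(2)[OF E_vf])

lemma hess_E: "q \<in> U \<Longrightarrow> smooth_map A f \<Longrightarrow> hess f c q (E i) (E j) =
    d i (\<lambda>s. E j s f) q - (\<Sum>k\<in>UNIV. G i j k q * d k f q) - c * gg i j q"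
  by (simp add: hess_def nab_E E_U smooth_E gg_def)

lemma hess_expand:
  assumes f: "smooth_map A f" and X: "X \<in> vector_fields A" and Y: "Y \<in> vector_fields A" and q: "q \<in> U"
  shows "hess f c q X Y = (\<Sum>i\<in>UNIV. X q (xt i) * hess f c q (E i) Y)"
    "hess f c q X Y = (\<Sum>j\<in>UNIV. Y q (xt j) * hess f c q X (E j))"
proof -
  show "hess f c q X Y = (\<Sum>i\<in>UNIV. X q (xt i) * hess f c q (E i) Y)"
    by (rule tensorial[where T="\<lambda>X. hess f c q X Y", OF _ _ X q])
      (simp_all add: hess_linear(1)[OF f _ _ Y smooth_map_const] hess_linear(3)[OF f _ Y Y])
  show "hess f c q X Y = (\<Sum>j\<in>UNIV. Y q (xt j) * hess f c q X (E j))"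
    by (rule tensorial[where T="\<lambda>Y. hess f c q X Y", OF _ _ Y q])
      (simp_all add: hess_linear(2)[OF f _ _ X smooth_map_const] hess_linear(4)[OF f _ X X])
qed

lemma hess_zero_iff:
  assumes f: "smooth_map A f" and q: "q \<in> U"
  shows "(\<forall>X\<in>vector_fields A. \<forall>Y\<in>vector_fields A. hess f c q X Y = 0) \<longleftrightarrow>
    (\<forall>i j. d i (\<lambda>s. E j s f) q = (\<Sum>k\<in>UNIV. G i j k q * d k f q) + c * gg i j q)"
proof
  assume "\<forall>X\<in>vector_fields A. \<forall>Y\<in>vector_fields A. hess f c q X Y = 0"
  then have "hess f c q (E i) (E j) = 0" for i j using E_vf by blast
  then show "\<forall>i j. d i (\<lambda>s. E j s f) q = (\<Sum>k\<in>UNIV. G i j k q * d k f q) + c * gg i j q"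
    by (simp add: hess_E[OF q f] algebra_simps)
next
  assume "\<forall>i j. d i (\<lambda>s. E j s f) q = (\<Sum>k\<in>UNIV. G i j k q * d k f q) + c * gg i j q"
  then have 0: "hess f c q (E i) (E j) = 0" for i j by (simp add: hess_E[OF q f])
  show "\<forall>X\<in>vector_fields A. \<forall>Y\<in>vector_fields A. hess f c q X Y = 0"
    by (simp add: hess_expand(1)[OF f _ _ q] hess_expand(2)[OF f E_vf _ q] 0)
qed

lemma d_ext_const:
  assumes "q \<in> U" "\<And>s. s \<in> U \<Longrightarrow> f s = c" "smooth_map A f"
  shows "d i f q = 0"
  using d_local[OF open_U assms(1) subset_refl assms(2,3), of i] d_const by simp

text \<open>On \<open>U\<close> the components of the frame fields are constant. Outside, the cutoff
  may produce a nonzero bracket, so the claim is made pointwise on \<open>U\<close>.\<close>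

lemma bracket_E:
  assumes q: "q \<in> U"
  shows "lie_bracket (E i) (E j) q (xt k) = 0"
proof -
  have "d i (\<lambda>s. E j s (xt k)) q = 0" for i j
    by (rule d_ext_const[OF q, of _ "if j = k then 1 else 0"])
      (simp_all add: E_U smooth_xt d_xt smooth_E)
  then show ?thesis using q by (simp add: lie_bracket_def E_U smooth_E smooth_xt)
qed

lemma bracket_vf: "lie_bracket (E i) (E j) \<in> vector_fields A"
proof -
  have "lie_bracket (E i) (E j) = nab (E i) (E j) - nab (E j) (E i)"
    using tf E_vf unfolding torsionfree_def by metis
  then show ?thesis using vf_diff[OF nab_vf[OF E_vf E_vf] nab_vf[OF E_vf E_vf]] by metis
qed

lemma G_sym:
  assumes q: "q \<in> U"
  shows "G i j k q = G j i k q"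
proof -
  have "(nab (E i) (E j) - nab (E j) (E i)) q (xt k) = lie_bracket (E i) (E j) q (xt k)"
    using tf E_vf unfolding torsionfree_def by metis
  then show ?thesis by (simp add: G_def bracket_E[OF q])
qed

text \<open>In the frame the Hessian of the coordinate function \<open>xt l\<close> is minus a
  Christoffel symbol. Tensoriality of \<open>hess\<close> in the last argument extends this to an
  arbitrary field \<open>Y\<close>.\<close>

lemma nab_E_vf:
  assumes q: "q \<in> U" and Y: "Y \<in> vector_fields A"
  shows "nab (E i) Y q (xt l) = d i (\<lambda>s. Y s (xt l)) q + (\<Sum>m\<in>UNIV. Y q (xt m) * G i m l q)"
proof -
  have z: "d i (\<lambda>s. E m s (xt l)) q = 0" for m
    by (rule d_ext_const[OF q, of _ "if m = l then 1 else 0"])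
      (simp_all add: E_U smooth_xt d_xt smooth_E)
  have "(\<Sum>k\<in>UNIV. G i m k q * d k (xt l) q) = G i m l q" for m
    using q by (simp add: d_xt if_distrib[of "(*) _"] cong: if_cong)
  then have "hess (xt l) 0 q (E i) (E m) = - G i m l q" for m
    by (simp add: hess_E[OF q smooth_xt] z)
  then have "hess (xt l) 0 q (E i) Y = (\<Sum>m\<in>UNIV. Y q (xt m) * - G i m l q)"
    using hess_expand(2)[OF smooth_xt E_vf Y q, of l 0 i] by simp
  then show ?thesis
    by (simp add: hess_def E_U[OF q vfD(2)[OF Y smooth_xt]] sum_negf)
qed

lemma nab_bracket:
  assumes q: "q \<in> U" and Z: "Z \<in> vector_fields A"
  shows "nab (lie_bracket (E i) (E j)) Z q f = 0"
proof -
  have "nab (lie_bracket (E i) (E j)) Z q f =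
    (\<Sum>m\<in>UNIV. lie_bracket (E i) (E j) q (xt m) * nab (E m) Z q f)"
    by (rule tensorial[where T="\<lambda>W. nab W Z q f", OF _ _ bracket_vf q])
      (simp_all only: nab_add(1)[OF _ _ Z] nab_scale(1)[OF _ Z] plus_fun_apply,
        simp_all add: vf_scale_def fscale_def)
  then show ?thesis by (simp add: bracket_E[OF q])
qed

text \<open>The curvature of three frame fields, read off in the coordinate \<open>xt l\<close>; the
  bracket term drops out because \<open>nab\<close> is tensorial in its first argument.\<close>

lemma G_flat:
  assumes q: "q \<in> U"
  shows "d i (G j k l) q + (\<Sum>m\<in>UNIV. G j k m q * G i m l q) =
    d j (G i k l) q + (\<Sum>m\<in>UNIV. G i k m q * G j m l q)"
proof -
  have "(nab (E i) (nab (E j) (E k)) - nab (E j) (nab (E i) (E k)) - nab (lie_bracket (E i) (E j)) (E k)) q (xt l) = 0"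
    using fl E_vf unfolding flat_def by simp
  then have "nab (E i) (nab (E j) (E k)) q (xt l) = nab (E j) (nab (E i) (E k)) q (xt l)"
    by (simp add: nab_bracket[OF q E_vf])
  then show ?thesis
    by (simp add: nab_E_vf[OF q nab_vf[OF E_vf E_vf]] G_def[symmetric] G_def[abs_def, symmetric])
qed

lemma g_expand:
  assumes q: "q \<in> U" and Y: "Y \<in> vector_fields A"
  shows "g q (E i q) (Y q) = (\<Sum>m\<in>UNIV. Y q (xt m) * gg i m q)"
  unfolding gg_def
  by (rule tensorial[where T="\<lambda>Y. g q (E i q) (Y q)", OF _ _ Y q])
    (simp_all only: plus_fun_apply[of _ _ q] vf_scale_def g_add g_scale vfD(1) E_tangent vf_scale_def)

text \<open>On each side of \<open>codazzi\<close> one connection term is symmetric in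
  \<open>i\<close> and \<open>j\<close> by torsionfreeness, and these two terms cancel.\<close>

lemma gg_codazzi:
  assumes q: "q \<in> U"
  shows "d i (gg j k) q - (\<Sum>m\<in>UNIV. G i k m q * gg j m q) = d j (gg i k) q - (\<Sum>m\<in>UNIV. G j k m q * gg i m q)"
proof -
  have 1: "g q (nab (E i) (E j) q) (E k q) = g q (nab (E j) (E i) q) (E k q)"
  proof -
    have "g q (nab (E i) (E j) q) (E k q) = (\<Sum>m\<in>UNIV. G i j m q * gg k m q)" for i j
      using g_sym[OF vfD(1)[OF nab_vf[OF E_vf E_vf]] E_tangent] g_expand[OF q nab_vf[OF E_vf E_vf]]
      by (simp add: G_def)
    then show ?thesis by (simp add: G_sym[OF q, of i j])
  qed
  have 2: "g q (E j q) (nab (E i) (E k) q) = (\<Sum>m\<in>UNIV. G i k m q * gg j m q)" for i j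
    unfolding G_def by (rule g_expand[OF q nab_vf[OF E_vf E_vf]])
  have "E i q (gg j k) - g q (nab (E i) (E j) q) (E k q) - g q (E j q) (nab (E i) (E k) q) =
      E j q (gg i k) - g q (nab (E j) (E i) q) (E k q) - g q (E i q) (nab (E j) (E k) q)"
    unfolding gg_def by (rule codazzi[OF E_vf E_vf E_vf])
  then show ?thesis using 1 by (simp add: 2 E_U[OF q smooth_gg])
qed

end

section \<open>The linear system for the jet of a solution\<close>

lemma has_derivative_vecI:
  fixes f :: "'v::real_normed_vector \<Rightarrow> 'b::euclidean_space ^ 'k::finite"
  assumes "\<And>i. ((\<lambda>x. f x $ i) has_derivative (\<lambda>w. f' w $ i)) F"
  shows "(f has_derivative f') F"
proof -
  have e: "y = (\<Sum>i\<in>UNIV. axis i (y $ i))" for y :: "'b ^ 'k"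
    by (simp add: vec_eq_iff axis_def if_distrib cong: if_cong)
  have "linear (\<lambda>y :: 'b. axis i y :: 'b ^ 'k)" for i
    by (rule linearI) (auto simp: vec_eq_iff axis_def)
  then have b: "bounded_linear (\<lambda>y :: 'b. axis i y :: 'b ^ 'k)" for i
    by (simp add: linear_conv_bounded_linear)
  have "((\<lambda>x. \<Sum>i\<in>UNIV. axis i (f x $ i)) has_derivative (\<lambda>w. \<Sum>i\<in>UNIV. axis i (f' w $ i))) F"
    by (intro has_derivative_sum bounded_linear.has_derivative[OF b assms])
  then show ?thesis by (simp only: e[symmetric])
qed

lemma linear_axis_expand:
  fixes L :: "real ^ 'n::finite \<Rightarrow> real"
  assumes "linear L"
  shows "L w = (\<Sum>l\<in>UNIV. w $ l * L (axis l 1))"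
proof -
  have "L w = L (\<Sum>l\<in>UNIV. w $ l *\<^sub>R axis l 1)"
    using basis_expansion[of w] by (simp add: scalar_mult_eq_scaleR)
  then show ?thesis by (simp add: linear_sum[OF assms] linear_scale[OF assms])
qed

context coord
begin

lemma D_expand:
  assumes f: "smooth_map A f" and z: "z \<in> ball a r"
  shows "frechet_derivative (rep f) (at z) w = (\<Sum>l\<in>UNIV. w $ l * d l f (inv_x z))"
proof -
  have "z = x (inv_x z)" "inv_x z \<in> V" using inv_ball[OF z] U_V by auto
  then have "linear (frechet_derivative (rep f) (at z))"
    using has_derivative_linear[OF rep_has_derivative[OF f]] by metis
  from linear_axis_expand[OF this, of w] show ?thesis by (simp add: d_def inv_ball(2)[OF z])
qed

lemma rep_E:
  assumes f: "smooth_map A f" and z: "z \<in> ball a r"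
  shows "rep (\<lambda>s. E k s f) z = frechet_derivative (rep f) (at z) (axis k 1)"
  using inv_ball[OF z] by (simp add: rep_def E_U[OF _ f] d_def)

lemma rep_derivative:
  assumes f: "smooth_map A f" and z: "z \<in> ball a r"
  shows "(rep f has_derivative (\<lambda>w. \<Sum>l\<in>UNIV. w $ l * d l f (inv_x z))) (at z)"
  using smooth_on_has_derivative[OF smooth_rep[OF f], of z] z ball_sub(3)
  by (simp add: D_expand[OF f z, symmetric] subset_iff)

end

type_synonym 'n jet = "real \<times> (real ^ 'n) \<times> real"

context hessian_coord
begin

text \<open>Solutions of \<open>\<nabla> df = c g\<close> correspond to solutions \<open>(f, df, c)\<close> of this flat linear system.\<close>

definition sysA :: "real ^ 'n \<Rightarrow> real ^ 'n \<Rightarrow> 'n jet \<Rightarrow> 'n jet" where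
  "sysA z v y = (v \<bullet> fst (snd y), (\<chi> j. \<Sum>i\<in>UNIV. v $ i *
     ((\<Sum>k\<in>UNIV. rep (G i j k) z * fst (snd y) $ k) + snd (snd y) * rep (gg i j) z)), 0)"

text \<open>The derivative of \<open>sysA\<close> with respect to \<open>z\<close> in direction
  \<open>w\<close>; only the middle component has variable coefficients.\<close>

definition sysD :: "real ^ 'n \<Rightarrow> real ^ 'n \<Rightarrow> real ^ 'n \<Rightarrow> 'n jet \<Rightarrow> 'n jet" where
  "sysD z w v y = (0, (\<chi> j. \<Sum>i\<in>UNIV. v $ i *
     ((\<Sum>k\<in>UNIV. frechet_derivative (rep (G i j k)) (at z) w * fst (snd y) $ k) +
      snd (snd y) * frechet_derivative (rep (gg i j)) (at z) w)), 0)"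

lemma bilinear_sys: "bilinear (sysA z)" "bilinear (sysD z w)"
  unfolding bilinear_def sysA_def sysD_def
  by (auto intro!: linearI simp: vec_eq_iff sum.distrib sum_distrib_left sum_distrib_right algebra_simps inner_add_left inner_add_right)

lemma rep_smooth_derivative:
  "smooth_map A f \<Longrightarrow> z \<in> ball a r \<Longrightarrow> (rep f has_derivative frechet_derivative (rep f) (at z)) (at z)"
  using smooth_on_has_derivative[OF smooth_rep] ball_sub(3) by blast

lemma sysA_derivative:
  assumes z: "z \<in> ball a r"
  shows "((\<lambda>z. sysA z v y) has_derivative (\<lambda>w. sysD z w v y)) (at z)"
proof -
  have 1: "((\<lambda>z. \<chi> j. \<Sum>i\<in>UNIV. v $ i * ((\<Sum>k\<in>UNIV. rep (G i j k) z * fst (snd y) $ k) + snd (snd y) * rep (gg i j) z))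
      has_derivative (\<lambda>w. \<chi> j. \<Sum>i\<in>UNIV. v $ i *
     ((\<Sum>k\<in>UNIV. frechet_derivative (rep (G i j k)) (at z) w * fst (snd y) $ k) +
      snd (snd y) * frechet_derivative (rep (gg i j)) (at z) w))) (at z)"
    by (rule has_derivative_vecI)
      (simp, intro has_derivative_sum has_derivative_mult_right has_derivative_add has_derivative_mult_left
        rep_smooth_derivative[OF smooth_G z] rep_smooth_derivative[OF smooth_gg z])
  show ?thesis
    unfolding sysA_def sysD_def
    by (intro has_derivative_Pair has_derivative_const 1)
qed

lemma continuous_rep: "smooth_map A f \<Longrightarrow> continuous_on (ball a r) (rep f)"
  using smooth_on_continuous[OF smooth_on_subset[OF smooth_rep ball_sub(3)]] .

lemma continuous_sysD: "continuous_on (ball a r) (\<lambda>z. sysD z w v y)"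
proof -
  have D: "continuous_on (ball a r) (\<lambda>z. frechet_derivative (rep f) (at z) w)" if "smooth_map A f" for f
    by (rule smooth_on_continuous[OF smooth_on_subset[OF smooth_on_derivative[OF smooth_rep[OF that]] ball_sub(3)]])
  show ?thesis
    unfolding sysD_def
    by (intro continuous_on_Pair continuous_on_const continuous_on_vec_lambda continuous_on_sum
      continuous_on_mult continuous_on_add D[OF smooth_G] D[OF smooth_gg])
qed

text \<open>The first component is symmetric because \<nabla> is torsionfree and \<open>g\<close>
  symmetric. In the middle component the terms with \<alpha> are symmetric by \<open>G_flat\<close>
  and those with \<open>c\<close> by \<open>gg_codazzi\<close>.\<close>

lemma sys_flat:
  assumes z: "z \<in> ball a r"
  shows "sysD z w v y + sysA z v (sysA z w y) = sysD z v w y + sysA z w (sysA z v y)"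
proof -
  define q where "q = inv_x z"
  have q: "q \<in> U" using inv_ball(1)[OF z] by (simp add: q_def)
  have rep: "rep f z = f q" for f by (simp add: rep_def q_def)
  define \<alpha> where "\<alpha> = fst (snd y)"
  define c where "c = snd (snd y)"
  \<comment> \<open>\<open>B i j\<close> is the derivative that the system prescribes for \<alpha>_j
    in direction i, and \<open>K l i j\<close> the derivative of this expression in direction l,
    again computed from the system.\<close>
  define B where "B i j = (\<Sum>k\<in>UNIV. G i j k q * \<alpha> $ k) + c * gg i j q" for i j
  have Bsym: "B i j = B j i" for i j unfolding B_def by (simp add: G_sym[OF q, of i j] gg_sym[of i j])
  define K where "K l i j = (\<Sum>k\<in>UNIV. d l (G i j k) q * \<alpha> $ k) + c * d l (gg i j) q +
    (\<Sum>k\<in>UNIV. G i j k q * B l k)" for l i j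
  have K: "K l i j = (\<Sum>m\<in>UNIV. \<alpha> $ m * (d l (G i j m) q + (\<Sum>k\<in>UNIV. G i j k q * G l k m q))) +
      c * (d l (gg i j) q + (\<Sum>m\<in>UNIV. G i j m q * gg l m q))" for l i j
  proof -
    have "(\<Sum>k\<in>UNIV. G i j k q * (\<Sum>m\<in>UNIV. G l k m q * \<alpha> $ m)) =
        (\<Sum>k\<in>UNIV. \<Sum>m\<in>UNIV. \<alpha> $ m * (G i j k q * G l k m q))"
      by (simp add: sum_distrib_left mult_ac)
    also have "\<dots> = (\<Sum>m\<in>UNIV. \<alpha> $ m * (\<Sum>k\<in>UNIV. G i j k q * G l k m q))"
      by (subst sum.swap) (simp add: sum_distrib_left)
    finally show ?thesis
      by (simp add: K_def B_def distrib_left sum.distrib sum_distrib_left mult_ac)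
  qed
  have cod: "d l (gg i j) q + (\<Sum>m\<in>UNIV. G i j m q * gg l m q) = d i (gg l j) q + (\<Sum>m\<in>UNIV. G l j m q * gg i m q)" for l i j
    using gg_codazzi[OF q, of l i j] by linarith
  have Ksym: "K l i j = K i l j" for l i j
    unfolding K G_flat[OF q, of l i j] cod[of l i j] by simp
  have D: "frechet_derivative (rep f) (at z) w = (\<Sum>l\<in>UNIV. w $ l * d l f q)" if "smooth_map A f" for f w
    using D_expand[OF that z] by (simp add: q_def)
  have sA: "sysA z w y = (w \<bullet> \<alpha>, (\<chi> j. \<Sum>i\<in>UNIV. w $ i * B i j), 0)" for w
    by (simp add: sysA_def rep \<alpha>_def B_def c_def)
  have pull: "t * (\<Sum>l\<in>UNIV. w $ l * X l) = (\<Sum>l\<in>UNIV. t * w $ l * X l)" for t X and w :: "real ^ 'n"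
    by (simp add: sum_distrib_left mult.assoc)
  have sA0: "sysA z v (p, \<beta>, 0) = (v \<bullet> \<beta>, (\<chi> j. \<Sum>i\<in>UNIV. v $ i * (\<Sum>k\<in>UNIV. G i j k q * \<beta> $ k)), 0)" for v p \<beta>
    by (simp add: sysA_def rep)
  have sAA: "sysA z v (sysA z w y) = ((\<Sum>j\<in>UNIV. \<Sum>i\<in>UNIV. v $ j * w $ i * B i j),
      (\<chi> j. \<Sum>i\<in>UNIV. \<Sum>l\<in>UNIV. v $ i * w $ l * (\<Sum>k\<in>UNIV. G i j k q * B l k)), 0)" for v w
  proof -
    have "(\<Sum>k\<in>UNIV. G i j k q * (\<Sum>l\<in>UNIV. w $ l * B l k)) = (\<Sum>l\<in>UNIV. w $ l * (\<Sum>k\<in>UNIV. G i j k q * B l k))" for i j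
      unfolding sum_distrib_left by (subst sum.swap) (simp only: mult_ac)
    then show ?thesis
      by (simp only: sA sA0 vec_lambda_beta inner_vec_def inner_real_def pull)
  qed
  have sD: "sysD z w v y = (0, (\<chi> j. \<Sum>i\<in>UNIV. \<Sum>l\<in>UNIV. v $ i * w $ l *
      ((\<Sum>k\<in>UNIV. d l (G i j k) q * \<alpha> $ k) + c * d l (gg i j) q)), 0)" for w v
  proof -
    have 1: "(\<Sum>k\<in>UNIV. (\<Sum>l\<in>UNIV. w $ l * d l (G i j k) q) * \<alpha> $ k) =
        (\<Sum>l\<in>UNIV. w $ l * (\<Sum>k\<in>UNIV. d l (G i j k) q * \<alpha> $ k))" for i j
      unfolding sum_distrib_left sum_distrib_right by (subst sum.swap) (simp only: mult_ac)
    have 2: "(\<Sum>l\<in>UNIV. w $ l * X l) + c * (\<Sum>l\<in>UNIV. w $ l * Y l) = (\<Sum>l\<in>UNIV. w $ l * (X l + c * Y l))"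
      for X Y :: "'n \<Rightarrow> real"
      by (simp add: sum_distrib_left sum.distrib[symmetric] algebra_simps)
    show ?thesis
      by (simp only: sysD_def D smooth_G smooth_gg \<alpha>_def[symmetric] c_def[symmetric] 1 2, simp only: pull)
  qed
  have tot: "sysD z w v y + sysA z v (sysA z w y) = ((\<Sum>j\<in>UNIV. \<Sum>i\<in>UNIV. v $ j * w $ i * B i j),
      (\<chi> j. \<Sum>i\<in>UNIV. \<Sum>l\<in>UNIV. v $ i * w $ l * K l i j), 0)" for v w
    by (simp add: sAA sD K_def vec_eq_iff distrib_left sum.distrib)
  have "(\<Sum>j\<in>UNIV. \<Sum>i\<in>UNIV. v $ j * w $ i * B i j) = (\<Sum>j\<in>UNIV. \<Sum>i\<in>UNIV. w $ j * v $ i * B i j)"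
    by (subst sum.swap) (simp add: Bsym mult_ac)
  moreover have "(\<Sum>i\<in>UNIV. \<Sum>l\<in>UNIV. v $ i * w $ l * K l i j) = (\<Sum>i\<in>UNIV. \<Sum>l\<in>UNIV. w $ i * v $ l * K l i j)" for j
    by (subst sum.swap) (simp add: Ksym mult_ac)
  ultimately show ?thesis by (simp add: tot)
qed

definition solves :: "(real ^ 'n) set \<Rightarrow> (real ^ 'n \<Rightarrow> 'n jet) \<Rightarrow> bool" where
  "solves S y \<longleftrightarrow> (\<forall>z\<in>S. (y has_derivative (\<lambda>v. sysA z v (y z))) (at z))"

lemma solves_subset: "solves S y \<Longrightarrow> T \<subseteq> S \<Longrightarrow> solves T y"
  by (auto simp: solves_def)

definition jet :: "('a \<Rightarrow> real) \<Rightarrow> real \<Rightarrow> real ^ 'n \<Rightarrow> 'n jet" where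
  "jet f c z = (rep f z, (\<chi> k. frechet_derivative (rep f) (at z) (axis k 1)), c)"

lemma jet_solves:
  assumes f: "smooth_map A f" and S: "S \<subseteq> ball a r"
    and h: "\<And>z X Y. z \<in> S \<Longrightarrow> X \<in> vector_fields A \<Longrightarrow> Y \<in> vector_fields A \<Longrightarrow> hess f c (inv_x z) X Y = 0"
  shows "solves S (jet f c)"
  unfolding solves_def
proof
  fix z assume zS: "z \<in> S"
  then have z: "z \<in> ball a r" using S by blast
  define q where "q = inv_x z"
  have q: "q \<in> U" using inv_ball(1)[OF z] by (simp add: q_def)
  have eq: "d i (\<lambda>s. E j s f) q = (\<Sum>k\<in>UNIV. G i j k q * d k f q) + c * gg i j q" for i j
    using hess_zero_iff[OF f q, of c] h[OF zS] by (auto simp: q_def)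
  have rep: "rep f z = f q" for f by (simp add: rep_def q_def)
  have dk: "frechet_derivative (rep f) (at z) (axis k 1) = d k f q" for k
    using inv_ball(2)[OF z] by (simp add: d_def q_def)
  have 1: "(rep f has_derivative (\<lambda>v. \<Sum>l\<in>UNIV. v $ l * d l f q)) (at z)"
    using rep_derivative[OF f z] by (simp add: q_def)
  have 2: "((\<lambda>z. frechet_derivative (rep f) (at z) (axis j 1)) has_derivative
      (\<lambda>v. \<Sum>i\<in>UNIV. v $ i * d i (\<lambda>s. E j s f) q)) (at z)" for j
    by (rule has_derivative_transform_within_open[OF _ open_ball z, of "rep (\<lambda>s. E j s f)"])
      (use rep_derivative[OF smooth_E[OF f] z] rep_E[OF f] in \<open>auto simp: q_def\<close>)
  have 3: "((\<lambda>z. \<chi> k. frechet_derivative (rep f) (at z) (axis k 1)) has_derivative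
      (\<lambda>v. \<chi> j. \<Sum>i\<in>UNIV. v $ i * d i (\<lambda>s. E j s f) q)) (at z)"
    by (rule has_derivative_vecI) (simp add: 2)
  have "(jet f c has_derivative (\<lambda>v. ((\<Sum>l\<in>UNIV. v $ l * d l f q), (\<chi> j. \<Sum>i\<in>UNIV. v $ i * d i (\<lambda>s. E j s f) q), 0))) (at z)"
    unfolding jet_def by (intro has_derivative_Pair 1 3 has_derivative_const)
  moreover have "((\<Sum>l\<in>UNIV. v $ l * d l f q), (\<chi> j. \<Sum>i\<in>UNIV. v $ i * d i (\<lambda>s. E j s f) q), 0) = sysA z v (jet f c z)" for v
    by (simp add: sysA_def jet_def dk rep inner_vec_def eq)
  ultimately show "(jet f c has_derivative (\<lambda>v. sysA z v (jet f c z))) (at z)" by simp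
qed

lemma solves_components:
  assumes y: "solves S y" and z: "z \<in> S"
  shows "((\<lambda>z. fst (y z)) has_derivative (\<lambda>v. v \<bullet> fst (snd (y z)))) (at z)"
    "((\<lambda>z. fst (snd (y z)) $ j) has_derivative (\<lambda>v. \<Sum>i\<in>UNIV. v $ i *
     ((\<Sum>k\<in>UNIV. rep (G i j k) z * fst (snd (y z)) $ k) + snd (snd (y z)) * rep (gg i j) z))) (at z)"
    "((\<lambda>z. snd (snd (y z))) has_derivative (\<lambda>v. 0)) (at z)"
proof -
  have y: "(y has_derivative (\<lambda>v. sysA z v (y z))) (at z)" using y z by (simp add: solves_def)
  show "((\<lambda>z. fst (y z)) has_derivative (\<lambda>v. v \<bullet> fst (snd (y z)))) (at z)"
    using has_derivative_fst[OF y] by (simp add: sysA_def)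
  show "((\<lambda>z. fst (snd (y z)) $ j) has_derivative (\<lambda>v. \<Sum>i\<in>UNIV. v $ i *
     ((\<Sum>k\<in>UNIV. rep (G i j k) z * fst (snd (y z)) $ k) + snd (snd (y z)) * rep (gg i j) z))) (at z)"
    using bounded_linear.has_derivative[OF bounded_linear_vec_nth has_derivative_fst[OF has_derivative_snd[OF y]], of j]
    by (simp add: sysA_def)
  show "((\<lambda>z. snd (snd (y z))) has_derivative (\<lambda>v. 0)) (at z)"
    using has_derivative_snd[OF has_derivative_snd[OF y]] by (simp add: sysA_def)
qed

lemma solves_const:
  assumes y: "solves S y" and S: "open S" "convex S" "z \<in> S" "w \<in> S"
  shows "snd (snd (y z)) = snd (snd (y w))"
  by (rule has_derivative_zero_unique[OF S(2) _ S(3,4), of "\<lambda>z. snd (snd (y z))"])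
    (use solves_components(3)[OF y] has_derivative_at_withinI in blast)

text \<open>Bootstrapping: the derivatives of the components are polynomials in the smooth
  coefficients and the components themselves, while the last component is constant on the convex
  set.\<close>

lemma solves_smooth:
  assumes y: "solves S y" and S: "open S" "convex S" "S \<subseteq> ball a r"
  shows "smooth_on S (\<lambda>z. fst (y z))"
proof (cases "S = {}")
  case False
  then obtain w where w: "w \<in> S" by blast
  define c where "c = snd (snd (y w))"
  have c: "snd (snd (y z)) = c" if "z \<in> S" for z using solves_const[OF y S(1,2) that w] by (simp add: c_def)
  have sm: "Ck_on k S (rep f)" if "smooth_map A f" for f k
    using smooth_onD[OF smooth_on_subset[OF smooth_rep[OF that]]] S(3) ball_sub(3) by blast
  have "Ck_on k S (\<lambda>z. fst (y z)) \<and> (\<forall>j. Ck_on k S (\<lambda>z. fst (snd (y z)) $ j))" for k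
  proof (induction k)
    case 0
    have "continuous_on S (\<lambda>z. fst (y z))"
      by (rule has_derivative_continuous_on[OF has_derivative_at_withinI[OF solves_components(1)[OF y]]])
    moreover have "continuous_on S (\<lambda>z. fst (snd (y z)) $ j)" for j
      by (rule has_derivative_continuous_on[OF has_derivative_at_withinI[OF solves_components(2)[OF y]]])
    ultimately show ?case by simp
  next
    case (Suc k)
    have "Ck_on (Suc k) S (\<lambda>z. fst (y z))"
    proof (rule Ck_on_SucI[OF S(1) solves_components(1)[OF y]])
      fix v
      show "Ck_on k S (\<lambda>z. v \<bullet> fst (snd (y z)))"
        unfolding inner_vec_def inner_real_def
        using Suc by (intro Ck_on_sum[OF S(1)] Ck_on_mult[OF S(1)] Ck_on_const[OF S(1)]) auto
    qed
    moreover have "Ck_on (Suc k) S (\<lambda>z. fst (snd (y z)) $ j)" for j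
    proof (rule Ck_on_SucI[OF S(1) solves_components(2)[OF y]])
      fix v :: "real ^ 'n"
      have "Ck_on k S (\<lambda>z. \<Sum>i\<in>UNIV. v $ i * ((\<Sum>k\<in>UNIV. rep (G i j k) z * fst (snd (y z)) $ k) + c * rep (gg i j) z))"
        using Suc
        by (intro Ck_on_sum[OF S(1)] Ck_on_mult[OF S(1)] Ck_on_add[OF S(1)] Ck_on_const[OF S(1)] sm smooth_G smooth_gg) auto
      then show "Ck_on k S (\<lambda>z. \<Sum>i\<in>UNIV. v $ i * ((\<Sum>k\<in>UNIV. rep (G i j k) z * fst (snd (y z)) $ k) + snd (snd (y z)) * rep (gg i j) z))"
        by (rule Ck_on_cong[OF S(1), rotated]) (simp add: c)
    qed
    ultimately show ?case by blast
  qed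
  then show ?thesis by (simp add: smooth_on_def)
qed (rule smooth_on_localI, simp)

lemma solves_hess:
  assumes y: "solves S y" and S: "open S" "convex S" "S \<subseteq> ball a r"
    and f: "smooth_map A f" "\<And>z. z \<in> S \<Longrightarrow> rep f z = fst (y z)" and z: "z \<in> S"
    and X: "X \<in> vector_fields A" "Y \<in> vector_fields A"
  shows "hess f (snd (snd (y z))) (inv_x z) X Y = 0"
proof -
  have Sr: "w \<in> ball a r" if "w \<in> S" for w using S(3) that by blast
  define q where "q = inv_x z"
  have q: "q \<in> U" "x q = z" using inv_ball[OF Sr[OF z]] by (simp_all add: q_def)
  have "(rep f has_derivative (\<lambda>v. v \<bullet> fst (snd (y w)))) (at w)" if w: "w \<in> S" for w
    by (rule has_derivative_transform_within_open[OF solves_components(1)[OF y w] S(1) w]) (simp add: f(2))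
  then have F: "frechet_derivative (rep f) (at w) v = v \<bullet> fst (snd (y w))" if "w \<in> S" for v w
    using fun_cong[OF frechet_derivative_at[of "rep f" "\<lambda>v. v \<bullet> fst (snd (y w))" w], of v] that by simp
  have "(rep (\<lambda>s. E j s f) has_derivative (\<lambda>v. \<Sum>i\<in>UNIV. v $ i *
     ((\<Sum>k\<in>UNIV. rep (G i j k) z * fst (snd (y z)) $ k) + snd (snd (y z)) * rep (gg i j) z))) (at z)" for j
    by (rule has_derivative_transform_within_open[OF solves_components(2)[OF y z] S(1) z])
      (simp add: rep_E[OF f(1) Sr] F cart_eq_inner_axis inner_commute)
  then have "d i (\<lambda>s. E j s f) q = (\<Sum>l\<in>UNIV. axis i 1 $ l *
     ((\<Sum>k\<in>UNIV. rep (G l j k) z * fst (snd (y z)) $ k) + snd (snd (y z)) * rep (gg l j) z))" for i j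
    unfolding d_def q(2) by (rule fun_cong[OF frechet_derivative_at[symmetric]])
  moreover have "d k f q = fst (snd (y z)) $ k" for k
    by (simp add: d_def q(2) F[OF z] cart_eq_inner_axis inner_commute)
  moreover have "rep h z = h q" for h by (simp add: rep_def q_def)
  moreover have "(\<Sum>l\<in>UNIV. axis i (1::real) $ l * u l) = u i" for i :: 'n and u
    by (simp add: axis_def if_distrib[of "\<lambda>t. t * _"] cong: if_cong)
  ultimately have eq: "\<forall>i j. d i (\<lambda>s. E j s f) q = (\<Sum>k\<in>UNIV. G i j k q * d k f q) + snd (snd (y z)) * gg i j q"
    by simp
  show ?thesis using hess_zero_iff[OF f(1) q(1), THEN iffD2, OF eq] X unfolding q_def by blast
qed

text \<open>One radius for both halves of local triviality: existence from every base point, and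
  uniqueness on convex subsets.\<close>

definition good_radius :: "'a \<Rightarrow> real \<Rightarrow> bool" where
  "good_radius p e \<longleftrightarrow> 0 < e \<and> ball (x p) e \<subseteq> ball a r \<and>
    (\<forall>q\<in>ball (x p) e. \<forall>y0. \<exists>y. y q = y0 \<and> solves (ball (x p) e) y) \<and>
    (\<forall>S y1 y2 q. convex S \<longrightarrow> S \<subseteq> ball (x p) e \<longrightarrow> q \<in> S \<longrightarrow> y1 q = y2 q \<longrightarrow>
      solves S y1 \<longrightarrow> solves S y2 \<longrightarrow> (\<forall>z\<in>S. y1 z = y2 z))"

lemma ex_good_radius:
  assumes p: "p \<in> U"
  shows "\<exists>e. good_radius p e"
proof -
  note xp = x_U(1)[OF p]
  obtain e1 where e1: "e1 > 0" "ball (x p) e1 \<subseteq> ball a r"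
    and ex: "\<And>q y0. q \<in> ball (x p) e1 \<Longrightarrow> \<exists>y. y q = y0 \<and> solves (ball (x p) e1) y"
    using frobenius_components[OF open_ball xp bilinear_sys sysA_derivative continuous_sysD sys_flat]
    unfolding solves_def by blast
  have "continuous_on (ball a r) (\<lambda>z. sysA z v y)" for v y
    by (rule has_derivative_continuous_on[OF has_derivative_at_withinI[OF sysA_derivative]])
  then obtain e2 where e2: "e2 > 0"
    and un: "\<And>S y q. convex S \<Longrightarrow> S \<subseteq> ball (x p) e2 \<Longrightarrow> q \<in> S \<Longrightarrow> y q = 0 \<Longrightarrow> solves S y \<Longrightarrow> \<forall>z\<in>S. y z = 0"
    using linear_ode_unique[OF open_ball xp, of sysA, OF bilinear_sys(1)] unfolding solves_def by blast
  define e where "e = min e1 e2"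
  have "\<exists>y. y q = y0 \<and> solves (ball (x p) e) y" if "q \<in> ball (x p) e" for q y0
  proof -
    have "ball (x p) e \<subseteq> ball (x p) e1" by (auto simp: e_def)
    then show ?thesis using ex[of q y0] that solves_subset by blast
  qed
  moreover have "\<forall>z\<in>S. y1 z = y2 z" if S: "convex S" "S \<subseteq> ball (x p) e" "q \<in> S" "y1 q = y2 q"
      and y: "solves S y1" "solves S y2" for S y1 y2 q
  proof -
    have "solves S (\<lambda>z. y1 z - y2 z)"
      unfolding solves_def
    proof
      fix z assume z: "z \<in> S"
      have "linear (sysA z v)" for v using bilinear_sys(1) by (simp add: bilinear_def)
      then show "((\<lambda>z. y1 z - y2 z) has_derivative (\<lambda>v. sysA z v (y1 z - y2 z))) (at z)"
        using has_derivative_diff[of y1 "\<lambda>v. sysA z v (y1 z)" "at z" y2 "\<lambda>v. sysA z v (y2 z)"] y z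
        by (simp add: solves_def linear_diff)
    qed
    moreover have "S \<subseteq> ball (x p) e2" using S(2) by (auto simp: e_def)
    ultimately have "\<forall>z\<in>S. y1 z - y2 z = 0"
      using un[OF S(1) _ S(3), of "\<lambda>z. y1 z - y2 z"] S(4) by simp
    then show ?thesis by simp
  qed
  moreover have "0 < e" "ball (x p) e \<subseteq> ball a r" using e1 e2 by (auto simp: e_def)
  ultimately show ?thesis unfolding good_radius_def by blast
qed

lemma good_radiusD:
  assumes "good_radius p e"
  shows "0 < e" "ball (x p) e \<subseteq> ball a r"
    "q \<in> ball (x p) e \<Longrightarrow> \<exists>y. y q = y0 \<and> solves (ball (x p) e) y"
    "convex S \<Longrightarrow> S \<subseteq> ball (x p) e \<Longrightarrow> q \<in> S \<Longrightarrow> y1 q = y2 q \<Longrightarrow> solves S y1 \<Longrightarrow> solves S y2 \<Longrightarrow> z \<in> S \<Longrightarrow> y1 z = y2 z"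
  using assms unfolding good_radius_def by blast+

end


section \<open>Solutions as a local system of germs\<close>

context hessian_mfd
begin

text \<open>A representative is smooth on the whole manifold but satisfies the equation only near
  \<open>q\<close>; this encodes a local solution as a total function.\<close>

definition sol :: "real \<Rightarrow> 'a \<Rightarrow> ('a \<Rightarrow> real) \<Rightarrow> bool" where
  "sol c q f \<longleftrightarrow> smooth_map A f \<and> (\<exists>W. open W \<and> q \<in> W \<and>
     (\<forall>s\<in>W. \<forall>X\<in>vector_fields A. \<forall>Y\<in>vector_fields A. hess f c s X Y = 0))"

text \<open>Agreement near \<open>q\<close> says nothing about smoothness elsewhere. The equivalence
  of global smoothness is included so that \<open>sol\<close> is invariant under
  \<open>germ_eq\<close>.\<close>

definition germ_eq :: "'a \<Rightarrow> ('a \<Rightarrow> real) \<Rightarrow> ('a \<Rightarrow> real) \<Rightarrow> bool" where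
  "germ_eq q f h \<longleftrightarrow> (smooth_map A f \<longleftrightarrow> smooth_map A h) \<and>
     (\<exists>W. open W \<and> q \<in> W \<and> (\<forall>s\<in>W. f s = h s))"

lemma germ_eqI: "smooth_map A f \<Longrightarrow> smooth_map A h \<Longrightarrow> open W \<Longrightarrow> q \<in> W \<Longrightarrow> (\<And>s. s \<in> W \<Longrightarrow> f s = h s) \<Longrightarrow> germ_eq q f h"
  unfolding germ_eq_def by blast

lemma hess_local:
  assumes f: "smooth_map A f" "smooth_map A h" and W: "open W" "q \<in> W" "\<And>s. s \<in> W \<Longrightarrow> f s = h s"
    and X: "X \<in> vector_fields A" "Y \<in> vector_fields A"
  shows "hess f c q X Y = hess h c q X Y"
proof -
  have "Y s f = Y s h" if "s \<in> W" for s by (rule tangent_local[OF vfD(1)[OF X(2)] f W(1) that W(3)])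
  then have "X q (\<lambda>s. Y s f) = X q (\<lambda>s. Y s h)"
    by (intro tangent_local[OF vfD(1)[OF X(1)] vfD(2)[OF X(2) f(1)] vfD(2)[OF X(2) f(2)] W(1,2)]) auto
  moreover have "nab X Y q f = nab X Y q h"
    by (rule tangent_local[OF vfD(1)[OF nab_vf[OF X]] f W])
  ultimately show ?thesis by (simp add: hess_def)
qed

lemma ex_hessian_coord:
  assumes c: "compatible_chart A (V, x)" and p: "p \<in> V" and O: "open S" "p \<in> S"
  shows "\<exists>r b. hessian_coord A nab g V x (x p) r b \<and> inv_into V x ` cball (x p) (3 * r) \<subseteq> S \<and> p \<in> coord.U V x (x p) r"
proof -
  obtain r b where rb: "coord A V x (x p) r b" "inv_into V x ` cball (x p) (3 * r) \<subseteq> S"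
    using ex_coord[OF c p O] by blast
  have "hessian_coord A nab g V x (x p) r b"
    using rb(1) hessian_mfd_axioms by (simp add: hessian_coord_def)
  moreover have "p \<in> coord.U V x (x p) r"
    using rb(1) p by (simp add: coord.U_def coord.r)
  ultimately show ?thesis using rb(2) by blast
qed

end

context hessian_coord
begin

text \<open>A solution on the ball of radius \<open>e\<close> becomes a global function only after a
  cutoff; the new radii keep that cutoff inside the region where the solution is known.\<close>

lemma good_radius_smaller:
  assumes p: "p \<in> U" and e: "good_radius p e"
  shows "\<exists>r' b'. coord A V x (x p) r' b' \<and> ball (x p) (3 * r') \<subseteq> ball (x p) e \<and> 0 < r'"
proof -
  define S where "S = {q\<in>V. x q \<in> ball (x p) e}"
  have S: "open S" "p \<in> S" using open_preimage[OF open_ball] good_radiusD(1)[OF e] U_V[OF p] by (auto simp: S_def)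
  obtain r' b' where c: "coord A V x (x p) r' b'" and sub: "inv_x ` cball (x p) (3 * r') \<subseteq> S"
    using ex_coord[OF compat U_V[OF p] S] by blast
  have "z \<in> ball (x p) e" if z: "z \<in> ball (x p) (3 * r')" for z
  proof -
    have zc: "z \<in> cball (x p) (3 * r')" using z by auto
    then have "inv_x z \<in> S" using sub by blast
    moreover have "x (inv_x z) = z" using zc coord.sub[OF c] chart(6) by blast
    ultimately show ?thesis by (simp add: S_def)
  qed
  then show ?thesis using c coord.r[OF c] by blast
qed

lemma germ_to_jet:
  assumes f: "smooth_map A f" "smooth_map A h" and q: "q \<in> U" and e: "germ_eq q f h"
  shows "jet f c (x q) = jet h c (x q)"
proof -
  obtain W where W: "open W" "q \<in> W" "\<forall>s\<in>W. f s = h s" using e unfolding germ_eq_def by blast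
  have "d k f q = d k h q" for k
    by (rule d_local[of "W \<inter> U"]) (use W q f open_U in auto)
  moreover have "rep f (x q) = rep h (x q)" using W q by (simp add: rep_x U_V)
  ultimately show ?thesis by (simp add: jet_def d_def)
qed

text \<open>Both functions solve the equation on \<open>W\<close> only, so uniqueness for the linear
  system is applied on a small ball about \<open>x q\<close> whose preimage lies in
  \<open>W\<close>.\<close>

lemma jet_to_germ:
  assumes f: "smooth_map A f" "smooth_map A h" and e: "good_radius p e" and q: "q \<in> V" "x q \<in> ball (x p) e"
    and W: "open W" "q \<in> W" "\<And>s X Y. s \<in> W \<Longrightarrow> X \<in> vector_fields A \<Longrightarrow> Y \<in> vector_fields A \<Longrightarrow> hess f c s X Y = 0 \<and> hess h c s X Y = 0"
    and j: "jet f c (x q) = jet h c (x q)"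
  shows "germ_eq q f h"
proof -
  have qU: "q \<in> U" using q good_radiusD(2)[OF e] by (auto simp: U_def)
  have "open (x ` (W \<inter> U) \<inter> ball (x p) e)" using x_image_open[of "W \<inter> U"] W(1) open_U by auto
  moreover have "x q \<in> x ` (W \<inter> U) \<inter> ball (x p) e" using q W qU by auto
  ultimately obtain \<rho> where \<rho>: "\<rho> > 0" "ball (x q) \<rho> \<subseteq> x ` (W \<inter> U) \<inter> ball (x p) e"
    using openE by blast
  define S where "S = ball (x q) \<rho>"
  have S: "S \<subseteq> ball a r" "S \<subseteq> ball (x p) e" using \<rho>(2) good_radiusD(2)[OF e] by (auto simp: S_def)
  have SW: "inv_x z \<in> W" if "z \<in> S" for z
    using that \<rho>(2) x_U(2) by (force simp: S_def)
  have sv: "solves S (jet f c)" "solves S (jet h c)"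
    using W(3) SW S(1) f by (auto intro!: jet_solves)
  have jz: "jet f c z = jet h c z" if "z \<in> S" for z
    by (rule good_radiusD(4)[where ?y1.0="jet f c" and ?y2.0="jet h c", OF e _ S(2) _ j sv that])
      (use \<rho>(1) in \<open>auto simp: S_def\<close>)
  have "f s = h s" if s: "s \<in> {s\<in>V. x s \<in> S}" for s
  proof -
    have "rep f (x s) = rep h (x s)" using jz[of "x s"] s by (simp add: jet_def)
    then show ?thesis using s by (simp add: rep_x)
  qed
  moreover have "q \<in> {s\<in>V. x s \<in> S}" using q \<rho>(1) by (simp add: S_def)
  moreover have "open {s\<in>V. x s \<in> S}" by (rule open_preimage) (simp add: S_def)
  ultimately show ?thesis by (intro germ_eqI[OF f]) auto
qed

lemma ex_sol:
  assumes p: "p \<in> U" and e: "good_radius p e"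
    and c2: "coord A V x (x p) r' b'" and r': "ball (x p) (3 * r') \<subseteq> ball (x p) e"
    and q: "x q \<in> ball (x p) r'"
  shows "\<exists>h. smooth_map A h \<and> jet h c (x q) = (u, \<alpha>, c) \<and>
    (\<forall>s\<in>coord.U V x (x p) r'. \<forall>X\<in>vector_fields A. \<forall>Y\<in>vector_fields A. hess h c s X Y = 0)"
proof -
  interpret c2: coord A V x "x p" r' b' by (rule c2)
  have qe: "x q \<in> ball (x p) e" using q r' c2.ball_sub(3) by blast
  obtain y where y: "y (x q) = (u, \<alpha>, c)" "solves (ball (x p) e) y"
    using good_radiusD(3)[OF e qe] by blast
  note er = good_radiusD(2)[OF e]
  have cst: "snd (snd (y z)) = c" if "z \<in> ball (x p) e" for z
    using solves_const[OF y(2) open_ball convex_ball that qe] y(1) by simp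
  have "smooth_on (ball (x p) (3 * r')) (\<lambda>z. fst (y z))"
    by (rule smooth_on_subset[OF solves_smooth[OF y(2) open_ball convex_ball er] r'])
  then have sm: "smooth_map A (c2.ext (\<lambda>z. fst (y z)))" (is "smooth_map A ?h") by (rule c2.smooth_ext)
  define S where "S = ball (x p) r'"
  have S: "S \<subseteq> ball (x p) e" "S \<subseteq> ball a r" using r' er c2.ball_sub(3) by (auto simp: S_def)
  have ySolves: "solves S y" by (rule solves_subset[OF y(2) S(1)])
  have oS: "open S" "convex S" by (simp_all add: S_def)
  have rep: "rep ?h z = fst (y z)" if "z \<in> S" for z
  proof -
    have "z \<in> ball (x p) r'" using that by (simp add: S_def)
    from c2.inv_ball[OF this] show ?thesis by (simp add: rep_def c2.ext_U)
  qed
  have h0: "hess ?h c s X Y = 0" if "s \<in> c2.U" "X \<in> vector_fields A" "Y \<in> vector_fields A" for s X Y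
  proof -
    have "x s \<in> S" using c2.x_U(1)[OF that(1)] by (simp add: S_def)
    from solves_hess[OF ySolves oS S(2) sm rep this that(2,3)] show ?thesis
      using cst[of "x s"] S(1) \<open>x s \<in> S\<close> c2.x_U(2)[OF that(1)] by auto
  qed
  have xq: "x q \<in> S" using q by (simp add: S_def)
  have "(rep ?h has_derivative (\<lambda>v. v \<bullet> fst (snd (y (x q))))) (at (x q))"
    by (rule has_derivative_transform_within_open[OF solves_components(1)[OF ySolves xq] oS(1) xq]) (simp add: rep)
  then have "frechet_derivative (rep ?h) (at (x q)) = (\<lambda>v. v \<bullet> fst (snd (y (x q))))"
    by (rule frechet_derivative_at[symmetric])
  then have "jet ?h c (x q) = (u, \<alpha>, c)"
    using rep[OF xq] y(1) by (simp add: jet_def vec_eq_iff inner_axis inner_axis')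
  then show ?thesis using sm h0 by blast
qed

text \<open>A germ extends by solving the system with its jet as initial value. Two solutions over
  the neighbourhood that share a germ share a jet, hence all jets.\<close>

lemma trivial_nbhd_sol:
  assumes p: "p \<in> U"
  shows "\<exists>W. open W \<and> p \<in> W \<and> path_connected W \<and>
    (\<forall>q\<in>W. \<forall>f. sol c q f \<longrightarrow> (\<exists>h. (\<forall>s\<in>W. sol c s h) \<and> germ_eq q h f)) \<and>
    (\<forall>f h. (\<forall>s\<in>W. sol c s f \<and> sol c s h) \<longrightarrow> (\<forall>q\<in>W. \<forall>s\<in>W. germ_eq q f h \<longrightarrow> germ_eq s f h))"
proof -
  obtain e where e: "good_radius p e" using ex_good_radius[OF p] by blast
  obtain r' b' where c2: "coord A V x (x p) r' b'" and r': "ball (x p) (3 * r') \<subseteq> ball (x p) e" "0 < r'"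
    using good_radius_smaller[OF p e] by blast
  interpret c2: coord A V x "x p" r' b' by (rule c2)
  define W where "W = c2.U"
  have W: "open W" "p \<in> W" "path_connected W"
    using c2.open_U c2.path_connected_U U_V[OF p] r'(2) by (auto simp: W_def c2.U_def)
  have We: "q \<in> V" "x q \<in> ball (x p) r'" "x q \<in> ball (x p) e" if "q \<in> W" for q
    using that c2.U_V[of q] c2.x_U(1)[of q] subsetD[OF subset_trans[OF c2.ball_sub(3) r'(1)], of "x q"]
    by (simp_all add: W_def)
  have WU: "q \<in> U" if "q \<in> W" for q using We[OF that] good_radiusD(2)[OF e] by (auto simp: U_def)
  have ex: "\<exists>h. (\<forall>s\<in>W. sol c s h) \<and> germ_eq q h f" if q: "q \<in> W" and f: "sol c q f" for q f
  proof -
    obtain N where f: "smooth_map A f" and N: "open N" "q \<in> N"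
      "\<And>s X Y. s \<in> N \<Longrightarrow> X \<in> vector_fields A \<Longrightarrow> Y \<in> vector_fields A \<Longrightarrow> hess f c s X Y = 0"
      using f unfolding sol_def by blast
    obtain h where h: "smooth_map A h" "jet h c (x q) = jet f c (x q)"
      "\<And>s X Y. s \<in> W \<Longrightarrow> X \<in> vector_fields A \<Longrightarrow> Y \<in> vector_fields A \<Longrightarrow> hess h c s X Y = 0"
      using ex_sol[OF p e c2 r'(1) We(2)[OF q], of c "fst (jet f c (x q))" "fst (snd (jet f c (x q)))"]
      by (auto simp: W_def jet_def)
    have "germ_eq q h f"
      by (rule jet_to_germ[OF h(1) f e We(1)[OF q] We(3)[OF q], of "W \<inter> N", OF _ _ _ h(2)])
        (use W N q h(3) in auto)
    moreover have "sol c s h" if "s \<in> W" for s unfolding sol_def using h W(1) that by blast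
    ultimately show ?thesis by blast
  qed
  have un: "germ_eq s f h" if fh: "\<forall>s\<in>W. sol c s f \<and> sol c s h" and q: "q \<in> W" and s: "s \<in> W" and g: "germ_eq q f h"
    for f h q s
  proof -
    have f: "smooth_map A f" "smooth_map A h" using fh q unfolding sol_def by blast+
    have 0: "hess f c t X Y = 0" "hess h c t X Y = 0"
      if "t \<in> W" "X \<in> vector_fields A" "Y \<in> vector_fields A" for t X Y
      using fh that unfolding sol_def by blast+
    define S where "S = ball (x p) r'"
    have S: "S \<subseteq> ball a r" "S \<subseteq> ball (x p) e" "convex S" using r' good_radiusD(2)[OF e] c2.ball_sub(3) by (auto simp: S_def)
    have iS: "inv_x z \<in> W" if "z \<in> S" for z using c2.inv_ball(1) that by (simp add: S_def W_def)
    have sv: "solves S (jet f c)" "solves S (jet h c)"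
      by (rule jet_solves[OF f(1) S(1) 0(1)[OF iS]], assumption+, rule jet_solves[OF f(2) S(1) 0(2)[OF iS]])
    have jz: "jet f c z = jet h c z" if "z \<in> S" for z
      by (rule good_radiusD(4)[where ?y1.0="jet f c" and ?y2.0="jet h c", OF e S(3,2) _ germ_to_jet[OF f WU[OF q] g] sv that])
        (use We(2)[OF q] in \<open>simp add: S_def\<close>)
    have "f t = h t" if "t \<in> W" for t
    proof -
      have "rep f (x t) = rep h (x t)" using jz[of "x t"] We(2)[OF that] by (simp add: jet_def S_def)
      then show ?thesis using We(1)[OF that] by (simp add: rep_x)
    qed
    then show ?thesis by (rule germ_eqI[OF f W(1) s])
  qed
  show ?thesis
    by (intro exI[of _ W] conjI W allI ballI impI) (rule ex un, assumption+)+
qed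

end

context hessian_mfd
begin

lemma local_system_sol: "local_system (sol c) germ_eq"
proof
  fix p s t u
  show "germ_eq p s s" unfolding germ_eq_def by (auto intro!: exI[of _ UNIV])
  show "germ_eq p t s" if "germ_eq p s t" using that unfolding germ_eq_def by fastforce
  show "germ_eq p s u" if st: "germ_eq p s t" "germ_eq p t u"
  proof -
    obtain W1 where "open W1" "p \<in> W1" "\<forall>q\<in>W1. s q = t q" using st(1) unfolding germ_eq_def by blast
    moreover obtain W2 where "open W2" "p \<in> W2" "\<forall>q\<in>W2. t q = u q" using st(2) unfolding germ_eq_def by blast
    ultimately have "open (W1 \<inter> W2) \<and> p \<in> W1 \<inter> W2 \<and> (\<forall>q\<in>W1 \<inter> W2. s q = u q)" by auto
    then show ?thesis using st unfolding germ_eq_def by blast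
  qed
  show "\<exists>W. open W \<and> p \<in> W \<and> (\<forall>q\<in>W. germ_eq q s t)" if "germ_eq p s t"
    using that unfolding germ_eq_def by blast
  show "sol c p t" if st: "germ_eq p s t" and s: "sol c p s"
  proof -
    obtain W where W: "open W" "p \<in> W" "\<forall>q\<in>W. s q = t q" using st unfolding germ_eq_def by blast
    obtain N where N: "open N" "p \<in> N" "\<forall>q\<in>N. \<forall>X\<in>vector_fields A. \<forall>Y\<in>vector_fields A. hess s c q X Y = 0"
      and sm: "smooth_map A s" using s unfolding sol_def by blast
    have smt: "smooth_map A t" using st sm unfolding germ_eq_def by blast
    have "hess t c q X Y = 0" if "q \<in> W \<inter> N" "X \<in> vector_fields A" "Y \<in> vector_fields A" for q X Y
      using hess_local[OF sm smt W(1) _ _ that(2,3), of q c] W(3) N(3) that by auto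
    then show ?thesis unfolding sol_def using smt W(1,2) N(1,2) by (intro conjI exI[of _ "W \<inter> N"]) auto
  qed
  obtain V x where V: "(V, x) \<in> A" "p \<in> V" using ex_chart by blast
  obtain r b where c: "hessian_coord A nab g V x (x p) r b" "p \<in> coord.U V x (x p) r"
    using ex_hessian_coord[OF chart_compatible[OF V(1)] V(2) open_UNIV] by blast
  show "\<exists>U. open U \<and> p \<in> U \<and> path_connected U \<and>
      (\<forall>q\<in>U. \<forall>s. sol c q s \<longrightarrow> (\<exists>t. (\<forall>r\<in>U. sol c r t) \<and> germ_eq q t s)) \<and>
      (\<forall>s t. (\<forall>r\<in>U. sol c r s \<and> sol c r t) \<longrightarrow> (\<forall>q\<in>U. \<forall>r\<in>U. germ_eq q s t \<longrightarrow> germ_eq r s t))"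
    using hessian_coord.trivial_nbhd_sol[OF c, of c] .
qed

theorem global_sol:
  assumes sc: "simply_connected (UNIV :: 'a set)" and s: "sol c p0 f0"
  shows "\<exists>f. smooth_map A f \<and> germ_eq p0 f f0 \<and>
    (\<forall>q. \<forall>X\<in>vector_fields A. \<forall>Y\<in>vector_fields A. hess f c q X Y = 0)"
proof -
  interpret L: local_system "sol c" germ_eq by (rule local_system_sol)
  obtain \<sigma> where \<sigma>: "\<And>p. sol c p (\<sigma> p)" "germ_eq p0 (\<sigma> p0) f0"
    and near: "\<And>p. \<exists>W. open W \<and> p \<in> W \<and> (\<forall>q\<in>W. germ_eq q (\<sigma> q) (\<sigma> p))"
    using L.global_section[OF sc s] by blast
  \<comment> \<open>The diagonal of the family of representatives: for \<open>q\<close> near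
    \<open>p\<close>, the functions \<sigma> q and \<sigma> p have the same germ at
    \<open>q\<close>, so \<open>f\<close> coincides with \<sigma> p near \<open>p\<close>.\<close>
  define f where "f q = \<sigma> q q" for q
  have loc: "\<exists>W. open W \<and> p \<in> W \<and> (\<forall>q\<in>W. f q = \<sigma> p q)" for p
  proof -
    obtain W where W: "open W" "p \<in> W" "\<forall>q\<in>W. germ_eq q (\<sigma> q) (\<sigma> p)"
      using near[of p] by (elim exE conjE)
    have "f q = \<sigma> p q" if "q \<in> W" for q
      using bspec[OF W(3) that] unfolding germ_eq_def f_def by (elim conjE exE) blast
    then show ?thesis using W(1,2) by (intro exI[of _ W]) simp
  qed
  have sm\<sigma>: "smooth_map A (\<sigma> p)" for p using \<sigma>(1) unfolding sol_def by blast
  have sm: "smooth_map A f"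
  proof (rule smooth_map_cong_local)
    fix p show "\<exists>S h. open S \<and> p \<in> S \<and> smooth_map A h \<and> (\<forall>q\<in>S. f q = h q)"
      using loc[of p] sm\<sigma>[of p] by blast
  qed
  have germ: "germ_eq p f (\<sigma> p)" for p using loc[of p] sm sm\<sigma> unfolding germ_eq_def by blast
  have "hess f c q X Y = 0" if "X \<in> vector_fields A" "Y \<in> vector_fields A" for q X Y
  proof -
    have "sol c q f" using L.sol_eqv[OF L.eqv_sym[OF germ] \<sigma>(1)] .
    then show ?thesis using that unfolding sol_def by blast
  qed
  moreover have "germ_eq p0 f f0" using L.eqv_trans[OF germ \<sigma>(2)] .
  ultimately show ?thesis using sm by blast
qed

end

section \<open>Derivatives of determinants, parallel forms and affine functions\<close>

context smooth_mfd
begin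

lemma smooth_map_det:
  fixes m :: "'k::finite \<Rightarrow> 'k \<Rightarrow> 'a \<Rightarrow> real"
  assumes "\<And>i j. smooth_map A (m i j)"
  shows "smooth_map A (\<lambda>q. det (\<chi> i j. m i j q))"
  unfolding det_def
  by (simp, intro smooth_map_sum smooth_map_mult smooth_map_const smooth_map_prod assms)

lemma tangent_det:
  fixes m :: "'k::finite \<Rightarrow> 'k \<Rightarrow> 'a \<Rightarrow> real"
  assumes v: "v \<in> tangent_space A p" and m: "\<And>i j. smooth_map A (m i j)"
  shows "v (\<lambda>q. det (\<chi> i j. m i j q)) = (\<Sum>k\<in>UNIV. det (\<chi> i j. if i = k then v (m i j) else m i j p))"
proof -
  define P where "P = {\<pi> :: 'k \<Rightarrow> 'k. \<pi> permutes UNIV}"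
  have P: "finite P" by (simp add: P_def finite_permutations)
  have "v (\<lambda>q. det (\<chi> i j. m i j q)) = v (\<lambda>q. \<Sum>\<pi>\<in>P. of_int (sign \<pi>) * (\<Prod>i\<in>UNIV. m i (\<pi> i) q))"
    by (simp add: det_def P_def)
  also have "\<dots> = (\<Sum>\<pi>\<in>P. of_int (sign \<pi>) * v (\<lambda>q. \<Prod>i\<in>UNIV. m i (\<pi> i) q))"
    by (subst tangent_sum[OF v P])
      (auto intro!: sum.cong smooth_map_mult smooth_map_const smooth_map_prod m
        tangentD(2)[OF v _ smooth_map_const])
  also have "\<dots> = (\<Sum>\<pi>\<in>P. \<Sum>k\<in>UNIV. of_int (sign \<pi>) * (v (m k (\<pi> k)) * (\<Prod>i\<in>UNIV - {k}. m i (\<pi> i) p)))"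
    by (simp add: tangent_prod[OF v finite m] sum_distrib_left)
  also have "\<dots> = (\<Sum>k\<in>UNIV. \<Sum>\<pi>\<in>P. of_int (sign \<pi>) * (v (m k (\<pi> k)) * (\<Prod>i\<in>UNIV - {k}. m i (\<pi> i) p)))"
    by (rule sum.swap)
  also have "\<dots> = (\<Sum>k\<in>UNIV. det (\<chi> i j. if i = k then v (m i j) else m i j p))"
  proof (rule sum.cong[OF refl])
    fix k :: 'k
    have "(\<Prod>i\<in>UNIV. if i = k then v (m i (\<pi> i)) else m i (\<pi> i) p) =
        v (m k (\<pi> k)) * (\<Prod>i\<in>UNIV - {k}. m i (\<pi> i) p)" for \<pi>
      by (subst prod.remove[of _ k]) auto
    then show "(\<Sum>\<pi>\<in>P. of_int (sign \<pi>) * (v (m k (\<pi> k)) * (\<Prod>i\<in>UNIV - {k}. m i (\<pi> i) p))) =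
        det (\<chi> i j. if i = k then v (m i j) else m i j p)"
      by (simp add: det_def P_def)
  qed
  finally show ?thesis .
qed

end

context coord
begin

lemma E_expand: "v \<in> tangent_space A q \<Longrightarrow> q \<in> U \<Longrightarrow> smooth_map A f \<Longrightarrow> v f = (\<Sum>i\<in>UNIV. v (xt i) * E i q f)"
  by (simp add: tangent_expand E_U)

lemma tangent_eqI:
  assumes "v \<in> tangent_space A q" "w \<in> tangent_space A q" "q \<in> U" "\<And>i. v (xt i) = w (xt i)"
  shows "v = w"
  using tangent_eq_sum[OF assms(1,3)] tangent_eq_sum[OF assms(2,3)] assms(4) by simp

lemma lincomb_apply: "(\<Sum>i\<in>I. u i *\<^sub>f w i) f = (\<Sum>i\<in>I. u i * w i f)"
  for u :: "'i \<Rightarrow> real" and w :: "'i \<Rightarrow> 'a tangent"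
  by (induction I rule: infinite_finite_induct) (auto simp: fscale_def)

lemma E_xt: "q \<in> U \<Longrightarrow> E i q (xt j) = (if i = j then 1 else 0)"
  by (simp add: E_U smooth_xt d_xt)

lemma bilinear_field_expand:
  assumes T: "bilinear_field A T" and q: "q \<in> U" and v: "v \<in> tangent_space A q" "w \<in> tangent_space A q"
  shows "T q v w = (\<Sum>i\<in>UNIV. \<Sum>j\<in>UNIV. v (xt i) * w (xt j) * T q (E i q) (E j q))"
proof -
  obtain X where X: "X \<in> vector_fields A" "X q = v" using ex_vf[OF v(1) q] by blast
  obtain Y where Y: "Y \<in> vector_fields A" "Y q = w" using ex_vf[OF v(2) q] by blast
  have add: "T q (u + u') w = T q u w + T q u' w" "T q w (u + u') = T q w u + T q w u'"
    if "u \<in> tangent_space A q" "u' \<in> tangent_space A q" "w \<in> tangent_space A q" for u u' w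
    using T that unfolding bilinear_field_def by blast+
  have scale: "T q (c *\<^sub>f u) w = c * T q u w" "T q w (c *\<^sub>f u) = c * T q w u"
    if "u \<in> tangent_space A q" "w \<in> tangent_space A q" for u w c
    using T that unfolding bilinear_field_def by blast+
  note lin = add scale
  have 1: "T q (X q) w = (\<Sum>i\<in>UNIV. X q (xt i) * T q (E i q) w)"
    if w: "w \<in> tangent_space A q" for w
    by (rule tensorial[where T="\<lambda>X. T q (X q) w", OF _ _ X(1) q])
      (simp_all only: plus_fun_apply[of _ _ q] vf_scale_def lin vfD(1) w)
  have 2: "T q u (Y q) = (\<Sum>j\<in>UNIV. Y q (xt j) * T q u (E j q))"
    if u: "u \<in> tangent_space A q" for u
    by (rule tensorial[where T="\<lambda>Y. T q u (Y q)", OF _ _ Y(1) q])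
      (simp_all only: plus_fun_apply[of _ _ q] vf_scale_def lin vfD(1) u)
  show ?thesis
    using 1[OF v(2)] 2[OF E_tangent] by (simp add: X Y sum_distrib_left mult.assoc)
qed

end

context hessian_coord
begin

lemma smooth_Tc: "bilinear_field A T \<Longrightarrow> smooth_map A (\<lambda>s. T s (E i s) (E j s))"
  using E_vf unfolding bilinear_field_def by blast

text \<open>In the coordinate frame the components of a parallel form satisfy a linear system with
  the Christoffel symbols as coefficients, so uniqueness propagates the value 0.\<close>

lemma parallel_zero_nbhd:
  assumes T: "bilinear_field A T" "parallel_bilinear A nab T" and p: "p \<in> U"
  shows "\<exists>W. open W \<and> p \<in> W \<and> W \<subseteq> U \<and> (\<forall>q\<in>W. \<forall>s\<in>W. (\<forall>i j. T q (E i q) (E j q) = 0) \<longrightarrow> (\<forall>i j. T s (E i s) (E j s) = 0))"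
proof -
  define Tc where "Tc i j s = T s (E i s) (E j s)" for i j s
  have sTc: "smooth_map A (Tc i j)" for i j unfolding Tc_def by (rule smooth_Tc[OF T(1)])
  have dT: "d k (Tc i j) q = (\<Sum>m\<in>UNIV. G k i m q * Tc m j q + G k j m q * Tc i m q)" if q: "q \<in> U" for k i j q
  proof -
    have "E k q (Tc i j) = T q (nab (E k) (E i) q) (E j q) + T q (E i q) (nab (E k) (E j) q)"
      using T(2) E_vf unfolding parallel_bilinear_def Tc_def by blast
    moreover have "T q (nab (E k) (E i) q) (E j q) = (\<Sum>m\<in>UNIV. G k i m q * Tc m j q)" for i j
      using bilinear_field_expand[OF T(1) q vfD(1)[OF nab_vf[OF E_vf E_vf]] E_tangent, of k i j]
      by (simp add: E_xt[OF q] G_def Tc_def if_distrib[of "\<lambda>t. _ * t * _"] cong: if_cong)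
    moreover have "T q (E i q) (nab (E k) (E j) q) = (\<Sum>m\<in>UNIV. G k j m q * Tc i m q)" for i j
      using bilinear_field_expand[OF T(1) q E_tangent vfD(1)[OF nab_vf[OF E_vf E_vf]], of i k j]
      by (simp add: E_xt[OF q] G_def Tc_def if_distrib[of "\<lambda>t. t * _ * _"] sum.swap[of _ UNIV UNIV] cong: if_cong)
    ultimately show ?thesis by (simp add: E_U[OF q sTc] sum.distrib)
  qed
  define sT where "sT z v M = (\<chi> i j. \<Sum>k\<in>UNIV. v $ k * (\<Sum>m\<in>UNIV. rep (G k i m) z * M $ m $ j + rep (G k j m) z * M $ i $ m))"
    for z v :: "real ^ 'n" and M :: "real ^ 'n ^ 'n"
  have bil: "bilinear (sT z)" for z
    unfolding bilinear_def sT_def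
    by (auto intro!: linearI simp: vec_eq_iff sum.distrib sum_distrib_left sum_distrib_right algebra_simps)
  have cont: "continuous_on (ball a r) (\<lambda>z. sT z v M)" for v M
    unfolding sT_def
    by (intro continuous_on_vec_lambda continuous_on_sum continuous_on_mult continuous_on_add
      continuous_on_const continuous_rep smooth_G)
  obtain e where e: "e > 0" "ball (x p) e \<subseteq> ball a r"
    and un: "\<And>S y q. convex S \<Longrightarrow> S \<subseteq> ball (x p) e \<Longrightarrow> q \<in> S \<Longrightarrow> y q = 0 \<Longrightarrow>
      \<forall>z\<in>S. (y has_derivative (\<lambda>v. sT z v (y z))) (at z) \<Longrightarrow> \<forall>z\<in>S. y z = 0"
    using linear_ode_unique[OF open_ball x_U(1)[OF p], of sT, OF bil cont] by blast
  define y where "y z = (\<chi> i j. rep (Tc i j) z)" for z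
  have y: "(y has_derivative (\<lambda>v. sT z v (y z))) (at z)" if z: "z \<in> ball (x p) e" for z
  proof (rule has_derivative_vecI, rule has_derivative_vecI)
    fix i j
    have zr: "z \<in> ball a r" using z e(2) by blast
    have "(\<lambda>v. sT z v (y z) $ i $ j) = (\<lambda>w. \<Sum>l\<in>UNIV. w $ l * d l (Tc i j) (inv_x z))"
      by (simp add: sT_def y_def dT[OF inv_ball(1)[OF zr]] rep_def)
    then show "((\<lambda>z. y z $ i $ j) has_derivative (\<lambda>v. sT z v (y z) $ i $ j)) (at z)"
      using rep_derivative[OF sTc zr] by (simp add: y_def)
  qed
  define W where "W = {s\<in>V. x s \<in> ball (x p) e}"
  have W: "open W" "p \<in> W" using open_preimage[OF open_ball, of "x p" e] U_V[OF p] e(1) by (auto simp: W_def)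
  have WU: "s \<in> U" if "s \<in> W" for s using that e(2) by (auto simp: W_def U_def)
  have "\<forall>i j. Tc i j s = 0" if "q \<in> W" "s \<in> W" "\<forall>i j. Tc i j q = 0" for q s
  proof -
    have "y (x q) = 0" using that by (simp add: y_def vec_eq_iff rep_x W_def)
    moreover have "x q \<in> ball (x p) e" "x s \<in> ball (x p) e" using that by (auto simp: W_def)
    ultimately have "y (x s) = 0" using un[OF convex_ball subset_refl] y by blast
    then show ?thesis using that by (simp add: y_def vec_eq_iff rep_x W_def)
  qed
  then show ?thesis using W WU unfolding Tc_def by (intro exI[of _ W]) blast
qed

text \<open>The initial jet (0, \<alpha>, c) is solved near \<open>p\<close>, and simple
  connectedness continues the germ over the manifold.\<close>

lemma ex_global:
  assumes sc: "simply_connected (UNIV :: 'a set)" and p: "p \<in> U"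
  shows "\<exists>f. smooth_map A f \<and> (\<forall>i. d i f p = \<alpha> i) \<and>
    (\<forall>q. \<forall>X\<in>vector_fields A. \<forall>Y\<in>vector_fields A. hess f c q X Y = 0)"
proof -
  obtain e where e: "good_radius p e" using ex_good_radius[OF p] by blast
  obtain r' b' where c2: "coord A V x (x p) r' b'" and r': "ball (x p) (3 * r') \<subseteq> ball (x p) e" "0 < r'"
    using good_radius_smaller[OF p e] by blast
  interpret c2: coord A V x "x p" r' b' by (rule c2)
  have "x p \<in> ball (x p) r'" using r' by simp
  from ex_sol[OF p e c2 r'(1) this, of c 0 "\<chi> i. \<alpha> i"]
  obtain h where h: "smooth_map A h" "jet h c (x p) = (0, (\<chi> i. \<alpha> i), c)"
    "\<forall>s\<in>c2.U. \<forall>X\<in>vector_fields A. \<forall>Y\<in>vector_fields A. hess h c s X Y = 0"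
    by (elim exE conjE)
  have "p \<in> c2.U" using U_V[OF p] r'(2) by (simp add: c2.U_def)
  then have "sol c p h" unfolding sol_def using h c2.open_U by blast
  from global_sol[OF sc this] obtain f where f: "smooth_map A f" "germ_eq p f h"
    "\<forall>q. \<forall>X\<in>vector_fields A. \<forall>Y\<in>vector_fields A. hess f c q X Y = 0"
    by (elim exE conjE)
  have "jet f c (x p) = (0, (\<chi> i. \<alpha> i), c)" using germ_to_jet[OF f(1) h(1) p f(2)] h(2) by simp
  then have "d i f p = \<alpha> i" for i by (simp add: jet_def d_def vec_eq_iff)
  then show ?thesis using f by blast
qed

end

context hessian_mfd
begin

lemma ex_hessian_coord_at: "\<exists>V x a r b. hessian_coord A nab g V x a r b \<and> p \<in> coord.U V x a r"
proof -
  obtain V x where V: "(V, x) \<in> A" "p \<in> V" using ex_chart by blast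
  show ?thesis using ex_hessian_coord[OF chart_compatible[OF V(1)] V(2) open_UNIV] by blast
qed

theorem parallel_zero:
  assumes con: "connected (UNIV :: 'a set)" and T: "bilinear_field A T" "parallel_bilinear A nab T"
    and p0: "\<And>u v. u \<in> tangent_space A p0 \<Longrightarrow> v \<in> tangent_space A p0 \<Longrightarrow> T p0 u v = 0"
    and uv: "u \<in> tangent_space A q" "v \<in> tangent_space A q"
  shows "T q u v = 0"
proof -
  define Z where "Z s \<longleftrightarrow> (\<forall>u\<in>tangent_space A s. \<forall>v\<in>tangent_space A s. T s u v = 0)" for s
  have "Z q"
  proof (rule connected_induction_simple[OF con, of p0 q Z])
    fix p :: 'a
    obtain V x a r b where c: "hessian_coord A nab g V x a r b" "p \<in> coord.U V x a r"
      using ex_hessian_coord_at[of p] by (elim exE conjE)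
    interpret hessian_coord A nab g V x a r b by (rule c(1))
    have Z: "Z s \<longleftrightarrow> (\<forall>i j. T s (E i s) (E j s) = 0)" if "s \<in> U" for s
    proof
      assume "Z s" then show "\<forall>i j. T s (E i s) (E j s) = 0" using E_tangent by (simp add: Z_def)
    next
      assume "\<forall>i j. T s (E i s) (E j s) = 0"
      then show "Z s" by (simp add: Z_def bilinear_field_expand[OF T(1) that])
    qed
    obtain W where W: "open W" "p \<in> W" "W \<subseteq> U"
      "\<forall>q\<in>W. \<forall>s\<in>W. (\<forall>i j. T q (E i q) (E j q) = 0) \<longrightarrow> (\<forall>i j. T s (E i s) (E j s) = 0)"
      using parallel_zero_nbhd[OF T c(2)] by (elim exE conjE)
    have "\<forall>q\<in>W. \<forall>s\<in>W. Z q \<longrightarrow> Z s" using W(4) Z W(3) by (metis subsetD)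
    then show "\<exists>T. openin (top_of_set UNIV) T \<and> p \<in> T \<and> (\<forall>x\<in>T. \<forall>y\<in>T. Z x \<longrightarrow> Z y)"
      using W(1,2) by (intro exI[of _ W]) simp
  qed (use p0 in \<open>auto simp: Z_def\<close>)
  then show ?thesis using uv by (simp add: Z_def)
qed

text \<open>\<open>f\<close> and the constant function with value \<open>f p0\<close> are both
  affine and have the same jet at \<open>p0\<close>. Equality of germs then spreads over the
  connected manifold by local triviality.\<close>

theorem affine_const:
  assumes con: "connected (UNIV :: 'a set)" and f: "smooth_map A f"
    and h: "\<And>q X Y. X \<in> vector_fields A \<Longrightarrow> Y \<in> vector_fields A \<Longrightarrow> hess f 0 q X Y = 0"
    and p0: "\<And>v. v \<in> tangent_space A p0 \<Longrightarrow> v f = 0"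
  shows "f q = f p0"
proof -
  interpret L: local_system "sol 0" germ_eq by (rule local_system_sol)
  define k where "k = (\<lambda>_ :: 'a. f p0)"
  have k: "smooth_map A k" unfolding k_def by (rule smooth_map_const)
  have hk: "hess k 0 q X Y = 0" if "X \<in> vector_fields A" "Y \<in> vector_fields A" for q X Y
    using tangent_const[OF vfD(1)[OF that(1)]] tangent_const[OF vfD(1)[OF that(2)]]
      tangent_const[OF vfD(1)[OF nab_vf[OF that]]]
    by (simp add: hess_def k_def)
  have sf: "sol 0 q f" for q unfolding sol_def using f h by (intro conjI exI[of _ UNIV]) auto
  have sk: "sol 0 q k" for q unfolding sol_def using k hk by (intro conjI exI[of _ UNIV]) auto
  have init: "germ_eq p0 f k"
  proof -
    obtain V x a r b where c: "hessian_coord A nab g V x a r b" "p0 \<in> coord.U V x a r"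
      using ex_hessian_coord_at[of p0] by (elim exE conjE)
    interpret hessian_coord A nab g V x a r b by (rule c(1))
    obtain e where e: "good_radius p0 e" using ex_good_radius[OF c(2)] by blast
    have "d i f p0 = 0" for i using p0[OF E_tangent, of i] by (simp add: E_U[OF c(2) f])
    moreover have "d i k p0 = 0" for i unfolding k_def by (rule d_const)
    ultimately have j: "jet f 0 (x p0) = jet k 0 (x p0)"
      by (simp add: jet_def d_def rep_x U_V[OF c(2)]) (simp add: k_def)
    show ?thesis
      by (rule jet_to_germ[OF f k e U_V[OF c(2)] _ open_UNIV UNIV_I _ j])
        (use h hk good_radiusD(1)[OF e] in auto)
  qed
  have "germ_eq q f k"
  proof (rule connected_induction_simple[OF con, of p0 q "\<lambda>q. germ_eq q f k"])
    fix p :: 'a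
    obtain W where W: "open W" "p \<in> W" "path_connected W" "L.trivial_on W" by (rule L.trivial_nbhdE)
    have step: "germ_eq s f k" if "q \<in> W" "s \<in> W" "germ_eq q f k" for q s
      by (rule L.trivial_onD(2)[OF W(4) _ that(1,2,3)]) (use sf sk in auto)
    show "\<exists>T. openin (top_of_set UNIV) T \<and> p \<in> T \<and> (\<forall>x\<in>T. \<forall>y\<in>T. germ_eq x f k \<longrightarrow> germ_eq y f k)"
    proof (intro exI[of _ W] conjI ballI impI)
      show "openin (top_of_set UNIV) W" using W(1) by simp
    qed (rule W(2) step, assumption?)+
  qed (rule UNIV_I UNIV_I init)+
  then show ?thesis unfolding germ_eq_def k_def by blast
qed

end

section \<open>The induced volume and the Gauss equation\<close>

lemma std_volume_rows: "std_volume v = det (\<chi> i. v i)"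
  using det_transpose[of "\<chi> i j. v j $ i"] by (simp add: std_volume_def transpose_def)

lemma std_volume_matrix: "std_volume (\<lambda>j. (L :: real ^ 'k ^ 'k::finite) *v v j) = det L * std_volume v"
proof -
  have "(\<chi> i j. (L *v v j) $ i) = L ** (\<chi> i j. v j $ i)"
    by (simp add: matrix_matrix_mult_def matrix_vector_mult_def vec_eq_iff)
  then show ?thesis by (simp add: std_volume_def det_mul)
qed

lemma std_volume_None_linear:
  fixes u :: "'k::finite \<Rightarrow> real ^ 'k option"
  shows "linear (\<lambda>w. std_volume (case_option w u))"
proof (rule linearI)
  fix v w :: "real ^ 'k option" and c :: real
  have e: "(\<chi> i. case_option w u i) = (\<chi> i. if i = None then w else case_option 0 u i)" for w
    by (auto simp: vec_eq_iff split: option.splits)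
  show "std_volume (case_option (v + w) u) = std_volume (case_option v u) + std_volume (case_option w u)"
    unfolding std_volume_rows e by (rule det_row_add[of None "\<lambda>_. v" "\<lambda>_. w"])
  show "std_volume (case_option (c *\<^sub>R v) u) = c *\<^sub>R std_volume (case_option v u)"
    unfolding std_volume_rows e using det_row_mul[of None c "\<lambda>_. v" "case_option 0 u"]
    by (simp add: scalar_mult_eq_scaleR[symmetric] cong: if_cong)
qed

lemma std_volume_None_repeat: "std_volume (case_option (u k) u) = 0"
  unfolding std_volume_rows
  by (rule det_identical_rows[of None "Some k"]) (auto simp: row_def vec_eq_iff)

context hessian_mfd
begin

lemma dir_deriv_linear:
  "dir_deriv (u + v) \<phi> = dir_deriv u \<phi> + dir_deriv v \<phi>" "dir_deriv (c *\<^sub>f u) \<phi> = c *\<^sub>R dir_deriv u \<phi>"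
  "dir_deriv (u - v) \<phi> = dir_deriv u \<phi> - dir_deriv v \<phi>"
  by (simp_all add: dir_deriv_def vec_eq_iff fscale_def)

lemma smooth_dir_deriv:
  "X \<in> vector_fields A \<Longrightarrow> smooth_map A \<phi> \<Longrightarrow> smooth_map A (\<lambda>q. dir_deriv (X q) \<phi> $ i)"
  for \<phi> :: "'a \<Rightarrow> real ^ 'k::finite"
  by (simp add: dir_deriv_def) (blast intro: vfD(2) dest: smooth_map_vec[THEN iffD1])

text \<open>The product rule is applied row by row. In a row \<open>Some k\<close> the Gauss formula
  adds a multiple of \<xi>, which repeats the row \<open>None\<close> and drops out. The row
  \<open>None\<close> itself contributes the derivative of \<xi>.\<close>

lemma induced_volume_derivative:
  fixes \<phi> \<xi> :: "'a \<Rightarrow> real ^ 'n option"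
  assumes s: "smooth_map A \<phi>" "smooth_map A \<xi>" and X: "X \<in> vector_fields A" and Y: "\<And>k. Y k \<in> vector_fields A"
    and gauss: "\<And>k. dir_deriv (X p) (\<lambda>q. dir_deriv (Y k q) \<phi>) = dir_deriv (nab X (Y k) p) \<phi> + g p (X p) (Y k p) *\<^sub>R \<xi> p"
  shows "X p (\<lambda>q. induced_volume \<phi> \<xi> q (\<lambda>k. Y k q)) =
    std_volume (case_option (dir_deriv (X p) \<xi>) (\<lambda>k. dir_deriv (Y k p) \<phi>)) +
    (\<Sum>k\<in>UNIV. induced_volume \<phi> \<xi> p (\<lambda>j. (Y(k := nab X (Y k))) j p))"
proof -
  define m where "m i j q = case_option (\<xi> q) (\<lambda>k. dir_deriv (Y k q) \<phi>) i $ j" for i j q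
  have m: "smooth_map A (m i j)" for i j
    using smooth_dir_deriv[OF Y s(1)] s(2)[unfolded smooth_map_vec] by (cases i) (simp_all add: m_def[abs_def])
  have m': "m None j = (\<lambda>q. \<xi> q $ j)" "m (Some k) j = (\<lambda>q. dir_deriv (Y k q) \<phi> $ j)" for j k
    by (simp_all add: m_def[abs_def])
  define M where "M k = det (\<chi> i j. if i = k then X p (m i j) else m i j p)" for k
  have "(\<lambda>q. induced_volume \<phi> \<xi> q (\<lambda>k. Y k q)) = (\<lambda>q. det (\<chi> i j. m i j q))"
    by (simp add: induced_volume_def std_volume_rows m_def fun_eq_iff)
  then have "X p (\<lambda>q. induced_volume \<phi> \<xi> q (\<lambda>k. Y k q)) = (\<Sum>k\<in>UNIV. M k)"
    using tangent_det[OF vfD(1)[OF X] m, of p] by (simp add: M_def)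
  also have "\<dots> = M None + (\<Sum>k\<in>UNIV. M (Some k))"
    by (simp add: UNIV_option_conv sum.reindex)
  also have "M None = std_volume (case_option (dir_deriv (X p) \<xi>) (\<lambda>k. dir_deriv (Y k p) \<phi>))"
    unfolding M_def std_volume_rows
    by (rule arg_cong[where f=det]) (auto simp: vec_eq_iff m' dir_deriv_def split: option.splits)
  also have "(\<Sum>k\<in>UNIV. M (Some k)) = (\<Sum>k\<in>UNIV. induced_volume \<phi> \<xi> p (\<lambda>j. (Y(k := nab X (Y k))) j p))"
  proof (rule sum.cong[OF refl])
    fix k
    define c where "c = case_option (\<xi> p) (\<lambda>k. dir_deriv (Y k p) \<phi>)"
    define u where "u = dir_deriv (nab X (Y k) p) \<phi>"
    have "M (Some k) = det (\<chi> i. if i = Some k then dir_deriv (X p) (\<lambda>q. dir_deriv (Y k q) \<phi>) else c i)"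
      unfolding M_def
      by (rule arg_cong[where f=det]) (auto simp: vec_eq_iff m' dir_deriv_def[of "X p"] c_def split: option.splits)
    also have "\<dots> = det (\<chi> i. if i = Some k then u + g p (X p) (Y k p) *\<^sub>R \<xi> p else c i)"
      unfolding gauss u_def by (rule refl)
    also have "\<dots> = det (\<chi> i. if i = Some k then u else c i) + det (\<chi> i. if i = Some k then g p (X p) (Y k p) *\<^sub>R \<xi> p else c i)"
      by (rule det_row_add)
    also have "det (\<chi> i. if i = Some k then g p (X p) (Y k p) *\<^sub>R \<xi> p else c i) =
        g p (X p) (Y k p) * det (\<chi> i. if i = Some k then \<xi> p else c i)"
      using det_row_mul[of "Some k" "g p (X p) (Y k p)" "\<lambda>_. \<xi> p" c]
      by (simp add: scalar_mult_eq_scaleR[symmetric] cong: if_cong)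
    also have "det (\<chi> i. if i = Some k then \<xi> p else c i) = 0"
      by (rule det_identical_rows[of None "Some k"]) (auto simp: row_def c_def vec_eq_iff)
    also have "det (\<chi> i. if i = Some k then u else c i) = induced_volume \<phi> \<xi> p (\<lambda>j. (Y(k := nab X (Y k))) j p)"
      unfolding induced_volume_def std_volume_rows
      by (rule arg_cong[where f=det]) (auto simp: vec_eq_iff c_def u_def split: option.splits)
    finally show "M (Some k) = induced_volume \<phi> \<xi> p (\<lambda>j. (Y(k := nab X (Y k))) j p)" by simp
  qed
  finally show ?thesis .
qed

text \<open>Second derivatives of \<phi> along Z are compared in two orders. The standard connection
  and \<nabla> are both flat, so only terms with \<open>S\<close> and with \<xi> remain, and
  transversality makes each of the two parts vanish.\<close>

lemma flat_gauss_equation: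
  fixes \<phi> \<xi> :: "'a \<Rightarrow> real ^ 'n option"
  assumes ai: "affine_immersion A \<phi> \<xi> nab g S \<tau>" and \<tau>: "\<And>v. v \<in> tangent_space A p \<Longrightarrow> \<tau> p v = 0"
    and v: "u \<in> tangent_space A p" "v \<in> tangent_space A p" "w \<in> tangent_space A p"
  shows "g p u w *\<^sub>f S p v = g p v w *\<^sub>f S p u"
proof -
  have im: "immersion A \<phi>" and tr: "transversal A \<phi> \<xi>"
    and gauss: "\<And>X Y p. X \<in> vector_fields A \<Longrightarrow> Y \<in> vector_fields A \<Longrightarrow>
      dir_deriv (X p) (\<lambda>q. dir_deriv (Y q) \<phi>) = dir_deriv (nab X Y p) \<phi> + g p (X p) (Y p) *\<^sub>R \<xi> p"
    and ST: "\<And>p v. v \<in> tangent_space A p \<Longrightarrow> S p v \<in> tangent_space A p"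
    and shape: "\<And>p v. v \<in> tangent_space A p \<Longrightarrow> dir_deriv v \<xi> = - dir_deriv (S p v) \<phi> + \<tau> p v *\<^sub>R \<xi> p"
    using ai unfolding affine_immersion_def by blast+
  obtain V x a r b where c: "hessian_coord A nab g V x a r b" "p \<in> coord.U V x a r"
    using ex_hessian_coord_at[of p] by (elim exE conjE)
  interpret hessian_coord A nab g V x a r b by (rule c(1))
  obtain X where X: "X \<in> vector_fields A" "X p = u" using ex_vf[OF v(1) c(2)] by blast
  obtain Y where Y: "Y \<in> vector_fields A" "Y p = v" using ex_vf[OF v(2) c(2)] by blast
  obtain Z where Z: "Z \<in> vector_fields A" "Z p = w" using ex_vf[OF v(3) c(2)] by blast
  have s: "smooth_map A (\<lambda>q. \<phi> q $ i)" "smooth_map A (\<lambda>q. \<xi> q $ i)" for i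
    using im tr by (auto simp: immersion_def transversal_def smooth_map_vec)
  have gaussi: "X q (\<lambda>s. Y s (\<lambda>t. \<phi> t $ i)) = nab X Y q (\<lambda>t. \<phi> t $ i) + g q (X q) (Y q) * \<xi> q $ i"
    if "X \<in> vector_fields A" "Y \<in> vector_fields A" for X Y q i
    using arg_cong[OF gauss[OF that], of "\<lambda>y. y $ i" q] by (simp add: dir_deriv_def)
  have second: "X p (\<lambda>q. Y q (\<lambda>s. Z s (\<lambda>t. \<phi> t $ i))) = nab X (nab Y Z) p (\<lambda>t. \<phi> t $ i) +
      (g p (X p) (nab Y Z p) + X p (\<lambda>q. g q (Y q) (Z q))) * \<xi> p $ i - g p (Y p) (Z p) * S p (X p) (\<lambda>t. \<phi> t $ i)"
    if X: "X \<in> vector_fields A" and Y: "Y \<in> vector_fields A" for X Y i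
  proof -
    note Xp = vfD(1)[OF X, of p]
    have "X p (\<lambda>q. Y q (\<lambda>s. Z s (\<lambda>t. \<phi> t $ i))) = X p (\<lambda>q. nab Y Z q (\<lambda>t. \<phi> t $ i) + g q (Y q) (Z q) * \<xi> q $ i)"
      by (simp add: gaussi[OF Y Z(1)])
    also have "\<dots> = X p (\<lambda>q. nab Y Z q (\<lambda>t. \<phi> t $ i)) + X p (\<lambda>q. g q (Y q) (Z q) * \<xi> q $ i)"
      by (rule tangentD(1)[OF Xp vfD(2)[OF nab_vf[OF Y Z(1)] s(1)] smooth_map_mult[OF g_smooth[OF Y Z(1)] s(2)]])
    also have "X p (\<lambda>q. g q (Y q) (Z q) * \<xi> q $ i) =
        g p (Y p) (Z p) * X p (\<lambda>q. \<xi> q $ i) + \<xi> p $ i * X p (\<lambda>q. g q (Y q) (Z q))"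
      by (rule tangentD(3)[OF Xp g_smooth[OF Y Z(1)] s(2)])
    also have "X p (\<lambda>q. \<xi> q $ i) = - S p (X p) (\<lambda>t. \<phi> t $ i)"
      using arg_cong[OF shape[OF Xp], of "\<lambda>y. y $ i"] \<tau>[OF Xp] by (simp add: dir_deriv_def)
    finally show ?thesis by (simp add: gaussi[OF X nab_vf[OF Y Z(1)]] algebra_simps)
  qed
  have br: "lie_bracket X Y = nab X Y - nab Y X" using tf X(1) Y(1) unfolding torsionfree_def by metis
  have B: "lie_bracket X Y \<in> vector_fields A" unfolding br by (rule vf_diff[OF nab_vf[OF X(1) Y(1)] nab_vf[OF Y(1) X(1)]])
  \<comment> \<open>The coefficient of \<xi> in the difference of the two orders; \<open>D\<close>
    is the tangential part.\<close>
  define \<kappa> where "\<kappa> = g p (X p) (nab Y Z p) + X p (\<lambda>q. g q (Y q) (Z q)) - g p (Y p) (nab X Z p)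
    - Y p (\<lambda>q. g q (X q) (Z q)) - g p (lie_bracket X Y p) (Z p)"
  define D where "D = g p (X p) (Z p) *\<^sub>f S p (Y p) - g p (Y p) (Z p) *\<^sub>f S p (X p)"
  have DT: "D \<in> tangent_space A p"
    unfolding D_def using ST vfD(1)[OF X(1), of p] vfD(1)[OF Y(1), of p] by (intro tangent_lincomb) auto
  have "dir_deriv D \<phi> + \<kappa> *\<^sub>R \<xi> p = 0"
  proof (simp only: vec_eq_iff, rule allI)
    fix i
    have "(nab X (nab Y Z) - nab Y (nab X Z) - nab (lie_bracket X Y) Z) p (\<lambda>t. \<phi> t $ i) = 0"
      using fl X(1) Y(1) Z(1) unfolding flat_def by simp
    then have f: "nab X (nab Y Z) p (\<lambda>t. \<phi> t $ i) - nab Y (nab X Z) p (\<lambda>t. \<phi> t $ i) - nab (lie_bracket X Y) Z p (\<lambda>t. \<phi> t $ i) = 0"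
      by simp
    have "X p (\<lambda>q. Y q (\<lambda>s. Z s (\<lambda>t. \<phi> t $ i))) - Y p (\<lambda>q. X q (\<lambda>s. Z s (\<lambda>t. \<phi> t $ i))) =
        lie_bracket X Y p (\<lambda>s. Z s (\<lambda>t. \<phi> t $ i))"
      by (simp add: lie_bracket_def)
    also have "\<dots> = nab (lie_bracket X Y) Z p (\<lambda>t. \<phi> t $ i) + g p (lie_bracket X Y p) (Z p) * \<xi> p $ i"
      by (rule gaussi[OF B Z(1)])
    finally show "(dir_deriv D \<phi> + \<kappa> *\<^sub>R \<xi> p) $ i = 0 $ i"
      using f second[OF X(1) Y(1), of i] second[OF Y(1) X(1), of i]
      by (simp add: dir_deriv_def D_def \<kappa>_def fscale_def algebra_simps)
  qed
  moreover have "\<kappa> = 0"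
  proof (rule ccontr)
    assume k: "\<kappa> \<noteq> 0"
    have "\<xi> p = - (1 / \<kappa>) *\<^sub>R dir_deriv D \<phi>"
    proof -
      have "\<kappa> *\<^sub>R \<xi> p = - dir_deriv D \<phi>" using calculation by (simp add: eq_neg_iff_add_eq_0 add.commute)
      then have "(1 / \<kappa>) *\<^sub>R (\<kappa> *\<^sub>R \<xi> p) = (1 / \<kappa>) *\<^sub>R (- dir_deriv D \<phi>)" by simp
      then show ?thesis using k by simp
    qed
    then have "\<xi> p = dir_deriv ((- (1 / \<kappa>)) *\<^sub>f D) \<phi>" by (simp only: dir_deriv_linear)
    then show False using tr tangent_lincomb(2)[OF DT DT] unfolding transversal_def by blast
  qed
  ultimately have "dir_deriv D \<phi> = 0" by simp
  then have "D = 0" using im DT unfolding immersion_def by blast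
  then show ?thesis by (simp add: D_def X Y Z)
qed

end

section \<open>Special Kaehler manifolds\<close>

locale special_kaehler_mfd =
  fixes A :: "('a::{t2_space, second_countable_topology}, 'm::finite + 'm) chart set"
    and J :: "'a \<Rightarrow> 'a tangent \<Rightarrow> 'a tangent" and nab :: "'a conn"
    and g :: "'a \<Rightarrow> 'a tangent \<Rightarrow> 'a tangent \<Rightarrow> real"
  assumes sk: "special_kaehler A J nab g" and sc: "simply_connected (UNIV :: 'a set)"
begin

lemma kaehlerD:
  "smooth_atlas A" "integrable_complex_structure A J" "pseudo_riemannian_metric A g"
  "v \<in> tangent_space A p \<Longrightarrow> w \<in> tangent_space A p \<Longrightarrow> g p (J p v) (J p w) = g p v w"
  using sk unfolding special_kaehler_def kaehler_manifold_def by blast+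

lemma J_facts:
  "v \<in> tangent_space A p \<Longrightarrow> J p v \<in> tangent_space A p"
  "v \<in> tangent_space A p \<Longrightarrow> w \<in> tangent_space A p \<Longrightarrow> J p (v + w) = J p v + J p w"
  "v \<in> tangent_space A p \<Longrightarrow> J p (c *\<^sub>f v) = c *\<^sub>f J p v"
  "v \<in> tangent_space A p \<Longrightarrow> J p (J p v) = - v"
  "X \<in> vector_fields A \<Longrightarrow> endo_app J X \<in> vector_fields A"
  using kaehlerD(2) unfolding integrable_complex_structure_def endo_field_def by blast+

lemma specialD:
  "connection A nab" "torsionfree A nab" "flat A nab" "parallel_bilinear A nab (kaehler_form J g)"
  "X \<in> vector_fields A \<Longrightarrow> Y \<in> vector_fields A \<Longrightarrow> cov_deriv_endo nab J X Y = cov_deriv_endo nab J Y X"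
  using sk unfolding special_kaehler_def by auto

lemma metricD:
  "bilinear_field A g" "nondegenerate A g"
  "v \<in> tangent_space A p \<Longrightarrow> w \<in> tangent_space A p \<Longrightarrow> g p v w = g p w v"
  using kaehlerD(3) unfolding pseudo_riemannian_metric_def by blast+

end

sublocale special_kaehler_mfd \<subseteq> smooth_mfd A
  by unfold_locales (rule kaehlerD(1))

context special_kaehler_mfd
begin

text \<open>Since g(Y, Z) = \<omega>(JY, Z), the condition \<nabla>\<omega> = 0 expresses the
  derivative of \<open>g\<close> through \<nabla>(JY) and \<nabla>Z. Invariance of \<open>g\<close>
  under J cancels the term with \<nabla>Z.\<close>

lemma metric_derivative:
  assumes X: "X \<in> vector_fields A" and Y: "Y \<in> vector_fields A" and Z: "Z \<in> vector_fields A"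
  shows "X p (\<lambda>q. g q (Y q) (Z q)) - g p (nab X Y p) (Z p) - g p (Y p) (nab X Z p) =
    g p (cov_deriv_endo nab J X Y p) (J p (Z p))"
proof -
  note JY = J_facts(5)[OF Y]
  have nv: "nab X Y \<in> vector_fields A" if "X \<in> vector_fields A" "Y \<in> vector_fields A" for X Y
    using specialD(1) that unfolding connection_def by blast
  note T = vfD(1)[OF X, of p] vfD(1)[OF Y, of p] vfD(1)[OF Z, of p] vfD(1)[OF nv[OF X Y], of p]
    vfD(1)[OF nv[OF X Z], of p] vfD(1)[OF nv[OF X JY], of p]
  have "(\<lambda>q. g q (Y q) (Z q)) = (\<lambda>q. kaehler_form J g q (endo_app J Y q) (Z q))"
    using kaehlerD(4)[OF vfD(1)[OF Y] vfD(1)[OF Z]] by (simp add: kaehler_form_def endo_app_def)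
  then have "X p (\<lambda>q. g q (Y q) (Z q)) =
      kaehler_form J g p (nab X (endo_app J Y) p) (Z p) + kaehler_form J g p (endo_app J Y p) (nab X Z p)"
    using specialD(4) X JY Z unfolding parallel_bilinear_def by simp
  also have "\<dots> = g p (nab X (endo_app J Y) p) (J p (Z p)) + g p (Y p) (nab X Z p)"
    using kaehlerD(4)[OF T(2,5)] by (simp add: kaehler_form_def endo_app_def)
  also have "g p (nab X Y p) (Z p) = g p (J p (nab X Y p)) (J p (Z p))"
    using kaehlerD(4)[OF T(4,3)] by simp
  moreover have "g p (u - w) z = g p u z - g p w z"
    if "u \<in> tangent_space A p" "w \<in> tangent_space A p" "z \<in> tangent_space A p" for u w z
  proof -
    have l: "g p (u + v) z = g p u z + g p v z" if "u \<in> tangent_space A p" "v \<in> tangent_space A p" "z \<in> tangent_space A p" for u v z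
      using metricD(1) that unfolding bilinear_field_def by blast
    have "u - w + w = u" by simp
    then show ?thesis using l[OF tangent_lincomb(4)[OF that(1,2)] that(2,3)] by simp
  qed
  ultimately show ?thesis
    using T J_facts(1) by (simp add: cov_deriv_endo_def endo_app_def)
qed

end

text \<open>By \<open>metric_derivative\<close> the Codazzi equation follows from the symmetry of
  \<nabla>J in its two arguments, which is the condition \<open>d^\<nabla> J = 0\<close>.\<close>

sublocale special_kaehler_mfd \<subseteq> hessian_mfd A nab g
  by unfold_locales
    (use specialD metricD metric_derivative in \<open>simp_all\<close>)

context special_kaehler_mfd
begin

lemma conn_UNIV: "connected (UNIV :: 'a set)"
proof -
  have "path_connected (UNIV :: 'a set)"
    unfolding path_connected_def
    using ex_path_if_simply_connected[OF sc] by (auto simp: pathstart_def pathfinish_def)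
  then show ?thesis by (rule path_connected_imp_connected)
qed

text \<open>A relation Jv = l v would give l * l = -1, so v and Jv are independent. Nondegeneracy
  then separates them, even when v is a null vector of the indefinite metric.\<close>

lemma ex_kernel_vector:
  assumes v: "v \<in> tangent_space A p" "v \<noteq> 0"
  shows "\<exists>z\<in>tangent_space A p. g p v z = 0 \<and> g p (J p v) z \<noteq> 0"
proof -
  have nd: "\<exists>z\<in>tangent_space A p. g p u z \<noteq> 0" if "u \<in> tangent_space A p" "u \<noteq> 0" for u
    using metricD(2) that unfolding nondegenerate_def by blast
  obtain z0 where z0: "z0 \<in> tangent_space A p" "g p v z0 \<noteq> 0" using nd[OF v] by blast
  \<comment> \<open>\<open>l\<close> makes \<open>u\<close> orthogonal to \<open>z0\<close>.
    Correcting \<open>z1\<close> by a multiple of \<open>z0\<close>, in order to make it orthogonal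
    to \<open>v\<close>, therefore leaves its product with \<open>u\<close> unchanged.\<close>
  define l where "l = g p (J p v) z0 / g p v z0"
  define u where "u = J p v + (- l) *\<^sub>f v"
  note Jv = J_facts(1)[OF v(1)]
  have u: "u \<in> tangent_space A p" unfolding u_def using Jv v(1) by (intro tangent_lincomb) auto
  have "u \<noteq> 0"
  proof
    assume u0: "u = 0"
    have Jf: "J p v f = l * v f" for f using fun_cong[OF u0, of f] by (simp add: u_def fscale_def)
    then have "J p v = l *\<^sub>f v" by (auto simp: fun_eq_iff fscale_def)
    then have e: "- v = l *\<^sub>f J p v" using J_facts(3,4)[OF v(1)] by metis
    have "(1 + l * l) * v f = 0" for f
      using arg_cong[OF e, of "\<lambda>u. u f"] Jf[of f] unfolding fscale_def uminus_apply by (simp add: algebra_simps)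
    moreover have "1 + l * l \<noteq> 0" by (metis add_pos_nonneg less_irrefl zero_le_square zero_less_one)
    ultimately have "v f = 0" for f by simp
    then show False using v(2) by (auto simp: fun_eq_iff)
  qed
  then obtain z1 where z1: "z1 \<in> tangent_space A p" "g p u z1 \<noteq> 0" using nd[OF u] by blast
  define z where "z = z1 + (- (g p v z1 / g p v z0)) *\<^sub>f z0"
  have z: "z \<in> tangent_space A p" unfolding z_def using z0 z1 by (intro tangent_lincomb) auto
  have gz: "g p w z = g p w z1 - g p v z1 / g p v z0 * g p w z0" if "w \<in> tangent_space A p" for w
    unfolding z_def using z0(1) z1(1) that by (simp add: g_add g_scale tangent_lincomb(2)[OF z0(1) z0(1)])
  have gu: "g p u w = g p (J p v) w - l * g p v w" if "w \<in> tangent_space A p" for w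
    unfolding u_def using Jv v(1) that by (simp add: g_add g_scale tangent_lincomb(2)[OF v(1) v(1)])
  have "g p v z = 0" using gz[OF v(1)] z0(2) by simp
  moreover have "g p u z = g p u z1" using gz[OF u] gu[OF z0(1)] z0(2) by (simp add: l_def)
  then have "g p (J p v) z \<noteq> 0" using gu[OF z] calculation z1(2) by simp
  ultimately show ?thesis using z by blast
qed

end

section \<open>Holomorphic coordinates, Gram determinants and the orientation\<close>

locale complex_coord = special_kaehler_mfd A J nab g + hessian_coord A nab g V x a r b
  for A :: "('a::{t2_space, second_countable_topology}, 'm::finite + 'm) chart set"
    and J nab g V x a r b +
  assumes J_chart: "\<And>q w. q \<in> V \<Longrightarrow> J q (chart_vector A (V, x) q w) = chart_vector A (V, x) q (std_J w)"
begin

definition comp :: "'a tangent \<Rightarrow> real ^ ('m + 'm)" where "comp v = (\<chi> i. v (xt i))"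

lemma chart_vector_apply:
  assumes q: "q \<in> U" and f: "smooth_map A f"
  shows "chart_vector A (V, x) q w f = (\<Sum>i\<in>UNIV. w $ i * d i f q)"
  using D_expand[OF f x_U(1)[OF q], of w] x_U(2)[OF q] f by (simp add: chart_vector_def rep_def)

lemma chart_vector_comp:
  assumes q: "q \<in> U" and v: "v \<in> tangent_space A q"
  shows "v = chart_vector A (V, x) q (comp v)"
proof
  fix f show "v f = chart_vector A (V, x) q (comp v) f"
  proof (cases "smooth_map A f")
    case True
    then show ?thesis using chart_vector_apply[OF q True] tangent_expand[OF v q True] by (simp add: comp_def)
  qed (simp add: chart_vector_def tangent_nonsmooth[OF v])
qed

lemma comp_J:
  assumes q: "q \<in> U" and v: "v \<in> tangent_space A q"
  shows "comp (J q v) = std_J (comp v)"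
proof -
  have "J q v = chart_vector A (V, x) q (std_J (comp v))"
    using chart_vector_comp[OF q v] J_chart[OF U_V[OF q]] by metis
  then show ?thesis
    by (simp add: comp_def vec_eq_iff chart_vector_apply[OF q smooth_xt] d_xt[OF q] if_distrib cong: if_cong)
qed

lemma comp_E: "q \<in> U \<Longrightarrow> comp (E i q) = axis i 1"
  by (auto simp: comp_def vec_eq_iff E_xt axis_def)

lemma std_J_axis: "std_J (axis (Inl k) 1) = axis (Inr k) (1::real)" for k :: 'm
  by (auto simp: std_J_def vec_eq_iff axis_def split: sum.splits)

lemma J_E:
  assumes q: "q \<in> U"
  shows "J q (E (Inl k) q) = E (Inr k) q"
proof (rule tangent_eqI[OF J_facts(1)[OF E_tangent] E_tangent q])
  fix i
  have "comp (J q (E (Inl k) q)) = comp (E (Inr k) q)"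
    by (simp add: comp_J[OF q E_tangent] comp_E[OF q] std_J_axis)
  then show "J q (E (Inl k) q) (xt i) = E (Inr k) q (xt i)" by (simp add: comp_def vec_eq_iff)
qed

lemma frame_E:
  assumes q: "q \<in> U"
  shows "frame A q (\<lambda>i. E i q)"
  unfolding frame_def
proof (intro conjI allI ballI E_tangent)
  fix v assume v: "v \<in> tangent_space A q"
  show "\<exists>!c. v = (\<Sum>i\<in>UNIV. c i *\<^sub>f E i q)"
  proof (rule ex1I[of _ "\<lambda>i. v (xt i)"])
    show "v = (\<Sum>i\<in>UNIV. v (xt i) *\<^sub>f E i q)" by (rule tangent_eq_sum[OF v q])
    fix c assume c: "v = (\<Sum>i\<in>UNIV. c i *\<^sub>f E i q)"
    show "c = (\<lambda>i. v (xt i))"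
    proof
      fix j
      have "v (xt j) = (\<Sum>i\<in>UNIV. c i * E i q (xt j))" by (subst c) (rule lincomb_apply)
      then show "c j = v (xt j)" by (simp add: E_xt[OF q] if_distrib cong: if_cong)
    qed
  qed
qed

definition cm :: "('m + 'm \<Rightarrow> 'a tangent) \<Rightarrow> real ^ ('m + 'm) ^ ('m + 'm)" where
  "cm X = (\<chi> i. comp (X i))"

lemma cm_apply:
  assumes q: "q \<in> U" and X: "\<And>i. X i \<in> tangent_space A q" and f: "\<And>k. smooth_map A (f k)"
  shows "(\<chi> i k. X i (f k)) = cm X ** (\<chi> l k. E l q (f k))"
  by (simp add: vec_eq_iff matrix_matrix_mult_def cm_def comp_def E_expand[OF X q f])

definition gm :: "'a \<Rightarrow> real ^ ('m + 'm) ^ ('m + 'm)" where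
  "gm q = (\<chi> i j. g q (E i q) (E j q))"

lemma det_gram:
  assumes q: "q \<in> U" and X: "\<And>i. X i \<in> tangent_space A q"
  shows "det (\<chi> i j. g q (X i) (X j)) = (det (cm X))\<^sup>2 * det (gm q)"
proof -
  have "(\<chi> i j. g q (X i) (X j)) = cm X ** gm q ** transpose (cm X)"
  proof (simp only: vec_eq_iff, intro allI)
    fix i j
    have "(cm X ** gm q ** transpose (cm X)) $ i $ j =
        (\<Sum>l\<in>UNIV. (\<Sum>k\<in>UNIV. X i (xt k) * g q (E k q) (E l q)) * X j (xt l))"
      by (simp add: matrix_matrix_mult_def transpose_def cm_def comp_def gm_def)
    also have "\<dots> = (\<Sum>k\<in>UNIV. \<Sum>l\<in>UNIV. X i (xt k) * X j (xt l) * g q (E k q) (E l q))"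
      unfolding sum_distrib_right by (subst sum.swap) (simp only: mult_ac)
    finally show "(\<chi> i j. g q (X i) (X j)) $ i $ j = (cm X ** gm q ** transpose (cm X)) $ i $ j"
      by (simp add: bilinear_field_expand[OF gb q X X])
  qed
  then show ?thesis by (simp add: det_mul power2_eq_square)
qed

lemma det_gm_nonzero:
  assumes q: "q \<in> U"
  shows "det (gm q) \<noteq> 0"
proof -
  have "u = 0" if u: "gm q *v u = 0" for u
  proof -
    define v where "v = (\<Sum>i\<in>UNIV. u $ i *\<^sub>f E i q)"
    have v: "v \<in> tangent_space A q"
      unfolding v_def using tangent_lincomb(2)[OF E_tangent E_tangent] by (intro tangent_sum_mem) blast
    have vx: "v (xt j) = u $ j" for j
    proof -
      have "v (xt j) = (\<Sum>i\<in>UNIV. u $ i * E i q (xt j))" unfolding v_def by (rule lincomb_apply)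
      then show ?thesis by (simp add: E_xt[OF q] if_distrib cong: if_cong)
    qed
    have "g q v w = 0" if w: "w \<in> tangent_space A q" for w
    proof -
      have "g q w v = (\<Sum>i\<in>UNIV. w (xt i) * (\<Sum>j\<in>UNIV. g q (E i q) (E j q) * u $ j))"
        by (simp add: bilinear_field_expand[OF gb q w v] vx sum_distrib_left mult_ac)
      also have "\<dots> = (\<Sum>i\<in>UNIV. w (xt i) * (gm q *v u) $ i)"
        by (simp add: matrix_vector_mult_def gm_def)
      finally show ?thesis using u g_sym[OF v w] by simp
    qed
    then have "v = 0" using metricD(2) v unfolding nondegenerate_def by blast
    then show ?thesis using vx by (simp add: vec_eq_iff)
  qed
  then show ?thesis using matrix_left_invertible_ker[of "gm q"] invertible_det_nz[of "gm q"] matrix_left_right_inverse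
    unfolding invertible_def by metis
qed

text \<open>A positive tuple arises from a complex frame by a matrix of positive determinant, and in
  holomorphic coordinates the determinant of the frame is a value of \<open>cdet\<close>.\<close>

lemma orientation_det_nonneg:
  assumes q: "q \<in> U" and X: "X \<in> complex_orientation A J q"
  shows "0 \<le> det (cm X)" "X i \<in> tangent_space A q"
proof -
  obtain e and m :: "real ^ ('m + 'm) ^ ('m + 'm)" where fr: "frame A q (case_sum e (\<lambda>k. J q (e k)))"
    and m: "det m > 0" and Xm: "\<And>j. X j = (\<Sum>i\<in>UNIV. (m $ i $ j) *\<^sub>f case_sum e (\<lambda>k. J q (e k)) i)"
    using X unfolding complex_orientation_def by blast
  define w where "w = case_sum e (\<lambda>k. J q (e k))"
  have w: "w i \<in> tangent_space A q" for i using fr by (simp add: frame_def w_def)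
  have e: "e k \<in> tangent_space A q" for k using w[of "Inl k"] by (simp add: w_def)
  show "X i \<in> tangent_space A q"
    unfolding Xm w_def[symmetric] using tangent_lincomb(2)[OF w w] by (intro tangent_sum_mem) blast
  have "X j (xt l) = (\<Sum>i\<in>UNIV. m $ i $ j * w i (xt l))" for j l
    unfolding Xm w_def[symmetric] by (rule lincomb_apply)
  then have "cm X = transpose m ** cm w"
    by (simp add: vec_eq_iff cm_def comp_def matrix_matrix_mult_def transpose_def)
  moreover have "cm w = (\<chi> i. case_sum (\<lambda>k. comp (e k)) (std_J \<circ> (\<lambda>k. comp (e k))) i)"
    unfolding cm_def w_def by (auto simp: vec_eq_iff comp_J[OF q e] split: sum.splits)
  then have "det (cm w) = cdet (\<lambda>k. comp (e k))" by (simp add: cdet_def)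
  ultimately show "0 \<le> det (cm X)" using m cdet_nonneg[of "\<lambda>k. comp (e k)"] by (simp add: det_mul)
qed

text \<open>The coordinate frame is itself of the form (e_k, J e_k), so the transposed component
  matrix is an admissible change of frame.\<close>

lemma orientation_if_det_pos:
  assumes q: "q \<in> U" and X: "\<And>i. X i \<in> tangent_space A q" and pos: "det (cm X) > 0"
  shows "X \<in> complex_orientation A J q"
proof -
  define e where "e k = E (Inl k) q" for k :: 'm
  have w: "case_sum e (\<lambda>k. J q (e k)) = (\<lambda>i. E i q)"
    by (auto simp: fun_eq_iff e_def J_E[OF q] split: sum.splits)
  have "X j = (\<Sum>i\<in>UNIV. (transpose (cm X) $ i $ j) *\<^sub>f E i q)" for j
    using tangent_eq_sum[OF X q] by (simp add: transpose_def cm_def comp_def)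
  then show ?thesis
    unfolding complex_orientation_def mem_Collect_eq
    by (intro exI[of _ e] exI[of _ "transpose (cm X)"]) (simp only: w frame_E[OF q] det_transpose pos simp_thms)
qed

text \<open>In matrices the hypothesis reads gm J = F w F^T, where F holds the derivatives of the
  functions along the frame. As det J is 1 or -1, the metric and its Kaehler form have the same
  determinant up to sign.\<close>

lemma det_gram_form:
  fixes w :: "real ^ ('m + 'm) ^ ('m + 'm)"
  assumes q: "q \<in> U"
    and form: "\<And>i j. kaehler_form J g q (E i q) (E j q) = (\<Sum>k\<in>UNIV. \<Sum>l\<in>UNIV. w $ k $ l * (E i q (f k) * E j q (f l)))"
  shows "\<bar>det (gm q)\<bar> = (det (\<chi> i k. E i q (f k)))\<^sup>2 * \<bar>det w\<bar>"
proof -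
  define F where "F = (\<chi> i k. E i q (f k))"
  have "(gm q ** matrix std_J) $ i $ j = (F ** w ** transpose F) $ i $ j" for i j
  proof -
    have "(F ** w ** transpose F) $ i $ j = (\<Sum>l\<in>UNIV. (\<Sum>k\<in>UNIV. E i q (f k) * w $ k $ l) * E j q (f l))"
      by (simp add: matrix_matrix_mult_def transpose_def F_def)
    also have "\<dots> = kaehler_form J g q (E i q) (E j q)"
      unfolding form sum_distrib_right by (subst sum.swap) (simp only: mult_ac)
    also have "\<dots> = (\<Sum>l\<in>UNIV. comp (J q (E j q)) $ l * g q (E i q) (E l q))"
      using bilinear_field_expand[OF gb q E_tangent J_facts(1)[OF E_tangent], of i j]
      by (simp add: kaehler_form_def E_xt[OF q] comp_def if_distrib[of "\<lambda>t. t * _ * _"] sum.swap[of _ UNIV UNIV] cong: if_cong)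
    also have "\<dots> = (gm q ** matrix std_J) $ i $ j"
      by (simp add: comp_J[OF q E_tangent] comp_E[OF q] matrix_matrix_mult_def matrix_def gm_def mult.commute)
    finally show ?thesis by simp
  qed
  then have "gm q ** matrix std_J = F ** w ** transpose F" by (simp add: vec_eq_iff)
  then have 1: "det (gm q) * det (matrix (std_J :: real ^ ('m + 'm) \<Rightarrow> _)) = (det F)\<^sup>2 * det w"
    by (metis (no_types, lifting) det_mul det_transpose mult.assoc mult.commute power2_eq_square)
  define M where "M = matrix (std_J :: real ^ ('m + 'm) \<Rightarrow> _)"
  have "M ** M = matrix (std_J \<circ> std_J)"
    unfolding M_def by (rule matrix_compose[OF std_J_linear std_J_linear, symmetric])
  also have "(std_J \<circ> std_J :: real ^ ('m + 'm) \<Rightarrow> _) = (*\<^sub>R) (-1)"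
    by (simp add: fun_eq_iff std_J_std_J)
  finally have "det M * det M = (-1) ^ CARD('m + 'm)" by (simp only: det_mul[symmetric] det_matrix_scaleR)
  \<comment> \<open>The dimension \<open>CARD('m + 'm)\<close> is even.\<close>
  then have "(det M)\<^sup>2 = 1" by (simp add: power2_eq_square)
  then have "\<bar>det (matrix (std_J :: real ^ ('m + 'm) \<Rightarrow> _))\<bar> = 1" by (auto simp: power2_eq_1_iff M_def)
  then have "\<bar>det (gm q)\<bar> = \<bar>det (gm q) * det (matrix (std_J :: real ^ ('m + 'm) \<Rightarrow> _))\<bar>" by (simp add: abs_mult)
  then show ?thesis by (simp add: 1 abs_mult F_def)
qed

end

context special_kaehler_mfd
begin

lemma ex_complex_coord: "\<exists>V x a r b. complex_coord A J nab g V x a r b \<and> p \<in> coord.U V x a r"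
proof -
  obtain c where c: "compatible_chart A c" "p \<in> fst c"
    "\<forall>q\<in>fst c. \<forall>w. J q (chart_vector A c q w) = chart_vector A c q (std_J w)"
    using kaehlerD(2) unfolding integrable_complex_structure_def by blast
  obtain V x where Vx: "c = (V, x)" by (cases c)
  obtain r b where h: "hessian_coord A nab g V x (x p) r b" "p \<in> coord.U V x (x p) r"
    using ex_hessian_coord[of V x p UNIV] c Vx by auto
  have "complex_coord A J nab g V x (x p) r b"
    by (intro complex_coord.intro complex_coord_axioms.intro special_kaehler_mfd_axioms h(1)) (use c Vx in auto)
  then show ?thesis using h(2) by blast
qed

section \<open>Affine functions adapted to the metric volume\<close>

definition affine_fun :: "('a \<Rightarrow> real) \<Rightarrow> bool" where
  "affine_fun f \<longleftrightarrow> smooth_map A f \<and> (\<forall>q. \<forall>X\<in>vector_fields A. \<forall>Y\<in>vector_fields A. hess f 0 q X Y = 0)"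

definition par :: "('a \<Rightarrow> 'a tangent \<Rightarrow> 'a tangent \<Rightarrow> real) \<Rightarrow> bool" where
  "par T \<longleftrightarrow> bilinear_field A T \<and> parallel_bilinear A nab T"

lemma par_kaehler: "par (kaehler_form J g)"
proof -
  have "kaehler_form J g q u v = g q u (J q v)" for q u v by (simp add: kaehler_form_def)
  then have "bilinear_field A (kaehler_form J g)"
    unfolding bilinear_field_def
    using J_facts(1,2,3) g_add g_scale g_smooth[OF _ J_facts(5)] by (auto simp: endo_app_def)
  then show ?thesis using specialD(4) by (simp add: par_def)
qed

lemma par_diff:
  assumes T: "par T" "par S"
  shows "par (\<lambda>q u v. T q u v - c * S q u v)"
proof -
  have sm: "smooth_map A (\<lambda>q. T q (Y q) (Z q))" "smooth_map A (\<lambda>q. S q (Y q) (Z q))"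
    if "Y \<in> vector_fields A" "Z \<in> vector_fields A" for Y Z
    using T that unfolding par_def bilinear_field_def by blast+
  have lin: "R p (u + v) w = R p u w + R p v w \<and> R p (k *\<^sub>f u) w = k * R p u w \<and>
        R p w (u + v) = R p w u + R p w v \<and> R p w (k *\<^sub>f u) = k * R p w u"
    if "par R" "u \<in> tangent_space A p" "v \<in> tangent_space A p" "w \<in> tangent_space A p" for R p u v w k
    using that unfolding par_def bilinear_field_def by blast
  have p: "X p (\<lambda>q. R q (Y q) (Z q)) = R p (nab X Y p) (Z p) + R p (Y p) (nab X Z p)"
    if "par R" "X \<in> vector_fields A" "Y \<in> vector_fields A" "Z \<in> vector_fields A" for R X Y Z p
    using that unfolding par_def parallel_bilinear_def by blast
  have "bilinear_field A (\<lambda>q u v. T q u v - c * S q u v)"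
    unfolding bilinear_field_def
    using lin[OF T(1)] lin[OF T(2)] sm
    by (auto simp: algebra_simps intro!: smooth_map_diff smooth_map_mult smooth_map_const)
  moreover have "parallel_bilinear A nab (\<lambda>q u v. T q u v - c * S q u v)"
    unfolding parallel_bilinear_def
  proof (intro ballI allI)
    fix X Y Z p assume X: "X \<in> vector_fields A" "Y \<in> vector_fields A" "Z \<in> vector_fields A"
    have "X p (\<lambda>q. T q (Y q) (Z q) - c * S q (Y q) (Z q)) = X p (\<lambda>q. T q (Y q) (Z q)) - c * X p (\<lambda>q. S q (Y q) (Z q))"
      using tangent_diff[OF vfD(1)[OF X(1)] sm(1)[OF X(2,3)] smooth_map_mult[OF smooth_map_const[where c=c] sm(2)[OF X(2,3)]]]
        tangentD(2)[OF vfD(1)[OF X(1)] sm(2)[OF X(2,3)] sm(2)[OF X(2,3)], where c=c] by simp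
    then show "X p (\<lambda>q. T q (Y q) (Z q) - c * S q (Y q) (Z q)) =
        T p (nab X Y p) (Z p) - c * S p (nab X Y p) (Z p) + (T p (Y p) (nab X Z p) - c * S p (Y p) (nab X Z p))"
      by (simp add: p[OF T(1) X] p[OF T(2) X] algebra_simps)
  qed
  ultimately show ?thesis by (simp add: par_def)
qed

lemma par_affine:
  assumes f: "affine_fun f" "affine_fun h"
  shows "par (\<lambda>q u v. u f * v h)"
proof -
  have s: "smooth_map A f" "smooth_map A h" using f by (auto simp: affine_fun_def)
  have p: "X p (\<lambda>q. Y q f) = nab X Y p f" "X p (\<lambda>q. Y q h) = nab X Y p h"
    if "X \<in> vector_fields A" "Y \<in> vector_fields A" for X Y p
    using f that by (auto simp: affine_fun_def hess_def)
  have "smooth_map A (\<lambda>q. X q f * Y q h)" if "X \<in> vector_fields A" "Y \<in> vector_fields A" for X Y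
    by (rule smooth_map_mult[OF vfD(2)[OF that(1) s(1)] vfD(2)[OF that(2) s(2)]])
  then have "bilinear_field A (\<lambda>q u v. u f * v h)"
    unfolding bilinear_field_def by (simp add: fscale_def algebra_simps)
  moreover have "parallel_bilinear A nab (\<lambda>q u v. u f * v h)"
    unfolding parallel_bilinear_def
  proof (intro ballI allI)
    fix X Y Z q assume X: "X \<in> vector_fields A" "Y \<in> vector_fields A" "Z \<in> vector_fields A"
    show "X q (\<lambda>q. Y q f * Z q h) = nab X Y q f * Z q h + Y q f * nab X Z q h"
      using tangentD(3)[OF vfD(1)[OF X(1)] vfD(2)[OF X(2) s(1)] vfD(2)[OF X(3) s(2)], of q]
      unfolding p(1)[OF X(1,2)] p(2)[OF X(1,3)] by (simp add: mult.commute)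
  qed
  ultimately show ?thesis by (simp add: par_def)
qed

text \<open>Tensor products of differentials of affine functions are parallel. They are subtracted
  from \<omega> one index pair at a time, with \<open>par_diff\<close> as the induction
  step.\<close>

lemma par_form:
  fixes f :: "'k::finite \<Rightarrow> 'a \<Rightarrow> real" and w :: "real ^ 'k ^ 'k"
  assumes f: "\<And>k. affine_fun (f k)"
  shows "par (\<lambda>q u v. kaehler_form J g q u v - (\<Sum>k\<in>UNIV. \<Sum>l\<in>UNIV. w $ k $ l * (u (f k) * v (f l))))"
proof -
  have "par (\<lambda>q u v. kaehler_form J g q u v - (\<Sum>(k, l)\<in>I. w $ k $ l * (u (f k) * v (f l))))" if "finite I" for I
    using that
  proof (induction I)
    case empty
    then show ?case using par_kaehler by simp
  next
    case (insert i I)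
    obtain k l where i: "i = (k, l)" by (cases i)
    show ?case
      using par_diff[OF insert.IH par_affine[OF f f], of "w $ k $ l" k l] insert.hyps
      by (simp add: i algebra_simps)
  qed
  from this[OF finite[of UNIV]] show ?thesis by (simp add: sum.cartesian_product UNIV_Times_UNIV[symmetric] del: UNIV_Times_UNIV)
qed

text \<open>Expressed through some oriented frame, so that the notion is independent of charts and
  can be carried from one chart to the next.\<close>

definition positive_at :: "('m + 'm \<Rightarrow> 'a \<Rightarrow> real) \<Rightarrow> 'a \<Rightarrow> bool" where
  "positive_at f q \<longleftrightarrow> (\<exists>X\<in>complex_orientation A J q. det (\<chi> i k. X i (f k)) > 0)"

end

context complex_coord
begin

lemma cm_E: "q \<in> U \<Longrightarrow> cm (\<lambda>i. E i q) = mat 1"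
  by (simp add: cm_def comp_E vec_eq_iff mat_def axis_def)

lemma positive_at_iff:
  assumes q: "q \<in> U" and f: "\<And>k. smooth_map A (f k)"
  shows "positive_at f q \<longleftrightarrow> det (\<chi> i k. E i q (f k)) > 0"
proof
  assume "positive_at f q"
  then obtain X where X: "X \<in> complex_orientation A J q" "det (\<chi> i k. X i (f k)) > 0"
    unfolding positive_at_def by blast
  have "det (\<chi> i k. X i (f k)) = det (cm X) * det (\<chi> i k. E i q (f k))"
    by (simp only: cm_apply[OF q orientation_det_nonneg(2)[OF q X(1)] f] det_mul)
  then show "det (\<chi> i k. E i q (f k)) > 0"
    using X(2) orientation_det_nonneg(1)[OF q X(1)] by (simp add: zero_less_mult_iff)
next
  assume "det (\<chi> i k. E i q (f k)) > 0"
  moreover have "(\<lambda>i. E i q) \<in> complex_orientation A J q"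
    by (rule orientation_if_det_pos[OF q E_tangent]) (simp add: cm_E[OF q])
  ultimately show "positive_at f q" unfolding positive_at_def by (rule bexI[where x="\<lambda>i. E i q"])
qed

text \<open>The determinant of the derivatives is continuous and nowhere zero on the connected set
  \<open>U\<close>, so the intermediate value theorem fixes its sign.\<close>

lemma positive_at_locally_constant:
  assumes f: "\<And>k. smooth_map A (f k)" and nz: "\<And>q. q \<in> U \<Longrightarrow> det (\<chi> i k. E i q (f k)) \<noteq> 0"
    and q: "q \<in> U" and s: "s \<in> U" and pos: "positive_at f q"
  shows "positive_at f s"
proof (rule ccontr)
  assume n: "\<not> positive_at f s"
  define D where "D t = det (\<chi> i k. E i t (f k))" for t
  have "smooth_map A D" unfolding D_def by (intro smooth_map_det smooth_E f)
  then have "continuous_on (ball a r) (rep D)" by (rule continuous_rep)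
  then have "connected (rep D ` ball a r)" by (intro connected_continuous_image) (auto intro: convex_connected)
  moreover have "D s \<in> rep D ` ball a r" "D q \<in> rep D ` ball a r"
    using x_U(1)[OF s] x_U(1)[OF q] rep_x[OF U_V[OF s], of D] rep_x[OF U_V[OF q], of D] by (metis imageI)+
  moreover have "D s \<le> 0" "0 \<le> D q"
    using n pos by (simp_all add: positive_at_iff[OF s f] positive_at_iff[OF q f] D_def)
  ultimately have "0 \<in> rep D ` ball a r" by (rule connectedD_interval)
  then obtain z where z: "z \<in> ball a r" "D (inv_x z) = 0" by (auto simp: rep_def)
  then show False using nz[OF inv_ball(1)[OF z(1)]] by (simp add: D_def)
qed

lemma tangent_zero:
  assumes q: "q \<in> U" and f: "\<And>k. smooth_map A (f k)" and nz: "det (\<chi> i k. E i q (f k)) \<noteq> 0"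
    and v: "v \<in> tangent_space A q" "\<And>k. v (f k) = 0"
  shows "v = 0"
proof -
  define F where "F = (\<chi> i k. E i q (f k))"
  have "transpose F *v comp v = 0"
    using v(2) by (simp add: vec_eq_iff matrix_vector_mult_def transpose_def F_def comp_def E_expand[OF v(1) q f] mult.commute)
  moreover have "invertible (transpose F)" using nz by (simp add: invertible_det_nz F_def)
  ultimately have "comp v = 0"
    using matrix_left_invertible_ker[of "transpose F"] unfolding invertible_def by blast
  then show ?thesis
    by (intro tangent_eqI[OF v(1) tangent_lincomb(3)[OF v(1) v(1)] q]) (simp add: comp_def vec_eq_iff)
qed

text \<open>Up to sign both sides are \<open>det (cm X)\<close> times the same positive factor. The
  orientation detects the sign of this determinant, and for dependent tuples both sides
  vanish.\<close>

lemma metric_volume_eq: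
  assumes q: "q \<in> U" and f: "\<And>k. smooth_map A (f k)" and pos: "det (\<chi> i k. E i q (f k)) > 0"
    and vol: "\<bar>det (gm q)\<bar> = (det (\<chi> i k. E i q (f k)))\<^sup>2" and X: "\<And>i. X i \<in> tangent_space A q"
  shows "metric_volume (complex_orientation A J) g q X = det (\<chi> i k. X i (f k))"
proof -
  define D where "D = det (\<chi> i k. E i q (f k))"
  have "sqrt \<bar>det (\<chi> i j. g q (X i) (X j))\<bar> = \<bar>det (cm X)\<bar> * D"
    using pos by (simp add: det_gram[OF q X] abs_mult vol real_sqrt_mult D_def)
  moreover have "det (\<chi> i k. X i (f k)) = det (cm X) * D"
    by (simp only: cm_apply[OF q X f] det_mul D_def)
  moreover have "X \<in> complex_orientation A J q" if "det (cm X) > 0"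
    using orientation_if_det_pos[OF q X that] .
  moreover have "X \<notin> complex_orientation A J q" if "det (cm X) < 0"
    using orientation_det_nonneg(1)[OF q, of X] that by auto
  ultimately show ?thesis
    by (cases "det (cm X)" "0 :: real" rule: linorder_cases) (simp_all add: metric_volume_def)
qed

lemma ex_adapted_functions:
  assumes p: "p \<in> U"
  shows "\<exists>f :: 'm + 'm \<Rightarrow> 'a \<Rightarrow> real. \<exists>w :: real ^ ('m + 'm) ^ ('m + 'm). (\<forall>k. affine_fun (f k)) \<and> positive_at f p \<and> \<bar>det w\<bar> = 1 \<and>
    (\<forall>q. \<forall>u\<in>tangent_space A q. \<forall>v\<in>tangent_space A q.
      kaehler_form J g q u v = (\<Sum>k\<in>UNIV. \<Sum>l\<in>UNIV. w $ k $ l * (u (f k) * v (f l))))"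
proof -
  define n where "n = CARD('m + 'm)"
  have n: "0 < n" by (simp add: n_def)
  \<comment> \<open>With this scale the determinant of the differentials at \<open>p\<close> is the
    square root of \<bar>det (gm p)\<bar>, which forces \<bar>det w\<bar> = 1.\<close>
  define s where "s = root n (sqrt \<bar>det (gm p)\<bar>)"
  have s: "0 < s" "s ^ n = sqrt \<bar>det (gm p)\<bar>"
    using n det_gm_nonzero[OF p] by (simp_all add: s_def)
  have "\<exists>f. affine_fun f \<and> (\<forall>i. d i f p = (if i = k then s else 0))" for k
    using ex_global[OF sc p, of "\<lambda>i. if i = k then s else 0" 0] unfolding affine_fun_def by blast
  then obtain f where f: "\<And>k. affine_fun (f k)" "\<And>k i. d i (f k) p = (if i = k then s else 0)" by metis
  have sm: "smooth_map A (f k)" for k using f(1) by (simp add: affine_fun_def)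
  have Ef: "E i p (f k) = (if i = k then s else 0)" for i k by (simp add: E_U[OF p sm] f(2))
  have detF: "det (\<chi> i k. E i p (f k)) = s ^ n"
  proof -
    have "(\<chi> i k. E i p (f k)) = matrix ((*\<^sub>R) s :: real ^ ('m + 'm) \<Rightarrow> _)"
      by (simp add: matrix_def vec_eq_iff Ef axis_def)
    then show ?thesis by (simp only: det_matrix_scaleR n_def)
  qed
  \<comment> \<open>The coefficients of \<omega> with respect to the differentials at
    \<open>p\<close>, where df_k is \<open>s\<close> times the k-th coordinate differential. Both
    \<omega> and the combination with these constants are parallel, so equality at \<open>p\<close>
    extends to the manifold.\<close>
  define w where "w = (\<chi> k l. kaehler_form J g p (E k p) (E l p) / s\<^sup>2)"
  define T where "T q u v = kaehler_form J g q u v - (\<Sum>k\<in>UNIV. \<Sum>l\<in>UNIV. w $ k $ l * (u (f k) * v (f l)))" for q u v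
  have T: "bilinear_field A T" "parallel_bilinear A nab T"
    using par_form[of f w, OF f(1)] by (simp_all add: par_def T_def[abs_def])
  have TE: "T p (E i p) (E j p) = 0" for i j
  proof -
    have "(\<Sum>k\<in>UNIV. \<Sum>l\<in>UNIV. w $ k $ l * (E i p (f k) * E j p (f l))) = w $ i $ j * (s * s)"
      by (simp add: Ef if_distrib[of "\<lambda>t. _ * t"] if_distrib[of "\<lambda>t. t * _"] cong: if_cong)
    then show ?thesis using s(1) by (simp add: T_def w_def power2_eq_square)
  qed
  have Tp: "T p u v = 0" if "u \<in> tangent_space A p" "v \<in> tangent_space A p" for u v
    by (simp add: bilinear_field_expand[OF T(1) p that] TE)
  have Tz: "T q u v = 0" if "u \<in> tangent_space A q" "v \<in> tangent_space A q" for q u v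
    by (rule parallel_zero[OF conn_UNIV T _ that]) (rule Tp)
  have form: "kaehler_form J g q u v = (\<Sum>k\<in>UNIV. \<Sum>l\<in>UNIV. w $ k $ l * (u (f k) * v (f l)))"
    if "u \<in> tangent_space A q" "v \<in> tangent_space A q" for q u v
    using Tz[OF that] unfolding T_def by (rule eq_iff_diff_eq_0[THEN iffD2])
  have "\<bar>det (gm p)\<bar> = (s ^ n)\<^sup>2 * \<bar>det w\<bar>"
    using det_gram_form[OF p, of w f, OF form[OF E_tangent E_tangent]] unfolding detF .
  then have "\<bar>det w\<bar> = 1" using s det_gm_nonzero[OF p] by simp
  moreover have "positive_at f p" unfolding positive_at_iff[OF p sm] detF using s(1) by simp
  ultimately show ?thesis using f(1) form by blast
qed

lemma adapted_volume:
  assumes q: "q \<in> U" and f: "\<And>k. affine_fun (f k)" and w: "\<bar>det w\<bar> = 1"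
    and form: "\<forall>u\<in>tangent_space A q. \<forall>v\<in>tangent_space A q.
      kaehler_form J g q u v = (\<Sum>k\<in>UNIV. \<Sum>l\<in>UNIV. w $ k $ l * (u (f k) * v (f l)))"
  shows "\<bar>det (gm q)\<bar> = (det (\<chi> i k. E i q (f k)))\<^sup>2" "det (\<chi> i k. E i q (f k)) \<noteq> 0"
proof -
  show 1: "\<bar>det (gm q)\<bar> = (det (\<chi> i k. E i q (f k)))\<^sup>2"
    using det_gram_form[OF q, of w f, OF form[rule_format, OF E_tangent E_tangent]] w by simp
  show "det (\<chi> i k. E i q (f k)) \<noteq> 0" using 1 det_gm_nonzero[OF q] by auto
qed

end

context special_kaehler_mfd
begin

text \<open>Positivity at one point spreads over the connected manifold. Together with \<bar>det
  w\<bar> = 1 it identifies the metric volume with the determinant of the differentials in every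
  chart.\<close>

lemma ex_volume_functions:
  "\<exists>f :: 'm + 'm \<Rightarrow> 'a \<Rightarrow> real. (\<forall>k. affine_fun (f k)) \<and>
    (\<forall>q. \<forall>v\<in>tangent_space A q. (\<forall>k. v (f k) = 0) \<longrightarrow> v = 0) \<and>
    (\<forall>q X. (\<forall>i. X i \<in> tangent_space A q) \<longrightarrow>
      metric_volume (complex_orientation A J) g q X = det (\<chi> i k. X i (f k)))"
proof -
  obtain p0 :: 'a where True by simp
  obtain V x a r b where c0: "complex_coord A J nab g V x a r b" "p0 \<in> coord.U V x a r"
    using ex_complex_coord[of p0] by (elim exE conjE)
  obtain f :: "'m + 'm \<Rightarrow> 'a \<Rightarrow> real" and w :: "real ^ ('m + 'm) ^ ('m + 'm)"
    where f: "\<forall>k. affine_fun (f k)" and pos0: "positive_at f p0" and w: "\<bar>det w\<bar> = 1"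
      and form: "\<forall>q. \<forall>u\<in>tangent_space A q. \<forall>v\<in>tangent_space A q.
        kaehler_form J g q u v = (\<Sum>k\<in>UNIV. \<Sum>l\<in>UNIV. w $ k $ l * (u (f k) * v (f l)))"
    using complex_coord.ex_adapted_functions[OF c0] by (elim exE conjE)
  have sm: "smooth_map A (f k)" for k using f by (simp add: affine_fun_def)
  have pos: "positive_at f q" for q
  proof (rule connected_induction_simple[OF conn_UNIV, of p0 q "positive_at f"])
    fix p :: 'a
    obtain V x a r b where c: "complex_coord A J nab g V x a r b" "p \<in> coord.U V x a r"
      using ex_complex_coord[of p] by (elim exE conjE)
    interpret complex_coord A J nab g V x a r b by (rule c(1))
    have step: "positive_at f s" if "q \<in> U" "s \<in> U" "positive_at f q" for q s
      by (rule positive_at_locally_constant[OF sm adapted_volume(2)[OF _ _ w] that]) (use f form in auto)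
    show "\<exists>T. openin (top_of_set UNIV) T \<and> p \<in> T \<and> (\<forall>x\<in>T. \<forall>y\<in>T. positive_at f x \<longrightarrow> positive_at f y)"
    proof (intro exI[of _ U] conjI ballI impI)
      show "openin (top_of_set UNIV) U" using open_U by simp
    qed (rule c(2) step, assumption?)+
  qed (rule UNIV_I pos0)+
  have "v = 0" if v: "v \<in> tangent_space A q" "\<forall>k. v (f k) = 0" for q v
  proof -
    obtain V x a r b where c: "complex_coord A J nab g V x a r b" "q \<in> coord.U V x a r"
      using ex_complex_coord[of q] by (elim exE conjE)
    interpret complex_coord A J nab g V x a r b by (rule c(1))
    show ?thesis
      by (rule tangent_zero[OF c(2) sm adapted_volume(2)[OF c(2) _ w]]) (use f form v in auto)
  qed
  moreover have "metric_volume (complex_orientation A J) g q X = det (\<chi> i k. X i (f k))"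
    if X: "\<forall>i. X i \<in> tangent_space A q" for q X
  proof -
    obtain V x a r b where c: "complex_coord A J nab g V x a r b" "q \<in> coord.U V x a r"
      using ex_complex_coord[of q] by (elim exE conjE)
    interpret complex_coord A J nab g V x a r b by (rule c(1))
    show ?thesis
      by (rule metric_volume_eq[OF c(2) sm positive_at_iff[OF c(2) sm, THEN iffD1, OF pos] adapted_volume(1)[OF c(2) _ w]])
        (use f form X in auto)
  qed
  ultimately show ?thesis using f by blast
qed

section \<open>Existence of the immersion\<close>

lemma ex_potential:
  "\<exists>F. smooth_map A F \<and> (\<forall>q. \<forall>X\<in>vector_fields A. \<forall>Y\<in>vector_fields A. hess F 1 q X Y = 0)"
proof -
  obtain p :: 'a where True by simp
  obtain V x a r b where c: "hessian_coord A nab g V x a r b" "p \<in> coord.U V x a r"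
    using ex_hessian_coord_at[of p] by (elim exE conjE)
  show ?thesis using hessian_coord.ex_global[OF c(1) sc c(2), of "\<lambda>_. 0" 1] by blast
qed

text \<open>The only term of \<open>induced_volume_derivative\<close> that could disturb parallelism
  contains the derivative of \<xi>, which is 0 here.\<close>

lemma parallel_volume_if_induced:
  fixes \<phi> \<xi> :: "'a \<Rightarrow> real ^ ('m + 'm) option"
  assumes s: "smooth_map A \<phi>" "smooth_map A \<xi>"
    and gauss: "\<And>X Y p. X \<in> vector_fields A \<Longrightarrow> Y \<in> vector_fields A \<Longrightarrow>
      dir_deriv (X p) (\<lambda>q. dir_deriv (Y q) \<phi>) = dir_deriv (nab X Y p) \<phi> + g p (X p) (Y p) *\<^sub>R \<xi> p"
    and const: "\<And>p v. v \<in> tangent_space A p \<Longrightarrow> dir_deriv v \<xi> = 0"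
    and vol: "\<And>p X. (\<forall>i. X i \<in> tangent_space A p) \<Longrightarrow> vol p X = induced_volume \<phi> \<xi> p X"
  shows "parallel_volume A nab vol"
  unfolding parallel_volume_def
proof (intro ballI allI impI)
  fix X and Y :: "'m + 'm \<Rightarrow> 'a vfield" and p
  assume X: "X \<in> vector_fields A" and Y: "\<forall>i. Y i \<in> vector_fields A"
  have z: "std_volume (case_option (0 :: real ^ ('m + 'm) option) u) = 0" for u
    using linear_0[OF std_volume_None_linear] .
  have Yt: "\<forall>j. (Y(i := nab X (Y i))) j q \<in> tangent_space A q" for i q
    using vfD(1)[OF nab_vf[OF X]] Y vfD(1) by auto
  have "X p (\<lambda>q. vol q (\<lambda>j. Y j q)) = X p (\<lambda>q. induced_volume \<phi> \<xi> q (\<lambda>j. Y j q))"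
    using vol Y vfD(1) by simp
  also have "\<dots> = (\<Sum>i\<in>UNIV. induced_volume \<phi> \<xi> p (\<lambda>j. (Y(i := nab X (Y i))) j p))"
    using induced_volume_derivative[OF s X _ gauss[OF X], of Y] Y const[OF vfD(1)[OF X]] by (simp add: z)
  finally show "X p (\<lambda>q. vol q (\<lambda>j. Y j q)) = (\<Sum>i\<in>UNIV. vol p (\<lambda>j. (Y(i := nab X (Y i))) j p))"
    using vol[OF Yt] by simp
qed

theorem ex_blaschke: "\<exists>\<phi> \<xi>. blaschke_immersion A (complex_orientation A J) \<phi> \<xi> nab g"
proof -
  obtain f :: "'m + 'm \<Rightarrow> 'a \<Rightarrow> real" where f: "\<forall>k. affine_fun (f k)"
    and inj: "\<forall>q. \<forall>v\<in>tangent_space A q. (\<forall>k. v (f k) = 0) \<longrightarrow> v = 0"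
    and vol: "\<forall>q X. (\<forall>i. X i \<in> tangent_space A q) \<longrightarrow>
      metric_volume (complex_orientation A J) g q X = det (\<chi> i k. X i (f k))"
    using ex_volume_functions by (elim exE conjE)
  obtain F where F: "smooth_map A F" "\<forall>q. \<forall>X\<in>vector_fields A. \<forall>Y\<in>vector_fields A. hess F 1 q X Y = 0"
    using ex_potential by (elim exE conjE)
  define \<phi> :: "'a \<Rightarrow> real ^ ('m + 'm) option" where "\<phi> q = (\<chi> i. case i of None \<Rightarrow> F q | Some k \<Rightarrow> f k q)" for q
  define \<xi> :: "'a \<Rightarrow> real ^ ('m + 'm) option" where "\<xi> q = axis None 1" for q
  have sm: "smooth_map A (f k)" for k using f by (simp add: affine_fun_def)
  have s: "smooth_map A \<phi>" "smooth_map A \<xi>"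
  proof -
    have "smooth_map A (\<lambda>q. \<phi> q $ i)" for i by (cases i) (simp_all add: \<phi>_def F(1) sm)
    then show "smooth_map A \<phi>" by (simp add: smooth_map_vec)
    show "smooth_map A \<xi>" by (simp add: smooth_map_vec \<xi>_def smooth_map_const)
  qed
  have dS: "dir_deriv v \<phi> $ Some k = v (f k)" and dN: "dir_deriv v \<phi> $ None = v F" for v k
    by (simp_all add: dir_deriv_def \<phi>_def)
  have const: "dir_deriv v \<xi> = 0" if "v \<in> tangent_space A p" for p v
    using tangent_const[OF that] by (simp add: dir_deriv_def \<xi>_def vec_eq_iff)
  have hS: "X p (\<lambda>q. Y q (f k)) = nab X Y p (f k)" and hN: "X p (\<lambda>q. Y q F) = nab X Y p F + g p (X p) (Y p)"
    if "X \<in> vector_fields A" "Y \<in> vector_fields A" for X Y p k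
  proof -
    have "hess (f k) 0 p X Y = 0" using f that unfolding affine_fun_def by blast
    then show "X p (\<lambda>q. Y q (f k)) = nab X Y p (f k)" by (simp add: hess_def)
    have "hess F 1 p X Y = 0" using F(2) that by blast
    then show "X p (\<lambda>q. Y q F) = nab X Y p F + g p (X p) (Y p)" by (simp add: hess_def)
  qed
  have gauss: "dir_deriv (X p) (\<lambda>q. dir_deriv (Y q) \<phi>) = dir_deriv (nab X Y p) \<phi> + g p (X p) (Y p) *\<^sub>R \<xi> p"
    if X: "X \<in> vector_fields A" "Y \<in> vector_fields A" for X Y p
  proof (simp only: vec_eq_iff, rule allI)
    fix i show "dir_deriv (X p) (\<lambda>q. dir_deriv (Y q) \<phi>) $ i = (dir_deriv (nab X Y p) \<phi> + g p (X p) (Y p) *\<^sub>R \<xi> p) $ i"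
      using hS[OF X] hN[OF X]
      by (cases i) (simp_all add: dir_deriv_def[of "X p"] dS dN \<xi>_def axis_def)
  qed
  have imm: "immersion A \<phi>"
    unfolding immersion_def
  proof (intro conjI s(1) allI ballI impI)
    fix p v assume v: "v \<in> tangent_space A p" "dir_deriv v \<phi> = 0"
    then have "v (f k) = 0" for k using dS[of v k] by simp
    then show "v = 0" using inj v(1) by blast
  qed
  have tra: "transversal A \<phi> \<xi>"
    unfolding transversal_def
  proof (intro conjI s(2) allI notI)
    fix p assume "\<xi> p \<in> (\<lambda>v. dir_deriv v \<phi>) ` tangent_space A p"
    then obtain v where v: "v \<in> tangent_space A p" "\<xi> p = dir_deriv v \<phi>" by blast
    have "v (f k) = 0" for k using arg_cong[OF v(2), of "\<lambda>y. y $ Some k"] by (simp add: dS \<xi>_def axis_def)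
    then have "v = 0" using inj v(1) by blast
    then show False using arg_cong[OF v(2), of "\<lambda>y. y $ None"] by (simp add: dN \<xi>_def axis_def)
  qed
  have "affine_immersion A \<phi> \<xi> nab g (\<lambda>_ _. 0) (\<lambda>_ _. 0)"
    unfolding affine_immersion_def
  proof (intro conjI imm tra ballI allI nab_vf gauss, assumption+)
    fix p v assume v: "v \<in> tangent_space A p"
    show "0 \<in> tangent_space A p" by (rule tangent_lincomb(3)[OF v v])
    show "dir_deriv v \<xi> = - dir_deriv 0 \<phi> + 0 *\<^sub>R \<xi> p" using const[OF v] by (simp add: dir_deriv_def vec_eq_iff)
  qed
  moreover have ind: "metric_volume (complex_orientation A J) g p X = induced_volume \<phi> \<xi> p X"
    if X: "\<forall>i. X i \<in> tangent_space A p" for p X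
  proof -
    define m where "m = (\<chi> i j. case_option (\<xi> p) (\<lambda>k. dir_deriv (X k) \<phi>) j $ i)"
    have "induced_volume \<phi> \<xi> p X = det m" by (simp add: induced_volume_def std_volume_def m_def)
    \<comment> \<open>The column \<open>None\<close> is \<xi> = e_0, so only the minor formed by the
      differentials of the \<open>f k\<close> remains.\<close>
    also have "\<dots> = m $ None $ None * det (\<chi> i j. m $ Some i $ Some j)"
      by (rule det_option) (simp add: m_def \<xi>_def axis_def)
    also have "\<dots> = det (\<chi> i j. X j (f i))" by (simp add: m_def \<xi>_def axis_def dS)
    also have "\<dots> = det (transpose (\<chi> i k. X i (f k)))" by (simp add: transpose_def)
    also have "\<dots> = det (\<chi> i k. X i (f k))" by (rule det_transpose)
    finally show ?thesis using vol X by simp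
  qed
  moreover have "parallel_volume A nab (metric_volume (complex_orientation A J) g)"
    by (rule parallel_volume_if_induced[OF s gauss const ind])
  ultimately show ?thesis
    unfolding blaschke_immersion_def affine_normal_def using metricD(2)
    by (intro exI[of _ \<phi>] exI[of _ \<xi>]) blast
qed

section \<open>The shape tensor, the affine normal and uniqueness\<close>

lemma volume_nonzero:
  assumes c: "complex_coord A J nab g V x a r b" "p \<in> coord.U V x a r"
  shows "metric_volume (complex_orientation A J) g p (\<lambda>i. coord.E A V x b i p) \<noteq> 0"
proof -
  interpret complex_coord A J nab g V x a r b by (rule c(1))
  show ?thesis using det_gm_nonzero[OF c(2)] by (simp add: metric_volume_def gm_def)
qed

theorem blaschke_shape_zero:
  fixes \<phi> \<xi> :: "'a \<Rightarrow> real ^ ('m + 'm) option"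
  assumes ai: "affine_immersion A \<phi> \<xi> nab g S \<tau>"
    and an: "affine_normal A (complex_orientation A J) \<phi> \<xi> nab g" and v: "v \<in> tangent_space A p"
  shows "\<tau> p v = 0" "S p v = 0"
proof -
  have imm: "immersion A \<phi>" and tra: "transversal A \<phi> \<xi>"
    and gauss: "\<And>X Y p. X \<in> vector_fields A \<Longrightarrow> Y \<in> vector_fields A \<Longrightarrow>
      dir_deriv (X p) (\<lambda>q. dir_deriv (Y q) \<phi>) = dir_deriv (nab X Y p) \<phi> + g p (X p) (Y p) *\<^sub>R \<xi> p"
    and ST: "\<And>p v. v \<in> tangent_space A p \<Longrightarrow> S p v \<in> tangent_space A p"
    and shape: "\<And>p v. v \<in> tangent_space A p \<Longrightarrow> dir_deriv v \<xi> = - dir_deriv (S p v) \<phi> + \<tau> p v *\<^sub>R \<xi> p"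
    using ai unfolding affine_immersion_def by blast+
  have s: "smooth_map A \<phi>" "smooth_map A \<xi>" using imm tra by (auto simp: immersion_def transversal_def)
  have par: "parallel_volume A nab (metric_volume (complex_orientation A J) g)"
    and vol: "\<And>p X. (\<forall>i. X i \<in> tangent_space A p) \<Longrightarrow>
      metric_volume (complex_orientation A J) g p X = induced_volume \<phi> \<xi> p X"
    using an unfolding affine_normal_def by blast+
  have \<tau>: "\<tau> p v = 0" if v: "v \<in> tangent_space A p" for v
  proof -
    obtain V x a r b where c: "complex_coord A J nab g V x a r b" "p \<in> coord.U V x a r"
      using ex_complex_coord[of p] by (elim exE conjE)
    interpret complex_coord A J nab g V x a r b by (rule c(1))
    obtain X where X: "X \<in> vector_fields A" "X p = v" using ex_vf[OF v c(2)] by blast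
    define u where "u k = dir_deriv (E k p) \<phi>" for k
    have Yt: "\<forall>j. (E(i := nab X (E i))) j q \<in> tangent_space A q" for i q
      using vfD(1)[OF nab_vf[OF X(1) E_vf]] E_tangent by auto
    have "X p (\<lambda>q. induced_volume \<phi> \<xi> q (\<lambda>k. E k q)) = X p (\<lambda>q. metric_volume (complex_orientation A J) g q (\<lambda>k. E k q))"
      using vol E_tangent by simp
    also have "\<dots> = (\<Sum>i\<in>UNIV. metric_volume (complex_orientation A J) g p (\<lambda>j. (E(i := nab X (E i))) j p))"
      using par X(1) E_vf unfolding parallel_volume_def by blast
    also have "\<dots> = (\<Sum>i\<in>UNIV. induced_volume \<phi> \<xi> p (\<lambda>j. (E(i := nab X (E i))) j p))"
      using vol[OF Yt] by simp
    \<comment> \<open>The induced volume equals the parallel metric volume, so the extra term of its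
      derivative, the one with the derivative of \<xi>, must vanish.\<close>
    finally have "std_volume (case_option (dir_deriv (X p) \<xi>) u) = 0"
      using induced_volume_derivative[where Y=E and p=p, OF s X(1) E_vf gauss[OF X(1) E_vf]]
      by (simp add: u_def[abs_def])
    \<comment> \<open>The tangential part of the derivative of \<xi> lies in the span of the other
      arguments and contributes 0; there remains \<tau> times a nonzero volume.\<close>
    moreover have "dir_deriv (S p v) \<phi> = (\<Sum>k\<in>UNIV. S p v (xt k) *\<^sub>R u k)"
      using E_expand[OF ST[OF v] c(2)] s(1)[unfolded smooth_map_vec]
      by (simp add: vec_eq_iff dir_deriv_def u_def)
    moreover note l = std_volume_None_linear[of u]
    have "std_volume (case_option (\<Sum>k\<in>UNIV. S p v (xt k) *\<^sub>R u k) u) = 0"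
      by (simp add: linear_sum[OF l] linear_scale[OF l] std_volume_None_repeat)
    ultimately have "\<tau> p v * std_volume (case_option (\<xi> p) u) = 0"
      using shape[OF v] X(2) by (simp add: linear_diff[OF l] linear_scale[OF l])
    moreover have "std_volume (case_option (\<xi> p) u) \<noteq> 0"
      using volume_nonzero[OF c] vol[of "\<lambda>i. E i p" p] E_tangent by (simp add: induced_volume_def u_def[abs_def])
    ultimately show ?thesis by simp
  qed
  show "\<tau> p v = 0" by (rule \<tau>[OF v])
  show "S p v = 0"
  proof (cases "v = 0")
    \<comment> \<open>Linearity of \<open>S\<close> is not part of \<open>affine_immersion\<close>;
      at 0 the structure equation and the injectivity of the differential of \<phi> are used
      instead.\<close>
    case True
    then have "dir_deriv (S p v) \<phi> = 0"
      using shape[OF v] \<tau>[OF v] by (simp add: dir_deriv_def vec_eq_iff)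
    then show ?thesis using imm ST[OF v] unfolding immersion_def by blast
  next
    case False
    obtain z where z: "z \<in> tangent_space A p" "g p v z = 0" "g p (J p v) z \<noteq> 0"
      using ex_kernel_vector[OF v False] by blast
    have "g p (J p v) z *\<^sub>f S p v = g p v z *\<^sub>f S p (J p v)"
      by (rule flat_gauss_equation[OF ai \<tau> J_facts(1)[OF v] v z(1)])
    from fun_cong[OF this] have "g p (J p v) z * S p v f = 0" for f
      by (simp add: fscale_def z(2))
    then show ?thesis using z(3) by (auto simp: fun_eq_iff)
  qed
qed

text \<open>Each component of \<xi> has zero differential because \<open>S\<close> and \<tau>
  vanish, so it is an affine function to which \<open>affine_const\<close> applies.\<close>

lemma blaschke_normal_const:
  fixes \<phi> \<xi> :: "'a \<Rightarrow> real ^ ('m + 'm) option"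
  assumes ai: "affine_immersion A \<phi> \<xi> nab g S \<tau>"
    and an: "affine_normal A (complex_orientation A J) \<phi> \<xi> nab g"
  shows "\<xi> q = \<xi> p"
proof -
  have s: "smooth_map A (\<lambda>q. \<xi> q $ i)" for i
    using ai by (simp add: affine_immersion_def transversal_def smooth_map_vec)
  have "dir_deriv v \<xi> = - dir_deriv (S p v) \<phi> + \<tau> p v *\<^sub>R \<xi> p" if "v \<in> tangent_space A p" for p v
    using ai that unfolding affine_immersion_def by blast
  then have z: "v (\<lambda>q. \<xi> q $ i) = 0" if "v \<in> tangent_space A p" for p v i
    using blaschke_shape_zero[OF ai an that] that by (fastforce simp: dir_deriv_def vec_eq_iff)
  have "(\<lambda>q. \<xi> q $ i) q = (\<lambda>q. \<xi> q $ i) p" for i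
  proof (rule affine_const[OF conn_UNIV s])
    fix q X Y assume X: "X \<in> vector_fields A" "Y \<in> vector_fields A"
    have "(\<lambda>t. Y t (\<lambda>q. \<xi> q $ i)) = (\<lambda>_. 0)" using z[OF vfD(1)[OF X(2)]] by (simp add: fun_eq_iff)
    then show "hess (\<lambda>q. \<xi> q $ i) 0 q X Y = 0"
      using tangent_const[OF vfD(1)[OF X(1)]] z[OF vfD(1)[OF nab_vf[OF X]]] by (simp add: hess_def)
  qed (rule z)
  then show ?thesis by (simp add: vec_eq_iff)
qed

theorem blaschke_unique:
  fixes \<phi> \<xi> \<psi> \<eta> :: "'a \<Rightarrow> real ^ ('m + 'm) option"
  assumes b1: "blaschke_immersion A (complex_orientation A J) \<phi> \<xi> nab g"
    and b2: "blaschke_immersion A (complex_orientation A J) \<psi> \<eta> nab g"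
  shows "\<exists>F. equiaffine F \<and> \<psi> = F \<circ> \<phi>"
proof -
  obtain S1 \<tau>1 where ai1: "affine_immersion A \<phi> \<xi> nab g S1 \<tau>1"
    and an1: "affine_normal A (complex_orientation A J) \<phi> \<xi> nab g"
    using b1 unfolding blaschke_immersion_def by (elim exE conjE)
  obtain S2 \<tau>2 where ai2: "affine_immersion A \<psi> \<eta> nab g S2 \<tau>2"
    and an2: "affine_normal A (complex_orientation A J) \<psi> \<eta> nab g"
    using b2 unfolding blaschke_immersion_def by (elim exE conjE)
  obtain p :: 'a where True by simp
  obtain V x a r b where c: "complex_coord A J nab g V x a r b" "p \<in> coord.U V x a r"
    using ex_complex_coord[of p] by (elim exE conjE)
  interpret complex_coord A J nab g V x a r b by (rule c(1))
  define M where "M \<phi> \<xi> = (\<chi> i j. case_option (\<xi> p) (\<lambda>k. dir_deriv (E k p) \<phi>) j $ i)"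
    for \<phi> \<xi> :: "'a \<Rightarrow> real ^ ('m + 'm) option"
  have detM: "det (M \<phi> \<xi>) = metric_volume (complex_orientation A J) g p (\<lambda>i. E i p)"
    if "affine_normal A (complex_orientation A J) \<phi> \<xi> nab g" for \<phi> \<xi>
    using that E_tangent by (simp add: M_def affine_normal_def induced_volume_def std_volume_def)
  have nz: "det (M \<phi> \<xi>) \<noteq> 0" unfolding detM[OF an1] by (rule volume_nonzero[OF c])
  then obtain N where N: "M \<phi> \<xi> ** N = mat 1" "N ** M \<phi> \<xi> = mat 1"
    using invertible_det_nz[of "M \<phi> \<xi>"] unfolding invertible_def by blast
  \<comment> \<open>\<open>L\<close> takes the frame of \<phi> at \<open>p\<close>, formed by \<xi>
    and the images of the \<open>E k\<close>, to the corresponding frame of \<psi>. Both frames have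
    the same metric volume as determinant, hence det L = 1.\<close>
  define L where "L = M \<psi> \<eta> ** N"
  have LM: "L ** M \<phi> \<xi> = M \<psi> \<eta>" by (simp add: L_def matrix_mul_assoc[symmetric] N)
  have "det L * det (M \<phi> \<xi>) = det (M \<phi> \<xi>)" using det_mul[of L "M \<phi> \<xi>"] unfolding LM detM[OF an1] detM[OF an2] by simp
  then have detL: "det L = 1" using nz by simp
  have col: "L *v case_option (\<xi> p) (\<lambda>k. dir_deriv (E k p) \<phi>) j = case_option (\<eta> p) (\<lambda>k. dir_deriv (E k p) \<psi>) j" for j
    using LM by (simp add: vec_eq_iff matrix_matrix_mult_def matrix_vector_mult_def M_def)
  have L\<xi>: "L *v \<xi> q = \<eta> q" for q
    using col[of None] blaschke_normal_const[OF ai1 an1, of q p] blaschke_normal_const[OF ai2 an2, of q p] by simp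
  have s: "smooth_map A (\<lambda>q. \<phi> q $ i)" "smooth_map A (\<lambda>q. \<psi> q $ i)" for i
    using ai1 ai2 by (simp_all add: affine_immersion_def immersion_def smooth_map_vec)
  \<comment> \<open>The components of L \<phi> - \<psi>. These functions are affine because
    \<open>L\<close> maps \<xi> to \<eta> everywhere, so the terms with \<open>g\<close>
    cancel.\<close>
  define h where "h i q = (\<Sum>j\<in>UNIV. L $ i $ j * \<phi> q $ j) - \<psi> q $ i" for i q
  have hs: "smooth_map A (h i)" for i
    unfolding h_def by (intro smooth_map_diff smooth_map_sum smooth_map_mult smooth_map_const s)
  have vh: "v (h i) = (\<Sum>j\<in>UNIV. L $ i $ j * v (\<lambda>q. \<phi> q $ j)) - v (\<lambda>q. \<psi> q $ i)"
    if v: "v \<in> tangent_space A q" for v q i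
  proof -
    have "v (h i) = v (\<lambda>q. \<Sum>j\<in>UNIV. L $ i $ j * \<phi> q $ j) - v (\<lambda>q. \<psi> q $ i)"
      unfolding h_def by (intro tangent_diff[OF v] smooth_map_sum smooth_map_mult smooth_map_const s)
    also have "v (\<lambda>q. \<Sum>j\<in>UNIV. L $ i $ j * \<phi> q $ j) = (\<Sum>j\<in>UNIV. v (\<lambda>q. L $ i $ j * \<phi> q $ j))"
      by (intro tangent_sum[OF v] smooth_map_mult smooth_map_const s) simp
    finally show ?thesis by (simp add: tangentD(2)[OF v s(1) s(1)])
  qed
  have gauss: "dir_deriv (X q) (\<lambda>q. dir_deriv (Y q) \<phi>) = dir_deriv (nab X Y q) \<phi> + g q (X q) (Y q) *\<^sub>R \<xi> q"
    "dir_deriv (X q) (\<lambda>q. dir_deriv (Y q) \<psi>) = dir_deriv (nab X Y q) \<psi> + g q (X q) (Y q) *\<^sub>R \<eta> q"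
    if "X \<in> vector_fields A" "Y \<in> vector_fields A" for X Y q
    using ai1 ai2 that unfolding affine_immersion_def by blast+
  have "h i q = h i p" for i q
  proof (rule affine_const[OF conn_UNIV hs])
    fix q X Y assume X: "X \<in> vector_fields A" "Y \<in> vector_fields A"
    note Xq = vfD(1)[OF X(1), of q]
    have sY: "smooth_map A (\<lambda>q. Y q (\<lambda>t. \<phi> t $ i))" "smooth_map A (\<lambda>q. Y q (\<lambda>t. \<psi> t $ i))" for i
      by (rule vfD(2)[OF X(2) s(1)], rule vfD(2)[OF X(2) s(2)])
    have "X q (\<lambda>t. Y t (h i)) = X q (\<lambda>t. (\<Sum>j\<in>UNIV. L $ i $ j * Y t (\<lambda>q. \<phi> q $ j)) - Y t (\<lambda>q. \<psi> q $ i))"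
      by (simp add: vh[OF vfD(1)[OF X(2)]])
    also have "\<dots> = X q (\<lambda>t. \<Sum>j\<in>UNIV. L $ i $ j * Y t (\<lambda>q. \<phi> q $ j)) - X q (\<lambda>t. Y t (\<lambda>q. \<psi> q $ i))"
      by (intro tangent_diff[OF Xq] smooth_map_sum smooth_map_mult smooth_map_const sY)
    also have "X q (\<lambda>t. \<Sum>j\<in>UNIV. L $ i $ j * Y t (\<lambda>q. \<phi> q $ j)) = (\<Sum>j\<in>UNIV. X q (\<lambda>t. L $ i $ j * Y t (\<lambda>q. \<phi> q $ j)))"
      by (intro tangent_sum[OF Xq] smooth_map_mult smooth_map_const sY) simp
    also have "\<dots> = (\<Sum>j\<in>UNIV. L $ i $ j * X q (\<lambda>t. Y t (\<lambda>q. \<phi> q $ j)))"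
      by (simp add: tangentD(2)[OF Xq sY(1) sY(1)])
    also have "\<dots> = (\<Sum>j\<in>UNIV. L $ i $ j * (nab X Y q (\<lambda>q. \<phi> q $ j) + g q (X q) (Y q) * \<xi> q $ j))"
      using arg_cong[OF gauss(1)[OF X, of q], of "\<lambda>y. y $ _"] by (simp add: dir_deriv_def)
    also have "\<dots> = (\<Sum>j\<in>UNIV. L $ i $ j * nab X Y q (\<lambda>q. \<phi> q $ j)) + g q (X q) (Y q) * (L *v \<xi> q) $ i"
      by (simp add: matrix_vector_mult_def distrib_left sum.distrib sum_distrib_left mult_ac)
    also have "X q (\<lambda>t. Y t (\<lambda>q. \<psi> q $ i)) = nab X Y q (\<lambda>q. \<psi> q $ i) + g q (X q) (Y q) * \<eta> q $ i"
      using arg_cong[OF gauss(2)[OF X, of q], of "\<lambda>y. y $ i"] by (simp add: dir_deriv_def)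
    finally have "X q (\<lambda>t. Y t (h i)) = nab X Y q (h i)"
      by (simp add: vh[OF vfD(1)[OF nab_vf[OF X]]] L\<xi>)
    then show "hess (h i) 0 q X Y = 0" by (simp add: hess_def)
  next
    fix v assume v: "v \<in> tangent_space A p"
    have "E k p (h i) = 0" for k
      using arg_cong[OF col[of "Some k"], of "\<lambda>y. y $ i"]
      by (simp add: vh[OF E_tangent] matrix_vector_mult_def dir_deriv_def)
    then show "v (h i) = 0" by (simp add: E_expand[OF v c(2) hs])
  qed
  then have h: "L *v \<phi> q - \<psi> q = L *v \<phi> p - \<psi> p" for q
    by (simp add: vec_eq_iff h_def matrix_vector_mult_def)
  define F where "F y = L *v y + (\<psi> p - L *v \<phi> p)" for y
  have "invertible L" using detL by (simp add: invertible_det_nz)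
  then have "bij ((*v) L)" by (simp add: invertible_eq_bij)
  then have "equiaffine F"
    unfolding equiaffine_def
    by (intro exI[of _ "(*v) L"] exI[of _ "\<psi> p - L *v \<phi> p"]) (simp add: F_def std_volume_matrix detL)
  moreover have "\<psi> = F \<circ> \<phi>"
  proof
    fix q show "\<psi> q = (F \<circ> \<phi>) q" using h[of q] by (simp add: F_def algebra_simps)
  qed
  ultimately show ?thesis by blast
qed

end

theorem theorem3p1:
  fixes A :: "('a::{t2_space, second_countable_topology}, 'm::finite + 'm) chart set"
    and J :: "'a \<Rightarrow> 'a tangent \<Rightarrow> 'a tangent"
    and nab :: "'a conn"
    and g :: "'a \<Rightarrow> 'a tangent \<Rightarrow> 'a tangent \<Rightarrow> real"
  assumes "special_kaehler A J nab g"
    and "simply_connected (UNIV :: 'a set)"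
  shows "(\<exists>\<phi> \<xi>. blaschke_immersion A (complex_orientation A J) \<phi> \<xi> nab g) \<and>
    (\<forall>\<phi> \<xi>. blaschke_immersion A (complex_orientation A J) \<phi> \<xi> nab g \<longrightarrow>
       parabolic_hypersphere A (complex_orientation A J) \<phi> \<xi>) \<and>
    (\<forall>\<phi> \<xi> \<psi> \<eta>. blaschke_immersion A (complex_orientation A J) \<phi> \<xi> nab g \<longrightarrow>
       blaschke_immersion A (complex_orientation A J) \<psi> \<eta> nab g \<longrightarrow>
       (\<exists>F. equiaffine F \<and> \<psi> = F \<circ> \<phi>))"
proof -
  interpret special_kaehler_mfd A J nab g by unfold_locales (rule assms)+
  have "parabolic_hypersphere A (complex_orientation A J) \<phi> \<xi>"
    if b: "blaschke_immersion A (complex_orientation A J) \<phi> \<xi> nab g" for \<phi> \<xi>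
  proof -
    obtain S \<tau> where ai: "affine_immersion A \<phi> \<xi> nab g S \<tau>"
      and an: "affine_normal A (complex_orientation A J) \<phi> \<xi> nab g"
      using b unfolding blaschke_immersion_def by (elim exE conjE)
    have "S p v = 0 *\<^sub>f v" if "v \<in> tangent_space A p" for p v
      using blaschke_shape_zero(2)[OF ai an that] by (simp add: fscale_def fun_eq_iff)
    then show ?thesis
      unfolding affine_hypersphere_def using ai an
      by (intro exI[of _ nab] exI[of _ g] exI[of _ S] exI[of _ \<tau>]) blast
  qed
  then show ?thesis using ex_blaschke blaschke_unique by blast
qed

end
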